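(* In the dynamic $b$-matching setting (defined in the context), there is a randomized algorithm that, with high probability, maintains after every update a $b$-matching $M\subseteq E$ of the current graph whose size is at least a constant fraction (for an absolute constant) of the size of a maximum $b$-matching of the current graph, with $O(\log^3 n)$ amortized update time.
   Context: Dynamic $b$-matching: a graph $G=(V,E)$ with $|V|=n$ nodes, each node $v$ having capacity $c_v\in\{1,\dots,n\}$; $V$ and the capacities are fixed, initially $E=\emptyset$, and at each time step one edge is inserted or deleted. A $b$-matching is a subset $E'\subseteq E$ such that each node $v$ is incident to at most $c_v$ edges of $E'$; the goal is a $b$-matching of maximum cardinality. "With high probability" means with probability at least $1-1/\mathrm{poly}(n)$. Amortized update time $T$ means total time $O(t\cdot T)$ over any $t$ updates starting from the empty graph. *)

theory Defs
  imports "HOL-Probability.Probability"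
begin

text \<open>A graph on the vertices \<open>0, \<dots>, n - 1\<close> is given by its set of edges,
  an edge being a two-element set of vertices.\<close>

datatype update = Insert nat nat | Delete nat nat

fun apply_update :: "update \<Rightarrow> nat set set \<Rightarrow> nat set set" where
  "apply_update (Insert u v) E = insert {u, v} E"
| "apply_update (Delete u v) E = E - {{u, v}}"

definition graph_after :: "update list \<Rightarrow> nat set set" where
  "graph_after us = fold apply_update us {}"

fun valid_update :: "nat \<Rightarrow> nat set set \<Rightarrow> update \<Rightarrow> bool" where
  "valid_update n E (Insert u v) \<longleftrightarrow> u < n \<and> v < n \<and> u \<noteq> v \<and> {u, v} \<notin> E"
| "valid_update n E (Delete u v) \<longleftrightarrow> {u, v} \<in> E"

definition valid_updates :: "nat \<Rightarrow> update list \<Rightarrow> bool" where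
  "valid_updates n us \<longleftrightarrow> (\<forall>i < length us. valid_update n (graph_after (take i us)) (us ! i))"

definition b_matching :: "nat \<Rightarrow> (nat \<Rightarrow> nat) \<Rightarrow> nat set set \<Rightarrow> nat set set \<Rightarrow> bool" where
  "b_matching n c E M \<longleftrightarrow> M \<subseteq> E \<and> (\<forall>v < n. card {e \<in> M. v \<in> e} \<le> c v)"

definition max_b_matching_size :: "nat \<Rightarrow> (nat \<Rightarrow> nat) \<Rightarrow> nat set set \<Rightarrow> nat" where
  "max_b_matching_size n c E = Max {card M |M. b_matching n c E M}"

text \<open>Programs use scalar registers and zero-initialised arrays; the names of registers and arrays
  are fixed in the program text. Every register and array cell holds a machine word, a number
  below the word bound \<open>B\<close>. The field \<open>clock\<close> counts the elementary operations executed so far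
  and is not accessible to programs.\<close>

record state =
  reg :: "nat \<Rightarrow> nat"
  arr :: "nat \<Rightarrow> nat \<Rightarrow> nat"
  clock :: nat

datatype exp =
    Const nat
  | Reg nat
  | Arr nat exp
  | Add exp exp
  | Sub exp exp
  | Mul exp exp
  | Div exp exp
  | Mod exp exp
  | Less exp exp
  | Equal exp exp

text \<open>Addition and multiplication wrap around at \<open>B\<close>; subtraction is truncated at 0.\<close>

primrec eval :: "nat \<Rightarrow> state \<Rightarrow> exp \<Rightarrow> nat" where
  "eval B s (Const k) = k mod B"
| "eval B s (Reg x) = reg s x"
| "eval B s (Arr a e) = arr s a (eval B s e)"
| "eval B s (Add e f) = (eval B s e + eval B s f) mod B"
| "eval B s (Sub e f) = eval B s e - eval B s f"
| "eval B s (Mul e f) = (eval B s e * eval B s f) mod B"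
| "eval B s (Div e f) = eval B s e div eval B s f"
| "eval B s (Mod e f) = eval B s e mod eval B s f"
| "eval B s (Less e f) = (if eval B s e < eval B s f then 1 else 0)"
| "eval B s (Equal e f) = (if eval B s e = eval B s f then 1 else 0)"

primrec cost :: "exp \<Rightarrow> nat" where
  "cost (Const k) = 1"
| "cost (Reg x) = 1"
| "cost (Arr a e) = 1 + cost e"
| "cost (Add e f) = 1 + cost e + cost f"
| "cost (Sub e f) = 1 + cost e + cost f"
| "cost (Mul e f) = 1 + cost e + cost f"
| "cost (Div e f) = 1 + cost e + cost f"
| "cost (Mod e f) = 1 + cost e + cost f"
| "cost (Less e f) = 1 + cost e + cost f"
| "cost (Equal e f) = 1 + cost e + cost f"

definition tick :: "nat \<Rightarrow> state \<Rightarrow> state" where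
  "tick k s = s\<lparr>clock := clock s + k\<rparr>"

definition set_reg :: "nat \<Rightarrow> nat \<Rightarrow> state \<Rightarrow> state" where
  "set_reg x k s = s\<lparr>reg := (reg s)(x := k)\<rparr>"

definition set_arr :: "nat \<Rightarrow> nat \<Rightarrow> nat \<Rightarrow> state \<Rightarrow> state" where
  "set_arr a i k s = s\<lparr>arr := (arr s)(a := (arr s a)(i := k))\<rparr>"

text \<open>\<open>Rand x e\<close> stores in register \<open>x\<close> a uniformly random number between 0 and the value of
  \<open>e\<close>, both included, independent of all previous draws.\<close>

datatype com =
    Skip
  | Assign nat exp
  | Store nat exp exp
  | Rand nat exp
  | Seq com com
  | If exp com com
  | While exp com

partial_function (spmf) loop ::
  "(state \<Rightarrow> bool) \<Rightarrow> (state \<Rightarrow> state) \<Rightarrow> (state \<Rightarrow> state spmf) \<Rightarrow> state \<Rightarrow> state spmf" where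
  "loop test charge body s =
     (if test s then bind_spmf (body (charge s)) (loop test charge body)
      else return_spmf (charge s))"

text \<open>The missing mass of \<open>exec B p s\<close> is the probability that \<open>p\<close> does not terminate.\<close>

primrec exec :: "nat \<Rightarrow> com \<Rightarrow> state \<Rightarrow> state spmf" where
  "exec B Skip s = return_spmf (tick 1 s)"
| "exec B (Assign x e) s = return_spmf (tick (1 + cost e) (set_reg x (eval B s e) s))"
| "exec B (Store a e f) s =
     return_spmf (tick (1 + cost e + cost f) (set_arr a (eval B s e) (eval B s f) s))"
| "exec B (Rand x e) s =
     map_spmf (\<lambda>k. tick (1 + cost e) (set_reg x k s)) (spmf_of_set {..eval B s e})"
| "exec B (Seq p q) s = bind_spmf (exec B p s) (exec B q)"
| "exec B (If e p q) s =
     (if eval B s e \<noteq> 0 then exec B p (tick (1 + cost e) s) else exec B q (tick (1 + cost e) s))"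
| "exec B (While e p) s = loop (\<lambda>s. eval B s e \<noteq> 0) (tick (1 + cost e)) (exec B p) s"

text \<open>A dynamic algorithm is a program that is executed once per update and whose state persists
  between updates. Initially register 0 contains \<open>n\<close>, array 0 the capacities, and all other
  words are 0. Each update is passed in registers 1 (1 for an insertion, 0 for a deletion), 2
  and 3. The maintained edge set is read off array 1, in which the word at position \<open>u * n + v\<close>
  for \<open>u < v < n\<close> tells whether the edge between \<open>u\<close> and \<open>v\<close> is selected.\<close>

definition init_state :: "nat \<Rightarrow> (nat \<Rightarrow> nat) \<Rightarrow> state" where
  "init_state n c =
     \<lparr>reg = (\<lambda>_. 0)(0 := n),
      arr = (\<lambda>_ _. 0)(0 := (\<lambda>v. if v < n then c v else 0)),
      clock = 0\<rparr>"

fun load_update :: "update \<Rightarrow> state \<Rightarrow> state" where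
  "load_update (Insert u v) s = set_reg 1 1 (set_reg 2 u (set_reg 3 v s))"
| "load_update (Delete u v) s = set_reg 1 0 (set_reg 2 u (set_reg 3 v s))"

definition output_edges :: "nat \<Rightarrow> state \<Rightarrow> nat set set" where
  "output_edges n s = {{u, v} |u v. u < v \<and> v < n \<and> arr s 1 (u * n + v) \<noteq> 0}"

primrec trace :: "nat \<Rightarrow> com \<Rightarrow> update list \<Rightarrow> state \<Rightarrow> state list spmf" where
  "trace B P [] s = return_spmf []"
| "trace B P (u # us) s =
     bind_spmf (exec B P (load_update u s)) (\<lambda>s'. map_spmf (Cons s') (trace B P us s'))"

text \<open>Words have \<open>O(log (n + t))\<close> bits when \<open>t\<close> updates are processed on \<open>n\<close> vertices. The update
  list is fixed before any random draw, that is, the adversary is oblivious.\<close>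

definition run :: "nat \<Rightarrow> com \<Rightarrow> nat \<Rightarrow> (nat \<Rightarrow> nat) \<Rightarrow> update list \<Rightarrow> state list spmf" where
  "run K P n c us = trace ((n + length us + 2) ^ K) P us (init_state n c)"

definition approx_b_matching ::
  "real \<Rightarrow> nat \<Rightarrow> (nat \<Rightarrow> nat) \<Rightarrow> nat set set \<Rightarrow> nat set set \<Rightarrow> bool" where
  "approx_b_matching \<alpha> n c E M \<longleftrightarrow>
     b_matching n c E M \<and> \<alpha> * real (max_b_matching_size n c E) \<le> real (card M)"

text \<open>Amortized update time \<open>T\<close>: in every execution, and for every \<open>t\<close>, the first \<open>t\<close> updates
  together take at most \<open>t * T\<close> operations.\<close>

definition amortized_time :: "real \<Rightarrow> state list spmf \<Rightarrow> bool" where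
  "amortized_time T p \<longleftrightarrow>
     lossless_spmf p \<and>
     (\<forall>ss \<in> set_spmf p. \<forall>i < length ss. real (clock (ss ! i)) \<le> real (Suc i) * T)"

definition maintains_approx_b_matching ::
  "real \<Rightarrow> nat \<Rightarrow> (nat \<Rightarrow> nat) \<Rightarrow> update list \<Rightarrow> state list \<Rightarrow> bool" where
  "maintains_approx_b_matching \<alpha> n c us ss \<longleftrightarrow>
     (\<forall>i < length us.
        approx_b_matching \<alpha> n c (graph_after (take (Suc i) us)) (output_edges n (ss ! i)))"

end

theory Submission
  imports Defs "HOL-Library.Nat_Bijection"
begin

text \<open>The algorithm is deterministic. Every vertex \<open>v\<close> has a level, an edge of class \<open>i\<close> (the maximum of
  the levels of its ends) has weight \<open>2 ^ - i\<close>, and the levels are adjusted until the weight at \<open>v\<close> is at most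
  the capacity, and at least an eighth of it if the level is positive; such a fractional matching is
  constant-factor optimal. Each adjacency list of a class is cut into slots of \<open>K i\<close> entries, about
  \<open>2 ^ i / log n\<close>, and the edges of the class are properly coloured with \<open>2 * K i\<close> colours with respect to
  slots. Keeping one colour per class, a nearly fullest one, yields a sparse graph that still carries a
  constant fraction of the fractional matching, with about one edge per slot. On this graph a maximal matching
  is maintained lazily: a saturated vertex remains marked until half of its capacity has been lost, and only
  then are its slots scanned. The three kinds of work are paid for by the potentials \<open>phi\<close>, \<open>pot2\<close> and \<open>pot3\<close>.\<close>

text \<open>A fractional matching has to be made integral without random sampling. The selected
  colour of class \<open>i\<close> acts as a sample of rate about \<open>1 / (2 * K i)\<close>.
  Properness means that at each vertex it takes at most one edge from every slot, so the sampled
  weight, scaled up by \<open>K i\<close>, exceeds the true weight at a vertex by at most one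
  incomplete slot per class. There are \<open>L + 1\<close> classes, and the factor
  \<open>1 / log n\<close> in the slot size makes all these surpluses together at most one unit of
  capacity. With twice as many colours as slot entries a free colour always exists, because the
  uncoloured edge itself occupies a position in both of its slots; so no third edge has to give way.
  Every threshold comes with a gap that pays for crossing it: weight between an eighth and the whole
  of the capacity for levels, shares \<open>1 / (2 * K)\<close> and \<open>1 / (8 * K)\<close> for
  colours, half of the capacity for marks. The ratio 1296 is \<open>9 * 8 * 9 * 2\<close>: a
  \<open>b\<close>-matching against the weights, the loss by selection, maximality with lazy marks,
  and the two ends of an edge.\<close>

section \<open>Hoare triples for deterministic programs\<close>

text \<open>Total correctness: the result is required to be a point mass, which is attainable
  because the programs contain no \<open>Rand\<close>. Termination, and with it
  \<open>lossless_spmf\<close>, is thereby included.\<close>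

definition ht :: "nat \<Rightarrow> com \<Rightarrow> state \<Rightarrow> (state \<Rightarrow> bool) \<Rightarrow> bool" where
 "ht B p s Q \<longleftrightarrow> (\<exists>s'. exec B p s = return_spmf s' \<and> Q s')"

lemma ht_mono: "ht B p s P ==> (\<And>s'. P s' ==> Q s') ==> ht B p s Q"
 unfolding ht_def by blast

lemma ht_Seq: "ht B p s P ==> (\<And>s'. P s' ==> ht B q s' Q) ==> ht B (Seq p q) s Q"
 unfolding ht_def by fastforce

lemma ht_Skip [simp]: "ht B Skip s Q = Q (tick 1 s)"
 and ht_Assign [simp]: "ht B (Assign x e) s Q = Q (tick (1 + cost e) (set_reg x (eval B s e) s))"
 and ht_Store [simp]: "ht B (Store a e f) s Q =
  Q (tick (1 + cost e + cost f) (set_arr a (eval B s e) (eval B s f) s))"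
 and ht_If [simp]: "ht B (If e p q) s Q =
  (if eval B s e ~= 0 then ht B p (tick (1 + cost e) s) Q else ht B q (tick (1 + cost e) s) Q)"
 unfolding ht_def by auto

text \<open>With these equations the simplifier is a symbolic executor: sequences are nested to the
  right and the leading command is applied to the state.\<close>

lemma ht_Seq_Skip [simp]: "ht B (Seq Skip q) s Q = ht B q (tick 1 s) Q"
 and ht_Seq_Assign [simp]: "ht B (Seq (Assign x e) q) s Q =
  ht B q (tick (1 + cost e) (set_reg x (eval B s e) s)) Q"
 and ht_Seq_Store [simp]: "ht B (Seq (Store a e f) q) s Q =
  ht B q (tick (1 + cost e + cost f) (set_arr a (eval B s e) (eval B s f) s)) Q"
 and ht_Seq_If [simp]: "ht B (Seq (If e p p') q) s Q =
  (if eval B s e ~= 0 then ht B (Seq p q) (tick (1 + cost e) s) Q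
   else ht B (Seq p' q) (tick (1 + cost e) s) Q)"
 and ht_Seq_Seq [simp]: "ht B (Seq (Seq p p') q) s Q = ht B (Seq p (Seq p' q)) s Q"
proof -
 have *: "exec B (Seq p' q) = (\<lambda>s. bind_spmf (exec B p' s) (exec B q))" by auto
 show "ht B (Seq (Seq p p') q) s Q = ht B (Seq p (Seq p' q)) s Q"
  unfolding ht_def by (simp add: * bind_spmf_assoc)
qed (auto simp: ht_def)

text \<open>The measure \<open>m\<close> serves termination only. Time bounds enter through
  \<open>clock\<close> in the invariant \<open>I\<close>, and the final failing test is charged
  before \<open>Q\<close>.\<close>

lemma ht_While:
 fixes m :: "state \<Rightarrow> nat"
 assumes "I s"
  and step: "\<And>s. I s ==> eval B s e ~= 0 ==> ht B p (tick (1 + cost e) s) (\<lambda>s'. I s' \<and> m s' < m s)"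
  and exit: "\<And>s. I s ==> eval B s e = 0 ==> Q (tick (1 + cost e) s)"
 shows "ht B (While e p) s Q"
 using assms(1)
proof (induction "m s" arbitrary: s rule: less_induct)
 case less
 show ?case
 proof (cases "eval B s e = 0")
  case True
  then show ?thesis using exit[OF less.prems True] unfolding ht_def by (auto simp: loop.simps)
 next
  case False
  then obtain s1 where s1: "exec B p (tick (1 + cost e) s) = return_spmf s1" "I s1" "m s1 < m s"
   using step[OF less.prems False] unfolding ht_def by blast
  then show ?thesis using less.hyps[OF s1(3,2)] False unfolding ht_def
   by (auto simp: loop.simps[of _ _ _ s])
 qed
qed

text \<open>A singleton block gets no trailing \<open>Skip\<close>, so an unfolded block is exactly
  the nested \<open>Seq\<close> that the symbolic execution consumes.\<close>

fun blk :: "com list \<Rightarrow> com" where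
 "blk [] = Skip"
| "blk [p] = p"
| "blk (p # q # ps) = Seq p (blk (q # ps))"

lemma reg_upd [simp]:
 "reg (tick k s) = reg s" "reg (set_reg x v s) = (reg s)(x := v)" "reg (set_arr a i v s) = reg s"
 "arr (tick k s) = arr s" "arr (set_reg x v s) = arr s"
 "arr (set_arr a i v s) = (arr s)(a := (arr s a)(i := v))"
 "clock (tick k s) = clock s + k" "clock (set_reg x v s) = clock s" "clock (set_arr a i v s) = clock s"
 by (simp_all add: tick_def set_reg_def set_arr_def)

section \<open>The Cantor pairing as an expression\<close>

text \<open>Arrays have one index, so cells of tables with several indices are addressed by nested
  pairings. The first argument is evaluated three times and the second twice, which is reflected in
  \<open>cost_PE\<close>.\<close>

definition PE :: "exp \<Rightarrow> exp \<Rightarrow> exp" where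
 "PE a b = Add (Div (Mul (Add a b) (Add (Add a b) (Const 1))) (Const 2)) a"

abbreviation pr :: "nat \<Rightarrow> nat \<Rightarrow> nat" where
 "pr x y \<equiv> prod_encode (x, y)"

lemma cost_PE [simp]: "cost (PE a b) = 3 * cost a + 2 * cost b + 8"
 by (simp add: PE_def)

lemma pr_less: "pr x y < (x + y + 1)\<^sup>2"
proof -
 have "pr x y <= (x + y) * Suc (x + y) + x"
  unfolding prod_encode_def triangle_def split_conv by (intro add_right_mono div_le_dividend)
 also have "\<dots> < (x + y + 1)\<^sup>2" by (simp add: power2_eq_square algebra_simps)
 finally show ?thesis .
qed

lemma eval_PE:
 assumes "(eval B s a + eval B s b + 1)\<^sup>2 < B"
 shows "eval B s (PE a b) = pr (eval B s a) (eval B s b)"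
proof -
 define x where "x = eval B s a"
 define y where "y = eval B s b"
 have B: "(x + y + 1)\<^sup>2 < B" using assms by (simp add: x_def y_def)
 have s: "x + y + 1 <= (x + y + 1)\<^sup>2" by (simp add: power2_eq_square)
 have p: "(x + y) * (x + y + 1) <= (x + y + 1)\<^sup>2" by (simp add: power2_eq_square)
 \<comment> \<open>For \<open>x = y = 0\<close> the bound allows \<open>B = 2\<close>, and then
   \<open>Const 2\<close> evaluates to 0. The value of the pairing is still right because
   \<open>0 div 0 = 0\<close>.\<close>
 have B1: "1 < B" "2 < B \<or> (x = 0 \<and> y = 0)"
 proof -
  show "1 < B" using B s by linarith
  show "2 < B \<or> (x = 0 \<and> y = 0)"
  proof (cases "x + y = 0")
   case False
   then have "2\<^sup>2 <= (x + y + 1)\<^sup>2" by (intro power_mono) auto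
   then show ?thesis using B by simp
  qed auto
 qed
 have "pr x y < B" using pr_less[of x y] B by linarith
 then show ?thesis
  using B s p B1 unfolding PE_def
  by (auto simp: x_def[symmetric] y_def[symmetric] prod_encode_def triangle_def)
qed

section \<open>Binary trees in heap numbering\<close>

text \<open>The root is 1 and the children of \<open>nd\<close> are \<open>2 * nd\<close> and
  \<open>2 * nd + 1\<close>, so ancestors arise by repeated halving; a node is its own ancestor. The
  number 0 is no node, which frees it to mean an absent colour.\<close>

definition anc :: "nat \<Rightarrow> nat \<Rightarrow> bool" where
 "anc nd l \<longleftrightarrow> nd ~= 0 \<and> (\<exists>j. l div 2 ^ j = nd)"

lemma anc_self: "l ~= 0 ==> anc l l"
 unfolding anc_def by (metis div_by_1 power_0)

lemma anc_0 [simp]: "\<not> anc 0 l" "\<not> anc nd 0"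
 by (auto simp: anc_def)

lemma anc_le: "anc nd l ==> nd <= l"
 by (auto simp: anc_def)

lemma anc_half: "anc nd l ==> nd div 2 ~= 0 ==> anc (nd div 2) l"
 unfolding anc_def by (metis div_mult2_eq power_Suc2)

text \<open>Both nodes are iterated halves of \<open>l\<close>. The smaller one results from more
  halvings, hence from at least one halving of \<open>cur\<close>.\<close>

lemma anc_chain: "anc nd l ==> anc cur l ==> nd < cur ==> nd <= cur div 2"
proof -
 assume "anc nd l" "anc cur l" "nd < cur"
 then obtain i j where ij: "nd = l div 2 ^ i" "cur = l div 2 ^ j" by (auto simp: anc_def)
 have "i > j"
 proof (rule ccontr)
  assume "\<not> i > j"
  then have "(2::nat) ^ i <= 2 ^ j" by simp
  then have "l div 2 ^ j <= l div 2 ^ i" by (simp add: div_le_mono2)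
  then show False using \<open>nd < cur\<close> ij by simp
 qed
 then obtain k where k: "i = j + Suc k" using less_imp_Suc_add by auto
 have "nd = l div (2 ^ j * (2 * 2 ^ k))" by (simp add: ij k power_add mult.left_commute)
 also have "\<dots> = cur div 2 div 2 ^ k" by (simp add: ij div_mult2_eq)
 finally show ?thesis by simp
qed

lemma anc_one: "l ~= 0 ==> anc 1 l"
proof (induction l rule: less_induct)
 case (less l)
 show ?case
 proof (cases "l = 1")
  case False
  then have "l div 2 < l" "l div 2 ~= 0" using less.prems by auto
  then obtain j where "l div 2 div 2 ^ j = 1" using less.IH[of "l div 2"] by (auto simp: anc_def)
  then have "l div 2 ^ Suc j = 1" by (simp add: div_mult2_eq)
  then show ?thesis unfolding anc_def by blast
 qed (simp add: anc_self)
qed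

lemma anc_children:
 assumes "nd ~= 0"
 shows "anc nd l \<longleftrightarrow> nd = l \<or> anc (2 * nd) l \<or> anc (Suc (2 * nd)) l"
proof
 assume a: "anc nd l"
 then obtain j where j: "l div 2 ^ j = nd" by (auto simp: anc_def)
 show "nd = l \<or> anc (2 * nd) l \<or> anc (Suc (2 * nd)) l"
 proof (cases j)
  case 0
  then show ?thesis using j by simp
 next
  case (Suc k)
  define m where "m = l div 2 ^ k"
  have "m div 2 = nd" using j Suc by (simp add: m_def mult.commute flip: div_mult2_eq)
  then have "m = 2 * nd \<or> m = Suc (2 * nd)" by linarith
  then show ?thesis using assms unfolding m_def anc_def by auto
 qed
next
 assume "nd = l \<or> anc (2 * nd) l \<or> anc (Suc (2 * nd)) l"
 moreover have "anc nd l" if "anc (2 * nd) l" using anc_half[OF that] assms by simp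
 moreover have "anc nd l" if "anc (Suc (2 * nd)) l" using anc_half[OF that] assms by simp
 ultimately show "anc nd l" using assms anc_self by blast
qed

lemma anc_children_disj: "nd ~= 0 ==> \<not> (anc (2 * nd) l \<and> anc (Suc (2 * nd)) l)"
 using anc_chain[of "2 * nd" l "Suc (2 * nd)"] by auto

text \<open>A proper ancestor of \<open>l\<close> is at most \<open>l div 2\<close>, which lies
  below \<open>k\<close>; so the leaves \<open>k\<close>, ..., \<open>2 * k - 1\<close> are pairwise
  incomparable.\<close>

lemma anc_leaf: "anc nd l ==> l < 2 * k ==> k <= nd ==> nd = l"
 using anc_chain[of nd l l] anc_self[of l] anc_le[of nd l] by (cases "nd = l"; cases "l = 0") auto

text \<open>This is why a node counter is the sum of the counters of its children. An element
  sitting at \<open>nd\<close> itself would be missed by both children, hence the exclusion.\<close>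

lemma card_split_anc:
 assumes fin: "finite S" and nd: "nd ~= 0" and lf: "\<And>y. y \<in> S ==> f y ~= nd"
 shows "card {y \<in> S. anc nd (f y)} =
  card {y \<in> S. anc (2 * nd) (f y)} + card {y \<in> S. anc (Suc (2 * nd)) (f y)}"
proof -
 have "{y \<in> S. anc nd (f y)} = {y \<in> S. anc (2 * nd) (f y)} \<union> {y \<in> S. anc (Suc (2 * nd)) (f y)}"
  using anc_children[OF nd] lf by auto
 moreover have "{y \<in> S. anc (2 * nd) (f y)} \<inter> {y \<in> S. anc (Suc (2 * nd)) (f y)} = {}"
  using anc_children_disj[OF nd] by blast
 ultimately show ?thesis using fin by (simp add: card_Un_disjoint)
qed

text \<open>Registers are numbered so that a subprogram mostly works above the registers of its
  callers; the least register that it writes is then all a caller has to know.\<close>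

definition same :: "nat \<Rightarrow> state \<Rightarrow> state \<Rightarrow> bool" where
 "same R s s' \<longleftrightarrow> (\<forall>r < R. reg s' r = reg s r)"

lemma same_refl [simp]: "same R s s"
 by (simp add: same_def)

lemma same_trans: "same R s s' ==> same R' s' s'' ==> R <= R' ==> same R s s''"
 by (simp add: same_def)

lemma same_mono: "same R' s s' ==> R <= R' ==> same R s s'"
 by (simp add: same_def)

lemma same_reg: "same R s s' ==> r < R ==> reg s' r = reg s r"
 by (simp add: same_def)

section \<open>Parameters and word sizes\<close>

text \<open>\<open>2 ^ L\<close> is \<open>n\<close> and \<open>2 ^ ll\<close> is
  \<open>L + 1\<close>, each up to a factor 2. The exponent 16 leaves room for three nested
  pairings: a tree node within a slot, the slot being a vertex paired with a class and a block
  number.\<close>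

locale bm =
 fixes n L ll B :: nat and c :: "nat \<Rightarrow> nat"
 assumes n2: "2 <= n" and c1: "\<And>v. v < n ==> 1 <= c v" and cn: "\<And>v. v < n ==> c v <= n"
  and Ln: "n <= 2 ^ L" and Ln2: "2 ^ L <= 2 * n"
  and llL: "ll <= L" and ll1: "L + 1 <= 2 ^ ll" and ll2: "2 ^ ll <= 2 * (L + 1)"
  and Bbig: "(80 * n) ^ 16 <= B"
begin

text \<open>Three sizes of numbers: indices, pairs of indices, and pairs of such pairs. Leaf numbers
  stay below \<open>4 * 2 ^ L <= 8 * n\<close> and the factor \<open>8 * K i\<close> of a test is at
  most \<open>16 * n\<close>, whence \<open>q0\<close>. Pairing two numbers of one size lands in the
  next, and \<open>q2B\<close> allows one further pairing without wrap-around.\<close>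

definition q0 :: nat where "q0 = 16 * n"
definition q1 :: nat where "q1 = (40 * n) ^ 2"
definition q2 :: nat where "q2 = (80 * n) ^ 4"
definition sm0 :: "nat \<Rightarrow> bool" where "sm0 x \<longleftrightarrow> x <= q0"
definition sm1 :: "nat \<Rightarrow> bool" where "sm1 x \<longleftrightarrow> x <= q1"
definition sm :: "nat \<Rightarrow> bool" where "sm x \<longleftrightarrow> x <= q2"

lemma q01: "q0 <= q1" and q12: "q1 <= q2"
proof -
 have "16 * n <= 40 * n" "1 <= 40 * n" using n2 by auto
 moreover have "40 * n <= (40 * n)\<^sup>2" by (simp add: power2_eq_square)
 ultimately show "q0 <= q1" unfolding q0_def q1_def by linarith
 have "(40 * n) ^ 2 <= (80 * n) ^ 2" by (intro power_mono) auto
 also have "\<dots> <= (80 * n) ^ 4" using n2 by (intro power_increasing) auto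
 finally show "q1 <= q2" unfolding q1_def q2_def .
qed

lemma q2B: "(2 * q2 + 2)\<^sup>2 < B"
proof -
 have n: "1 < 80 * n" using n2 by simp
 have "(2::nat) < 80 * n" using n2 by linarith
 also have "80 * n <= (80 * n) ^ 4" using n by (intro self_le_power) auto
 finally have "2 * q2 + 2 <= 4 * q2" unfolding q2_def by linarith
 also have "4 * q2 <= (80 * n) * (80*n) ^ 4" unfolding q2_def using n2 by (intro mult_right_mono) auto
 also have "\<dots> = (80 * n) ^ 5" by (simp only: power_Suc[symmetric]) simp
 finally have "(2 * q2 + 2)\<^sup>2 <= ((80 * n) ^ 5)\<^sup>2" by (intro power_mono) auto
 also have "\<dots> = (80 * n) ^ 10" by (simp only: power_mult[symmetric]) simp
 also have "\<dots> < (80 * n) ^ 16" using n by (intro power_strict_increasing) auto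
 finally show ?thesis using Bbig by simp
qed

lemma sm01: "sm0 x ==> sm1 x" and sm12: "sm1 x ==> sm x" and sm02: "sm0 x ==> sm x"
 using q01 q12 by (auto simp: sm0_def sm1_def sm_def)

declare sm02 [simp]

lemma sm_pr: "sm0 x ==> sm0 y ==> sm1 (pr x y)"
proof -
 assume "sm0 x" "sm0 y"
 then have "x + y + 1 <= 40 * n" using n2 by (auto simp: sm0_def q0_def)
 then have "(x + y + 1)\<^sup>2 <= (40 * n)\<^sup>2" by (intro power_mono) auto
 then show ?thesis using pr_less[of x y] by (simp add: sm1_def q1_def)
qed

lemma sm_pr1: "sm1 x ==> sm1 y ==> sm (pr x y)"
proof -
 assume "sm1 x" "sm1 y"
 then have "x + y + 1 <= 2 * (40*n)^2 + 1" by (auto simp: sm1_def q1_def)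
 also have "\<dots> <= (80 * n)^2" using n2 by (simp add: power2_eq_square)
 finally have "(x + y + 1)\<^sup>2 <= ((80 * n)\<^sup>2)\<^sup>2" by (intro power_mono) auto
 then show ?thesis using pr_less[of x y] by (simp add: sm_def q2_def flip: power_mult)
qed

lemma eval_PE' [simp]:
 "sm (eval B s a) ==> sm (eval B s b) ==> eval B s (PE a b) = pr (eval B s a) (eval B s b)"
proof (rule eval_PE)
 assume "sm (eval B s a)" "sm (eval B s b)"
 then have "(eval B s a + eval B s b + 1)\<^sup>2 <= (2 * q2 + 2)\<^sup>2" by (intro power_mono) (auto simp: sm_def)
 then show "(eval B s a + eval B s b + 1)\<^sup>2 < B" using q2B by (rule le_less_trans)
qed

lemma B16: "16 < B"
proof -
 have "(4::nat)\<^sup>2 <= (2 * q2 + 2)\<^sup>2" using n2 by (intro power_mono) (auto simp: q2_def)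
 then show ?thesis using q2B by simp
qed

lemma B_ne [simp]: "B ~= Suc 0" "B ~= 0"
 using B16 by auto

lemma mod_B [simp]:
 "sm x ==> sm y ==> (x + y) mod B = x + y"
 "sm x ==> sm y ==> (x * y) mod B = x * y"
 "sm x ==> Suc x mod B = Suc x" "sm x ==> x mod B = x"
 "Suc 0 mod B = Suc 0" "2 mod B = 2" "8 mod B = 8"
proof -
 have "2 * q2 + 2 < B" using q2B by (simp add: power2_eq_square)
 then show "sm x ==> sm y ==> (x + y) mod B = x + y" "sm x ==> Suc x mod B = Suc x"
  "sm x ==> x mod B = x"
  by (auto simp: sm_def)
 have "q2 * q2 < B" using q2B by (simp add: power2_eq_square algebra_simps)
 then show "(x * y) mod B = x * y" if "sm x" "sm y"
  using that mult_mono[of x q2 y q2] by (auto simp: sm_def)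
qed (use B16 in auto)

lemma sm0_n [simp]: "x <= n ==> sm0 x" "x < n ==> sm0 x"
 by (auto simp: sm0_def q0_def)

lemma sm0_leaf [simp]: "x < 4 * 2 ^ L ==> sm0 x"
 using Ln2 by (auto simp: sm0_def q0_def)

lemma sm0_L [simp]: "x <= 2 * L + 2 ==> sm0 x"
proof -
 assume "x <= 2 * L + 2"
 moreover have "L < 2 ^ L" by (rule less_exp)
 ultimately have "x <= 16 * n" using Ln2 n2 by linarith
 then show ?thesis by (simp add: sm0_def q0_def)
qed

end

section \<open>Matching an edge; walks in the colour trees\<close>

abbreviation "Inc a i \<equiv> Store a i (Add (Arr a i) (Const 1))"
abbreviation "Dec a i \<equiv> Store a i (Sub (Arr a i) (Const 1))"

text \<open>One greedy step. Both orientations of the pair are written, which spares a comparison of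
  the ends. An end is marked at the moment it becomes saturated.\<close>

definition TryMatch :: com where
 "TryMatch = If (Arr 15 (PE (Reg 60) (Reg 61))) Skip (If (Arr 17 (Reg 60)) Skip (If (Arr 17 (Reg 61)) Skip (blk [
   Store 15 (PE (Reg 60) (Reg 61)) (Const 1),
   Store 15 (PE (Reg 61) (Reg 60)) (Const 1),
   Store 1 (Add (Mul (Reg 60) (Reg 0)) (Reg 61)) (Const 1),
   Store 1 (Add (Mul (Reg 61) (Reg 0)) (Reg 60)) (Const 1),
   Inc 16 (Reg 60),
   Inc 16 (Reg 61),
   Store 17 (Reg 60) (Equal (Arr 16 (Reg 60)) (Arr 0 (Reg 60))),
   Store 17 (Reg 61) (Equal (Arr 16 (Reg 61)) (Arr 0 (Reg 61)))])))"

text \<open>A single walk from a leaf to the root serves three trees, those of the two slots and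
  that of the class. Increment and decrement are separate registers because words are never negative
  and subtraction is truncated.\<close>

definition PathUpdate :: com where
 "PathUpdate = While (Reg 53) (blk [
   Store 9 (PE (Reg 50) (Reg 53)) (Sub (Add (Arr 9 (PE (Reg 50) (Reg 53))) (Reg 54)) (Reg 55)),
   Store 9 (PE (Reg 51) (Reg 53)) (Sub (Add (Arr 9 (PE (Reg 51) (Reg 53))) (Reg 54)) (Reg 55)),
   Store 10 (PE (Reg 52) (Reg 53)) (Sub (Add (Arr 10 (PE (Reg 52) (Reg 53))) (Reg 54)) (Reg 55)),
   Assign 53 (Div (Reg 53) (Const 2))])"

definition FindFree :: com where
 "FindFree = blk [Assign 53 (Const 1), Assign 57 (Reg 56), While (Less (Reg 53) (Reg 56)) (blk [
   Assign 57 (Div (Reg 57) (Const 2)),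
   Assign 53 (Add (Reg 53) (Reg 53)),
   If (Less (Add (Arr 9 (PE (Reg 50) (Reg 53))) (Arr 9 (PE (Reg 51) (Reg 53)))) (Reg 57))
    Skip (Assign 53 (Add (Reg 53) (Const 1)))])]"

definition FindFullest :: com where
 "FindFullest = blk [Assign 53 (Const 1), While (Less (Reg 53) (Reg 56)) (blk [
   Assign 53 (Add (Reg 53) (Reg 53)),
   If (Less (Arr 10 (PE (Reg 52) (Reg 53))) (Arr 10 (PE (Reg 52) (Add (Reg 53) (Const 1)))))
    (Assign 53 (Add (Reg 53) (Const 1))) Skip])]"

definition bump :: "(nat \<Rightarrow> bool) \<Rightarrow> nat \<Rightarrow> nat \<Rightarrow> (nat \<Rightarrow> nat) \<Rightarrow> nat \<Rightarrow> nat" where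
 "bump P a b f = (\<lambda>j. if P j then f j + a - b else f j)"

text \<open>No ancestor of \<open>l\<close> lies strictly between \<open>cur div 2\<close> and
  \<open>cur\<close>, so one step up the path adds exactly \<open>cur\<close> to the visited
  nodes.\<close>

lemma anc_step: "anc cur l ==>
 (\<exists>nd > cur div 2. anc nd l \<and> Q nd) \<longleftrightarrow> (\<exists>nd > cur. anc nd l \<and> Q nd) \<or> Q cur"
proof -
 assume a: "anc cur l"
 then have "cur ~= 0" by (auto simp: anc_def)
 then have c0: "cur div 2 < cur" by auto
 show ?thesis
  using anc_chain[OF _ a] c0 a by (metis leD linorder_neqE_nat order_less_trans)
qed

text \<open>The cells already updated when the walk up from leaf \<open>l\<close> stands at
  \<open>cur\<close>. With \<open>cur = 0\<close> it is the whole path, which is the form used in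
  the specifications.\<close>

definition pathT :: "nat \<Rightarrow> nat \<Rightarrow> nat \<Rightarrow> nat \<Rightarrow> nat \<Rightarrow> bool" where
 "pathT cur l su sv j \<longleftrightarrow> (\<exists>nd > cur. anc nd l \<and> (j = pr su nd \<or> j = pr sv nd))"

lemma bump_step1: "anc cur l ==> f = bump (pathT cur l i i) a b g ==>
 f (pr i cur := g (pr i cur) + a - b) = bump (pathT (cur div 2) l i i) a b g"
 using anc_step[of cur l] by (auto simp: fun_eq_iff bump_def pathT_def)

lemma bump_step2: "anc cur l ==> f = bump (pathT cur l i i') a b g ==>
 f (pr i cur := g (pr i cur) + a - b, pr i' cur := g (pr i' cur) + a - b) = bump (pathT (cur div 2) l i i') a b g"
 using anc_step[of cur l] by (auto simp: fun_eq_iff bump_def pathT_def)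

lemma bump_cur [simp]: "bump (pathT cur l i i') a b g (pr j cur) = g (pr j cur)"
 by (auto simp: bump_def pathT_def)

context bm
begin

lemma PathUpdate_spec:
 assumes r: "reg s 50 = su" "reg s 51 = sv" "reg s 52 = i" "reg s 53 = l" "reg s 54 = a" "reg s 55 = b"
  and sm: "sm su" "sm sv" "sm i" "sm a" and ne: "su ~= sv" and l: "l < 4 * 2 ^ L" "l ~= 0"
  and T: "\<And>j. sm (arr s 9 j)" and CT: "\<And>j. sm (arr s 10 j)"
 shows "ht B PathUpdate s (\<lambda>s'. same 50 s s' \<and> clock s' <= clock s + 200 * (L + 3) \<and>
  arr s' = (arr s)(9 := bump (pathT 0 l su sv) a b (arr s 9), 10 := bump (pathT 0 l i i) a b (arr s 10)))"
proof -
 define I where "I s1 \<longleftrightarrow> (\<exists>cur m. reg s1 53 = cur \<and> (cur = 0 \<or> anc cur l) \<and> same 53 s s1 \<and>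
  reg s1 54 = a \<and> reg s1 55 = b \<and> cur < 2 ^ m \<and> clock s1 + 200 * m <= clock s + 200 * (L + 2) \<and>
  arr s1 = (arr s)(9 := bump (pathT cur l su sv) a b (arr s 9), 10 := bump (pathT cur l i i) a b (arr s 10)))"
  for s1
 show ?thesis unfolding PathUpdate_def
 proof (rule ht_While[where I = I and m = "\<lambda>s. reg s 53"])
  have *: "\<not> pathT l l x y j" for x y j using anc_le by (fastforce simp: pathT_def)
  \<comment> \<open>\<open>l < 2 ^ (L + 2)\<close>, so at most \<open>L + 2\<close> halvings lead to
    0; each is charged 200.\<close>
  show "I s" unfolding I_def
   by (rule exI[of _ l], rule exI[of _ "L + 2"]) (use r l anc_self in \<open>auto simp: bump_def *\<close>)
 next
  fix s1 assume "I s1" and e: "eval B s1 (Reg 53) ~= 0"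
  then obtain cur m where cur: "reg s1 53 = cur" "anc cur l" "same 53 s s1"
   "reg s1 54 = a" "reg s1 55 = b" "cur < 2 ^ m" "clock s1 + 200 * m <= clock s + 200 * (L + 2)"
   and A: "arr s1 = (arr s)(9 := bump (pathT cur l su sv) a b (arr s 9),
    10 := bump (pathT cur l i i) a b (arr s 10))"
   unfolding I_def by auto
  have regs: "reg s1 50 = su" "reg s1 51 = sv" "reg s1 52 = i"
   using same_reg[OF cur(3)] r by auto
  have smc: "sm cur" using anc_le[OF cur(2)] l by (intro sm02 sm0_leaf) simp
  have c0: "cur ~= 0" using cur(2) by (auto simp: anc_def)
  obtain m' where m: "m = Suc m'" using cur(6) c0 by (cases m) auto
  have h: "cur div 2 = 0 \<or> anc (cur div 2) l" using anc_half[OF cur(2)] by auto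
  show "ht B (blk [
   Store 9 (PE (Reg 50) (Reg 53)) (Sub (Add (Arr 9 (PE (Reg 50) (Reg 53))) (Reg 54)) (Reg 55)),
   Store 9 (PE (Reg 51) (Reg 53)) (Sub (Add (Arr 9 (PE (Reg 51) (Reg 53))) (Reg 54)) (Reg 55)),
   Store 10 (PE (Reg 52) (Reg 53)) (Sub (Add (Arr 10 (PE (Reg 52) (Reg 53))) (Reg 54)) (Reg 55)),
   Assign 53 (Div (Reg 53) (Const 2))]) (tick (1 + cost (Reg 53)) s1) (\<lambda>s'. I s' \<and> reg s' 53 < reg s1 53)"
   using ne c0 T CT sm unfolding I_def
   apply (simp add: regs cur smc A)
   apply (intro conjI exI[of _ m'])
   using h apply simp
   using cur(3) apply (simp add: same_def)
   using cur(6) m apply simp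
   using cur(7) m apply simp
   apply (rule ext)
   apply (subst bump_step1[OF cur(2) refl, of i a b "arr s 10", symmetric])
   apply (subst bump_step2[OF cur(2) refl, of su sv a b "arr s 9", symmetric])
   by simp
 next
  fix s1 assume "I s1" "eval B s1 (Reg 53) = 0"
  then show "same 50 s (tick (1 + cost (Reg 53)) s1) \<and>
   clock (tick (1 + cost (Reg 53)) s1) <= clock s + 200 * (L + 3) \<and>
   arr (tick (1 + cost (Reg 53)) s1) = (arr s)(9 := bump (pathT 0 l su sv) a b (arr s 9), 10 := bump (pathT 0 l i i) a b (arr s 10))"
   unfolding I_def by (auto simp: same_def)
 qed
qed

text \<open>Pigeonhole descent: if the two slots together use fewer colours than the subtree has
  leaves, the same holds for one of the children. Register 57 carries the number of leaves; at a
  leaf it is 1, so both counters vanish.\<close>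

lemma FindFree_spec:
 assumes r: "reg s 50 = su" "reg s 51 = sv" "reg s 56 = 2 * k"
  and k: "k = 2 ^ h" "h <= L"
  and sm: "sm su" "sm sv" and T: "\<And>j. sm (arr s 9 j)"
  and root: "arr s 9 (pr su 1) + arr s 9 (pr sv 1) < 2 * k"
  and child: "\<And>x nd. x = su \<or> x = sv ==> nd ~= 0 ==> nd < 2 * k ==>
   arr s 9 (pr x nd) = arr s 9 (pr x (2 * nd)) + arr s 9 (pr x (Suc (2 * nd)))"
 shows "ht B FindFree s (\<lambda>s'. same 53 s s' \<and> clock s' <= clock s + 100 * (L + 3) \<and> arr s' = arr s \<and>
  2 * k <= reg s' 53 \<and> reg s' 53 < 4 * k \<and> arr s 9 (pr su (reg s' 53)) = 0 \<and> arr s 9 (pr sv (reg s' 53)) = 0)"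
proof -
 define I where "I s1 \<longleftrightarrow> (\<exists>nd j. j <= Suc h \<and> reg s1 53 = nd \<and> same 53 s s1 \<and> reg s1 56 = 2 * k \<and>
  reg s1 57 = 2 ^ (Suc h - j) \<and> 2 ^ j <= nd \<and> nd < 2 * 2 ^ j \<and> arr s1 = arr s \<and>
  arr s 9 (pr su nd) + arr s 9 (pr sv nd) < 2 ^ (Suc h - j) \<and>
  clock s1 <= clock s + 6 + 100 * j)" for s1
 have kL: "2 ^ Suc h <= 2 * (2::nat) ^ L" using k by simp
 have "0 < (2::nat) ^ L" by simp
 then have "2 * k < 4 * 2 ^ L" using kL k by (simp only: power_Suc)
 then have smk: "sm (2 * k)" by (intro sm02 sm0_leaf)
 show ?thesis unfolding FindFree_def
  apply (simp only: blk.simps ht_Seq_Assign)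
 proof (rule ht_While[where I = I and m = "\<lambda>s. 4 * k - reg s 53"])
  show "I (tick (1 + cost (Reg 56)) (set_reg 57 (eval B (tick (1 + cost (Const 1)) (set_reg 53 (eval B s (Const 1)) s)) (Reg 56))
    (tick (1 + cost (Const 1)) (set_reg 53 (eval B s (Const 1)) s))))"
   unfolding I_def by (rule exI[of _ 1], rule exI[of _ 0]) (use r k root B16 in \<open>auto simp: same_def\<close>)
 next
  fix s1 assume "I s1" and e: "eval B s1 (Less (Reg 53) (Reg 56)) ~= 0"
  then obtain nd j where I: "j <= Suc h" "reg s1 53 = nd" "same 53 s s1" "reg s1 56 = 2 * k"
   "reg s1 57 = 2 ^ (Suc h - j)" "2 ^ j <= nd" "nd < 2 * 2 ^ j" "arr s1 = arr s"
   "arr s 9 (pr su nd) + arr s 9 (pr sv nd) < 2 ^ (Suc h - j)" "clock s1 <= clock s + 6 + 100 * j"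
   unfolding I_def by blast
  have nd: "nd < 2 * k" using e I by (simp split: if_splits)
  have j: "j < Suc h"
  proof (rule ccontr)
   assume "\<not> j < Suc h"
   then have "j = Suc h" using I(1) by simp
   then show False using I(6) nd k by simp
  qed
  then obtain d where d: "h = j + d" by (metis add.commute less_Suc_eq_le le_Suc_ex)
  have nd0: "nd ~= 0" using I(6) by (metis le_zero_eq power_not_zero zero_neq_numeral)
  have regs: "reg s1 50 = su" "reg s1 51 = sv" using same_reg[OF I(3)] r by auto
  have "k <= 2 ^ L" using k by simp
  then have smn: "sm nd" "sm (2 * nd)" "sm (Suc (2 * nd))"
   using nd by (intro sm02 sm0_leaf; linarith)+
  have ch: "arr s 9 (pr su nd) = arr s 9 (pr su (2 * nd)) + arr s 9 (pr su (Suc (2 * nd)))"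
   "arr s 9 (pr sv nd) = arr s 9 (pr sv (2 * nd)) + arr s 9 (pr sv (Suc (2 * nd)))"
   using child[of su nd] child[of sv nd] nd nd0 by auto
  have dd: "Suc h - j = Suc d" "Suc h - Suc j = d" using d by auto
  have nn: "nd + nd = 2 * nd" by simp
  have t1: "arr s 9 (pr su (2 * nd)) + arr s 9 (pr sv (2 * nd)) < 2 ^ d \<or>
   arr s 9 (pr su (Suc (2 * nd))) + arr s 9 (pr sv (Suc (2 * nd))) < 2 ^ d"
   using I(9) unfolding ch dd by auto
  let ?body = "Seq (Assign 57 (Div (Reg 57) (Const 2))) (Seq (Assign 53 (Add (Reg 53) (Reg 53)))
   (If (Less (Add (Arr 9 (PE (Reg 50) (Reg 53))) (Arr 9 (PE (Reg 51) (Reg 53)))) (Reg 57))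
    Skip (Assign 53 (Add (Reg 53) (Const 1)))))"
  have I2: "I s2 \<and> 4 * k - reg s2 53 < 4 * k - reg s1 53"
   if "reg s2 53 = nd'" "nd' = 2 * nd \<or> nd' = Suc (2 * nd)" "same 53 s1 s2" "reg s2 56 = 2 * k"
    "reg s2 57 = 2 ^ d" "arr s2 = arr s" "arr s 9 (pr su nd') + arr s 9 (pr sv nd') < 2 ^ d"
    "clock s2 <= clock s1 + 100" for s2 nd'
  proof
   show "I s2" unfolding I_def
    by (rule exI[of _ nd'], rule exI[of _ "Suc j"])
      (use that I j dd same_trans[OF I(3) that(3)] in auto)
   show "4 * k - reg s2 53 < 4 * k - reg s1 53" using that nd nd0 I(2) by auto
  qed
  have dec: "4 * k - 2 * nd < 4 * k - nd" "4 * k - Suc (2 * nd) < 4 * k - nd" using nd nd0 by auto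
  show "ht B ?body (tick (1 + cost (Less (Reg 53) (Reg 56))) s1)
     (\<lambda>s'. I s' \<and> 4 * k - reg s' 53 < 4 * k - reg s1 53)"
   apply (simp add: I regs smn nn sm T dd dec)
   apply (intro conjI impI)
   subgoal
    apply (rule I2[of _ "2 * nd", THEN conjunct1]) by (auto simp: I same_def)
   subgoal apply (rule I2[of _ "Suc (2 * nd)", THEN conjunct1]) using t1 by (auto simp: I same_def)
   done
 next
  fix s1 assume "I s1" and e: "eval B s1 (Less (Reg 53) (Reg 56)) = 0"
  then obtain nd j where I: "j <= Suc h" "reg s1 53 = nd" "same 53 s s1" "reg s1 56 = 2 * k"
   "reg s1 57 = 2 ^ (Suc h - j)" "2 ^ j <= nd" "nd < 2 * 2 ^ j" "arr s1 = arr s"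
   "arr s 9 (pr su nd) + arr s 9 (pr sv nd) < 2 ^ (Suc h - j)" "clock s1 <= clock s + 6 + 100 * j"
   unfolding I_def by blast
  have nd: "2 ^ Suc h <= nd" using e I k by (simp split: if_splits)
  have "j = Suc h"
  proof (rule ccontr)
   assume "j ~= Suc h"
   then have "j <= h" using I(1) by simp
   then have "(2::nat) ^ j <= 2 ^ h" by simp
   then have "nd < 2 * 2 ^ h" using I(7) by linarith
   then show False using nd by simp
  qed
  then show "same 53 s (tick (1 + cost (Less (Reg 53) (Reg 56))) s1) \<and>
     clock (tick (1 + cost (Less (Reg 53) (Reg 56))) s1) <= clock s + 100 * (L + 3) \<and>
     arr (tick (1 + cost (Less (Reg 53) (Reg 56))) s1) = arr s \<and>
     2 * k <= reg (tick (1 + cost (Less (Reg 53) (Reg 56))) s1) 53 \<and>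
     reg (tick (1 + cost (Less (Reg 53) (Reg 56))) s1) 53 < 4 * k \<and>
     arr s 9 (pr su (reg (tick (1 + cost (Less (Reg 53) (Reg 56))) s1) 53)) = 0 \<and>
     arr s 9 (pr sv (reg (tick (1 + cost (Less (Reg 53) (Reg 56))) s1) 53)) = 0"
   using I nd k by (auto simp: same_def)
 qed
qed

text \<open>The larger child has at least half of the parent's count, so the leaf reached has at
  least the average over the \<open>2 * k\<close> colours.\<close>

lemma FindFullest_spec:
 assumes r: "reg s 52 = i" "reg s 56 = 2 * k"
  and k: "k = 2 ^ h" "h <= L"
  and sm: "sm i" and T: "\<And>j. sm (arr s 10 j)"
  and child: "\<And>nd. nd ~= 0 ==> nd < 2 * k ==>
   arr s 10 (pr i nd) = arr s 10 (pr i (2 * nd)) + arr s 10 (pr i (Suc (2 * nd)))"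
 shows "ht B FindFullest s (\<lambda>s'. same 53 s s' \<and> clock s' <= clock s + 100 * (L + 3) \<and> arr s' = arr s \<and>
  2 * k <= reg s' 53 \<and> reg s' 53 < 4 * k \<and> arr s 10 (pr i 1) <= 2 * k * arr s 10 (pr i (reg s' 53)))"
proof -
 define I where "I s1 \<longleftrightarrow> (\<exists>nd j. j <= Suc h \<and> reg s1 53 = nd \<and> same 53 s s1 \<and> reg s1 56 = 2 * k \<and>
  2 ^ j <= nd \<and> nd < 2 * 2 ^ j \<and> arr s1 = arr s \<and>
  arr s 10 (pr i 1) <= 2 ^ j * arr s 10 (pr i nd) \<and> clock s1 <= clock s + 6 + 100 * j)" for s1
 have kL: "2 ^ Suc h <= 2 * (2::nat) ^ L" using k by simp
 have "0 < (2::nat) ^ L" by simp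
 then have "2 * k < 4 * 2 ^ L" using kL k by (simp only: power_Suc)
 then have smk: "sm (2 * k)" by (intro sm02 sm0_leaf)
 show ?thesis unfolding FindFullest_def
  apply (simp only: blk.simps ht_Seq_Assign)
 proof (rule ht_While[where I = I and m = "\<lambda>s. 4 * k - reg s 53"])
  show "I (tick (1 + cost (Const 1)) (set_reg 53 (eval B s (Const 1)) s))"
   unfolding I_def by (rule exI[of _ 1], rule exI[of _ 0]) (use r k B16 in \<open>auto simp: same_def\<close>)
 next
  fix s1 assume "I s1" and e: "eval B s1 (Less (Reg 53) (Reg 56)) ~= 0"
  then obtain nd j where I: "j <= Suc h" "reg s1 53 = nd" "same 53 s s1" "reg s1 56 = 2 * k"
   "2 ^ j <= nd" "nd < 2 * 2 ^ j" "arr s1 = arr s"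
   "arr s 10 (pr i 1) <= 2 ^ j * arr s 10 (pr i nd)" "clock s1 <= clock s + 6 + 100 * j"
   unfolding I_def by blast
  have nd: "nd < 2 * k" using e I by (simp split: if_splits)
  have j: "j < Suc h"
  proof (rule ccontr)
   assume "\<not> j < Suc h"
   then have "j = Suc h" using I(1) by simp
   then show False using I(5) nd k by simp
  qed
  have nd0: "nd ~= 0" using I(5) by (metis le_zero_eq power_not_zero zero_neq_numeral)
  have regs: "reg s1 52 = i" using same_reg[OF I(3)] r by auto
  have "k <= 2 ^ L" using k by simp
  then have smn: "sm nd" "sm (2 * nd)" "sm (Suc (2 * nd))"
   using nd by (intro sm02 sm0_leaf; linarith)+
  note ch = child[OF nd0 nd]
  have nn: "nd + nd = 2 * nd" by simp
  let ?body = "Seq (Assign 53 (Add (Reg 53) (Reg 53)))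
   (If (Less (Arr 10 (PE (Reg 52) (Reg 53))) (Arr 10 (PE (Reg 52) (Add (Reg 53) (Const 1)))))
    (Assign 53 (Add (Reg 53) (Const 1))) Skip)"
  have I2: "I s2 \<and> 4 * k - reg s2 53 < 4 * k - reg s1 53"
   if "reg s2 53 = nd'" "nd' = 2 * nd \<or> nd' = Suc (2 * nd)" "same 53 s1 s2" "reg s2 56 = 2 * k"
    "arr s2 = arr s" "arr s 10 (pr i nd) <= 2 * arr s 10 (pr i nd')"
    "clock s2 <= clock s1 + 100" for s2 nd'
  proof
   have "arr s 10 (pr i 1) <= 2 ^ j * (2 * arr s 10 (pr i nd'))"
    using I(8) that(6) by (meson le_trans mult_le_mono2)
   then show "I s2" unfolding I_def
    by (intro exI[of _ nd'] exI[of _ "Suc j"])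
      (use that I j same_trans[OF I(3) that(3)] in \<open>auto simp: mult.assoc mult.left_commute\<close>)
   show "4 * k - reg s2 53 < 4 * k - reg s1 53" using that nd nd0 I(2) by auto
  qed
  have dec: "4 * k - 2 * nd < 4 * k - nd" "4 * k - Suc (2 * nd) < 4 * k - nd" using nd nd0 by auto
  show "ht B ?body (tick (1 + cost (Less (Reg 53) (Reg 56))) s1)
     (\<lambda>s'. I s' \<and> 4 * k - reg s' 53 < 4 * k - reg s1 53)"
   apply (simp add: I regs smn nn sm T dec)
   apply (intro conjI impI)
   subgoal apply (rule I2[of _ "Suc (2 * nd)", THEN conjunct1]) by (auto simp: I same_def ch)
   subgoal apply (rule I2[of _ "2 * nd", THEN conjunct1]) by (auto simp: I same_def ch)
   done
 next
  fix s1 assume "I s1" and e: "eval B s1 (Less (Reg 53) (Reg 56)) = 0"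
  then obtain nd j where I: "j <= Suc h" "reg s1 53 = nd" "same 53 s s1" "reg s1 56 = 2 * k"
   "2 ^ j <= nd" "nd < 2 * 2 ^ j" "arr s1 = arr s"
   "arr s 10 (pr i 1) <= 2 ^ j * arr s 10 (pr i nd)" "clock s1 <= clock s + 6 + 100 * j"
   unfolding I_def by blast
  have nd: "2 ^ Suc h <= nd" using e I k by (simp split: if_splits)
  have "j = Suc h"
  proof (rule ccontr)
   assume "j ~= Suc h"
   then have "j <= h" using I(1) by simp
   then have "(2::nat) ^ j <= 2 ^ h" by simp
   then have "nd < 2 * 2 ^ h" using I(6) by linarith
   then show False using nd by simp
  qed
  then show "same 53 s (tick (1 + cost (Less (Reg 53) (Reg 56))) s1) \<and>
     clock (tick (1 + cost (Less (Reg 53) (Reg 56))) s1) <= clock s + 100 * (L + 3) \<and>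
     arr (tick (1 + cost (Less (Reg 53) (Reg 56))) s1) = arr s \<and>
     2 * k <= reg (tick (1 + cost (Less (Reg 53) (Reg 56))) s1) 53 \<and>
     reg (tick (1 + cost (Less (Reg 53) (Reg 56))) s1) 53 < 4 * k \<and>
     arr s 10 (pr i 1) <= 2 * k * arr s 10 (pr i (reg (tick (1 + cost (Less (Reg 53) (Reg 56))) s1) 53))"
   using I nd k by (auto simp: same_def)
 qed
qed

section \<open>The maintained matching\<close>

text \<open>Graphs are kept as symmetric irreflexive relations on vertices. Each edge thus occurs as
  two ordered pairs, and several factors 2 later on come from this.\<close>

definition graph :: "(nat \<times> nat) set \<Rightarrow> bool" where
 "graph G \<longleftrightarrow> (\<forall>x y. (x, y) \<in> G --> x < n \<and> y < n \<and> x ~= y \<and> (y, x) \<in> G)"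

text \<open>\<open>full\<close> is the lazy mark: an unmarked vertex has spare capacity, and a
  marked one uses at least half of its capacity. The set \<open>X\<close> exempts from the latter
  the ends of the current update, whose marks have not yet been re-examined.\<close>

definition MI :: "(nat \<Rightarrow> nat) \<Rightarrow> (nat \<Rightarrow> nat) \<Rightarrow> (nat \<Rightarrow> nat) \<Rightarrow> (nat \<Rightarrow> nat) \<Rightarrow> (nat \<times> nat) set \<Rightarrow> nat set \<Rightarrow> bool" where
 "MI out M d full G X \<longleftrightarrow>
   (\<forall>u v. u < v \<and> v < n --> (out (u * n + v) ~= 0) = (M (pr u v) ~= 0)) \<and>
   (\<forall>x y. M (pr x y) = M (pr y x)) \<and> (\<forall>x y. M (pr x y) ~= 0 --> (x, y) \<in> G) \<and>
   (\<forall>x. d x = card {y. M (pr x y) ~= 0}) \<and> (\<forall>x<n. d x <= c x) \<and>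
   (\<forall>x<n. full x = 0 --> d x < c x) \<and> (\<forall>x<n. x \<notin> X --> full x ~= 0 --> c x <= 2 * d x)"

text \<open>The capacity that marked vertices have lost since they were saturated. It pays for the
  scan that follows the removal of a mark.\<close>

definition pot3 :: "(nat \<Rightarrow> nat) \<Rightarrow> (nat \<Rightarrow> nat) \<Rightarrow> nat" where
 "pot3 d full = (\<Sum>v<n. if full v ~= 0 then c v - d v else 0)"

lemma pos_inj: "u < n ==> v < n ==> u' < n ==> v' < n ==> u * n + v = u' * n + v' \<longleftrightarrow> u = u' \<and> v = v'"
proof
 assume a: "v < n" "v' < n" "u * n + v = u' * n + v'"
 have "(u * n + v) mod n = v" "(u' * n + v') mod n = v'" using a(1,2) by auto
 moreover have "(u * n + v) div n = u" "(u' * n + v') div n = u'" using a(1,2) by auto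
 ultimately show "u = u' \<and> v = v'" using a by metis
qed auto

lemma MI_D':
 assumes "MI out M d full G X"
 shows "\<forall>u v. u < v \<and> v < n --> (out (u * n + v) ~= 0) = (M (pr u v) ~= 0)"
  "\<forall>x y. M (pr x y) = M (pr y x)" "\<forall>x y. M (pr x y) ~= 0 --> (x, y) \<in> G"
  "\<forall>x. d x = card {y. M (pr x y) ~= 0}" "\<forall>x<n. d x <= c x"
  "\<forall>x<n. full x = 0 --> d x < c x" "\<forall>x<n. x \<notin> X --> full x ~= 0 --> c x <= 2 * d x"
 using assms unfolding MI_def by - (elim conjE, assumption)+

lemmas MI_D = MI_D'[rule_format]

lemma MI_I:
 assumes "\<And>u v. u < v ==> v < n ==> (out (u * n + v) ~= 0) = (M (pr u v) ~= 0)"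
  "\<And>x y. M (pr x y) = M (pr y x)" "\<And>x y. M (pr x y) ~= 0 ==> (x, y) \<in> G"
  "\<And>x. d x = card {y. M (pr x y) ~= 0}" "\<And>x. x < n ==> d x <= c x"
  "\<And>x. x < n ==> full x = 0 ==> d x < c x"
  "\<And>x. x < n ==> x \<notin> X ==> full x ~= 0 ==> c x <= 2 * d x"
 shows "MI out M d full G X"
 unfolding MI_def by (intro conjI allI impI; (elim conjE)?; rule assms; assumption)

lemma MI_finite: "graph G ==> MI out M d full G X ==> finite {y. M (pr x y) ~= 0}"
 by (rule finite_subset[of _ "{..<n}"]) (auto dest: MI_D(3) simp: graph_def)

text \<open>The two ends contribute nothing to \<open>pot3\<close> while unmarked, and an end that
  becomes marked here is saturated and contributes \<open>c - d = 0\<close>.\<close>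

lemma MI_add:
 assumes MI: "MI out M d full G X" and G: "graph G" and xy: "(x, y) \<in> G"
  and M: "M (pr x y) = 0" and full: "full x = 0" "full y = 0"
  and full': "full' = full (x := if Suc (d x) = c x then 1 else 0, y := if Suc (d y) = c y then 1 else 0)"
 shows "MI (out (x * n + y := 1, y * n + x := 1)) (M (pr x y := 1, pr y x := 1))
  (d (x := Suc (d x), y := Suc (d y))) full' G X"
  "pot3 (d (x := Suc (d x), y := Suc (d y))) full' = pot3 d full"
proof -
 have x: "x < n" "y < n" "x ~= y" "(y, x) \<in> G" using G xy by (auto simp: graph_def)
 let ?M = "M (pr x y := 1, pr y x := 1)"
 have M': "M (pr y x) = 0" using MI_D(2)[OF MI, of x y] M by simp
 have d: "d x < c x" "d y < c y" using MI_D(6)[OF MI] full x by auto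
 have s: "{z. ?M (pr w z) ~= 0} = (if w = x then insert y {z. M (pr w z) ~= 0}
   else if w = y then insert x {z. M (pr w z) ~= 0} else {z. M (pr w z) ~= 0})" for w
  using x by auto
 have fin: "finite {y. M (pr w y) ~= 0}" for w using MI_finite[OF G MI] .
 have card: "(d (x := Suc (d x), y := Suc (d y))) w = card {z. ?M (pr w z) ~= 0}" for w
 proof -
  have n: "y \<notin> {z. M (pr x z) ~= 0}" "x \<notin> {z. M (pr y z) ~= 0}" using M M' by auto
  have dv: "d v = card {z. M (pr v z) ~= 0}" for v by (rule MI_D(4)[OF MI])
  have i: "card (insert y {z. M (pr x z) ~= 0}) = Suc (d x)" "card (insert x {z. M (pr y z) ~= 0}) = Suc (d y)"
   unfolding dv by (intro card_insert_disjoint fin n)+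
  show ?thesis
  proof (cases "w = x \<or> w = y")
   case True
   then show ?thesis using x(3) i unfolding s by (elim disjE) (simp_all del: neq0_conv)
  next
   case False
   then show ?thesis using dv[of w] unfolding s by (simp del: neq0_conv)
  qed
 qed
 have out: "((out (x * n + y := 1, y * n + x := 1)) (u * n + v) ~= 0) = (?M (pr u v) ~= 0)"
  if "u < v" "v < n" for u v
 proof -
  have "u < n" using that by simp
  have "(out (u * n + v) ~= 0) = (M (pr u v) ~= 0)" by (rule MI_D(1)[OF MI conjI[OF that]])
  then show ?thesis using pos_inj[OF \<open>u < n\<close> that(2) x(1,2)] pos_inj[OF \<open>u < n\<close> that(2) x(2,1)] by simp
 qed
 show "MI (out (x * n + y := 1, y * n + x := 1)) ?M (d (x := Suc (d x), y := Suc (d y))) full' G X"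
 proof (rule MI_I)
  fix u v assume "u < v" "v < n"
  then show "((out (x * n + y := 1, y * n + x := 1)) (u * n + v) ~= 0) = (?M (pr u v) ~= 0)" by (rule out)
 next
  fix a b
  show "?M (pr a b) = ?M (pr b a)"
   unfolding fun_upd_apply prod_encode_eq prod.inject
   by (subst MI_D(2)[OF MI]) (simp only: disj_commute conj_commute split: if_split, blast)
 next
  fix a b assume "?M (pr a b) ~= 0"
  moreover have "M (pr a b) ~= 0 ==> (a, b) \<in> G" by (rule MI_D(3)[OF MI])
  ultimately show "(a, b) \<in> G" using xy x(4) by (auto split: if_splits)
 next
  fix w show "(d (x := Suc (d x), y := Suc (d y))) w = card {z. ?M (pr w z) ~= 0}" by (rule card)
 next
  fix w assume "w < n"
  moreover have "d w <= c w" by (rule MI_D(5)[OF MI \<open>w < n\<close>])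
  ultimately show "(d (x := Suc (d x), y := Suc (d y))) w <= c w" using d by auto
 next
  fix w assume "w < n" "full' w = 0"
  moreover have "full w = 0 ==> d w < c w" by (rule MI_D(6)[OF MI \<open>w < n\<close>])
  ultimately show "(d (x := Suc (d x), y := Suc (d y))) w < c w"
   using d full' by (auto split: if_splits)
 next
  fix w assume "w < n" "w \<notin> X" "full' w ~= 0"
  moreover have "full w ~= 0 ==> c w <= 2 * d w" by (rule MI_D(7)[OF MI \<open>w < n\<close> \<open>w \<notin> X\<close>])
  ultimately show "c w <= 2 * (d (x := Suc (d x), y := Suc (d y))) w"
   using d full' by (auto split: if_splits)
 qed
 show "pot3 (d (x := Suc (d x), y := Suc (d y))) full' = pot3 d full"
  unfolding pot3_def by (rule sum.cong) (use full full' in auto)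
qed

definition eqA :: "nat set \<Rightarrow> state \<Rightarrow> state \<Rightarrow> bool" where
 "eqA F s s' \<longleftrightarrow> (\<forall>a. a \<notin> F --> arr s' a = arr s a)"

lemma eqA_trans: "eqA F s s' ==> eqA F' s' s'' ==> F \<subseteq> H ==> F' \<subseteq> H ==> eqA H s s''"
 unfolding eqA_def by (metis subsetD)

lemma eqA_D: "eqA F s s' ==> a \<notin> F ==> arr s' a = arr s a"
 by (auto simp: eqA_def)

text \<open>As long as no mark is withdrawn and no matched edge deleted, the matching and the marks
  only grow, so covered edges stay covered. New marks appear at saturated vertices only, which keeps
  \<open>pot3\<close> fixed.\<close>

definition Mmono :: "state \<Rightarrow> state \<Rightarrow> bool" where
 "Mmono s s' \<longleftrightarrow> (\<forall>j. arr s 15 j ~= 0 --> arr s' 15 j ~= 0) \<and> (\<forall>x. arr s 17 x ~= 0 --> arr s' 17 x ~= 0)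
  \<and> pot3 (arr s' 16) (arr s' 17) = pot3 (arr s 16) (arr s 17)"

lemma Mmono_refl: "Mmono s s"
 by (simp add: Mmono_def)

lemma Mmono_trans: "Mmono s s' ==> Mmono s' s'' ==> Mmono s s''"
 by (simp add: Mmono_def)

definition cov :: "state \<Rightarrow> nat \<Rightarrow> nat \<Rightarrow> bool" where
 "cov s x y \<longleftrightarrow> arr s 15 (pr x y) ~= 0 \<or> arr s 17 x ~= 0 \<or> arr s 17 y ~= 0"

lemma Mmono_cov: "Mmono s s' ==> cov s x y ==> cov s' x y"
 unfolding Mmono_def cov_def by blast

abbreviation MIs :: "state \<Rightarrow> (nat \<times> nat) set \<Rightarrow> nat set \<Rightarrow> bool" where
 "MIs s G X \<equiv> MI (arr s 1) (arr s 15) (arr s 16) (arr s 17) G X"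

lemma TryMatch_spec:
 assumes r: "reg s 60 = x" "reg s 61 = y" "reg s 0 = n" and G: "graph G" and xy: "(x, y) \<in> G"
  and MI: "MIs s G X" and cap: "\<forall>v<n. arr s 0 v = c v"
 shows "ht B TryMatch s (\<lambda>s'. same 60 s s' \<and> eqA {1, 15, 16, 17} s s' \<and> clock s' <= clock s + 300 \<and>
  MIs s' G X \<and> Mmono s s' \<and> cov s' x y)"
proof -
 have x: "x < n" "y < n" "x ~= y" "(y, x) \<in> G" using G xy by (auto simp: graph_def)
 have sm: "sm x" "sm y" "sm n" using x by simp_all
 have sm2: "sm (x * n)" "sm (y * n)"
 proof -
  have "x * n <= n * n" "y * n <= n * n" using x by auto
  moreover have "n * n <= q1" by (simp add: q1_def power2_eq_square)
  ultimately have "sm1 (x * n)" "sm1 (y * n)" unfolding sm1_def by linarith+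
  then show "sm (x * n)" "sm (y * n)" using sm12 by blast+
 qed
 note sms = sm sm2
 show ?thesis
 proof (cases "arr s 15 (pr x y) ~= 0 \<or> arr s 17 x ~= 0 \<or> arr s 17 y ~= 0")
  case True
  have Q: "same 60 s (tick k s)" "eqA {1, 15, 16, 17} s (tick k s)" "Mmono s (tick k s)"
   "cov (tick k s) x y" for k
   using True unfolding same_def eqA_def Mmono_def cov_def reg_upd by blast+
  have P: "ht B TryMatch s P" if "\<And>k. k <= 300 ==> P (tick k s)" for P
  proof -
   consider "arr s 15 (pr x y) ~= 0" | "arr s 15 (pr x y) = 0" "arr s 17 x ~= 0"
    | "arr s 15 (pr x y) = 0" "arr s 17 x = 0" "arr s 17 y ~= 0" using True by blast
   \<comment> \<open>The three early exits return after 16, 19 and 22 ticks.\<close>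
   then show ?thesis
    using that[of 16] that[of 19] that[of 22]
    by cases (simp_all add: TryMatch_def r sms tick_def add.commute del: neq0_conv blk.simps)
  qed
  show ?thesis by (rule P) (use Q MI in simp)
 next
  case False
  then have F: "arr s 15 (pr x y) = 0" "arr s 17 x = 0" "arr s 17 y = 0" by auto
  have d: "arr s 16 x < c x" "arr s 16 y < c y" using MI_D(6)[OF MI] F x by auto
  then have smd: "sm (arr s 16 x)" "sm (arr s 16 y)" using cn[of x] cn[of y] x by simp_all
  define A where "A = (arr s)(15 := (arr s 15)(pr x y := 1, pr y x := 1), 1 := (arr s 1)(x * n + y := 1, y * n + x := 1),
   16 := (arr s 16)(x := Suc (arr s 16 x), y := Suc (arr s 16 y)),
   17 := (arr s 17)(x := if Suc (arr s 16 x) = c x then 1 else 0, y := if Suc (arr s 16 y) = c y then 1 else 0))"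
  have *: "MI (A 1) (A 15) (A 16) (A 17) G X" "pot3 (A 16) (A 17) = pot3 (arr s 16) (arr s 17)"
   using MI_add[OF MI G xy F refl] by (simp_all add: A_def)
  have Q: "same 60 s s' \<and> eqA {1, 15, 16, 17} s s' \<and> clock s' <= clock s + 300 \<and>
   MIs s' G X \<and> Mmono s s' \<and> cov s' x y" if "reg s' = reg s" "arr s' = A" "clock s' <= clock s + 300" for s'
  proof (intro conjI)
   show "eqA {1, 15, 16, 17} s s'" unfolding eqA_def that(2) A_def by simp
   show "Mmono s s'" unfolding Mmono_def that(2) *(2) by (simp add: A_def F)
   have "A 15 (pr x y) = 1" by (simp add: A_def)
   then show "cov s' x y" unfolding cov_def that(2) by simp
   show "same 60 s s'" unfolding same_def that(1) by simp
   show "MIs s' G X" unfolding that(2) by (rule *(1))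
   show "clock s' <= clock s + 300" by (rule that(3))
  qed
  have "ht B TryMatch s (\<lambda>s'. reg s' = reg s \<and> arr s' = A \<and> clock s' <= clock s + 300)"
   unfolding TryMatch_def
   by (simp add: F r sms smd x x(3)[symmetric] cap A_def fun_upd_twist)
  then show ?thesis by (rule ht_mono) (use Q in blast)
 qed
qed

end

context bm
begin

section \<open>Colouring the edges with respect to slots\<close>

text \<open>Truncated subtraction makes the slot size 1 for classes up to \<open>ll\<close>; such a
  class has just the two colours 2 and 3.\<close>

definition K :: "nat \<Rightarrow> nat" where
 "K i = 2 ^ (i - ll)"

text \<open>The vertex \<open>x\<close> belongs to the name of the slot, so an edge lies in two
  slots, one at each end, and the two are always different.\<close>

definition slot :: "(nat \<Rightarrow> nat) \<Rightarrow> (nat \<Rightarrow> nat) \<Rightarrow> nat \<Rightarrow> nat \<Rightarrow> nat" where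
 "slot cl ps x y = pr x (pr (cl (pr x y)) (ps (pr x y) div K (cl (pr x y))))"

definition TS :: "(nat \<Rightarrow> nat) \<Rightarrow> (nat \<Rightarrow> nat) \<Rightarrow> (nat \<Rightarrow> nat) \<Rightarrow> nat \<Rightarrow> nat \<Rightarrow> (nat \<times> nat) set" where
 "TS cl ps lf \<sigma> nd = {(x, y). slot cl ps x y = \<sigma> \<and> anc nd (lf (pr x y))}"

text \<open>The condition \<open>x < y\<close> counts every edge of the class once. In
  \<open>TS\<close> the slot already fixes the orientation.\<close>

definition CS :: "(nat \<Rightarrow> nat) \<Rightarrow> (nat \<Rightarrow> nat) \<Rightarrow> nat \<Rightarrow> nat \<Rightarrow> (nat \<times> nat) set" where
 "CS cl lf i nd = {(x, y). x < y \<and> cl (pr x y) = i \<and> anc nd (lf (pr x y))}"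

text \<open>A colour is a leaf number between \<open>2 * K\<close> and \<open>4 * K - 1\<close> in
  \<open>lf\<close>, with 0 for an uncoloured edge. That the colouring is proper is expressed by
  \<open>who\<close>, which recovers the other end from slot and colour and is shifted by one so
  that 0 means none. \<open>T\<close> and \<open>CT\<close> count coloured edges below a tree node,
  per slot and per class. \<open>CLa\<close> and \<open>CLb\<close> list the ends of the edges of
  one colour and \<open>cp\<close> gives the place in that list. The last clause speaks of leaves
  only, since an inner node counts edges of several colours and has no list.\<close>

definition COL where
 "COL cl ps lf T CT who CLa CLb cp \<longleftrightarrow>
   (\<forall>x y. lf (pr x y) = lf (pr y x)) \<and>
   (\<forall>x y. lf (pr x y) ~= 0 --> x < n \<and> y < n \<and> x ~= y \<and> cl (pr x y) = cl (pr y x) \<and> cl (pr x y) <= L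
    \<and> 2 * K (cl (pr x y)) <= lf (pr x y) \<and> lf (pr x y) < 4 * K (cl (pr x y))) \<and>
   (\<forall>x y. lf (pr x y) ~= 0 --> who (pr (slot cl ps x y) (lf (pr x y))) = Suc y) \<and>
   (\<forall>\<sigma> l. who (pr \<sigma> l) ~= 0 --> (\<exists>x y. slot cl ps x y = \<sigma> \<and> lf (pr x y) = l \<and> l ~= 0 \<and> who (pr \<sigma> l) = Suc y)) \<and>
   (\<forall>\<sigma> nd. T (pr \<sigma> nd) = card (TS cl ps lf \<sigma> nd)) \<and>
   (\<forall>i nd. CT (pr i nd) = card (CS cl lf i nd)) \<and>
   (\<forall>x y. lf (pr x y) ~= 0 --> cp (pr x y) < CT (pr (cl (pr x y)) (lf (pr x y))) \<and> cp (pr y x) = cp (pr x y) \<and>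
    (let q = pr (pr (cl (pr x y)) (lf (pr x y))) (cp (pr x y)) in
     CLa q = x \<and> CLb q = y \<or> CLa q = y \<and> CLb q = x)) \<and>
   (\<forall>i l p. p < CT (pr i l) \<and> 2 * K i <= l --> (let e = pr (CLa (pr (pr i l) p)) (CLb (pr (pr i l) p)) in
     lf e = l \<and> cl e = i \<and> cp e = p))"

lemma COL_D':
 assumes "COL cl ps lf T CT who CLa CLb cp"
 shows "\<forall>x y. lf (pr x y) = lf (pr y x)"
  "\<forall>x y. lf (pr x y) ~= 0 --> x < n \<and> y < n \<and> x ~= y \<and> cl (pr x y) = cl (pr y x) \<and> cl (pr x y) <= L
    \<and> 2 * K (cl (pr x y)) <= lf (pr x y) \<and> lf (pr x y) < 4 * K (cl (pr x y))"
  "\<forall>x y. lf (pr x y) ~= 0 --> who (pr (slot cl ps x y) (lf (pr x y))) = Suc y"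
  "\<forall>\<sigma> l. who (pr \<sigma> l) ~= 0 --> (\<exists>x y. slot cl ps x y = \<sigma> \<and> lf (pr x y) = l \<and> l ~= 0 \<and> who (pr \<sigma> l) = Suc y)"
  "\<forall>\<sigma> nd. T (pr \<sigma> nd) = card (TS cl ps lf \<sigma> nd)"
  "\<forall>i nd. CT (pr i nd) = card (CS cl lf i nd)"
  "\<forall>x y. lf (pr x y) ~= 0 --> cp (pr x y) < CT (pr (cl (pr x y)) (lf (pr x y))) \<and> cp (pr y x) = cp (pr x y) \<and>
    (let q = pr (pr (cl (pr x y)) (lf (pr x y))) (cp (pr x y)) in
     CLa q = x \<and> CLb q = y \<or> CLa q = y \<and> CLb q = x)"
  "\<forall>i l p. p < CT (pr i l) \<and> 2 * K i <= l --> (let e = pr (CLa (pr (pr i l) p)) (CLb (pr (pr i l) p)) in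
     lf e = l \<and> cl e = i \<and> cp e = p)"
 using assms unfolding COL_def by - (elim conjE, assumption)+

lemmas COL_D = COL_D'[rule_format]

lemma COL_I:
 assumes "\<And>x y. lf (pr x y) = lf (pr y x)"
  "\<And>x y. lf (pr x y) ~= 0 ==> x < n \<and> y < n \<and> x ~= y \<and> cl (pr x y) = cl (pr y x) \<and> cl (pr x y) <= L
    \<and> 2 * K (cl (pr x y)) <= lf (pr x y) \<and> lf (pr x y) < 4 * K (cl (pr x y))"
  "\<And>x y. lf (pr x y) ~= 0 ==> who (pr (slot cl ps x y) (lf (pr x y))) = Suc y"
  "\<And>\<sigma> l. who (pr \<sigma> l) ~= 0 ==> (\<exists>x y. slot cl ps x y = \<sigma> \<and> lf (pr x y) = l \<and> l ~= 0 \<and> who (pr \<sigma> l) = Suc y)"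
  "\<And>\<sigma> nd. T (pr \<sigma> nd) = card (TS cl ps lf \<sigma> nd)"
  "\<And>i nd. CT (pr i nd) = card (CS cl lf i nd)"
  "\<And>x y. lf (pr x y) ~= 0 ==> cp (pr x y) < CT (pr (cl (pr x y)) (lf (pr x y))) \<and> cp (pr y x) = cp (pr x y) \<and>
    (let q = pr (pr (cl (pr x y)) (lf (pr x y))) (cp (pr x y)) in
     CLa q = x \<and> CLb q = y \<or> CLa q = y \<and> CLb q = x)"
  "\<And>i l p. p < CT (pr i l) ==> 2 * K i <= l ==> (let e = pr (CLa (pr (pr i l) p)) (CLb (pr (pr i l) p)) in
     lf e = l \<and> cl e = i \<and> cp e = p)"
 shows "COL cl ps lf T CT who CLa CLb cp"
 unfolding COL_def
 apply (intro conjI)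
 subgoal by (intro allI; rule assms(1))
 subgoal by (intro allI impI; rule assms(2); assumption)
 subgoal by (intro allI impI; rule assms(3); assumption)
 subgoal by (intro allI impI; rule assms(4); assumption)
 subgoal by (intro allI; rule assms(5))
 subgoal by (intro allI; rule assms(6))
 subgoal by (intro allI impI; rule assms(7); assumption)
 subgoal by (intro allI impI; rule assms(8); elim conjE; assumption)
 done

lemma K_pos [simp]: "0 < K i" "K i ~= 0"
 by (simp_all add: K_def)

lemma K_le: "i <= L ==> K i <= 2 ^ L"
 unfolding K_def by (intro power_increasing) auto

context
 fixes cl ps lf T CT who CLa CLb cp :: "nat \<Rightarrow> nat"
 assumes COL: "COL cl ps lf T CT who CLa CLb cp"
begin

lemma TS_sub: "TS cl ps lf \<sigma> nd \<subseteq> {..<n} \<times> {..<n}"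
proof
 fix e assume "e \<in> TS cl ps lf \<sigma> nd"
 then obtain x y where e0: "e = (x, y)" "anc nd (lf (pr x y))" by (auto simp: TS_def)
 then have e: "e = (x, y)" "lf (pr x y) ~= 0" by (auto intro: ccontr)
 then show "e \<in> {..<n} \<times> {..<n}" using COL_D(2)[OF COL e(2)] by simp
qed

lemma CS_sub: "CS cl lf i nd \<subseteq> {..<n} \<times> {..<n}"
proof
 fix e assume "e \<in> CS cl lf i nd"
 then obtain x y where e0: "e = (x, y)" "anc nd (lf (pr x y))" by (auto simp: CS_def)
 then have e: "e = (x, y)" "lf (pr x y) ~= 0" by (auto intro: ccontr)
 then show "e \<in> {..<n} \<times> {..<n}" using COL_D(2)[OF COL e(2)] by simp
qed

lemma TS_fin: "finite (TS cl ps lf \<sigma> nd)" and CS_fin: "finite (CS cl lf i nd)"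
 by (rule finite_subset[OF TS_sub], simp) (rule finite_subset[OF CS_sub], simp)

lemma col_sm: "sm (T j)" "sm (CT j)"
proof -
 obtain a b where j: "j = pr a b" by (metis prod_decode_inverse surj_pair)
 have q: "card S <= q1" if "S \<subseteq> {..<n} \<times> {..<n}" for S
 proof -
  have "card S <= card ({..<n} \<times> {..<n})" using that by (intro card_mono) auto
  also have "\<dots> <= q1" by (simp add: q1_def power2_eq_square)
  finally show ?thesis .
 qed
 show "sm (T j)" "sm (CT j)" unfolding j COL_D(5)[OF COL] COL_D(6)[OF COL]
  using q[OF TS_sub] q[OF CS_sub] by (auto intro!: sm12 simp: sm1_def)
qed

text \<open>The form of \<open>\<sigma>\<close> fixes the class and thereby the depth of the tree.
  All colours in use are leaves of that tree, so nothing is counted at an inner node itself.\<close>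

lemma T_child:
 assumes "\<sigma> = pr x (pr i s)" "nd ~= 0" "nd < 2 * K i"
 shows "T (pr \<sigma> nd) = T (pr \<sigma> (2 * nd)) + T (pr \<sigma> (Suc (2 * nd)))"
proof -
 let ?S = "{e \<in> {..<n} \<times> {..<n}. slot cl ps (fst e) (snd e) = \<sigma> \<and> lf (pr (fst e) (snd e)) ~= 0}"
 have eq: "TS cl ps lf \<sigma> m = {e \<in> ?S. anc m (lf (pr (fst e) (snd e)))}" for m
 proof -
  have "lf (pr x y) ~= 0" if "anc m (lf (pr x y))" for x y using that by (auto intro: ccontr)
  then show ?thesis using TS_sub[of \<sigma> m] unfolding TS_def by fastforce
 qed
 have "lf (pr (fst e) (snd e)) ~= nd" if "e \<in> ?S" for e
 proof -
  have nz: "lf (pr (fst e) (snd e)) ~= 0" and s: "slot cl ps (fst e) (snd e) = \<sigma>" using that by auto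
  have "cl (pr (fst e) (snd e)) = i" using s assms(1) by (cases e) (simp add: slot_def)
  then show ?thesis using COL_D(2)[OF COL nz] assms(3) by auto
 qed
 then show ?thesis unfolding COL_D(5)[OF COL] eq
  by (intro card_split_anc[where f = "\<lambda>e. lf (pr (fst e) (snd e))"] assms(2)) auto
qed

lemma CT_child:
 assumes "nd ~= 0" "nd < 2 * K i"
 shows "CT (pr i nd) = CT (pr i (2 * nd)) + CT (pr i (Suc (2 * nd)))"
proof -
 let ?S = "{e \<in> {..<n} \<times> {..<n}. fst e < snd e \<and> cl (pr (fst e) (snd e)) = i \<and> lf (pr (fst e) (snd e)) ~= 0}"
 have eq: "CS cl lf i m = {e \<in> ?S. anc m (lf (pr (fst e) (snd e)))}" for m
 proof -
  have "lf (pr x y) ~= 0" if "anc m (lf (pr x y))" for x y using that by (auto intro: ccontr)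
  then show ?thesis using CS_sub[of i m] unfolding CS_def by fastforce
 qed
 have "lf (pr (fst e) (snd e)) ~= nd" if "e \<in> ?S" for e
 proof -
  have nz: "lf (pr (fst e) (snd e)) ~= 0" and s: "cl (pr (fst e) (snd e)) = i" using that by auto
  then show ?thesis using COL_D(2)[OF COL nz] assms(2) by auto
 qed
 then show ?thesis unfolding COL_D(6)[OF COL] eq
  by (intro card_split_anc[where f = "\<lambda>e. lf (pr (fst e) (snd e))"] assms(1)) auto
qed

text \<open>The list cell addressed by class, colour and position names both ends, so it determines
  the edge up to orientation.\<close>

lemma cp_inj:
 assumes "lf (pr x y) ~= 0" "lf (pr x' y') = lf (pr x y)" "cl (pr x' y') = cl (pr x y)" "cp (pr x' y') = cp (pr x y)"
 shows "x' = x \<and> y' = y \<or> x' = y \<and> y' = x"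
 using COL_D(7)[OF COL assms(1)] COL_D(7)[OF COL, of x' y'] assms unfolding Let_def by auto

lemma leaf_anc:
 assumes "lf (pr x y) ~= 0" "cl (pr x y) = i" "2 * K i <= l'" "anc l' (lf (pr x y))"
 shows "l' = lf (pr x y)"
 by (rule anc_leaf[of _ _ "2 * K i"]) (use assms COL_D(2)[OF COL assms(1)] in auto)

end

lemma bump_path: "bump (pathT 0 l i j) a b f (pr k nd) =
  (if anc nd l \<and> (k = i \<or> k = j) then f (pr k nd) + a - b else f (pr k nd))"
 unfolding bump_def pathT_def using anc_0(1)[of l] by (auto simp: neq0_conv[symmetric] simp del: neq0_conv)

lemma card_minus2:
 assumes "finite S" "a ~= b"
 shows "card (S - {a, b}) = card S - (if a \<in> S then 1 else 0) - (if b \<in> S then 1 else 0)"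
proof -
 have "S - {a, b} = S - {a} - {b}" by auto
 then show ?thesis using assms by (simp add: card_Diff_singleton_if)
qed

text \<open>The pairs name the same undirected edge. By \<open>E2_upd\<close> a simultaneous write
  to both orientations becomes one case distinction, which keeps the simplifier away from the four
  coordinate equations.\<close>

definition E2 :: "nat \<Rightarrow> nat \<Rightarrow> nat \<Rightarrow> nat \<Rightarrow> bool" where
 "E2 u v a b \<longleftrightarrow> a = u \<and> b = v \<or> a = v \<and> b = u"

lemma E2_upd: "(f(pr u v := k, pr v u := k)) (pr a b) = (if E2 u v a b then k else f (pr a b))"
proof (cases "E2 u v a b")
 case True
 then have "pr a b = pr u v \<or> pr a b = pr v u" unfolding E2_def by blast
 then have "(f(pr u v := k, pr v u := k)) (pr a b) = k" unfolding fun_upd_apply by presburger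
 then show ?thesis using True by (simp only: if_True)
next
 case False
 then have "pr a b ~= pr u v" "pr a b ~= pr v u" unfolding E2_def by simp_all
 then have "(f(pr u v := k, pr v u := k)) (pr a b) = f (pr a b)" unfolding fun_upd_apply by presburger
 then show ?thesis using False by (simp only: if_False)
qed

lemma E2_sym: "E2 u v a b = E2 u v b a"
 unfolding E2_def by blast

lemma E2_self [simp]: "E2 u v u v" "E2 u v v u"
 unfolding E2_def by blast+

text \<open>The last edge of the colour list moves into the vacated place \<open>p\<close>, so the
  list stays contiguous at constant cost. It may be the uncoloured edge itself; then the cell
  written lies beyond the new end of the list and \<open>cp\<close> is written for an uncoloured
  pair, and no clause constrains either.\<close>

lemma COL_uncolor:
 assumes COL: "COL cl ps lf T CT who CLa CLb cp"
  and l: "lf (pr u v) = l" "l ~= 0" and i: "cl (pr u v) = i" and p: "cp (pr u v) = p"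
  and su: "slot cl ps u v = su" and sv: "slot cl ps v u = sv"
  and lst: "lst = CT (pr i l) - 1"
  and x: "x = CLa (pr (pr i l) lst)" and y: "y = CLb (pr (pr i l) lst)"
 shows "COL cl ps (lf(pr u v := 0, pr v u := 0)) (bump (pathT 0 l su sv) 0 1 T) (bump (pathT 0 l i i) 0 1 CT)
  (who(pr su l := 0, pr sv l := 0)) (CLa(pr (pr i l) p := x)) (CLb(pr (pr i l) p := y)) (cp(pr x y := p, pr y x := p))"
  (is "COL cl ps ?lf ?T ?CT ?who ?CLa ?CLb ?cp")
proof -
 note D = COL_D[OF COL]
 have nz: "lf (pr u v) ~= 0" "lf (pr v u) ~= 0" using l D(1)[of u v] by auto
 note uv = D(2)[OF nz(1)]
 have lvu: "lf (pr v u) = l" using l D(1)[of u v] by simp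
 have ivu: "cl (pr v u) = i" using uv i by simp
 have ne: "su ~= sv" using uv su sv by (auto simp: slot_def)
 have leafl: "2 * K i <= l" "l < 4 * K i" using uv l i by auto
 have lf: "?lf (pr a b) = (if E2 u v a b then 0 else lf (pr a b))" for a b by (rule E2_upd)
 have cp: "?cp (pr a b) = (if E2 x y a b then p else cp (pr a b))" for a b by (rule E2_upd)
 have E2uv: "lf (pr a b) = l \<and> cl (pr a b) = i \<and> cp (pr a b) = p" if "E2 u v a b" for a b
  using that l lvu i ivu p COL_D(7)[OF COL nz(1)] unfolding E2_def by (elim disjE conjE) simp_all
 have lfnz: "?lf (pr a b) ~= 0 ==> lf (pr a b) ~= 0 \<and> \<not> E2 u v a b \<and> ?lf (pr a b) = lf (pr a b)" for a b
  unfolding lf by (cases "E2 u v a b") simp_all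
 have pl: "p < CT (pr i l)" "cp (pr v u) = p" using D(7)[OF nz(1)] l i p by auto
 have xy: "lf (pr x y) = l" "cl (pr x y) = i" "cp (pr x y) = lst"
  using D(8)[of lst i l] pl lst leafl x y by (auto simp: Let_def)
 have xy': "lf (pr y x) = l" "cl (pr y x) = i" "cp (pr y x) = lst" "x ~= y"
 proof -
  have "lf (pr x y) ~= 0" using xy l by simp
  note D(2)[OF this] D(7)[OF this]
  then show "lf (pr y x) = l" "cl (pr y x) = i" "cp (pr y x) = lst" "x ~= y" using xy D(1)[of x y] by auto
 qed
 have E2xy: "lf (pr a b) = l \<and> cl (pr a b) = i \<and> cp (pr a b) = lst" if "E2 x y a b" for a b
  using that xy xy' unfolding E2_def by (elim disjE conjE) simp_all
 show ?thesis
 proof (rule COL_I)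
  fix a b show "?lf (pr a b) = ?lf (pr b a)"
   unfolding lf by (simp only: D(1)[of a b] E2_sym[of u v a b])
 next
  fix a b assume "?lf (pr a b) ~= 0"
  from lfnz[OF this] D(2)[of a b] show "a < n \<and> b < n \<and> a ~= b \<and> cl (pr a b) = cl (pr b a) \<and> cl (pr a b) <= L
    \<and> 2 * K (cl (pr a b)) <= ?lf (pr a b) \<and> ?lf (pr a b) < 4 * K (cl (pr a b))" by metis
 next
  fix a b assume "?lf (pr a b) ~= 0"
  note ab = lfnz[OF this]
  then have w: "who (pr (slot cl ps a b) (lf (pr a b))) = Suc b" using D(3) by blast
  have "\<not> (slot cl ps a b = su \<and> lf (pr a b) = l)"
  proof
   assume a: "slot cl ps a b = su \<and> lf (pr a b) = l"
   then have "Suc b = Suc v" using w D(3)[OF nz(1)] su l by simp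
   moreover have "a = u" using a su by (auto simp: slot_def)
   ultimately show False using ab E2_self by simp
  qed
  moreover have "\<not> (slot cl ps a b = sv \<and> lf (pr a b) = l)"
  proof
   assume a: "slot cl ps a b = sv \<and> lf (pr a b) = l"
   then have "Suc b = Suc u" using w D(3)[OF nz(2)] sv lvu by simp
   moreover have "a = v" using a sv by (auto simp: slot_def)
   ultimately show False using ab E2_self by simp
  qed
  moreover have "?lf (pr a b) = lf (pr a b)" using ab by blast
  ultimately show "?who (pr (slot cl ps a b) (?lf (pr a b))) = Suc b" using w
   by (simp only: fun_upd_apply prod_encode_eq prod.inject if_False)
 next
  fix \<sigma> l' assume w: "?who (pr \<sigma> l') ~= 0"
  then have w': "?who (pr \<sigma> l') = who (pr \<sigma> l')" "\<not> (\<sigma> = su \<and> l' = l)" "\<not> (\<sigma> = sv \<and> l' = l)"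
   by (auto split: if_splits)
  then obtain a b where ab: "slot cl ps a b = \<sigma>" "lf (pr a b) = l'" "l' ~= 0" "who (pr \<sigma> l') = Suc b"
   using D(4)[of \<sigma> l'] w by metis
  have "\<not> E2 u v a b" unfolding E2_def using ab w' su sv l lvu by (intro notI) (elim disjE conjE, simp_all)
  then have "?lf (pr a b) = l'" using ab(2) unfolding lf by simp
  then show "\<exists>x y. slot cl ps x y = \<sigma> \<and> ?lf (pr x y) = l' \<and> l' ~= 0 \<and> ?who (pr \<sigma> l') = Suc y"
   using ab w' by metis
 next
  fix \<sigma> nd
  have "TS cl ps ?lf \<sigma> nd = TS cl ps lf \<sigma> nd - {(u, v), (v, u)}"
  proof -
   have "anc nd (?lf (pr a b)) \<longleftrightarrow> anc nd (lf (pr a b)) \<and> (a, b) \<notin> {(u, v), (v, u)}" for a b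
   proof -
    have "(a, b) \<in> {(u, v), (v, u)} \<longleftrightarrow> E2 u v a b" unfolding E2_def by simp
    then show ?thesis unfolding lf by (cases "E2 u v a b") simp_all
   qed
   then show ?thesis unfolding TS_def by blast
  qed
  moreover have "(u, v) \<in> TS cl ps lf \<sigma> nd \<longleftrightarrow> \<sigma> = su \<and> anc nd l" "(v, u) \<in> TS cl ps lf \<sigma> nd \<longleftrightarrow> \<sigma> = sv \<and> anc nd l"
   using su sv l lvu by (auto simp: TS_def)
  ultimately have "card (TS cl ps ?lf \<sigma> nd) = card (TS cl ps lf \<sigma> nd) - (if anc nd l \<and> (\<sigma> = su \<or> \<sigma> = sv) then 1 else 0)"
  proof -
   assume e: "TS cl ps ?lf \<sigma> nd = TS cl ps lf \<sigma> nd - {(u, v), (v, u)}"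
    and m: "(u, v) \<in> TS cl ps lf \<sigma> nd \<longleftrightarrow> \<sigma> = su \<and> anc nd l" "(v, u) \<in> TS cl ps lf \<sigma> nd \<longleftrightarrow> \<sigma> = sv \<and> anc nd l"
   have "(u, v) ~= (v, u)" using uv by simp
   note c = card_minus2[OF TS_fin[OF COL, of \<sigma> nd] this]
   show ?thesis unfolding e c m using ne by (cases "anc nd l"; cases "\<sigma> = su") simp_all
  qed
  then show "?T (pr \<sigma> nd) = card (TS cl ps ?lf \<sigma> nd)" unfolding bump_path D(5)
   by (cases "anc nd l \<and> (\<sigma> = su \<or> \<sigma> = sv)") (simp_all only: if_True if_False add_0_right diff_zero simp_thms)
 next
  fix i' nd
  define e where "e = (if u < v then (u, v) else (v, u))"
  have eq: "CS cl ?lf i' nd = CS cl lf i' nd - {e}"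
  proof -
   have "anc nd (?lf (pr a b)) \<longleftrightarrow> anc nd (lf (pr a b)) \<and> (a, b) \<notin> {(u, v), (v, u)}" for a b
   proof -
    have "(a, b) \<in> {(u, v), (v, u)} \<longleftrightarrow> E2 u v a b" unfolding E2_def by simp
    then show ?thesis unfolding lf by (cases "E2 u v a b") simp_all
   qed
   moreover have "a < b ==> (a, b) \<in> {(u, v), (v, u)} \<longleftrightarrow> (a, b) = e" for a b unfolding e_def by auto
   ultimately show ?thesis unfolding CS_def by blast
  qed
  have m: "e \<in> CS cl lf i' nd \<longleftrightarrow> i' = i \<and> anc nd l"
   using uv i ivu l lvu by (auto simp: CS_def e_def)
  show "?CT (pr i' nd) = card (CS cl ?lf i' nd)"
   unfolding bump_path D(6) eq card_Diff_singleton_if m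
   by (cases "anc nd l"; cases "i' = i") (simp_all only: simp_thms if_True if_False add_0_right diff_zero)
 next
  fix a b assume "?lf (pr a b) ~= 0"
  note ab = lfnz[OF this]
  then have abz: "lf (pr a b) ~= 0" by blast
  note q = D(7)[OF abz] D(2)[OF abz]
  have bl: "?lf (pr a b) = lf (pr a b)" using ab by blast
  show "?cp (pr a b) < ?CT (pr (cl (pr a b)) (?lf (pr a b))) \<and> ?cp (pr b a) = ?cp (pr a b) \<and>
    (let q = pr (pr (cl (pr a b)) (?lf (pr a b))) (?cp (pr a b)) in
     ?CLa q = a \<and> ?CLb q = b \<or> ?CLa q = b \<and> ?CLb q = a)"
  proof (cases "cl (pr a b) = i \<and> lf (pr a b) = l")
   case True
   have ct: "?CT (pr (cl (pr a b)) (?lf (pr a b))) = lst"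
    unfolding bl bump_path using True anc_self[OF l(2)] lst by simp
   have cpne: "cp (pr a b) ~= p"
   proof
    assume "cp (pr a b) = p"
    then have "E2 u v a b" unfolding E2_def using cp_inj[OF COL nz(1), of a b] True l i p by simp
    then show False using ab by blast
   qed
   show ?thesis
   proof (cases "E2 x y a b")
    case xyab: True
    then have "cp (pr a b) = lst" using E2xy by blast
    then have "p ~= lst" using cpne by simp
    then have "p < lst" using pl lst by simp
    moreover have "?cp (pr a b) = p" "?cp (pr b a) = p"
     unfolding cp using xyab E2_sym[of x y a b] by simp_all
    moreover have "cl (pr a b) = i" "lf (pr a b) = l" using True by auto
    moreover have "x = a \<and> y = b \<or> x = b \<and> y = a" using xyab unfolding E2_def by blast
    ultimately show ?thesis unfolding ct unfolding bl Let_def by (simp only: fun_upd_same simp_thms)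
   next
    case False
    have "cp (pr a b) ~= lst"
    proof
     assume "cp (pr a b) = lst"
     then have "E2 x y a b" unfolding E2_def using cp_inj[OF COL, of x y a b] True xy l by simp
     then show False using False by blast
    qed
    moreover have "cp (pr a b) < CT (pr i l)" using q True by simp
    ultimately have "cp (pr a b) < lst" using lst by simp
    moreover have "?cp (pr a b) = cp (pr a b)" "?cp (pr b a) = cp (pr b a)"
     unfolding cp using False E2_sym[of x y a b] by simp_all
    ultimately show ?thesis unfolding ct unfolding bl using q cpne True by (simp add: Let_def)
   qed
  next
   case False
   have "\<not> E2 x y a b" using False E2xy[of a b] by blast
   then have cp': "?cp (pr a b) = cp (pr a b)" "?cp (pr b a) = cp (pr b a)"
    unfolding cp using E2_sym[of x y a b] by simp_all
   \<comment> \<open>Among leaves only the counter of \<open>l\<close> changes: a leaf that is an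
     ancestor of \<open>l\<close> equals \<open>l\<close>.\<close>
   have ct: "?CT (pr (cl (pr a b)) (?lf (pr a b))) = CT (pr (cl (pr a b)) (lf (pr a b)))"
    unfolding bl bump_path using False leaf_anc[OF COL nz(1) i, of "lf (pr a b)"] q l by auto
   show ?thesis unfolding ct cp' unfolding bl using q False by (auto simp: Let_def)
  qed
 next
  fix i' l' p' assume p': "p' < ?CT (pr i' l')" "2 * K i' <= l'"
  have le: "?CT (pr i' l') <= CT (pr i' l')" unfolding bump_path by simp
  then have p'': "p' < CT (pr i' l')" using p' by simp
  note q = D(8)[OF conjI[OF p'' p'(2)], unfolded Let_def]
  let ?e = "pr (?CLa (pr (pr i' l') p')) (?CLb (pr (pr i' l') p'))"
  have l'0: "l' ~= 0" using p'(2) K_pos[of i'] by linarith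
  show "let e = ?e in ?lf e = l' \<and> cl e = i' \<and> ?cp e = p'"
  proof (cases "i' = i \<and> l' = l")
   case True
   have ct: "?CT (pr i' l') = lst" unfolding bump_path using True anc_self[OF l(2)] lst by simp
   show ?thesis
   proof (cases "p' = p")
    case pp: True
    have e: "?e = pr x y" using True pp by simp
    have "cp (pr x y) ~= p" using xy(3) ct p' pp by simp
    then have "\<not> E2 u v x y" using E2uv[of x y] by blast
    then have "?lf (pr x y) = l" using xy unfolding lf by simp
    then show ?thesis unfolding e Let_def cp using xy True pp by simp
   next
    case pp: False
    obtain a b where ab: "CLa (pr (pr i' l') p') = a" "CLb (pr (pr i' l') p') = b" by blast
    have e: "?e = pr a b" using True pp ab by simp
    have "cp (pr a b) = p'" using q ab by simp
    then have "\<not> E2 u v a b" "\<not> E2 x y a b"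
     using E2uv[of a b] E2xy[of a b] pp p'(1) ct by auto
    then show ?thesis unfolding e Let_def cp lf using q ab by simp
   qed
  next
   case False
   obtain a b where ab: "CLa (pr (pr i' l') p') = a" "CLb (pr (pr i' l') p') = b" by blast
   have e: "?e = pr a b" using False ab by auto
   have "cl (pr a b) = i'" "lf (pr a b) = l'" using q ab by auto
   then have "\<not> E2 u v a b" "\<not> E2 x y a b" using False E2uv[of a b] E2xy[of a b] by auto
   then show ?thesis unfolding e Let_def cp lf using q ab by simp
  qed
 qed
qed

text \<open>A vanishing leaf counter says that no edge of the slot has exactly this colour. Hence
  the two new entries of \<open>who\<close> do not displace those of other edges, and the colouring
  remains proper.\<close>

lemma COL_color:
 assumes COL: "COL cl ps lf T CT who CLa CLb cp"
  and lf0: "lf (pr u v) = 0" and uv: "u < n" "v < n" "u ~= v"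
  and i: "cl (pr u v) = i" "cl (pr v u) = i" "i <= L" and l: "2 * K i <= l" "l < 4 * K i"
  and su: "slot cl ps u v = su" and sv: "slot cl ps v u = sv"
  and T0: "T (pr su l) = 0" "T (pr sv l) = 0" and m: "m = CT (pr i l)"
 shows "COL cl ps (lf(pr u v := l, pr v u := l)) (bump (pathT 0 l su sv) 1 0 T) (bump (pathT 0 l i i) 1 0 CT)
  (who(pr su l := Suc v, pr sv l := Suc u)) (CLa(pr (pr i l) m := u)) (CLb(pr (pr i l) m := v)) (cp(pr u v := m, pr v u := m))"
  (is "COL cl ps ?lf ?T ?CT ?who ?CLa ?CLb ?cp")
proof -
 note D = COL_D[OF COL]
 have l0: "l ~= 0" using l(1) K_pos[of i] by linarith
 have lvu: "lf (pr v u) = 0" using lf0 D(1)[of u v] by simp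
 have ne: "su ~= sv" using uv su sv by (auto simp: slot_def)
 have lf: "?lf (pr a b) = (if E2 u v a b then l else lf (pr a b))" for a b by (rule E2_upd)
 have cp: "?cp (pr a b) = (if E2 u v a b then m else cp (pr a b))" for a b by (rule E2_upd)
 have E2uv: "lf (pr a b) = 0 \<and> cl (pr a b) = i" if "E2 u v a b" for a b
  using that lf0 lvu i unfolding E2_def by (elim disjE conjE) simp_all
 have free: "\<not> (slot cl ps a b = su \<and> lf (pr a b) = l)" "\<not> (slot cl ps a b = sv \<and> lf (pr a b) = l)" for a b
  using T0 TS_fin[OF COL] anc_self[OF l0] unfolding D(5) by (auto simp: TS_def)
 show ?thesis
 proof (rule COL_I)
  fix a b show "?lf (pr a b) = ?lf (pr b a)"
   unfolding lf by (simp only: D(1)[of a b] E2_sym[of u v a b])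
 next
  fix a b assume z: "?lf (pr a b) ~= 0"
  show "a < n \<and> b < n \<and> a ~= b \<and> cl (pr a b) = cl (pr b a) \<and> cl (pr a b) <= L
    \<and> 2 * K (cl (pr a b)) <= ?lf (pr a b) \<and> ?lf (pr a b) < 4 * K (cl (pr a b))"
  proof (cases "E2 u v a b")
   case True
   then have "a < n \<and> b < n \<and> a ~= b" "cl (pr a b) = i" "cl (pr b a) = i" "?lf (pr a b) = l"
    using uv i unfolding lf by (auto simp: E2_def)
   then show ?thesis using i l by simp
  next
   case False
   then have "?lf (pr a b) = lf (pr a b)" unfolding lf by simp
   then show ?thesis using D(2)[of a b] z by metis
  qed
 next
  fix a b assume z: "?lf (pr a b) ~= 0"
  show "?who (pr (slot cl ps a b) (?lf (pr a b))) = Suc b"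
  proof (cases "E2 u v a b")
   case True
   then have "?lf (pr a b) = l" "slot cl ps a b = su \<and> b = v \<or> slot cl ps a b = sv \<and> b = u"
    using su sv unfolding lf by (auto simp: E2_def)
   then show ?thesis using ne by auto
  next
   case False
   then have e: "?lf (pr a b) = lf (pr a b)" unfolding lf by simp
   then have "who (pr (slot cl ps a b) (lf (pr a b))) = Suc b" using D(3)[of a b] z by simp
   then show ?thesis unfolding e using free[of a b]
    by (simp only: fun_upd_apply[of who] fun_upd_apply[of "who(_ := _)"] prod_encode_eq prod.inject if_False)
  qed
 next
  fix \<sigma> l' assume w: "?who (pr \<sigma> l') ~= 0"
  show "\<exists>x y. slot cl ps x y = \<sigma> \<and> ?lf (pr x y) = l' \<and> l' ~= 0 \<and> ?who (pr \<sigma> l') = Suc y"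
  proof (cases "l' = l \<and> (\<sigma> = su \<or> \<sigma> = sv)")
   case True
   have "?lf (pr u v) = l" "?lf (pr v u) = l" unfolding lf by simp_all
   moreover have "?who (pr su l) = Suc v" "?who (pr sv l) = Suc u" using ne by simp_all
   ultimately show ?thesis using True l0 su sv by metis
  next
   case False
   then have e: "?who (pr \<sigma> l') = who (pr \<sigma> l')" by auto
   then obtain a b where ab: "slot cl ps a b = \<sigma>" "lf (pr a b) = l'" "l' ~= 0" "who (pr \<sigma> l') = Suc b"
    using D(4)[of \<sigma> l'] w by metis
   then have "\<not> E2 u v a b" using E2uv[of a b] by auto
   then have "?lf (pr a b) = l'" using ab unfolding lf by simp
   then show ?thesis using ab e by metis
  qed
 next
  fix \<sigma> nd
  let ?N = "(if \<sigma> = su \<and> anc nd l then {(u, v)} else {}) \<union> (if \<sigma> = sv \<and> anc nd l then {(v, u)} else {})"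
  have "TS cl ps ?lf \<sigma> nd = TS cl ps lf \<sigma> nd \<union> ?N"
  proof -
   have "anc nd (?lf (pr a b)) \<longleftrightarrow> anc nd (lf (pr a b)) \<or> anc nd l \<and> (a, b) \<in> {(u, v), (v, u)}" for a b
   proof -
    have m: "(a, b) \<in> {(u, v), (v, u)} \<longleftrightarrow> E2 u v a b" unfolding E2_def by simp
    show ?thesis unfolding lf m using E2uv[of a b] by (cases "E2 u v a b") simp_all
   qed
   then show ?thesis unfolding TS_def using su sv by auto
  qed
  moreover have "TS cl ps lf \<sigma> nd \<inter> ?N = {}" using lf0 lvu by (auto simp: TS_def)
  ultimately have "card (TS cl ps ?lf \<sigma> nd) = card (TS cl ps lf \<sigma> nd) + card ?N"
   using TS_fin[OF COL, of \<sigma> nd] by (simp add: card_Un_disjoint)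
  also have "card ?N = (if anc nd l \<and> (\<sigma> = su \<or> \<sigma> = sv) then 1 else 0)" using ne by auto
  finally show "?T (pr \<sigma> nd) = card (TS cl ps ?lf \<sigma> nd)" unfolding bump_path D(5)
   by (cases "anc nd l \<and> (\<sigma> = su \<or> \<sigma> = sv)") (simp_all only: if_True if_False add_0_right diff_zero simp_thms)
 next
  fix i' nd
  define e where "e = (if u < v then (u, v) else (v, u))"
  have eq: "CS cl ?lf i' nd = CS cl lf i' nd \<union> (if anc nd l \<and> i' = i then {e} else {})"
  proof -
   have "anc nd (?lf (pr a b)) \<longleftrightarrow> anc nd (lf (pr a b)) \<or> anc nd l \<and> (a, b) \<in> {(u, v), (v, u)}" for a b
   proof -
    have m: "(a, b) \<in> {(u, v), (v, u)} \<longleftrightarrow> E2 u v a b" unfolding E2_def by simp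
    show ?thesis unfolding lf m using E2uv[of a b] by (cases "E2 u v a b") simp_all
   qed
   then show ?thesis unfolding CS_def using uv i by (auto simp: e_def split: if_splits)
  qed
  have m: "e \<notin> CS cl lf i' nd" using lf0 lvu by (auto simp: CS_def e_def)
  show "?CT (pr i' nd) = card (CS cl ?lf i' nd)"
   unfolding bump_path D(6) eq using card_insert_disjoint[OF CS_fin[OF COL] m]
   by (cases "anc nd l"; cases "i' = i")
    (simp_all only: simp_thms if_True if_False add_0_right diff_zero Un_empty_right Un_insert_right
     Suc_eq_plus1)
 next
  fix a b assume z: "?lf (pr a b) ~= 0"
  show "?cp (pr a b) < ?CT (pr (cl (pr a b)) (?lf (pr a b))) \<and> ?cp (pr b a) = ?cp (pr a b) \<and>
    (let q = pr (pr (cl (pr a b)) (?lf (pr a b))) (?cp (pr a b)) in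
     ?CLa q = a \<and> ?CLb q = b \<or> ?CLa q = b \<and> ?CLb q = a)"
  proof (cases "E2 u v a b")
   case True
   have *: "?lf (pr a b) = l" "cl (pr a b) = i" "?cp (pr a b) = m" "?cp (pr b a) = m"
    using True E2_sym[of u v a b] E2uv[of a b] unfolding lf cp by simp_all
   have "u = a \<and> v = b \<or> u = b \<and> v = a" using True unfolding E2_def by blast
   then show ?thesis using anc_self[OF l0] m unfolding * Let_def bump_path
    by (simp only: fun_upd_same simp_thms if_True)
  next
   case False
   have bl: "?lf (pr a b) = lf (pr a b)" using False unfolding lf by simp
   have z': "lf (pr a b) ~= 0" using z bl by simp
   note q = D(7)[OF z'] D(2)[OF z']
   have cp': "?cp (pr a b) = cp (pr a b)" "?cp (pr b a) = cp (pr b a)"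
    using False E2_sym[of u v a b] unfolding cp by simp_all
   have ct: "CT (pr (cl (pr a b)) (lf (pr a b))) <= ?CT (pr (cl (pr a b)) (lf (pr a b)))"
    unfolding bump_path by simp
   have ne: "pr (pr (cl (pr a b)) (lf (pr a b))) (cp (pr a b)) ~= pr (pr i l) m" using q m by auto
   show ?thesis unfolding cp' bl Let_def using q ct ne
    by (simp only: fun_upd_apply if_False Let_def) (elim conjE, intro conjI refl TrueI, erule (1) less_le_trans)
  qed
 next
  fix i' l' p' assume p': "p' < ?CT (pr i' l')" "2 * K i' <= l'"
  let ?e = "pr (?CLa (pr (pr i' l') p')) (?CLb (pr (pr i' l') p'))"
  show "let e = ?e in ?lf e = l' \<and> cl e = i' \<and> ?cp e = p'"
  proof (cases "i' = i \<and> l' = l \<and> p' = m")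
   case True
   then have e: "?e = pr u v" by simp
   show ?thesis unfolding e Let_def lf cp using i True by simp
  next
   case False
   have p'': "p' < CT (pr i' l')"
   proof (cases "anc l' l \<and> i' = i")
    case True
    then have "l' = l" using anc_leaf[of l' l "2 * K i"] l p'(2) by simp
    then have "?CT (pr i' l') = Suc m" unfolding bump_path using True m by simp
    then show ?thesis using p' False True \<open>l' = l\<close> m by auto
   next
    case False
    then show ?thesis using p'(1) unfolding bump_path by auto
   qed
   note q = D(8)[OF conjI[OF p'' p'(2)], unfolded Let_def]
   obtain a b where ab: "CLa (pr (pr i' l') p') = a" "CLb (pr (pr i' l') p') = b" by blast
   have e: "?e = pr a b" using False ab by auto
   have l'0: "l' ~= 0" using p'(2) K_pos[of i'] by linarith
   have "lf (pr a b) = l'" using q ab by simp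
   then have "\<not> E2 u v a b" using E2uv[of a b] l'0 by auto
   then show ?thesis unfolding e Let_def lf cp using q ab by simp
  qed
 qed
qed

text \<open>The number of coloured edges that do not have the selected colour of their class. Where
  nothing has been selected, \<open>sel i\<close> is 0; no colour lies below node 0, so all edges of
  the class count.\<close>

definition pot2 :: "(nat \<Rightarrow> nat) \<Rightarrow> (nat \<Rightarrow> nat) \<Rightarrow> nat" where
 "pot2 CT sel = (\<Sum>i\<le>L. CT (pr i 1) - CT (pr i (sel i)))"

text \<open>Every leaf lies below the root, so the class total drops by one whether or not the
  counter of the selected colour does.\<close>

lemma pot2_uncolor: "l ~= 0 ==> pot2 (bump (pathT 0 l i i) 0 1 CT) sel <= pot2 CT sel"
 unfolding pot2_def bump_path by (intro sum_mono) (use anc_one in auto)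

lemma pot2_color: "pot2 (bump (pathT 0 l i i) 1 0 CT) sel <= pot2 CT sel + 1"
proof -
 have "pot2 (bump (pathT 0 l i i) 1 0 CT) sel <= (\<Sum>j\<le>L. (CT (pr j 1) - CT (pr j (sel j))) + (if j = i then 1 else 0))"
  unfolding pot2_def bump_path by (intro sum_mono) auto
 also have "\<dots> <= pot2 CT sel + 1" unfolding pot2_def sum.distrib by simp
 finally show ?thesis .
qed

end

section \<open>Programs that uncolour and colour an edge\<close>

definition Uncolor1 :: com where
 "Uncolor1 = blk [
   Assign 42 (Arr 4 (PE (Reg 40) (Reg 41))),
   Assign 43 (Arr 20 (Sub (Reg 42) (Reg 5))),
   Assign 50 (PE (Reg 40) (PE (Reg 42) (Div (Arr 5 (PE (Reg 40) (Reg 41))) (Reg 43)))),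
   Assign 51 (PE (Reg 41) (PE (Reg 42) (Div (Arr 5 (PE (Reg 41) (Reg 40))) (Reg 43)))),
   Assign 52 (Reg 42),
   Assign 53 (Arr 6 (PE (Reg 40) (Reg 41))),
   Store 11 (PE (Reg 50) (Reg 53)) (Const 0),
   Store 11 (PE (Reg 51) (Reg 53)) (Const 0),
   Assign 44 (PE (Reg 42) (Reg 53)),
   Assign 45 (Sub (Arr 10 (Reg 44)) (Const 1)),
   Assign 46 (Arr 13 (PE (Reg 40) (Reg 41))),
   Assign 47 (Arr 12 (PE (Reg 44) (Reg 45))),
   Assign 48 (Arr 21 (PE (Reg 44) (Reg 45))),
   Store 12 (PE (Reg 44) (Reg 46)) (Reg 47),
   Store 21 (PE (Reg 44) (Reg 46)) (Reg 48),
   Store 13 (PE (Reg 47) (Reg 48)) (Reg 46),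
   Store 13 (PE (Reg 48) (Reg 47)) (Reg 46),
   Store 6 (PE (Reg 40) (Reg 41)) (Const 0),
   Store 6 (PE (Reg 41) (Reg 40)) (Const 0),
   Assign 54 (Const 0),
   Assign 55 (Const 1)]"

definition Uncolor :: com where
 "Uncolor = Seq Uncolor1 PathUpdate"

definition Color1 :: com where
 "Color1 = blk [
   Assign 42 (Arr 4 (PE (Reg 40) (Reg 41))),
   Assign 43 (Arr 20 (Sub (Reg 42) (Reg 5))),
   Assign 50 (PE (Reg 40) (PE (Reg 42) (Div (Arr 5 (PE (Reg 40) (Reg 41))) (Reg 43)))),
   Assign 51 (PE (Reg 41) (PE (Reg 42) (Div (Arr 5 (PE (Reg 41) (Reg 40))) (Reg 43)))),
   Assign 52 (Reg 42),
   Assign 56 (Add (Reg 43) (Reg 43))]"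

definition Color2 :: com where
 "Color2 = blk [
   Store 6 (PE (Reg 40) (Reg 41)) (Reg 53),
   Store 6 (PE (Reg 41) (Reg 40)) (Reg 53),
   Store 11 (PE (Reg 50) (Reg 53)) (Add (Reg 41) (Const 1)),
   Store 11 (PE (Reg 51) (Reg 53)) (Add (Reg 40) (Const 1)),
   Assign 44 (PE (Reg 42) (Reg 53)),
   Assign 45 (Arr 10 (Reg 44)),
   Store 12 (PE (Reg 44) (Reg 45)) (Reg 40),
   Store 21 (PE (Reg 44) (Reg 45)) (Reg 41),
   Store 13 (PE (Reg 40) (Reg 41)) (Reg 45),
   Store 13 (PE (Reg 41) (Reg 40)) (Reg 45),
   Assign 46 (Reg 53),
   Assign 54 (Const 1),
   Assign 55 (Const 0)]"

text \<open>An edge that happens to receive the selected colour must be covered at once. Register 46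
  keeps its colour because the walk to the root has consumed register 53.\<close>

definition Color3 :: com where
 "Color3 = If (Equal (Reg 46) (Arr 14 (Reg 42)))
   (blk [Assign 60 (Reg 40), Assign 61 (Reg 41), TryMatch]) Skip"

definition Color :: com where
 "Color = Seq Color1 (Seq FindFree (Seq Color2 (Seq PathUpdate Color3)))"

context bm
begin

definition Cst :: "state \<Rightarrow> bool" where
 "Cst s \<longleftrightarrow> reg s 0 = n \<and> reg s 4 = L \<and> reg s 5 = ll \<and> (\<forall>v<n. arr s 0 v = c v) \<and> (\<forall>j\<le>L. arr s 20 j = 2 ^ j)"

lemma Cst_mono: "Cst s ==> same R s s' ==> 6 <= R ==> eqA F s s' ==> 0 \<notin> F ==> 20 \<notin> F ==> Cst s'"
 unfolding Cst_def using same_reg[of R s s'] eqA_D[of F s s'] by simp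

abbreviation COLs :: "state \<Rightarrow> bool" where
 "COLs s \<equiv> COL (arr s 4) (arr s 5) (arr s 6) (arr s 9) (arr s 10) (arr s 11) (arr s 12) (arr s 21) (arr s 13)"

text \<open>The sparse graph is never stored: it consists of the edges whose colour is the one
  selected in their class. This invariant is its maximality. The guard excludes uncoloured pairs,
  whose 0 would agree with the 0 of a class without selection.\<close>

definition J :: "state \<Rightarrow> bool" where
 "J s \<longleftrightarrow> (\<forall>x y. arr s 6 (pr x y) ~= 0 --> arr s 6 (pr x y) = arr s 14 (arr s 4 (pr x y)) --> cov s x y)"

abbreviation p2 :: "state \<Rightarrow> nat" where
 "p2 s \<equiv> pot2 (arr s 10) (arr s 14)"

lemma cov_sym: "MIs s G X ==> cov s x y ==> cov s y x"
 using MI_D(2)[of "arr s 1" "arr s 15" "arr s 16" "arr s 17" G X x y] unfolding cov_def by argo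

lemma slot_sm:
 assumes "u < n" "i <= L" "p < n"
 shows "sm (pr u (pr i (p div k)))" "sm (pr i (p div k))" "sm (p div k)"
proof -
 have "p div k < n" using assms(3) div_le_dividend[of p k] by linarith
 then have 0: "sm0 (p div k)" "sm0 i" "sm0 u" using assms by simp_all
 then show "sm (pr u (pr i (p div k)))" "sm (pr i (p div k))" "sm (p div k)"
  using sm_pr1[OF sm01[OF 0(3)] sm_pr[OF 0(2,1)]] sm12[OF sm_pr[OF 0(2,1)]] by simp_all
qed

lemma leaf_small: "l < 4 * K i ==> i <= L ==> l < 4 * 2 ^ L"
 using K_le[of i] by linarith

lemma Uncolor1_spec:
 assumes C: "Cst s" and COL: "COLs s" and l: "arr s 6 (pr u v) = l" "l ~= 0" and r: "reg s 40 = u" "reg s 41 = v"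
  and ps: "arr s 5 (pr u v) < n" "arr s 5 (pr v u) < n"
  and i: "arr s 4 (pr u v) = i" and p: "arr s 13 (pr u v) = p"
  and su: "slot (arr s 4) (arr s 5) u v = su" and sv: "slot (arr s 4) (arr s 5) v u = sv"
  and lst: "lst = arr s 10 (pr i l) - 1"
  and x: "x = arr s 12 (pr (pr i l) lst)" and y: "y = arr s 21 (pr (pr i l) lst)"
 shows "ht B Uncolor1 s (\<lambda>s'. same 40 s s' \<and> reg s' 50 = su \<and> reg s' 51 = sv \<and> reg s' 52 = i \<and> reg s' 53 = l \<and>
  reg s' 54 = 0 \<and> reg s' 55 = 1 \<and> clock s' <= clock s + 1000 \<and>
  arr s' = (arr s)(6 := (arr s 6)(pr u v := 0, pr v u := 0), 11 := (arr s 11)(pr su l := 0, pr sv l := 0),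
   12 := (arr s 12)(pr (pr i l) p := x), 21 := (arr s 21)(pr (pr i l) p := y),
   13 := (arr s 13)(pr x y := p, pr y x := p)))"
  "su ~= sv" "sm su" "sm sv" "i <= L" "l < 4 * 2 ^ L"
proof -
 note D = COL_D[OF COL]
 have nz: "arr s 6 (pr u v) ~= 0" using l by simp
 note uv = D(2)[OF nz]
 have uvn: "u < n" "v < n" "u ~= v" "i <= L" "2 * K i <= l" "l < 4 * K i" using uv l i by auto
 have ivu: "arr s 4 (pr v u) = i" using uv i by simp
 have sl: "su = pr u (pr i (arr s 5 (pr u v) div K i))" "sv = pr v (pr i (arr s 5 (pr v u) div K i))"
  using su sv i ivu unfolding slot_def by simp_all
 show "su ~= sv" using sl uvn by simp
 have pC: "p < arr s 10 (pr i l)" using D(7)[OF nz] l i p by auto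
 have "arr s 6 (pr x y) = l" using D(8)[of lst i l] pC lst uvn x y by (auto simp: Let_def)
 then have xyn: "x < n" "y < n" using D(2)[of x y] l by auto
 show smu: "sm su" "sm sv" using slot_sm[OF uvn(1,4) ps(1)] slot_sm[OF uvn(2,4) ps(2)] unfolding sl by auto
 show "i <= L" "l < 4 * 2 ^ L" using uvn leaf_small by auto
 have sml: "sm l" "sm0 l" "sm0 i" using uvn leaf_small[of l i] by simp_all
 have smil: "sm (pr i l)" using sm12[OF sm_pr[OF sml(3,2)]] .
 have smp: "sm p" "sm lst" using col_sm(2)[OF COL, of "pr i l"] pC lst by (auto simp: sm_def)
 have sms: "sm u" "sm v" "sm i" "sm x" "sm y" using uvn xyn by simp_all
 have kk: "arr s 20 (i - ll) = K i" "reg s 5 = ll" using C uvn unfolding Cst_def K_def by auto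
 note ss = slot_sm[OF uvn(1,4) ps(1)] slot_sm[OF uvn(2,4) ps(2)]
 show "ht B Uncolor1 s (\<lambda>s'. same 40 s s' \<and> reg s' 50 = su \<and> reg s' 51 = sv \<and> reg s' 52 = i \<and> reg s' 53 = l \<and>
  reg s' 54 = 0 \<and> reg s' 55 = 1 \<and> clock s' <= clock s + 1000 \<and>
  arr s' = (arr s)(6 := (arr s 6)(pr u v := 0, pr v u := 0), 11 := (arr s 11)(pr su l := 0, pr sv l := 0),
   12 := (arr s 12)(pr (pr i l) p := x), 21 := (arr s 21)(pr (pr i l) p := y),
   13 := (arr s 13)(pr x y := p, pr y x := p)))"
  unfolding Uncolor1_def
  by (simp add: r sms i kk ss ss[unfolded One_nat_def] sl[symmetric] smu l(1) sml smil lst[symmetric]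
    lst[symmetric, unfolded One_nat_def] smp p x[symmetric] y[symmetric] same_def fun_upd_twist)
qed

lemma Uncolor_spec:
 assumes C: "Cst s" and COL: "COLs s" and l: "arr s 6 (pr u v) ~= 0" and r: "reg s 40 = u" "reg s 41 = v"
  and ps: "arr s 5 (pr u v) < n" "arr s 5 (pr v u) < n"
 shows "ht B Uncolor s (\<lambda>s'. same 40 s s' \<and> eqA {6, 9, 10, 11, 12, 13, 21} s s' \<and> COLs s' \<and>
  arr s' 6 = (arr s 6)(pr u v := 0, pr v u := 0) \<and> p2 s' <= p2 s \<and> clock s' <= clock s + 600 * (L + 3))"
proof -
 define l where "l = arr s 6 (pr u v)"
 define i where "i = arr s 4 (pr u v)"
 define p where "p = arr s 13 (pr u v)"
 define su where "su = slot (arr s 4) (arr s 5) u v"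
 define sv where "sv = slot (arr s 4) (arr s 5) v u"
 define lst where "lst = arr s 10 (pr i l) - 1"
 define x where "x = arr s 12 (pr (pr i l) lst)"
 define y where "y = arr s 21 (pr (pr i l) lst)"
 have l0: "l ~= 0" using l by (simp add: l_def)
 note d = l_def[symmetric] l0
 note 1 = Uncolor1_spec[OF C COL d r ps i_def[symmetric] p_def[symmetric] su_def[symmetric] sv_def[symmetric] lst_def x_def y_def]
 note un = COL_uncolor[OF COL d i_def[symmetric] p_def[symmetric] su_def[symmetric] sv_def[symmetric] lst_def x_def y_def]
 show ?thesis unfolding Uncolor_def
 proof (rule ht_Seq[OF 1(1)], elim conjE)
  fix s1 assume s1: "same 40 s s1" "reg s1 50 = su" "reg s1 51 = sv" "reg s1 52 = i" "reg s1 53 = l"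
   "reg s1 54 = 0" "reg s1 55 = 1" "clock s1 <= clock s + 1000"
   and A: "arr s1 = (arr s)(6 := (arr s 6)(pr u v := 0, pr v u := 0), 11 := (arr s 11)(pr su l := 0, pr sv l := 0),
   12 := (arr s 12)(pr (pr i l) p := x), 21 := (arr s 21)(pr (pr i l) p := y),
   13 := (arr s 13)(pr x y := p, pr y x := p))"
  have A9: "arr s1 9 = arr s 9" "arr s1 10 = arr s 10" by (simp_all add: A)
  have "ht B PathUpdate s1 (\<lambda>s'. same 50 s1 s' \<and> clock s' <= clock s1 + 200 * (L + 3) \<and>
   arr s' = (arr s1)(9 := bump (pathT 0 l su sv) 0 1 (arr s1 9), 10 := bump (pathT 0 l i i) 0 1 (arr s1 10)))"
   by (rule PathUpdate_spec[OF s1(2-7) 1(3,4) _ _ 1(2,6) l0])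
    (use 1(5) in \<open>simp_all add: A9 col_sm[OF COL]\<close>)
  then show "ht B PathUpdate s1 (\<lambda>s'. same 40 s s' \<and> eqA {6, 9, 10, 11, 12, 13, 21} s s' \<and> COLs s' \<and>
   arr s' 6 = (arr s 6)(pr u v := 0, pr v u := 0) \<and> p2 s' <= p2 s \<and> clock s' <= clock s + 600 * (L + 3))"
  proof (rule ht_mono, elim conjE)
   fix s' assume s': "same 50 s1 s'" "clock s' <= clock s1 + 200 * (L + 3)"
    and A': "arr s' = (arr s1)(9 := bump (pathT 0 l su sv) 0 1 (arr s1 9), 10 := bump (pathT 0 l i i) 0 1 (arr s1 10))"
   have A's: "arr s' 4 = arr s 4" "arr s' 5 = arr s 5" "arr s' 6 = (arr s 6)(pr u v := 0, pr v u := 0)"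
    "arr s' 9 = bump (pathT 0 l su sv) 0 1 (arr s 9)" "arr s' 10 = bump (pathT 0 l i i) 0 1 (arr s 10)"
    "arr s' 11 = (arr s 11)(pr su l := 0, pr sv l := 0)" "arr s' 12 = (arr s 12)(pr (pr i l) p := x)"
    "arr s' 21 = (arr s 21)(pr (pr i l) p := y)" "arr s' 13 = (arr s 13)(pr x y := p, pr y x := p)"
    "arr s' 14 = arr s 14"
    unfolding A' A9 unfolding A by simp_all
   show "same 40 s s' \<and> eqA {6, 9, 10, 11, 12, 13, 21} s s' \<and> COLs s' \<and>
    arr s' 6 = (arr s 6)(pr u v := 0, pr v u := 0) \<and> p2 s' <= p2 s \<and> clock s' <= clock s + 600 * (L + 3)"
   proof (intro conjI)
    show "same 40 s s'" by (rule same_trans[OF s1(1) s'(1)]) simp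
    show "eqA {6, 9, 10, 11, 12, 13, 21} s s'" unfolding eqA_def A' A by simp
    show "COLs s'" unfolding A's by (rule un)
    show "arr s' 6 = (arr s 6)(pr u v := 0, pr v u := 0)" by (rule A's)
    show "p2 s' <= p2 s" unfolding A's by (rule pot2_uncolor[OF l0])
    show "clock s' <= clock s + 600 * (L + 3)" using s1 s' by simp
   qed
  qed
 qed
qed

lemma Color1_spec:
 assumes C: "Cst s" and r: "reg s 40 = u" "reg s 41 = v" and uv: "u < n" "v < n"
  and i: "arr s 4 (pr u v) = i" "arr s 4 (pr v u) = i" "i <= L"
  and ps: "arr s 5 (pr u v) < n" "arr s 5 (pr v u) < n"
  and su: "slot (arr s 4) (arr s 5) u v = su" and sv: "slot (arr s 4) (arr s 5) v u = sv"
 shows "ht B Color1 s (\<lambda>s'. same 42 s s' \<and> reg s' 42 = i \<and> reg s' 50 = su \<and> reg s' 51 = sv \<and> reg s' 52 = i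
   \<and> reg s' 56 = 2 * K i \<and> clock s' <= clock s + 300 \<and> arr s' = arr s)"
  "sm su" "sm sv"
proof -
 have sl: "su = pr u (pr i (arr s 5 (pr u v) div K i))" "sv = pr v (pr i (arr s 5 (pr v u) div K i))"
  using su sv i unfolding slot_def by simp_all
 show smu: "sm su" "sm sv" using slot_sm[OF uv(1) i(3) ps(1)] slot_sm[OF uv(2) i(3) ps(2)] unfolding sl by auto
 have kk: "arr s 20 (i - ll) = K i" "reg s 5 = ll" using C i unfolding Cst_def K_def by auto
 have sms: "sm u" "sm v" "sm i" using uv i by simp_all
 have "0 < (2::nat) ^ L" by simp
 then have "K i < 4 * 2 ^ L" "2 * K i < 4 * 2 ^ L" using K_le[OF i(3)] by linarith+
 then have smk: "sm (K i)" "sm (2 * K i)" by simp_all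
 have k2: "K i + K i = 2 * K i" by simp
 note ss = slot_sm[OF uv(1) i(3) ps(1)] slot_sm[OF uv(2) i(3) ps(2)]
 show "ht B Color1 s (\<lambda>s'. same 42 s s' \<and> reg s' 42 = i \<and> reg s' 50 = su \<and> reg s' 51 = sv \<and> reg s' 52 = i
   \<and> reg s' 56 = 2 * K i \<and> clock s' <= clock s + 300 \<and> arr s' = arr s)"
  unfolding Color1_def
  by (simp add: r sms i(1) kk ss sl[symmetric] smu smk k2 same_def)
qed

text \<open>\<open>root\<close> is the pigeonhole supply for \<open>FindFree\<close>. Only the new
  edge can endanger \<open>J\<close>, and \<open>TryMatch\<close> covers it in case its colour is
  the selected one.\<close>

lemma Color_spec:
 assumes C: "Cst s" and COL: "COLs s" and r: "reg s 40 = u" "reg s 41 = v"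
  and G: "graph G" "(u, v) \<in> G" and MI: "MIs s G X" and J: "J s"
  and lf0: "arr s 6 (pr u v) = 0"
  and i: "arr s 4 (pr u v) = i" "arr s 4 (pr v u) = i" "i <= L"
  and ps: "arr s 5 (pr u v) < n" "arr s 5 (pr v u) < n"
  and root: "arr s 9 (pr (slot (arr s 4) (arr s 5) u v) 1) + arr s 9 (pr (slot (arr s 4) (arr s 5) v u) 1) < 2 * K i"
 shows "ht B Color s (\<lambda>s'. same 40 s s' \<and> eqA {1, 6, 9, 10, 11, 12, 13, 15, 16, 17, 21} s s' \<and> COLs s' \<and>
  (\<exists>l. l ~= 0 \<and> arr s' 6 = (arr s 6)(pr u v := l, pr v u := l)) \<and> MIs s' G X \<and> J s' \<and> Mmono s s' \<and>
  p2 s' <= p2 s + 1 \<and> clock s' <= clock s + 1000 * (L + 3))"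
  (is "ht B Color s ?Q")
proof -
 define su where "su = slot (arr s 4) (arr s 5) u v"
 define sv where "sv = slot (arr s 4) (arr s 5) v u"
 have uv: "u < n" "v < n" "u ~= v" using G by (auto simp: graph_def)
 have ne: "su ~= sv" using uv by (simp add: su_def sv_def slot_def)
 have h: "K i = 2 ^ (i - ll)" "i - ll <= L" using i by (simp_all add: K_def)
 note c1 = Color1_spec[OF C r uv(1,2) i ps su_def[symmetric] sv_def[symmetric]]
 have sms: "sm u" "sm v" "sm i" using uv i by simp_all
 have sl: "su = pr u (pr i (arr s 5 (pr u v) div K i))" "sv = pr v (pr i (arr s 5 (pr v u) div K i))"
  using i unfolding su_def sv_def slot_def by simp_all
 show ?thesis unfolding Color_def
 proof (rule ht_Seq[OF c1(1)], elim conjE)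
  fix s1 assume s1: "same 42 s s1" "reg s1 42 = i" "reg s1 50 = su" "reg s1 51 = sv" "reg s1 52 = i"
   "reg s1 56 = 2 * K i" "clock s1 <= clock s + 300" "arr s1 = arr s"
  have "ht B FindFree s1 (\<lambda>s'. same 53 s1 s' \<and> clock s' <= clock s1 + 100 * (L + 3) \<and> arr s' = arr s1 \<and>
   2 * K i <= reg s' 53 \<and> reg s' 53 < 4 * K i \<and> arr s1 9 (pr su (reg s' 53)) = 0 \<and> arr s1 9 (pr sv (reg s' 53)) = 0)"
  proof (rule FindFree_spec[OF s1(3,4,6) h c1(2,3)])
   show "sm (arr s1 9 j)" for j unfolding s1 by (rule col_sm[OF COL])
   show "arr s1 9 (pr su 1) + arr s1 9 (pr sv 1) < 2 * K i" unfolding s1 using root by (simp add: su_def sv_def)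
   show "arr s1 9 (pr x nd) = arr s1 9 (pr x (2 * nd)) + arr s1 9 (pr x (Suc (2 * nd)))"
    if "x = su \<or> x = sv" "nd ~= 0" "nd < 2 * K i" for x nd
    using T_child[OF COL sl(1) that(2,3)] T_child[OF COL sl(2) that(2,3)] that(1) unfolding s1 by auto
  qed
  then show "ht B (Seq FindFree (Seq Color2 (Seq PathUpdate Color3))) s1 ?Q"
  proof (rule ht_Seq, elim conjE)
   fix s2 assume s2: "same 53 s1 s2" "clock s2 <= clock s1 + 100 * (L + 3)" "arr s2 = arr s1"
    and l2: "2 * K i <= reg s2 53" "reg s2 53 < 4 * K i"
    and f: "arr s1 9 (pr su (reg s2 53)) = 0" "arr s1 9 (pr sv (reg s2 53)) = 0"
   define l where "l = reg s2 53"
   have l: "2 * K i <= l" "l < 4 * K i" "l < 4 * 2 ^ L" "l ~= 0"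
    using l2 leaf_small[of l i] i K_pos[of i] unfolding l_def by linarith+
   have T0: "arr s 9 (pr su l) = 0" "arr s 9 (pr sv l) = 0" using f s1 unfolding l_def by simp_all
   define m where "m = arr s 10 (pr i l)"
   note col = COL_color[OF COL lf0 uv i l(1,2) su_def[symmetric] sv_def[symmetric] T0 m_def]
   have A2: "arr s2 = arr s" using s1 s2 by simp
   have regs: "reg s2 40 = u" "reg s2 41 = v" "reg s2 42 = i" "reg s2 50 = su" "reg s2 51 = sv" "reg s2 52 = i" "reg s2 53 = l"
    using same_reg[OF s2(1)] same_reg[OF s1(1)] r s1 l_def by simp_all
   have sml: "sm l" "sm0 l" "sm0 i" using l i by simp_all
   have smil: "sm (pr i l)" using sm12[OF sm_pr[OF sml(3,2)]] .
   have smm: "sm m" using col_sm(2)[OF COL] by (simp add: m_def)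
   have "ht B Color2 s2 (\<lambda>s'. same 42 s2 s' \<and> reg s' 42 = i \<and> reg s' 46 = l \<and> reg s' 50 = su \<and> reg s' 51 = sv \<and> reg s' 52 = i \<and> reg s' 53 = l \<and>
    reg s' 54 = 1 \<and> reg s' 55 = 0 \<and> clock s' <= clock s2 + 500 \<and>
    arr s' = (arr s)(6 := (arr s 6)(pr u v := l, pr v u := l), 11 := (arr s 11)(pr su l := Suc v, pr sv l := Suc u),
     12 := (arr s 12)(pr (pr i l) m := u), 21 := (arr s 21)(pr (pr i l) m := v),
     13 := (arr s 13)(pr u v := m, pr v u := m)))"
    unfolding Color2_def
    by (simp add: A2 regs sms sml smil smm c1(2,3) m_def[symmetric] same_def fun_upd_twist)
   then show "ht B (Seq Color2 (Seq PathUpdate Color3)) s2 ?Q"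
   proof (rule ht_Seq, elim conjE)
    fix s3 assume s3: "same 42 s2 s3" "reg s3 42 = i" "reg s3 46 = l" "reg s3 50 = su" "reg s3 51 = sv" "reg s3 52 = i"
     "reg s3 53 = l" "reg s3 54 = 1" "reg s3 55 = 0" "clock s3 <= clock s2 + 500"
     and A3: "arr s3 = (arr s)(6 := (arr s 6)(pr u v := l, pr v u := l), 11 := (arr s 11)(pr su l := Suc v, pr sv l := Suc u),
     12 := (arr s 12)(pr (pr i l) m := u), 21 := (arr s 21)(pr (pr i l) m := v),
     13 := (arr s 13)(pr u v := m, pr v u := m))"
    have A9: "arr s3 9 = arr s 9" "arr s3 10 = arr s 10" by (simp_all add: A3)
    have sm1': "sm 1" using n2 by simp
    have "ht B PathUpdate s3 (\<lambda>s'. same 50 s3 s' \<and> clock s' <= clock s3 + 200 * (L + 3) \<and>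
     arr s' = (arr s3)(9 := bump (pathT 0 l su sv) 1 0 (arr s3 9), 10 := bump (pathT 0 l i i) 1 0 (arr s3 10)))"
     by (rule PathUpdate_spec[OF s3(4-9) c1(2,3) sms(3) sm1' ne l(3,4)]) (simp_all add: A9 col_sm[OF COL])
    then show "ht B (Seq PathUpdate Color3) s3 ?Q"
    proof (rule ht_Seq, elim conjE)
     fix s4 assume s4: "same 50 s3 s4" "clock s4 <= clock s3 + 200 * (L + 3)"
      and A4: "arr s4 = (arr s3)(9 := bump (pathT 0 l su sv) 1 0 (arr s3 9), 10 := bump (pathT 0 l i i) 1 0 (arr s3 10))"
     have A's: "arr s4 4 = arr s 4" "arr s4 5 = arr s 5" "arr s4 6 = (arr s 6)(pr u v := l, pr v u := l)"
      "arr s4 9 = bump (pathT 0 l su sv) 1 0 (arr s 9)" "arr s4 10 = bump (pathT 0 l i i) 1 0 (arr s 10)"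
      "arr s4 11 = (arr s 11)(pr su l := Suc v, pr sv l := Suc u)" "arr s4 12 = (arr s 12)(pr (pr i l) m := u)"
      "arr s4 21 = (arr s 21)(pr (pr i l) m := v)" "arr s4 13 = (arr s 13)(pr u v := m, pr v u := m)"
      "arr s4 14 = arr s 14" "arr s4 1 = arr s 1" "arr s4 15 = arr s 15" "arr s4 16 = arr s 16" "arr s4 17 = arr s 17"
      "arr s4 0 = arr s 0"
      unfolding A4 A9 unfolding A3 by simp_all
     have sm4: "same 40 s s4" using s1(1) s2(1) s3(1) s4(1) by (simp add: same_def)
     have eq4: "eqA {6, 9, 10, 11, 12, 13, 21} s s4" unfolding eqA_def A4 A3 by simp
     have C4: "COLs s4" unfolding A's by (rule col)
     have M4: "MIs s4 G X" unfolding A's by (rule MI)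
     have Mm4: "Mmono s s4" unfolding Mmono_def A's by simp
     have p4: "p2 s4 <= p2 s + 1" unfolding A's by (rule pot2_color)
     have cov4: "cov s4 a b = cov s a b" for a b unfolding cov_def A's ..
     have lf4: "arr s4 6 (pr a b) = (if E2 u v a b then l else arr s 6 (pr a b))" for a b unfolding A's by (rule E2_upd)
     have J4: "cov s4 a b" if "arr s4 6 (pr a b) ~= 0" "arr s4 6 (pr a b) = arr s4 14 (arr s4 4 (pr a b))" "\<not> E2 u v a b" for a b
     proof -
      have e: "arr s4 6 (pr a b) = arr s 6 (pr a b)" unfolding lf4 using that(3) by simp
      show ?thesis using that(1,2) J unfolding e cov4 J_def A's(1,10) by blast
     qed
     have clk: "clock s4 <= clock s + 800 + 300 * (L + 3)" using s1 s2 s3 s4 by simp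
     have regs4: "reg s4 40 = u" "reg s4 41 = v" "reg s4 42 = i" "reg s4 46 = l"
      using same_reg[OF s4(1)] same_reg[OF s3(1)] s3 regs by simp_all
     have ex: "\<exists>l. l ~= 0 \<and> arr s4 6 = (arr s 6)(pr u v := l, pr v u := l)" using l(4) A's by blast
     show "ht B Color3 s4 ?Q"
     proof (cases "l = arr s 14 i")
      case False
      have "J s4" unfolding J_def
      proof (intro allI impI)
       fix a b assume h: "arr s4 6 (pr a b) ~= 0" "arr s4 6 (pr a b) = arr s4 14 (arr s4 4 (pr a b))"
       have "\<not> E2 u v a b"
       proof
        assume e: "E2 u v a b"
        have "arr s 4 (pr a b) = i" using e i unfolding E2_def by auto
        moreover have "arr s4 6 (pr a b) = l" unfolding lf4 using e by simp
        ultimately show False using h(2) False unfolding A's(1,10) by metis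
       qed
       then show "cov s4 a b" using J4 h by blast
      qed
      then have Q: "?Q s'" if "reg s' = reg s4" "arr s' = arr s4" "clock s' <= clock s4 + 300" for s'
       using that sm4 eq4 C4 M4 Mm4 p4 ex clk unfolding J_def cov_def Mmono_def eqA_def same_def by auto
      have e3: "eval B s4 (Equal (Reg 46) (Arr 14 (Reg 42))) = 0" using regs4 A's(10) False by simp
      show ?thesis unfolding Color3_def
       by (simp only: ht_If e3 simp_thms if_False ht_Skip) (rule Q; simp)
     next
      case True
      have e3: "eval B s4 (Equal (Reg 46) (Arr 14 (Reg 42))) ~= 0" using regs4 A's(10) True by simp
      define s5 where "s5 = tick 2 (set_reg 61 v (tick 2 (set_reg 60 u (tick (1 + cost (Equal (Reg 46) (Arr 14 (Reg 42)))) s4))))"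
      have s5: "reg s5 60 = u" "reg s5 61 = v" "reg s5 0 = n" "arr s5 = arr s4" "clock s5 = clock s4 + 9" "same 60 s4 s5"
       using C same_reg[OF sm4, of 0] by (simp_all add: s5_def Cst_def same_def)
      have "ht B TryMatch s5 (\<lambda>s'. same 60 s5 s' \<and> eqA {1, 15, 16, 17} s5 s' \<and> clock s' <= clock s5 + 300 \<and>
       MIs s' G X \<and> Mmono s5 s' \<and> cov s' u v)"
       by (rule TryMatch_spec[OF s5(1-3) G]) (use M4 C in \<open>simp_all add: s5 A's Cst_def\<close>)
      then have "ht B TryMatch s5 ?Q"
      proof (rule ht_mono, elim conjE)
       fix s' assume s': "same 60 s5 s'" "eqA {1, 15, 16, 17} s5 s'" "clock s' <= clock s5 + 300"
        "MIs s' G X" "Mmono s5 s'" "cov s' u v"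
       have B's: "arr s' 4 = arr s4 4" "arr s' 5 = arr s4 5" "arr s' 6 = arr s4 6" "arr s' 9 = arr s4 9" "arr s' 10 = arr s4 10"
        "arr s' 11 = arr s4 11" "arr s' 12 = arr s4 12" "arr s' 21 = arr s4 21" "arr s' 13 = arr s4 13" "arr s' 14 = arr s4 14"
        using eqA_D[OF s'(2)] unfolding s5(4) by simp_all
       have Mm: "Mmono s4 s'" using s'(5) unfolding Mmono_def s5(4) .
       show "?Q s'"
       proof (intro conjI)
        show "same 40 s s'" using sm4 s5(6) s'(1) by (simp add: same_def)
        show "eqA {1, 6, 9, 10, 11, 12, 13, 15, 16, 17, 21} s s'"
         using eq4 s'(2) unfolding eqA_def s5(4) by simp
        show "COLs s'" unfolding B's by (rule C4)
        show "\<exists>l. l ~= 0 \<and> arr s' 6 = (arr s 6)(pr u v := l, pr v u := l)" unfolding B's by (rule ex)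
        show "MIs s' G X" by (rule s'(4))
        show "Mmono s s'" by (rule Mmono_trans[OF Mm4 Mm])
        show "p2 s' <= p2 s + 1" unfolding B's by (rule p4)
        show "clock s' <= clock s + 1000 * (L + 3)" using clk s' s5 by simp
        show "J s'" unfolding J_def
        proof (intro allI impI)
         fix a b assume h: "arr s' 6 (pr a b) ~= 0" "arr s' 6 (pr a b) = arr s' 14 (arr s' 4 (pr a b))"
         show "cov s' a b"
         proof (cases "E2 u v a b")
          case True
          then show ?thesis using s'(6) cov_sym[OF s'(4,6)] unfolding E2_def by blast
         next
          case False
          then have "cov s4 a b" using J4 h unfolding B's by blast
          then show ?thesis by (rule Mmono_cov[OF Mm])
         qed
        qed
       qed
      qed
      then show ?thesis unfolding Color3_def ht_If using e3 by (simp add: s5_def regs4 numeral_2_eq_2)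
     qed
    qed
   qed
  qed
 qed
qed

end

section \<open>Adjacency lists by vertex and class\<close>

definition RemEp1 :: com where
 "RemEp1 = blk [
   Assign 32 (Arr 4 (PE (Reg 30) (Reg 31))),
   Assign 33 (Sub (Arr 8 (PE (Reg 30) (Reg 32))) (Const 1)),
   Assign 34 (Arr 7 (PE (Reg 30) (PE (Reg 32) (Reg 33))))]"

definition RemEp2 :: com where
 "RemEp2 = blk [
   Assign 35 (Arr 5 (PE (Reg 30) (Reg 31))),
   Store 7 (PE (Reg 30) (PE (Reg 32) (Reg 35))) (Reg 34),
   Store 5 (PE (Reg 30) (Reg 34)) (Reg 35),
   Store 8 (PE (Reg 30) (Reg 32)) (Reg 33),
   Assign 40 (Reg 30),
   Assign 41 (Reg 34)]"

definition RemEp3 :: com where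
 "RemEp3 = If (Equal (Reg 34) (Reg 31)) (Store 8 (PE (Reg 30) (Reg 32)) (Reg 33))
   (blk [Assign 40 (Reg 30), Assign 41 (Reg 34), Uncolor, RemEp2, Color])"

definition RemEp :: com where
 "RemEp = Seq RemEp1 (Seq RemEp3 (Store 3 (Reg 30) (Sub (Arr 3 (Reg 30)) (Arr 20 (Sub (Reg 4) (Reg 32))))))"

definition AddEp :: com where
 "AddEp = blk [
   Assign 33 (Arr 8 (PE (Reg 30) (Reg 32))),
   Store 7 (PE (Reg 30) (PE (Reg 32) (Reg 33))) (Reg 31),
   Store 5 (PE (Reg 30) (Reg 31)) (Reg 33),
   Store 8 (PE (Reg 30) (Reg 32)) (Add (Reg 33) (Const 1)),
   Store 3 (Reg 30) (Add (Arr 3 (Reg 30)) (Arr 20 (Sub (Reg 4) (Reg 32))))]"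

context bm
begin

text \<open>\<open>E\<close> is a set of ordered pairs and may be asymmetric: in the midst of an
  insertion or deletion an edge is listed at one of its ends only.\<close>

definition LIST :: "(nat \<Rightarrow> nat) \<Rightarrow> (nat \<Rightarrow> nat) \<Rightarrow> (nat \<Rightarrow> nat) \<Rightarrow> (nat \<Rightarrow> nat) \<Rightarrow> (nat \<times> nat) set \<Rightarrow> bool" where
 "LIST cl ps nb len E \<longleftrightarrow>
   (\<forall>x y. (x, y) \<in> E --> x < n \<and> y < n \<and> x ~= y \<and> cl (pr x y) <= L \<and> ps (pr x y) < len (pr x (cl (pr x y)))
    \<and> nb (pr x (pr (cl (pr x y)) (ps (pr x y)))) = y) \<and>
   (\<forall>x i p. p < len (pr x i) --> (x, nb (pr x (pr i p))) \<in> E \<and> cl (pr x (nb (pr x (pr i p)))) = i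
    \<and> ps (pr x (nb (pr x (pr i p)))) = p)"

lemma LIST_1: "LIST cl ps nb len E ==> (x, y) \<in> E ==> x < n \<and> y < n \<and> x ~= y \<and> cl (pr x y) <= L
  \<and> ps (pr x y) < len (pr x (cl (pr x y))) \<and> nb (pr x (pr (cl (pr x y)) (ps (pr x y)))) = y"
 unfolding LIST_def by (drule conjunct1, drule spec, drule spec, drule mp, assumption) assumption

lemma LIST_2: "LIST cl ps nb len E ==> p < len (pr x i) ==> (x, nb (pr x (pr i p))) \<in> E
  \<and> cl (pr x (nb (pr x (pr i p)))) = i \<and> ps (pr x (nb (pr x (pr i p)))) = p"
 unfolding LIST_def by (drule conjunct2, drule spec, drule spec, drule spec, drule mp, assumption) assumption

lemma LIST_I:
 assumes "\<And>x y. (x, y) \<in> E ==> x < n \<and> y < n \<and> x ~= y \<and> cl (pr x y) <= L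
  \<and> ps (pr x y) < len (pr x (cl (pr x y))) \<and> nb (pr x (pr (cl (pr x y)) (ps (pr x y)))) = y"
  "\<And>x i p. p < len (pr x i) ==> (x, nb (pr x (pr i p))) \<in> E
  \<and> cl (pr x (nb (pr x (pr i p)))) = i \<and> ps (pr x (nb (pr x (pr i p)))) = p"
 shows "LIST cl ps nb len E"
 unfolding LIST_def
proof (rule conjI)
 show "\<forall>x y. (x, y) \<in> E --> x < n \<and> y < n \<and> x ~= y \<and> cl (pr x y) <= L \<and> ps (pr x y) < len (pr x (cl (pr x y)))
    \<and> nb (pr x (pr (cl (pr x y)) (ps (pr x y)))) = y" by (intro allI impI) (rule assms(1))
 show "\<forall>x i p. p < len (pr x i) --> (x, nb (pr x (pr i p))) \<in> E \<and> cl (pr x (nb (pr x (pr i p)))) = i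
    \<and> ps (pr x (nb (pr x (pr i p)))) = p" by (intro allI impI) (rule assms(2))
qed

lemma LIST_ps_inj:
 assumes "LIST cl ps nb len E" "(x, y) \<in> E" "(x, z) \<in> E" "cl (pr x y) = cl (pr x z)" "ps (pr x y) = ps (pr x z)"
 shows "y = z"
proof -
 have "nb (pr x (pr (cl (pr x y)) (ps (pr x y)))) = y" using LIST_1[OF assms(1,2)] by blast
 moreover have "nb (pr x (pr (cl (pr x z)) (ps (pr x z)))) = z" using LIST_1[OF assms(1,3)] by blast
 ultimately show ?thesis unfolding assms(4,5) by (rule trans[OF sym])
qed

lemma LIST_bij:
 assumes "LIST cl ps nb len E"
 shows "bij_betw (\<lambda>p. nb (pr x (pr i p))) {..<len (pr x i)} {y. (x, y) \<in> E \<and> cl (pr x y) = i}"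
proof (rule bij_betwI')
 fix p q assume a: "p \<in> {..<len (pr x i)}" "q \<in> {..<len (pr x i)}"
 show "(nb (pr x (pr i p)) = nb (pr x (pr i q))) = (p = q)"
 proof
  assume e: "nb (pr x (pr i p)) = nb (pr x (pr i q))"
  have pq: "p < len (pr x i)" "q < len (pr x i)" using a by simp_all
  have "ps (pr x (nb (pr x (pr i p)))) = p" by (rule LIST_2[OF assms pq(1), THEN conjunct2, THEN conjunct2])
  moreover have "ps (pr x (nb (pr x (pr i q)))) = q" by (rule LIST_2[OF assms pq(2), THEN conjunct2, THEN conjunct2])
  ultimately show "p = q" unfolding e by (rule trans[OF sym])
 qed simp
next
 fix p assume "p \<in> {..<len (pr x i)}"
 then have "p < len (pr x i)" by simp
 from LIST_2[OF assms this] show "nb (pr x (pr i p)) \<in> {y. (x, y) \<in> E \<and> cl (pr x y) = i}" by simp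
next
 fix y assume "y \<in> {y. (x, y) \<in> E \<and> cl (pr x y) = i}"
 then have E: "(x, y) \<in> E" and c: "cl (pr x y) = i" by simp_all
 have "ps (pr x y) < len (pr x i)" "nb (pr x (pr i (ps (pr x y)))) = y" using LIST_1[OF assms E] unfolding c by simp_all
 then show "\<exists>p\<in>{..<len (pr x i)}. y = nb (pr x (pr i p))" by (intro bexI[of _ "ps (pr x y)"]) simp_all
qed

lemma LIST_card: "LIST cl ps nb len E ==> len (pr x i) = card {y. (x, y) \<in> E \<and> cl (pr x y) = i}"
 using bij_betw_same_card[OF LIST_bij, of cl ps nb len E x i] by simp

lemma LIST_nbrs: "LIST cl ps nb len E ==> {y. (x, y) \<in> E} \<subseteq> {..<n} - {x}"
proof (rule subsetI)
 fix z assume l: "LIST cl ps nb len E" and "z \<in> {y. (x, y) \<in> E}"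
 then have "(x, z) \<in> E" by simp
 from LIST_1[OF l this] show "z \<in> {..<n} - {x}" by simp
qed

lemma LIST_fin: "LIST cl ps nb len E ==> finite {y. (x, y) \<in> E}"
 using LIST_nbrs[of cl ps nb len E x] by (auto intro: finite_subset)

lemma LIST_ln: "LIST cl ps nb len E ==> len (pr x i) <= n" and LIST_ln_less: "LIST cl ps nb len E ==> (x, y) \<in> E ==> len (pr x i) < n"
proof -
 assume l: "LIST cl ps nb len E"
 have "card {y. (x, y) \<in> E \<and> cl (pr x y) = i} <= card ({..<n} - {x})"
  using LIST_nbrs[OF l, of x] by (intro card_mono) auto
 then have *: "len (pr x i) <= card ({..<n} - {x})" unfolding LIST_card[OF l] .
 then show "len (pr x i) <= n" using card_Diff1_le[of "{..<n}" x] by simp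
 show "len (pr x i) < n" if "(x, y) \<in> E"
 proof -
  have "x < n" using LIST_1[OF l that] by simp
  then have "card ({..<n} - {x}) = n - 1" by simp
  then show ?thesis using * n2 by linarith
 qed
qed

lemma LIST_ps: "LIST cl ps nb len E ==> (x, y) \<in> E ==> ps (pr x y) < n"
 using LIST_1[of cl ps nb len E x y] LIST_ln_less[of cl ps nb len E x y "cl (pr x y)"] by linarith

lemma LIST_cong:
 assumes l: "LIST cl ps nb len E" and e: "\<And>x y. (x, y) \<in> E ==> cl' (pr x y) = cl (pr x y)"
 shows "LIST cl' ps nb len E"
proof (rule LIST_I)
 fix x y assume "(x, y) \<in> E"
 then show "x < n \<and> y < n \<and> x ~= y \<and> cl' (pr x y) <= L
  \<and> ps (pr x y) < len (pr x (cl' (pr x y))) \<and> nb (pr x (pr (cl' (pr x y)) (ps (pr x y)))) = y"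
  using LIST_1[OF l] e by simp
next
 fix x i p assume "p < len (pr x i)"
 then show "(x, nb (pr x (pr i p))) \<in> E
  \<and> cl' (pr x (nb (pr x (pr i p)))) = i \<and> ps (pr x (nb (pr x (pr i p)))) = p"
  using LIST_2[OF l] e by simp
qed

lemma LIST_add:
 assumes l: "LIST cl ps nb len E" and new: "(x, y) \<notin> E" and i: "cl (pr x y) = i" "i <= L"
  and x: "x < n" "y < n" "x ~= y" and m: "m = len (pr x i)"
 shows "LIST cl (ps(pr x y := m)) (nb(pr x (pr i m) := y)) (len(pr x i := Suc m)) (insert (x, y) E)"
proof (rule LIST_I)
 fix a b assume ab: "(a, b) \<in> insert (x, y) E"
 show "a < n \<and> b < n \<and> a ~= b \<and> cl (pr a b) <= L \<and> (ps(pr x y := m)) (pr a b) < (len(pr x i := Suc m)) (pr a (cl (pr a b)))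
  \<and> (nb(pr x (pr i m) := y)) (pr a (pr (cl (pr a b)) ((ps(pr x y := m)) (pr a b)))) = b"
 proof (cases "(a, b) = (x, y)")
  case True
  then show ?thesis using i x by simp
 next
  case False
  have E: "(a, b) \<in> E" using insertE[OF ab] False by blast
  note q = LIST_1[OF l E]
  have p: "(ps(pr x y := m)) (pr a b) = ps (pr a b)" using False by auto
  have len: "len (pr a (cl (pr a b))) <= (len(pr x i := Suc m)) (pr a (cl (pr a b)))"
   using m by (cases "pr a (cl (pr a b)) = pr x i") (simp_all del: prod_encode_eq)
  have "pr a (pr (cl (pr a b)) (ps (pr a b))) ~= pr x (pr i m)" using q m by auto
  then show ?thesis unfolding p using q len by (simp del: prod_encode_eq)
 qed
next
 fix a j p assume p: "p < (len(pr x i := Suc m)) (pr a j)"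
 show "(a, (nb(pr x (pr i m) := y)) (pr a (pr j p))) \<in> insert (x, y) E
  \<and> cl (pr a ((nb(pr x (pr i m) := y)) (pr a (pr j p)))) = j
  \<and> (ps(pr x y := m)) (pr a ((nb(pr x (pr i m) := y)) (pr a (pr j p)))) = p"
 proof (cases "a = x \<and> j = i \<and> p = m")
  case True
  then show ?thesis using i by simp
 next
  case False
  have e: "(nb(pr x (pr i m) := y)) (pr a (pr j p)) = nb (pr a (pr j p))" using False by auto
  have "p < len (pr a j)" using p False m by (cases "pr a j = pr x i") auto
  note q = LIST_2[OF l this]
  have "(a, nb (pr a (pr j p))) ~= (x, y)" using q new by auto
  then have ps: "(ps(pr x y := m)) (pr a (nb (pr a (pr j p)))) = ps (pr a (nb (pr a (pr j p))))" by auto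
  show ?thesis unfolding e ps using q by simp
 qed
qed

lemma LIST_remove_last:
 assumes l: "LIST cl ps nb len E" and xy: "(x, y) \<in> E" and i: "cl (pr x y) = i" and m: "m = len (pr x i) - 1"
  and z: "nb (pr x (pr i m)) = y"
 shows "LIST cl ps nb (len(pr x i := m)) (E - {(x, y)})"
proof -
 have pm: "m < len (pr x i)" using LIST_1[OF l xy] i m by auto
 then have psm: "ps (pr x y) = m" using LIST_2[OF l pm] z by simp
 show ?thesis
 proof (rule LIST_I)
  fix a b assume ab: "(a, b) \<in> E - {(x, y)}"
  then have E: "(a, b) \<in> E" by simp
  note q = LIST_1[OF l E]
  have "ps (pr a b) < (len(pr x i := m)) (pr a (cl (pr a b)))"
  proof (cases "a = x \<and> cl (pr a b) = i")
   case True
   then have "ps (pr a b) ~= m" using LIST_ps_inj[OF l xy, of b] E ab psm i by auto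
   then show ?thesis using q True m by auto
  next
   case False
   then show ?thesis using q by auto
  qed
  then show "a < n \<and> b < n \<and> a ~= b \<and> cl (pr a b) <= L \<and> ps (pr a b) < (len(pr x i := m)) (pr a (cl (pr a b)))
   \<and> nb (pr a (pr (cl (pr a b)) (ps (pr a b)))) = b" using q by blast
 next
  fix a j p assume p: "p < (len(pr x i := m)) (pr a j)"
  then have "p < len (pr a j)" using pm by (auto split: if_splits)
  note q = LIST_2[OF l this]
  have "(a, nb (pr a (pr j p))) ~= (x, y)"
  proof
   assume e: "(a, nb (pr a (pr j p))) = (x, y)"
   then have "j = i" "p = m" using q i psm by auto
   then show False using p e by simp
  qed
  then show "(a, nb (pr a (pr j p))) \<in> E - {(x, y)} \<and> cl (pr a (nb (pr a (pr j p)))) = j \<and> ps (pr a (nb (pr a (pr j p)))) = p"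
   using q by blast
 qed
qed

text \<open>The last neighbour \<open>z\<close> takes over the vacated position. Its entry is the
  only remaining one whose position, and hence possibly whose slot, changes.\<close>

lemma LIST_remove_swap:
 assumes l: "LIST cl ps nb len E" and xy: "(x, y) \<in> E" and i: "cl (pr x y) = i" and m: "m = len (pr x i) - 1"
  and z: "nb (pr x (pr i m)) = z" "z ~= y" and p: "p = ps (pr x y)"
 shows "LIST cl (ps(pr x z := p)) (nb(pr x (pr i p) := z)) (len(pr x i := m)) (E - {(x, y)})"
proof -
 have pm: "m < len (pr x i)" "p < len (pr x i)" "nb (pr x (pr i p)) = y" using LIST_1[OF l xy] i m p by auto
 then have zz: "(x, z) \<in> E" "cl (pr x z) = i" "ps (pr x z) = m" using LIST_2[OF l pm(1)] z by auto
 have ne: "p ~= m" using pm z by auto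
 then have pl: "p < m" using pm m by linarith
 show ?thesis
 proof (rule LIST_I)
  fix a b assume ab: "(a, b) \<in> E - {(x, y)}"
  then have E: "(a, b) \<in> E" by simp
  note q = LIST_1[OF l E]
  show "a < n \<and> b < n \<and> a ~= b \<and> cl (pr a b) <= L \<and> (ps(pr x z := p)) (pr a b) < (len(pr x i := m)) (pr a (cl (pr a b)))
   \<and> (nb(pr x (pr i p) := z)) (pr a (pr (cl (pr a b)) ((ps(pr x z := p)) (pr a b)))) = b"
  proof (cases "(a, b) = (x, z)")
   case True
   then show ?thesis using q zz pl by simp
  next
   case False
   then have ps: "(ps(pr x z := p)) (pr a b) = ps (pr a b)" by auto
   show ?thesis
   proof (cases "a = x \<and> cl (pr a b) = i")
    case True
    have "ps (pr a b) ~= m" using LIST_ps_inj[OF l zz(1), of b] E False zz True by auto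
    moreover have "ps (pr a b) ~= p" using LIST_ps_inj[OF l xy, of b] E ab i True p by auto
    ultimately show ?thesis unfolding ps using q True m by auto
   next
    case F2: False
    then have "pr a (cl (pr a b)) ~= pr x i" "pr a (pr (cl (pr a b)) (ps (pr a b))) ~= pr x (pr i p)" by auto
    then show ?thesis unfolding ps using q by (simp del: prod_encode_eq)
   qed
  qed
 next
  fix a j q assume q: "q < (len(pr x i := m)) (pr a j)"
  show "(a, (nb(pr x (pr i p) := z)) (pr a (pr j q))) \<in> E - {(x, y)}
   \<and> cl (pr a ((nb(pr x (pr i p) := z)) (pr a (pr j q)))) = j
   \<and> (ps(pr x z := p)) (pr a ((nb(pr x (pr i p) := z)) (pr a (pr j q)))) = q"
  proof (cases "a = x \<and> j = i \<and> q = p")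
   case True
   then show ?thesis using zz z by simp
  next
   case False
   then have e: "(nb(pr x (pr i p) := z)) (pr a (pr j q)) = nb (pr a (pr j q))" by auto
   have "q < len (pr a j)" using q pm by (auto split: if_splits)
   note r = LIST_2[OF l this]
   have "(a, nb (pr a (pr j q))) ~= (x, y)"
   proof
    assume "(a, nb (pr a (pr j q))) = (x, y)"
    then show False using r i p False by auto
   qed
   moreover have "(a, nb (pr a (pr j q))) ~= (x, z)"
   proof
    assume h: "(a, nb (pr a (pr j q))) = (x, z)"
    then have "j = i" "q = m" using r zz by auto
    then show False using q h by simp
   qed
   ultimately have ps: "(ps(pr x z := p)) (pr a (nb (pr a (pr j q)))) = ps (pr a (nb (pr a (pr j q))))"
    and "(a, nb (pr a (pr j q))) ~= (x, y)" by auto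
   then show ?thesis unfolding e ps using r by simp
  qed
 qed
qed

text \<open>The colouring constrains class and position of coloured pairs only. Therefore an edge is
  uncoloured before either of them is changed.\<close>

lemma COL_cong:
 assumes COL: "COL cl ps lf T CT who CLa CLb cp"
  and e: "\<And>a b. lf (pr a b) ~= 0 ==> cl' (pr a b) = cl (pr a b) \<and> ps' (pr a b) = ps (pr a b)"
 shows "COL cl' ps' lf T CT who CLa CLb cp"
proof -
 note D = COL_D[OF COL]
 have sl: "slot cl' ps' a b = slot cl ps a b" if "lf (pr a b) ~= 0" for a b
  using e[OF that] by (simp add: slot_def)
 have nz: "lf (pr a b) ~= 0" if "anc nd (lf (pr a b))" for a b nd using that by (auto intro: ccontr)
 have ts: "TS cl' ps' lf \<sigma> nd = TS cl ps lf \<sigma> nd" for \<sigma> nd unfolding TS_def using sl nz by auto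
 have cs: "CS cl' lf i nd = CS cl lf i nd" for i nd unfolding CS_def using e nz by auto
 show ?thesis
 proof (rule COL_I)
  fix a b show "lf (pr a b) = lf (pr b a)" by (rule D(1))
 next
  fix a b assume h: "lf (pr a b) ~= 0"
  then have h': "lf (pr b a) ~= 0" using D(1)[of a b] by simp
  show "a < n \<and> b < n \<and> a ~= b \<and> cl' (pr a b) = cl' (pr b a) \<and> cl' (pr a b) <= L
    \<and> 2 * K (cl' (pr a b)) <= lf (pr a b) \<and> lf (pr a b) < 4 * K (cl' (pr a b))"
  proof -
   have c: "cl' (pr a b) = cl (pr a b)" "cl' (pr b a) = cl (pr b a)" using e[OF h] e[OF h'] by blast+
   show ?thesis unfolding c by (rule D(2)[OF h])
  qed
 next
  fix a b assume h: "lf (pr a b) ~= 0"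
  show "who (pr (slot cl' ps' a b) (lf (pr a b))) = Suc b" unfolding sl[OF h] by (rule D(3)[OF h])
 next
  fix \<sigma> l assume "who (pr \<sigma> l) ~= 0"
  from D(4)[OF this] obtain a b where "slot cl ps a b = \<sigma>" "lf (pr a b) = l" "l ~= 0" "who (pr \<sigma> l) = Suc b" by blast
  then show "\<exists>x y. slot cl' ps' x y = \<sigma> \<and> lf (pr x y) = l \<and> l ~= 0 \<and> who (pr \<sigma> l) = Suc y" using sl[of a b] by metis
 next
  fix \<sigma> nd show "T (pr \<sigma> nd) = card (TS cl' ps' lf \<sigma> nd)" unfolding ts by (rule D(5))
 next
  fix i nd show "CT (pr i nd) = card (CS cl' lf i nd)" unfolding cs by (rule D(6))
 next
  fix a b assume h: "lf (pr a b) ~= 0"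
  have c: "cl' (pr a b) = cl (pr a b)" using e[OF h] by simp
  show "cp (pr a b) < CT (pr (cl' (pr a b)) (lf (pr a b))) \<and> cp (pr b a) = cp (pr a b) \<and>
    (let q = pr (pr (cl' (pr a b)) (lf (pr a b))) (cp (pr a b)) in
     CLa q = a \<and> CLb q = b \<or> CLa q = b \<and> CLb q = a)" unfolding c by (rule D(7)[OF h])
 next
  fix i l p assume "p < CT (pr i l)" and l: "2 * K i <= l"
  then have q: "let e = pr (CLa (pr (pr i l) p)) (CLb (pr (pr i l) p)) in lf e = l \<and> cl e = i \<and> cp e = p"
   by (intro D(8) conjI)
  have "l ~= 0" using l K_pos[of i] by linarith
  then have "lf (pr (CLa (pr (pr i l) p)) (CLb (pr (pr i l) p))) ~= 0" using q by (simp add: Let_def)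
  from e[OF this] show "let e = pr (CLa (pr (pr i l) p)) (CLb (pr (pr i l) p)) in lf e = l \<and> cl' e = i \<and> cp e = p"
   using q by (simp add: Let_def)
 qed
qed

text \<open>The uncoloured edge occupies a position of its slot, so fewer than \<open>K\<close> colours are in use there.\<close>

lemma slot_load:
 assumes l: "LIST cl ps nb len E" and COL: "COL cl ps lf T CT who CLa CLb cp"
  and uv: "(u, v) \<in> E" "lf (pr u v) = 0" and col: "\<And>y. lf (pr u y) ~= 0 ==> (u, y) \<in> E"
 shows "T (pr (slot cl ps u v) 1) < K (cl (pr u v))"
proof -
 define i where "i = cl (pr u v)"
 define t where "t = ps (pr u v) div K i"
 let ?S = "{y. slot cl ps u y = slot cl ps u v \<and> lf (pr u y) ~= 0}"
 let ?P = "{t * K i ..< t * K i + K i} - {ps (pr u v)}"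
 have sub: "TS cl ps lf (slot cl ps u v) 1 \<subseteq> Pair u ` ?S"
 proof
  fix e assume e: "e \<in> TS cl ps lf (slot cl ps u v) 1"
  then obtain x y where xy: "e = (x, y)" "slot cl ps x y = slot cl ps u v" "anc 1 (lf (pr x y))" by (auto simp: TS_def)
  have "x = u" using xy(2) by (simp add: slot_def)
  moreover have "lf (pr x y) ~= 0" using xy(3) by (auto intro: ccontr)
  ultimately show "e \<in> Pair u ` ?S" using xy by auto
 qed
 have S: "(u, y) \<in> E \<and> cl (pr u y) = i \<and> ps (pr u y) \<in> ?P" if "y \<in> ?S" for y
 proof -
  have E: "(u, y) \<in> E" using col that by simp
  have "slot cl ps u y = slot cl ps u v" using that by simp
  then have "cl (pr u y) = cl (pr u v) \<and> ps (pr u y) div K (cl (pr u y)) = ps (pr u v) div K (cl (pr u v))"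
   unfolding slot_def prod_encode_eq prod.inject by blast
  then have c1: "cl (pr u y) = i" and "ps (pr u y) div K (cl (pr u y)) = t" unfolding i_def t_def by blast+
  then have c: "cl (pr u y) = i" "ps (pr u y) div K i = t" by simp_all
  have "ps (pr u y) ~= ps (pr u v)"
  proof
   assume e: "ps (pr u y) = ps (pr u v)"
   have "cl (pr u v) = cl (pr u y)" using c1 i_def by simp
   from LIST_ps_inj[OF l uv(1) E this e[symmetric]] have "v = y" .
   then show False using that uv(2) by simp
  qed
  moreover have "ps (pr u y) = t * K i + ps (pr u y) mod K i"
   using c(2) div_mult_mod_eq[of "ps (pr u y)" "K i"] by simp
  moreover have "ps (pr u y) mod K i < K i" by simp
  ultimately have "ps (pr u y) ~= ps (pr u v)" "t * K i <= ps (pr u y)" "ps (pr u y) < t * K i + K i" by linarith+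
  then have "ps (pr u y) \<in> ?P" by simp
  then show ?thesis using E c1 by blast
 qed
 have inj: "inj_on (\<lambda>y. ps (pr u y)) ?S"
 proof (rule inj_onI)
  fix y z assume y: "y \<in> ?S" and z: "z \<in> ?S" and e: "ps (pr u y) = ps (pr u z)"
  have "cl (pr u y) = cl (pr u z)" using S[OF y] S[OF z] by simp
  from LIST_ps_inj[OF l _ _ this e] show "y = z" using S[OF y] S[OF z] by blast
 qed
 have fin: "finite ?S" by (rule finite_subset[OF _ LIST_fin[OF l, of u]]) (use col in auto)
 have "(\<lambda>y. ps (pr u y)) ` ?S \<subseteq> ?P" by (rule image_subsetI) (rule S[THEN conjunct2, THEN conjunct2])
 then have "card ?S <= card ?P" by (rule card_inj_on_le[OF inj]) simp
 also have "card ?P = K i - 1"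
 proof -
  have "ps (pr u v) = t * K i + ps (pr u v) mod K i" unfolding t_def by (rule div_mult_mod_eq[symmetric])
  moreover have "ps (pr u v) mod K i < K i" by simp
  ultimately have "t * K i <= ps (pr u v)" "ps (pr u v) < t * K i + K i" by linarith+
  then have "ps (pr u v) \<in> {t * K i ..< t * K i + K i}" by simp
  then show ?thesis by simp
 qed
 finally have "card ?S < K i" using K_pos(1)[of i] by linarith
 moreover have "T (pr (slot cl ps u v) 1) <= card (Pair u ` ?S)" unfolding COL_D(5)[OF COL]
  by (rule card_mono) (use fin sub in auto)
 moreover have "card (Pair u ` ?S) <= card ?S" by (rule card_image_le[OF fin])
 ultimately show ?thesis unfolding i_def by linarith
qed

text \<open>The weight at \<open>x\<close>, scaled by \<open>2 ^ L\<close> to make it a whole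
  number. In this scale the capacity of \<open>x\<close> is \<open>c x * 2 ^ L\<close>.\<close>

definition wt :: "(nat \<Rightarrow> nat) \<Rightarrow> (nat \<times> nat) set \<Rightarrow> nat \<Rightarrow> nat" where
 "wt cl E x = (\<Sum>y\<in>{y. (x, y) \<in> E}. 2 ^ (L - cl (pr x y)))"

lemma wt_sm:
 assumes "LIST cl ps nb len E" shows "sm (wt cl E x)" "wt cl E x <= 2 * n * n"
proof -
 have "wt cl E x <= (\<Sum>y\<in>{y. (x, y) \<in> E}. 2 ^ L)" unfolding wt_def by (intro sum_mono power_increasing) auto
 also have "\<dots> <= n * 2 ^ L"
  using card_mono[OF _ LIST_nbrs[OF assms, of x]] card_Diff1_le[of "{..<n}" x] by (simp add: mult_right_mono)
 also have "\<dots> <= n * (2 * n)" using Ln2 by (rule mult_left_mono) simp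
 finally show 1: "wt cl E x <= 2 * n * n" by simp
 then show "sm (wt cl E x)" by (intro sm12) (simp add: sm1_def q1_def power2_eq_square)
qed

lemma wt_remove:
 assumes fin: "finite {z. (x, z) \<in> E}" and "(x, y) \<in> E"
 shows "wt cl (E - {(x, y)}) = (wt cl E)(x := wt cl E x - 2 ^ (L - cl (pr x y)))"
proof
 fix a show "wt cl (E - {(x, y)}) a = ((wt cl E)(x := wt cl E x - 2 ^ (L - cl (pr x y)))) a"
 proof (cases "a = x")
  case True
  have "{z. (x, z) \<in> E - {(x, y)}} = {z. (x, z) \<in> E} - {y}" by auto
  then show ?thesis using True assms unfolding wt_def by (simp add: sum_diff1_nat)
 next
  case False
  then have "{z. (a, z) \<in> E - {(x, y)}} = {z. (a, z) \<in> E}" by auto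
  then show ?thesis using False unfolding wt_def by simp
 qed
qed

lemma wt_add:
 assumes fin: "finite {z. (x, z) \<in> E}" and "(x, y) \<notin> E"
 shows "wt cl (insert (x, y) E) = (wt cl E)(x := wt cl E x + 2 ^ (L - cl (pr x y)))"
proof
 fix a show "wt cl (insert (x, y) E) a = ((wt cl E)(x := wt cl E x + 2 ^ (L - cl (pr x y)))) a"
 proof (cases "a = x")
  case True
  have "{z. (x, z) \<in> insert (x, y) E} = insert y {z. (x, z) \<in> E}" by auto
  then show ?thesis using True assms unfolding wt_def by simp
 next
  case False
  then have "{z. (a, z) \<in> insert (x, y) E} = {z. (a, z) \<in> E}" by auto
  then show ?thesis using False unfolding wt_def by simp
 qed
qed

lemma wt_cong: "(\<And>x y. (x, y) \<in> E ==> cl' (pr x y) = cl (pr x y)) ==> wt cl' E = wt cl E"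
 unfolding wt_def by (intro ext sum.cong) auto

text \<open>Three sets are kept apart: \<open>G\<close> is the graph seen by the matching,
  \<open>E\<close> holds the pairs with an adjacency entry, and the \<open>F\<close> of
  \<open>NZ\<close> the coloured pairs. They coincide between updates; while an edge is inserted,
  deleted or moved it leaves and enters them one at a time.\<close>

definition Inv0 :: "state \<Rightarrow> (nat \<times> nat) set \<Rightarrow> nat set \<Rightarrow> (nat \<times> nat) set \<Rightarrow> bool" where
 "Inv0 s G X E \<longleftrightarrow> Cst s \<and> graph G \<and> MIs s G X \<and> J s \<and> COLs s \<and> LIST (arr s 4) (arr s 5) (arr s 7) (arr s 8) E
   \<and> arr s 3 = wt (arr s 4) E \<and> E \<subseteq> G"

definition NZ :: "state \<Rightarrow> (nat \<times> nat) set \<Rightarrow> bool" where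
 "NZ s F \<longleftrightarrow> (\<forall>a b. arr s 6 (pr a b) ~= 0 \<longleftrightarrow> (a, b) \<in> F)"

lemma Inv0_D:
 assumes "Inv0 s G X E"
 shows "Cst s" "graph G" "MIs s G X" "J s" "COLs s" "LIST (arr s 4) (arr s 5) (arr s 7) (arr s 8) E"
  "arr s 3 = wt (arr s 4) E" "E \<subseteq> G"
 using assms unfolding Inv0_def by - (elim conjE, assumption)+

abbreviation "FC \<equiv> {1, 3, 4, 5, 6, 7, 8, 9, 10, 11, 12, 13, 15, 16, 17, 21} :: nat set"

text \<open>\<open>k\<close> bounds the growth of \<open>pot2\<close>, that is, the number of edges
  coloured on the way, and \<open>d\<close> bounds the time.\<close>

definition Step :: "nat \<Rightarrow> nat \<Rightarrow> nat \<Rightarrow> state \<Rightarrow> state \<Rightarrow> bool" where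
 "Step R k d s s' \<longleftrightarrow> same R s s' \<and> eqA FC s s' \<and> Mmono s s' \<and> p2 s' <= p2 s + k \<and> clock s' <= clock s + d"

lemma Step_trans: "Step R k d s s' ==> Step R' k' d' s' s'' ==> R0 <= R ==> R0 <= R' ==> k + k' <= k0 ==> d + d' <= d0 ==> Step R0 k0 d0 s s''"
 unfolding Step_def using Mmono_trans[of s s' s''] eqA_trans[of FC s s' FC s'' FC]
 by (auto simp: same_def)

lemma COL_sm_facts: "Inv0 s G X E ==> sm (arr s 8 (pr x i)) \<and> sm0 (arr s 8 (pr x i))"
 using LIST_ln[OF Inv0_D(6), of s G X E x i] by simp

lemma pw: "Cst s ==> i <= L ==> arr s 20 (L - i) = 2 ^ (L - i)" "Cst s ==> reg s 4 = L" "Cst s ==> reg s 5 = ll" "Cst s ==> reg s 0 = n"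
 by (simp_all add: Cst_def)

lemma sm_pow: "sm (2 ^ (L - i))"
proof -
 have "(2::nat) ^ (L - i) <= 2 ^ L" by (rule power_increasing) auto
 moreover have "0 < (2::nat) ^ L" by simp
 ultimately have "(2::nat) ^ (L - i) < 4 * 2 ^ L" by linarith
 then show ?thesis by simp
qed

text \<open>Swapping \<open>z\<close> into the gap may change the slot of the edge \<open>xz\<close>
  at \<open>x\<close>. That edge is uncoloured before the swap and coloured again after it, which
  accounts for the single unit of \<open>pot2\<close>.\<close>

lemma RemEp3_spec:
 assumes I: "Inv0 s G X E" and F: "NZ s F" "F \<subseteq> E" "\<And>z. (x, z) \<in> E ==> z ~= y ==> (x, z) \<in> F"
  and symF: "\<And>a b. (a, b) \<in> F ==> (b, a) \<in> F"
  and xy: "(x, y) \<in> E" "(x, y) \<notin> F" and i: "arr s 4 (pr x y) = i" and m: "m = arr s 8 (pr x i) - 1"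
  and r: "reg s 30 = x" "reg s 31 = y" "reg s 32 = i" "reg s 33 = m" "reg s 34 = arr s 7 (pr x (pr i m))"
 shows "ht B RemEp3 s (\<lambda>s'. Step 34 1 (1800 * (L + 3)) s s' \<and> Cst s' \<and> MIs s' G X \<and> J s' \<and> COLs s'
  \<and> LIST (arr s' 4) (arr s' 5) (arr s' 7) (arr s' 8) (E - {(x, y)}) \<and> arr s' 3 = arr s 3 \<and> arr s' 4 = arr s 4 \<and> NZ s' F)"
  (is "ht B RemEp3 s ?Q")
proof -
 note D = Inv0_D[OF I]
 define z where "z = arr s 7 (pr x (pr i m))"
 have xyn: "x < n" "y < n" "x ~= y" "i <= L" using LIST_1[OF D(6) xy(1)] i by auto
 have mlt: "m < arr s 8 (pr x i)" using LIST_1[OF D(6) xy(1)] i m by auto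
 note z2 = LIST_2[OF D(6) mlt, folded z_def]
 have zn: "z < n" "z ~= x" using LIST_1[OF D(6)] z2 by auto
 have sml: "sm0 (arr s 8 (pr x i))" using COL_sm_facts[OF I] by simp
 then have smm: "sm m" "sm0 m" using m by (auto simp: sm0_def intro!: sm02)
 have sms: "sm x" "sm y" "sm z" "sm i" "sm0 i" "sm0 x" using xyn zn by simp_all
 show ?thesis
 proof (cases "z = y")
  case True
  define s' where "s' = tick (1 + cost (PE (Reg 30) (Reg 32)) + cost (Reg 33)) (set_arr 8 (pr x i) m (tick (1 + cost (Equal (Reg 34) (Reg 31))) s))"
  have e: "eval B s (Equal (Reg 34) (Reg 31)) ~= 0" using r True z_def by simp
  have run: "ht B RemEp3 s ?Q = ?Q s'" unfolding RemEp3_def ht_If using e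
   by (simp add: r sms s'_def)
  have a': "arr s' = (arr s)(8 := (arr s 8)(pr x i := m))" by (simp add: s'_def)
  have A': "arr s' a = arr s a" if "a ~= 8" for a unfolding a' using that by simp
  have A8: "arr s' 8 = (arr s 8)(pr x i := m)" unfolding a' by simp
  have R': "reg s' = reg s" by (simp add: s'_def)
  have "?Q s'"
  proof (intro conjI)
   show "Step 34 1 (1800 * (L + 3)) s s'"
    unfolding Step_def same_def eqA_def Mmono_def by (simp add: A' R') (simp add: s'_def)
   show "Cst s'" using D(1) unfolding Cst_def by (simp add: A' R')
   show "MIs s' G X" using D(3) by (simp add: A')
   show "J s'" using D(4) unfolding J_def cov_def by (simp add: A')
   show "COLs s'" using D(5) by (simp add: A')
   show "LIST (arr s' 4) (arr s' 5) (arr s' 7) (arr s' 8) (E - {(x, y)})"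
    using LIST_remove_last[OF D(6) xy(1) i m] True by (simp add: A' A8 z_def)
   show "NZ s' F" using F(1) unfolding NZ_def by (simp add: A')
  qed (simp_all add: A')
  then show ?thesis unfolding run .
 next
  case False
  have zF: "(x, z) \<in> F" "(z, x) \<in> F" using F(3)[of z] False z2 symF by auto
  then have lz: "arr s 6 (pr x z) ~= 0" using F(1) unfolding NZ_def by blast
  have zxE: "(z, x) \<in> E" using zF F(2) by auto
  have clz: "arr s 4 (pr x z) = i" "arr s 4 (pr z x) = i" using z2 COL_D(2)[OF D(5) lz] by auto
  define p where "p = arr s 5 (pr x y)"
  have pn: "p < n" using LIST_ps[OF D(6) xy(1)] by (simp add: p_def)
  define s1 where "s1 = tick 2 (set_reg 41 z (tick 2 (set_reg 40 x (tick (1 + cost (Equal (Reg 34) (Reg 31))) s))))"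
  have s1: "reg s1 40 = x" "reg s1 41 = z" "arr s1 = arr s" "clock s1 = clock s + 8" "same 40 s s1"
   by (simp_all add: s1_def same_def)
  have e: "eval B s (Equal (Reg 34) (Reg 31)) = 0" using r False z_def by simp
  have run: "ht B RemEp3 s ?Q = ht B (Seq Uncolor (Seq RemEp2 Color)) s1 ?Q" unfolding RemEp3_def ht_If using e
   by (simp add: r s1_def z_def numeral_2_eq_2)
  have C1: "Cst s1" using D(1) s1 same_reg[OF s1(5)] unfolding Cst_def by simp
  have "ht B Uncolor s1 (\<lambda>s'. same 40 s1 s' \<and> eqA {6, 9, 10, 11, 12, 13, 21} s1 s' \<and> COLs s' \<and>
   arr s' 6 = (arr s1 6)(pr x z := 0, pr z x := 0) \<and> p2 s' <= p2 s1 \<and> clock s' <= clock s1 + 600 * (L + 3))"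
   by (rule Uncolor_spec[OF C1 _ _ s1(1,2)])
    (use D(5) lz LIST_ps[OF D(6) z2[THEN conjunct1]] LIST_ps[OF D(6) zxE] in \<open>simp_all only: s1 not_False_eq_True\<close>)
  then have "ht B (Seq Uncolor (Seq RemEp2 Color)) s1 ?Q"
  proof (rule ht_Seq, elim conjE)
   fix s2 assume s2: "same 40 s1 s2" "eqA {6, 9, 10, 11, 12, 13, 21} s1 s2" "COLs s2"
    "arr s2 6 = (arr s1 6)(pr x z := 0, pr z x := 0)" "p2 s2 <= p2 s1" "clock s2 <= clock s1 + 600 * (L + 3)"
   have A2: "arr s2 a = arr s a" if "a \<notin> {6, 9, 10, 11, 12, 13, 21}" for a
    using eqA_D[OF s2(2) that] s1 by simp
   have regs: "reg s2 30 = x" "reg s2 31 = y" "reg s2 32 = i" "reg s2 33 = m" "reg s2 34 = z"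
    using same_reg[OF s2(1)] same_reg[OF s1(5)] r z_def by simp_all
   have smip: "sm (pr i p)" using sm12[OF sm_pr[OF sms(5)]] pn by simp
   have smp: "sm p" using pn by simp
   have "ht B RemEp2 s2 (\<lambda>s'. same 35 s2 s' \<and> reg s' 40 = x \<and> reg s' 41 = z \<and> clock s' <= clock s2 + 300 \<and>
    arr s' = (arr s2)(7 := (arr s 7)(pr x (pr i p) := z), 5 := (arr s 5)(pr x z := p), 8 := (arr s 8)(pr x i := m)))"
    unfolding RemEp2_def
    by (simp add: regs A2 sms smip smp p_def[symmetric] same_def fun_upd_twist)
   then show "ht B (Seq RemEp2 Color) s2 ?Q"
   proof (rule ht_Seq, elim conjE)
    fix s3 assume s3: "same 35 s2 s3" "reg s3 40 = x" "reg s3 41 = z" "clock s3 <= clock s2 + 300"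
     and a3: "arr s3 = (arr s2)(7 := (arr s 7)(pr x (pr i p) := z), 5 := (arr s 5)(pr x z := p), 8 := (arr s 8)(pr x i := m))"
    have A3: "arr s3 a = arr s2 a" if "a \<notin> {5, 7, 8}" for a unfolding a3 using that by simp
    have A3s: "arr s3 a = arr s a" if "a \<notin> {5, 6, 7, 8, 9, 10, 11, 12, 13, 21}" for a using A3 A2 that by simp
    have A35: "arr s3 5 = (arr s 5)(pr x z := p)" "arr s3 7 = (arr s 7)(pr x (pr i p) := z)" "arr s3 8 = (arr s 8)(pr x i := m)"
     unfolding a3 by simp_all
    have sm3: "same 35 s s3" using s1(5) s2(1) s3(1) by (simp add: same_def)
    have A36: "arr s3 6 = (arr s 6)(pr x z := 0, pr z x := 0)" using A3[of 6] s2(4) s1(3) by simp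
    have lf3: "arr s3 6 (pr a b) = (if E2 x z a b then 0 else arr s 6 (pr a b))" for a b unfolding A36 by (rule E2_upd)
    have L3: "LIST (arr s3 4) (arr s3 5) (arr s3 7) (arr s3 8) (E - {(x, y)})"
     using LIST_remove_swap[OF D(6) xy(1) i m z_def[symmetric] False p_def] A3s[of 4] unfolding A35 by simp
    have C3: "COLs s3"
    proof -
     have c: "COL (arr s 4) (arr s 5) (arr s3 6) (arr s3 9) (arr s3 10) (arr s3 11) (arr s3 12) (arr s3 21) (arr s3 13)"
      using s2(3) A2[of 4] A2[of 5] by (simp add: A3)
     have a4: "arr s3 4 = arr s 4" using A3s[of 4] by simp
     show ?thesis unfolding a4
     proof (rule COL_cong[OF c])
      fix a b assume "arr s3 6 (pr a b) ~= 0"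
      then have "\<not> E2 x z a b" unfolding lf3 by (auto split: if_splits)
      then have "pr a b ~= pr x z" by (auto simp: E2_def)
      then show "arr s 4 (pr a b) = arr s 4 (pr a b) \<and> arr s3 5 (pr a b) = arr s 5 (pr a b)" unfolding A35 by auto
     qed
    qed
    have M3: "MIs s3 G X" using D(3) by (simp add: A3s)
    have J3: "J s3" unfolding J_def
    proof (intro allI impI)
     fix a b assume h: "arr s3 6 (pr a b) ~= 0" "arr s3 6 (pr a b) = arr s3 14 (arr s3 4 (pr a b))"
     have "arr s3 6 (pr a b) = arr s 6 (pr a b)" using h(1) unfolding lf3 by (auto split: if_splits)
     then have "cov s a b" using h D(4) unfolding J_def by (simp add: A3s)
     then show "cov s3 a b" unfolding cov_def by (simp add: A3s)
    qed
    have Cst3: "Cst s3" using D(1) same_reg[OF sm3] unfolding Cst_def by (simp add: A3s)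
    have zx: "(x, z) \<in> E - {(x, y)}" "(z, x) \<in> E - {(x, y)}" using z2 zxE False zn by auto
    have nzE: "(a, b) \<in> E - {(x, y)}" if "arr s3 6 (pr a b) ~= 0" for a b
    proof -
     have "arr s 6 (pr a b) ~= 0" using that unfolding lf3 by (auto split: if_splits)
     then have "(a, b) \<in> F" using F(1) unfolding NZ_def by blast
     then show ?thesis using F(2) xy(2) by auto
    qed
    have lf30: "arr s3 6 (pr x z) = 0" "arr s3 6 (pr z x) = 0" unfolding lf3 by simp_all
    have cl3: "arr s3 4 (pr x z) = i" "arr s3 4 (pr z x) = i" using clz A3s[of 4] by simp_all
    have "arr s3 9 (pr (slot (arr s3 4) (arr s3 5) x z) 1) < K i"
     using slot_load[OF L3 C3 zx(1) lf30(1) nzE] cl3 by simp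
    moreover have "arr s3 9 (pr (slot (arr s3 4) (arr s3 5) z x) 1) < K i"
     using slot_load[OF L3 C3 zx(2) lf30(2) nzE] cl3 by simp
    ultimately have root: "arr s3 9 (pr (slot (arr s3 4) (arr s3 5) x z) 1) + arr s3 9 (pr (slot (arr s3 4) (arr s3 5) z x) 1) < 2 * K i"
     by linarith
    have xzG: "(x, z) \<in> G" using z2 D(8) by auto
    have p23: "p2 s3 <= p2 s" using s2(5) s1(3) by (simp add: A3)
    have "ht B Color s3 (\<lambda>s'. same 40 s3 s' \<and> eqA {1, 6, 9, 10, 11, 12, 13, 15, 16, 17, 21} s3 s' \<and> COLs s' \<and>
     (\<exists>l. l ~= 0 \<and> arr s' 6 = (arr s3 6)(pr x z := l, pr z x := l)) \<and> MIs s' G X \<and> J s' \<and> Mmono s3 s' \<and>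
     p2 s' <= p2 s3 + 1 \<and> clock s' <= clock s3 + 1000 * (L + 3))"
     by (rule Color_spec[OF Cst3 C3 s3(2,3) D(2) xzG M3 J3 lf30(1) cl3 xyn(4) LIST_ps[OF L3 zx(1)] LIST_ps[OF L3 zx(2)] root])
    then show "ht B Color s3 ?Q"
    proof (rule ht_mono, elim conjE exE)
     fix s' l assume s': "same 40 s3 s'" "eqA {1, 6, 9, 10, 11, 12, 13, 15, 16, 17, 21} s3 s'" "COLs s'"
      and l: "l ~= 0" "arr s' 6 = (arr s3 6)(pr x z := l, pr z x := l)"
      and s'': "MIs s' G X" "J s'" "Mmono s3 s'" "p2 s' <= p2 s3 + 1" "clock s' <= clock s3 + 1000 * (L + 3)"
     have A': "arr s' a = arr s3 a" if "a \<notin> {1, 6, 9, 10, 11, 12, 13, 15, 16, 17, 21}" for a by (rule eqA_D[OF s'(2) that])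
     have sm': "same 35 s s'" using sm3 s'(1) by (simp add: same_def)
     show "?Q s'"
     proof (intro conjI)
      have "Mmono s s3" unfolding Mmono_def by (simp add: A3s)
      then have "Mmono s s'" using s''(3) by (rule Mmono_trans)
      moreover have "eqA FC s s'" unfolding eqA_def using A' A3s by simp
      moreover have "clock s' <= clock s + 1800 * (L + 3)" using s''(5) s3(4) s2(6) s1(4) by simp
      moreover have "same 34 s s'" using sm' by (simp add: same_def)
      ultimately show "Step 34 1 (1800 * (L + 3)) s s'" unfolding Step_def using s''(4) p23 by simp
      show "Cst s'" using D(1) same_reg[OF sm'] unfolding Cst_def by (simp add: A' A3s)
      show "MIs s' G X" "J s'" "COLs s'" by (rule s'' s')+
      show "LIST (arr s' 4) (arr s' 5) (arr s' 7) (arr s' 8) (E - {(x, y)})" using L3 by (simp add: A')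
      show "arr s' 3 = arr s 3" "arr s' 4 = arr s 4" by (simp_all add: A' A3s)
      have lf': "arr s' 6 (pr a b) = (if E2 x z a b then l else arr s3 6 (pr a b))" for a b unfolding l(2) by (rule E2_upd)
      show "NZ s' F" unfolding NZ_def
      proof (intro allI)
       fix a b
       show "(arr s' 6 (pr a b) ~= 0) = ((a, b) \<in> F)"
       proof (cases "E2 x z a b")
        case True
        then have "(a, b) \<in> F" using zF unfolding E2_def by blast
        then show ?thesis using True l(1) unfolding lf' by simp
       next
        case False
        then show ?thesis using F(1) unfolding NZ_def lf' lf3 by simp
       qed
      qed
     qed
    qed
   qed
  qed
  then show ?thesis unfolding run .
 qed
qed

lemma RemEp_spec:
 assumes I: "Inv0 s G X E" and F: "NZ s F" "F \<subseteq> E" "\<And>z. (x, z) \<in> E ==> z ~= y ==> (x, z) \<in> F"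
  and symF: "\<And>a b. (a, b) \<in> F ==> (b, a) \<in> F"
  and xy: "(x, y) \<in> E" "(x, y) \<notin> F" and r: "reg s 30 = x" "reg s 31 = y"
 shows "ht B RemEp s (\<lambda>s'. Step 30 1 (2000 * (L + 3)) s s' \<and> Inv0 s' G X (E - {(x, y)}) \<and> NZ s' F \<and> arr s' 4 = arr s 4)"
  (is "ht B RemEp s ?Q")
proof -
 note D = Inv0_D[OF I]
 define i where "i = arr s 4 (pr x y)"
 define m where "m = arr s 8 (pr x i) - 1"
 have xyn: "x < n" "y < n" "x ~= y" "i <= L" using LIST_1[OF D(6) xy(1)] i_def by auto
 have sml: "sm0 (arr s 8 (pr x i))" using COL_sm_facts[OF I] by simp
 then have smm: "sm m" "sm0 m" using m_def by (auto simp: sm0_def intro!: sm02)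
 have sms: "sm x" "sm y" "sm i" "sm0 i" "sm0 x" using xyn by simp_all
 have smim: "sm (pr i m)" using sm12[OF sm_pr[OF sms(4) smm(2)]] .
 have "ht B RemEp1 s (\<lambda>s'. same 32 s s' \<and> reg s' 32 = i \<and> reg s' 33 = m \<and> reg s' 34 = arr s 7 (pr x (pr i m)) \<and>
  arr s' = arr s \<and> clock s' <= clock s + 100)"
  unfolding RemEp1_def by (simp add: r sms smim smm i_def[symmetric] m_def[symmetric] m_def[symmetric, unfolded One_nat_def] same_def)
 then show ?thesis unfolding RemEp_def
 proof (rule ht_Seq, elim conjE)
  fix s1 assume s1: "same 32 s s1" "reg s1 32 = i" "reg s1 33 = m" "reg s1 34 = arr s 7 (pr x (pr i m))"
   "arr s1 = arr s" "clock s1 <= clock s + 100"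
  have C1: "Cst s1" using D(1) same_reg[OF s1(1)] unfolding Cst_def by (simp add: s1)
  have I1: "Inv0 s1 G X E" using I C1 unfolding Inv0_def J_def cov_def s1(5) by blast
  have NZ1: "NZ s1 F" using F(1) unfolding NZ_def s1(5) .
  have regs: "reg s1 30 = x" "reg s1 31 = y" using same_reg[OF s1(1)] r by simp_all
  have i1: "arr s1 4 (pr x y) = i" "m = arr s1 8 (pr x i) - 1" "reg s1 34 = arr s1 7 (pr x (pr i m))"
   by (simp_all add: s1 i_def m_def)
  show "ht B (Seq RemEp3 (Store 3 (Reg 30) (Sub (Arr 3 (Reg 30)) (Arr 20 (Sub (Reg 4) (Reg 32)))))) s1 ?Q"
  proof (rule ht_Seq[OF RemEp3_spec[OF I1 NZ1 F(2,3) symF xy i1(1,2) regs s1(2,3) i1(3)]]; (elim conjE)?)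
   fix s2 assume S: "Step 34 1 (1800 * (L + 3)) s1 s2" and s2: "Cst s2" "MIs s2 G X" "J s2" "COLs s2"
    "LIST (arr s2 4) (arr s2 5) (arr s2 7) (arr s2 8) (E - {(x, y)})" "arr s2 3 = arr s1 3" "arr s2 4 = arr s1 4" "NZ s2 F"
   have regs2: "reg s2 30 = x" "reg s2 32 = i"
    using S same_reg[of 34 s1 s2] regs s1 unfolding Step_def by simp_all
   have w: "arr s2 3 x - 2 ^ (L - i) = wt (arr s 4) E x - 2 ^ (L - i)" using s2(6) s1(5) D(7) by simp
   show "ht B (Store 3 (Reg 30) (Sub (Arr 3 (Reg 30)) (Arr 20 (Sub (Reg 4) (Reg 32))))) s2 ?Q"
    unfolding ht_Store
   proof -
    let ?s = "tick (1 + cost (Reg 30) + cost (Sub (Arr 3 (Reg 30)) (Arr 20 (Sub (Reg 4) (Reg 32)))))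
      (set_arr 3 (eval B s2 (Reg 30)) (eval B s2 (Sub (Arr 3 (Reg 30)) (Arr 20 (Sub (Reg 4) (Reg 32))))) s2)"
    have a3: "arr ?s = (arr s2)(3 := (arr s2 3)(x := arr s2 3 x - 2 ^ (L - i)))"
     using regs2 pw(1)[OF s2(1) xyn(4)] pw(2)[OF s2(1)] by simp
    have A: "arr ?s a = arr s2 a" if "a ~= 3" for a unfolding a3 using that by simp
    have A3: "arr ?s 3 = wt (arr s 4) (E - {(x, y)})"
     unfolding a3 wt_remove[OF LIST_fin[OF D(6)] xy(1)] i_def[symmetric] using s2(6) s1(5) D(7) by simp
    have S': "Step 30 1 (2000 * (L + 3)) s s2"
    proof -
     have "Step 32 0 100 s s1" unfolding Step_def using s1 by (simp add: eqA_def Mmono_def)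
     then show ?thesis using S by (rule Step_trans) auto
    qed
    have S2: "same 30 s s2" "eqA FC s s2" "Mmono s s2" "p2 s2 <= p2 s + 1" using S' unfolding Step_def by auto
    have clk: "clock s2 <= clock s + 100 + 1800 * (L + 3)" using S s1 unfolding Step_def by simp
    have "Step 30 1 (2000 * (L + 3)) s ?s" unfolding Step_def
    proof (intro conjI)
     show "same 30 s ?s" using S2(1) by (simp add: same_def)
     show "eqA FC s ?s" using S2(2) A unfolding eqA_def by simp
     show "Mmono s ?s" using S2(3) unfolding Mmono_def by (simp add: A)
     show "p2 ?s <= p2 s + 1" using S2(4) by (simp add: A)
     show "clock ?s <= clock s + 2000 * (L + 3)" using clk by simp
    qed
    moreover have "Inv0 ?s G X (E - {(x, y)})" unfolding Inv0_def
    proof (intro conjI)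
     show "Cst ?s" using s2(1) unfolding Cst_def by (simp add: A)
     show "graph G" by (rule D(2))
     show "MIs ?s G X" using s2(2) by (simp add: A)
     show "J ?s" using s2(3) unfolding J_def cov_def by (simp add: A)
     show "COLs ?s" using s2(4) by (simp add: A)
     show "LIST (arr ?s 4) (arr ?s 5) (arr ?s 7) (arr ?s 8) (E - {(x, y)})" using s2(5) by (simp add: A)
     show "arr ?s 3 = wt (arr ?s 4) (E - {(x, y)})" unfolding A3 using s2(7) s1(5) A[of 4] by simp
     show "E - {(x, y)} \<subseteq> G" using D(8) by auto
    qed
    moreover have "NZ ?s F" using s2(8) unfolding NZ_def by (simp add: A)
    moreover have "arr ?s 4 = arr s 4" using A[of 4] s2(7) s1(5) by simp
    ultimately show "?Q ?s" by blast
   qed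
  qed
 qed
qed

end

section \<open>Deleting, inserting and moving edges\<close>

definition Del :: com where
 "Del = blk [Assign 40 (Reg 20), Assign 41 (Reg 21), Uncolor, Assign 30 (Reg 20), Assign 31 (Reg 21), RemEp,
   Assign 30 (Reg 21), Assign 31 (Reg 20), RemEp]"

definition Add1 :: com where
 "Add1 = blk [Store 4 (PE (Reg 20) (Reg 21)) (Reg 22), Store 4 (PE (Reg 21) (Reg 20)) (Reg 22),
   Assign 30 (Reg 20), Assign 31 (Reg 21), Assign 32 (Reg 22)]"

definition AddEdge :: com where
 "AddEdge = blk [Add1, AddEp, Assign 30 (Reg 21), Assign 31 (Reg 20), AddEp, Assign 40 (Reg 20), Assign 41 (Reg 21), Color]"

text \<open>Array 19 flags the vertices on the stack. A vertex is never stacked twice, so the height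
  is at most \<open>n\<close> and the pointer remains a small word.\<close>

definition Push :: "nat \<Rightarrow> com" where
 "Push r = If (Arr 19 (Reg r)) Skip (blk [Store 19 (Reg r) (Const 1), Store 18 (Reg 9) (Reg r), Assign 9 (Add (Reg 9) (Const 1))])"

text \<open>The list must be copied before its edges are moved, because a move takes an entry out of
  this very list, swaps the last one into its place, and may append to the list again.\<close>

definition Copy :: com where
 "Copy = blk [Assign 12 (Arr 8 (PE (Reg 10) (Reg 11))), Assign 13 (Const 0),
   While (Less (Reg 13) (Reg 12)) (blk [
    Store 22 (Reg 13) (Arr 7 (PE (Reg 10) (PE (Reg 11) (Reg 13)))), Assign 13 (Add (Reg 13) (Const 1))])]"

definition Move1 :: com where
 "Move1 = blk [Assign 14 (Arr 22 (Reg 13)), Assign 20 (Reg 10), Assign 21 (Reg 14)]"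

definition Move2 :: com where
 "Move2 = If (Less (Arr 2 (Reg 10)) (Arr 2 (Reg 14))) (Assign 22 (Arr 2 (Reg 14))) (Assign 22 (Arr 2 (Reg 10)))"

definition Move :: com where
 "Move = blk [Move1, Del, Move2, AddEdge, Push 14, Assign 13 (Add (Reg 13) (Const 1))]"

definition Relevel :: com where
 "Relevel = blk [Copy, Assign 13 (Const 0), While (Less (Reg 13) (Reg 12)) Move]"

context bm
begin

lemma Inv0_regs: "Inv0 s G X E ==> arr s' = arr s ==> same 6 s s' ==> Inv0 s' G X E"
 unfolding Inv0_def Cst_def J_def cov_def by (simp add: same_def)

lemma NZ_regs: "NZ s F ==> arr s' = arr s ==> NZ s' F"
 unfolding NZ_def by simp

lemma Step_regs: "arr s' = arr s ==> same R s s' ==> clock s' <= clock s + d ==> Step R 0 d s s'"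
 unfolding Step_def eqA_def Mmono_def by simp

lemma Step_same: "Step R k d s s' ==> r < R ==> reg s' r = reg s r"
 unfolding Step_def by (simp add: same_def)

lemma Step_arr: "Step R k d s s' ==> a \<notin> FC ==> arr s' a = arr s a"
 unfolding Step_def by (auto intro: eqA_D)

lemma Uncolor_Inv0:
 assumes I: "Inv0 s G X E" and F: "NZ s F" "F \<subseteq> E" "(u, v) \<in> F" "(v, u) \<in> F" and r: "reg s 40 = u" "reg s 41 = v"
 shows "ht B Uncolor s (\<lambda>s'. Step 40 0 (600 * (L + 3)) s s' \<and> Inv0 s' G X E \<and> NZ s' (F - {(u, v), (v, u)})
  \<and> arr s' 4 = arr s 4)"
proof -
 note D = Inv0_D[OF I]
 have E: "(u, v) \<in> E" "(v, u) \<in> E" using F by auto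
 have lz: "arr s 6 (pr u v) ~= 0" using F(1,3) unfolding NZ_def by blast
 show ?thesis
 proof (rule ht_mono[OF Uncolor_spec[OF D(1,5) lz r LIST_ps[OF D(6) E(1)] LIST_ps[OF D(6) E(2)]]], elim conjE)
  fix s' assume s': "same 40 s s'" "eqA {6, 9, 10, 11, 12, 13, 21} s s'" "COLs s'"
   "arr s' 6 = (arr s 6)(pr u v := 0, pr v u := 0)" "p2 s' <= p2 s" "clock s' <= clock s + 600 * (L + 3)"
  have A: "arr s' a = arr s a" if "a \<notin> {6, 9, 10, 11, 12, 13, 21}" for a by (rule eqA_D[OF s'(2) that])
  have lf: "arr s' 6 (pr a b) = (if E2 u v a b then 0 else arr s 6 (pr a b))" for a b unfolding s'(4) by (rule E2_upd)
  have "J s'" unfolding J_def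
  proof (intro allI impI)
   fix a b assume h: "arr s' 6 (pr a b) ~= 0" "arr s' 6 (pr a b) = arr s' 14 (arr s' 4 (pr a b))"
   have e: "arr s' 6 (pr a b) = arr s 6 (pr a b)" using h(1) unfolding lf by (auto split: if_splits)
   then have "cov s a b" using h D(4) unfolding J_def by (simp add: A)
   then show "cov s' a b" unfolding cov_def by (simp add: A)
  qed
  moreover have "Cst s'" by (rule Cst_mono[OF D(1) s'(1) _ s'(2)]) auto
  ultimately have "Inv0 s' G X E" using s'(3) D unfolding Inv0_def by (simp add: A)
  moreover have "NZ s' (F - {(u, v), (v, u)})" unfolding NZ_def
  proof (intro allI)
   fix a b
   have "(a, b) \<in> F - {(u, v), (v, u)} \<longleftrightarrow> (a, b) \<in> F \<and> \<not> E2 u v a b" unfolding E2_def by auto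
   then show "(arr s' 6 (pr a b) ~= 0) = ((a, b) \<in> F - {(u, v), (v, u)})"
    using F(1) unfolding NZ_def lf by (cases "E2 u v a b") simp_all
  qed
  moreover have "Step 40 0 (600 * (L + 3)) s s'" unfolding Step_def
   using s' by (simp add: eqA_def Mmono_def A)
  ultimately show "Step 40 0 (600 * (L + 3)) s s' \<and> Inv0 s' G X E \<and> NZ s' (F - {(u, v), (v, u)}) \<and> arr s' 4 = arr s 4"
   by (simp add: A)
 qed
qed

lemma Color_Inv0:
 assumes I: "Inv0 s G X E" and F: "NZ s F" "F \<subseteq> E" "(u, v) \<notin> F" "(v, u) \<notin> F" and E: "(u, v) \<in> E" "(v, u) \<in> E"
  and cl: "arr s 4 (pr u v) = arr s 4 (pr v u)" and r: "reg s 40 = u" "reg s 41 = v"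
 shows "ht B Color s (\<lambda>s'. Step 40 1 (1000 * (L + 3)) s s' \<and> Inv0 s' G X E \<and> NZ s' (F \<union> {(u, v), (v, u)})
  \<and> arr s' 4 = arr s 4)"
proof -
 note D = Inv0_D[OF I]
 define i where "i = arr s 4 (pr u v)"
 have i: "arr s 4 (pr u v) = i" "arr s 4 (pr v u) = i" "i <= L" using cl LIST_1[OF D(6) E(1)] by (simp_all add: i_def)
 have lz: "arr s 6 (pr u v) = 0" "arr s 6 (pr v u) = 0" using F unfolding NZ_def by blast+
 have nzE: "(a, b) \<in> E" if "arr s 6 (pr a b) ~= 0" for a b using F(1,2) that unfolding NZ_def by blast
 have "arr s 9 (pr (slot (arr s 4) (arr s 5) u v) 1) < K i" using slot_load[OF D(6,5) E(1) lz(1) nzE] unfolding i .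
 moreover have "arr s 9 (pr (slot (arr s 4) (arr s 5) v u) 1) < K i" using slot_load[OF D(6,5) E(2) lz(2) nzE] unfolding i .
 ultimately have root: "arr s 9 (pr (slot (arr s 4) (arr s 5) u v) 1) + arr s 9 (pr (slot (arr s 4) (arr s 5) v u) 1) < 2 * K i"
  by linarith
 have uvG: "(u, v) \<in> G" using E D(8) by auto
 show ?thesis
 proof (rule ht_mono[OF Color_spec[OF D(1,5) r D(2) uvG D(3,4) lz(1) i LIST_ps[OF D(6) E(1)] LIST_ps[OF D(6) E(2)] root]],
   elim conjE exE)
  fix s' l assume s': "same 40 s s'" "eqA {1, 6, 9, 10, 11, 12, 13, 15, 16, 17, 21} s s'" "COLs s'"
   and l: "l ~= 0" "arr s' 6 = (arr s 6)(pr u v := l, pr v u := l)"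
   and s'': "MIs s' G X" "J s'" "Mmono s s'" "p2 s' <= p2 s + 1" "clock s' <= clock s + 1000 * (L + 3)"
  have A: "arr s' a = arr s a" if "a \<notin> {1, 6, 9, 10, 11, 12, 13, 15, 16, 17, 21}" for a by (rule eqA_D[OF s'(2) that])
  have lf: "arr s' 6 (pr a b) = (if E2 u v a b then l else arr s 6 (pr a b))" for a b unfolding l(2) by (rule E2_upd)
  have "Cst s'" by (rule Cst_mono[OF D(1) s'(1) _ s'(2)]) auto
  then have "Inv0 s' G X E" using s'(3) s''(1,2) D unfolding Inv0_def by (simp add: A)
  moreover have "NZ s' (F \<union> {(u, v), (v, u)})" unfolding NZ_def
  proof (intro allI)
   fix a b
   have "(a, b) \<in> F \<union> {(u, v), (v, u)} \<longleftrightarrow> (a, b) \<in> F \<or> E2 u v a b" unfolding E2_def by auto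
   then show "(arr s' 6 (pr a b) ~= 0) = ((a, b) \<in> F \<union> {(u, v), (v, u)})"
    using F(1) l(1) unfolding NZ_def lf by (cases "E2 u v a b") simp_all
  qed
  moreover have "Step 40 1 (1000 * (L + 3)) s s'" unfolding Step_def
   using s' s'' by (simp add: eqA_def)
  ultimately show "Step 40 1 (1000 * (L + 3)) s s' \<and> Inv0 s' G X E \<and> NZ s' (F \<union> {(u, v), (v, u)}) \<and> arr s' 4 = arr s 4"
   by (simp add: A)
 qed
qed

lemma AddEp_spec:
 assumes I: "Inv0 s G X E" and F: "NZ s F" and xy: "(x, y) \<notin> E" "(x, y) \<in> G" and lf: "arr s 6 (pr x y) = 0"
  and i: "arr s 4 (pr x y) = i" "i <= L" and r: "reg s 30 = x" "reg s 31 = y" "reg s 32 = i"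
 shows "ht B AddEp s (\<lambda>s'. Step 33 0 200 s s' \<and> Inv0 s' G X (insert (x, y) E) \<and> NZ s' F \<and> arr s' 4 = arr s 4)"
proof -
 note D = Inv0_D[OF I]
 define m where "m = arr s 8 (pr x i)"
 have xyn: "x < n" "y < n" "x ~= y" using D(2) xy by (auto simp: graph_def)
 have smm: "sm m" "sm0 m" using COL_sm_facts[OF I, of x i] unfolding m_def by simp_all
 have sms: "sm x" "sm y" "sm i" "sm0 i" using xyn i by simp_all
 have smim: "sm (pr i m)" using sm12[OF sm_pr[OF sms(4) smm(2)]] .
 have smw: "sm (arr s 3 x)" using wt_sm(1)[OF D(6)] D(7) by simp
 note P = pw(1)[OF D(1) i(2)] pw(2)[OF D(1)]
 have "ht B AddEp s (\<lambda>s'. same 33 s s' \<and> clock s' <= clock s + 200 \<and>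
  arr s' = (arr s)(7 := (arr s 7)(pr x (pr i m) := y), 5 := (arr s 5)(pr x y := m), 8 := (arr s 8)(pr x i := Suc m),
   3 := (arr s 3)(x := arr s 3 x + 2 ^ (L - i))))"
  unfolding AddEp_def
  by (simp add: r sms smim smm smw sm_pow P m_def[symmetric] same_def fun_upd_twist)
 then show ?thesis
 proof (rule ht_mono, elim conjE)
  fix s' assume s': "same 33 s s'" "clock s' <= clock s + 200"
   and a': "arr s' = (arr s)(7 := (arr s 7)(pr x (pr i m) := y), 5 := (arr s 5)(pr x y := m), 8 := (arr s 8)(pr x i := Suc m),
   3 := (arr s 3)(x := arr s 3 x + 2 ^ (L - i)))"
  have A: "arr s' a = arr s a" if "a \<notin> {3, 5, 7, 8}" for a unfolding a' using that by simp
  have As: "arr s' 7 = (arr s 7)(pr x (pr i m) := y)" "arr s' 5 = (arr s 5)(pr x y := m)" "arr s' 8 = (arr s 8)(pr x i := Suc m)"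
   "arr s' 3 = (arr s 3)(x := arr s 3 x + 2 ^ (L - i))" unfolding a' by simp_all
  have eq: "eqA {3, 5, 7, 8} s s'" unfolding eqA_def using A by blast
  have "Cst s'" by (rule Cst_mono[OF D(1) s'(1) _ eq]) auto
  moreover have "J s'" using D(4) unfolding J_def cov_def by (simp add: A)
  moreover have "COLs s'"
  proof -
   have "COL (arr s 4) (arr s' 5) (arr s 6) (arr s 9) (arr s 10) (arr s 11) (arr s 12) (arr s 21) (arr s 13)"
   proof (rule COL_cong[OF D(5)])
    fix a b assume "arr s 6 (pr a b) ~= 0"
    then have "pr a b ~= pr x y" using lf by metis
    then show "arr s 4 (pr a b) = arr s 4 (pr a b) \<and> arr s' 5 (pr a b) = arr s 5 (pr a b)" unfolding As by auto
   qed
   then show ?thesis by (simp add: A)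
  qed
  moreover have "LIST (arr s' 4) (arr s' 5) (arr s' 7) (arr s' 8) (insert (x, y) E)"
   using LIST_add[OF D(6) xy(1) i xyn m_def] unfolding As by (simp add: A)
  moreover have "arr s' 3 = wt (arr s' 4) (insert (x, y) E)"
   unfolding wt_add[OF LIST_fin[OF D(6)] xy(1)] As using i D(7) by (simp add: A)
  moreover have "insert (x, y) E \<subseteq> G" using xy D(8) by simp
  moreover have "MIs s' G X" using D(3) by (simp add: A)
  ultimately have "Inv0 s' G X (insert (x, y) E)" using D(2) unfolding Inv0_def by blast
  moreover have "NZ s' F" using F unfolding NZ_def by (simp add: A)
  moreover have "Step 33 0 200 s s'" unfolding Step_def using s' by (simp add: eqA_def Mmono_def A)
  ultimately show "Step 33 0 200 s s' \<and> Inv0 s' G X (insert (x, y) E) \<and> NZ s' F \<and> arr s' 4 = arr s 4"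
   by (simp add: A)
 qed
qed

definition Inv :: "state \<Rightarrow> (nat \<times> nat) set \<Rightarrow> nat set \<Rightarrow> (nat \<times> nat) set \<Rightarrow> bool" where
 "Inv s G X E \<longleftrightarrow> Inv0 s G X E \<and> NZ s E \<and> (\<forall>a b. (a, b) \<in> E --> (b, a) \<in> E)"

lemma Inv_D: "Inv s G X E ==> Inv0 s G X E" "Inv s G X E ==> NZ s E" "Inv s G X E ==> (a, b) \<in> E ==> (b, a) \<in> E"
 unfolding Inv_def by blast+

text \<open>The edge loses its colour first and its two entries afterwards. Each of the two removals
  may recolour one swapped neighbour, whence the bound 2.\<close>

lemma Del_spec:
 assumes I: "Inv s G X E" and uv: "(u, v) \<in> E" and r: "reg s 20 = u" "reg s 21 = v"
 shows "ht B Del s (\<lambda>s'. Step 30 2 (5000 * (L + 3)) s s' \<and> Inv s' G X (E - {(u, v), (v, u)}) \<and> arr s' 4 = arr s 4)"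
  (is "ht B Del s ?Q")
proof -
 note I0 = Inv_D[OF I]
 have vu: "(v, u) \<in> E" using I0(3) uv by blast
 have ne: "u ~= v" using LIST_1[OF Inv0_D(6)[OF I0(1)] uv] by simp
 define F where "F = E - {(u, v), (v, u)}"
 have Fsym: "(b, a) \<in> F" if "(a, b) \<in> F" for a b using that I0(3) unfolding F_def by auto
 define s1 where "s1 = tick 2 (set_reg 41 v (tick 2 (set_reg 40 u s)))"
 have s1: "arr s1 = arr s" "same 40 s s1" "clock s1 = clock s + 4" "reg s1 40 = u" "reg s1 41 = v"
  by (simp_all add: s1_def same_def)
 have I1: "Inv0 s1 G X E" by (rule Inv0_regs[OF I0(1) s1(1) same_mono[OF s1(2)]]) simp
 have N1: "NZ s1 E" by (rule NZ_regs[OF I0(2) s1(1)])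
 have run: "ht B Del s ?Q = ht B (Seq Uncolor (blk [Assign 30 (Reg 20), Assign 31 (Reg 21), RemEp,
   Assign 30 (Reg 21), Assign 31 (Reg 20), RemEp])) s1 ?Q"
  unfolding Del_def by (simp add: s1_def r numeral_2_eq_2)
 show ?thesis unfolding run
 proof (rule ht_Seq[OF Uncolor_Inv0[OF I1 N1 subset_refl uv vu s1(4,5)]], elim conjE)
  fix s2 assume S2: "Step 40 0 (600 * (L + 3)) s1 s2" and I2: "Inv0 s2 G X E" "NZ s2 (E - {(u, v), (v, u)})" "arr s2 4 = arr s1 4"
  define s3 where "s3 = tick 2 (set_reg 31 v (tick 2 (set_reg 30 u s2)))"
  have s3: "arr s3 = arr s2" "same 30 s2 s3" "clock s3 = clock s2 + 4" "reg s3 30 = u" "reg s3 31 = v"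
   by (simp_all add: s3_def same_def)
  have S3: "Step 30 0 (600 * (L + 3) + 8) s s3"
  proof -
   have "Step 40 0 4 s s1" by (rule Step_regs) (use s1 in auto)
   from Step_trans[OF this S2, of 40 0 "600 * (L + 3) + 4"] have "Step 40 0 (600 * (L + 3) + 4) s s2" by simp
   moreover have "Step 30 0 4 s2 s3" by (rule Step_regs) (use s3 in auto)
   ultimately show ?thesis by (rule Step_trans) simp_all
  qed
  have I3: "Inv0 s3 G X E" by (rule Inv0_regs[OF I2(1) s3(1) same_mono[OF s3(2)]]) simp
  have N3: "NZ s3 F" unfolding F_def by (rule NZ_regs[OF I2(2) s3(1)])
  have regs2: "reg s2 20 = u" "reg s2 21 = v" using Step_same[OF S2] same_reg[OF s1(2)] r by simp_all
  have run2: "ht B (blk [Assign 30 (Reg 20), Assign 31 (Reg 21), RemEp, Assign 30 (Reg 21), Assign 31 (Reg 20), RemEp]) s2 ?Q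
   = ht B (Seq RemEp (blk [Assign 30 (Reg 21), Assign 31 (Reg 20), RemEp])) s3 ?Q"
   by (simp add: s3_def regs2 numeral_2_eq_2)
  have FE: "F \<subseteq> E" "(u, v) \<notin> F" "(v, u) \<notin> F" unfolding F_def by auto
  have col1: "(u, z) \<in> F" if "(u, z) \<in> E" "z ~= v" for z using that ne unfolding F_def by auto
  show "ht B (blk [Assign 30 (Reg 20), Assign 31 (Reg 21), RemEp, Assign 30 (Reg 21), Assign 31 (Reg 20), RemEp]) s2 ?Q"
   unfolding run2
  proof (rule ht_Seq[OF RemEp_spec[OF I3 N3 FE(1) col1 Fsym uv FE(2) s3(4,5)]]; (elim conjE)?)
   fix s4 assume S4: "Step 30 1 (2000 * (L + 3)) s3 s4" and I4: "Inv0 s4 G X (E - {(u, v)})" "NZ s4 F" "arr s4 4 = arr s3 4"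
   define s5 where "s5 = tick 2 (set_reg 31 u (tick 2 (set_reg 30 v s4)))"
   have s5: "arr s5 = arr s4" "same 30 s4 s5" "clock s5 = clock s4 + 4" "reg s5 30 = v" "reg s5 31 = u"
    by (simp_all add: s5_def same_def)
   have S5: "Step 30 1 (2600 * (L + 3) + 12) s s5"
   proof -
    have "Step 30 1 (2600 * (L + 3) + 8) s s4" by (rule Step_trans[OF S3 S4]) simp_all
    moreover have "Step 30 0 4 s4 s5" by (rule Step_regs) (use s5 in auto)
    ultimately show ?thesis by (rule Step_trans) simp_all
   qed
   have I5: "Inv0 s5 G X (E - {(u, v)})" by (rule Inv0_regs[OF I4(1) s5(1) same_mono[OF s5(2)]]) simp
   have N5: "NZ s5 F" by (rule NZ_regs[OF I4(2) s5(1)])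
   have regs4: "reg s4 20 = u" "reg s4 21 = v" using Step_same[OF S4] same_reg[OF s3(2)] regs2 by simp_all
   have run3: "ht B (blk [Assign 30 (Reg 21), Assign 31 (Reg 20), RemEp]) s4 ?Q = ht B RemEp s5 ?Q"
    by (simp add: s5_def regs4 numeral_2_eq_2)
   have FE': "F \<subseteq> E - {(u, v)}" "(v, u) \<in> E - {(u, v)}" using FE vu ne by auto
   have col2: "(v, z) \<in> F" if "(v, z) \<in> E - {(u, v)}" "z ~= u" for z using that ne unfolding F_def by auto
   show "ht B (blk [Assign 30 (Reg 21), Assign 31 (Reg 20), RemEp]) s4 ?Q" unfolding run3
   proof (rule ht_mono[OF RemEp_spec[OF I5 N5 FE'(1) col2 Fsym FE'(2) FE(3) s5(4,5)]]; (elim conjE)?)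
    fix s6 assume S6: "Step 30 1 (2000 * (L + 3)) s5 s6" and I6: "Inv0 s6 G X (E - {(u, v)} - {(v, u)})" "NZ s6 F" "arr s6 4 = arr s5 4"
    have "E - {(u, v)} - {(v, u)} = F" unfolding F_def by auto
    then have "Inv s6 G X F" unfolding Inv_def using I6 Fsym by simp
    moreover have "Step 30 2 (5000 * (L + 3)) s s6" by (rule Step_trans[OF S5 S6]) simp_all
    moreover have "arr s6 4 = arr s 4" using I6(3) s5(1) I4(3) s3(1) I2(3) s1(1) by simp
    ultimately show "?Q s6" unfolding F_def by blast
   qed
  qed
 qed
qed

text \<open>The class is written while the pair is neither listed nor coloured, which no invariant
  notices. Colouring waits until the edge is listed at both ends, since \<open>slot_load\<close>
  needs its entry in either slot.\<close>

lemma AddEdge_spec: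
 assumes I: "Inv s G X E" and uv: "(u, v) \<notin> E" "(u, v) \<in> G" and j: "j <= L"
  and r: "reg s 20 = u" "reg s 21 = v" "reg s 22 = j"
 shows "ht B AddEdge s (\<lambda>s'. Step 30 1 (2000 * (L + 3)) s s' \<and> Inv s' G X (E \<union> {(u, v), (v, u)})
  \<and> arr s' 4 = (arr s 4)(pr u v := j, pr v u := j))"
  (is "ht B AddEdge s ?Q")
proof -
 note I0 = Inv_D[OF I]
 note D = Inv0_D[OF I0(1)]
 have vu: "(v, u) \<notin> E" "(v, u) \<in> G" using I0(3)[of v u] uv D(2) by (auto simp: graph_def)
 have uvn: "u < n" "v < n" "u ~= v" using D(2) uv by (auto simp: graph_def)
 have sms: "sm u" "sm v" "sm j" using uvn j by simp_all
 let ?cl = "(arr s 4)(pr u v := j, pr v u := j)"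
 have cl: "?cl (pr a b) = (if E2 u v a b then j else arr s 4 (pr a b))" for a b by (rule E2_upd)
 have clE: "?cl (pr a b) = arr s 4 (pr a b)" if "(a, b) \<in> E" for a b
 proof -
  have "\<not> E2 u v a b" using that uv vu unfolding E2_def by auto
  then show ?thesis unfolding cl by simp
 qed
 have nz: "(a, b) \<in> E" if "arr s 6 (pr a b) ~= 0" for a b using I0(2) that unfolding NZ_def by blast
 have "ht B Add1 s (\<lambda>s'. same 30 s s' \<and> reg s' 30 = u \<and> reg s' 31 = v \<and> reg s' 32 = j \<and> arr s' = (arr s)(4 := ?cl) \<and> clock s' <= clock s + 100)"
  unfolding Add1_def by (simp add: r sms same_def)
 then show ?thesis unfolding AddEdge_def blk.simps
 proof (rule ht_Seq, elim conjE)
  fix s1 assume s1: "same 30 s s1" "reg s1 30 = u" "reg s1 31 = v" "reg s1 32 = j" "clock s1 <= clock s + 100"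
   and a1: "arr s1 = (arr s)(4 := ?cl)"
  have A: "arr s1 a = arr s a" if "a ~= 4" for a unfolding a1 using that by simp
  have A4: "arr s1 4 = ?cl" unfolding a1 by simp
  have eq1: "eqA {4} s s1" unfolding eqA_def using A by blast
  have "Cst s1" by (rule Cst_mono[OF D(1) s1(1) _ eq1]) auto
  moreover have "J s1" unfolding J_def
  proof (intro allI impI)
   fix a b assume h: "arr s1 6 (pr a b) ~= 0" "arr s1 6 (pr a b) = arr s1 14 (arr s1 4 (pr a b))"
   have h': "arr s 6 (pr a b) ~= 0" using h(1) by (simp add: A)
   have c: "arr s1 4 (pr a b) = arr s 4 (pr a b)" unfolding A4 by (rule clE[OF nz[OF h']])
   have "arr s 6 (pr a b) = arr s 14 (arr s 4 (pr a b))" using h(2) unfolding c by (simp add: A)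
   then have "cov s a b" using D(4) h' unfolding J_def by blast
   then show "cov s1 a b" unfolding cov_def by (simp add: A)
  qed
  moreover have "COLs s1"
  proof -
   have "COL ?cl (arr s 5) (arr s 6) (arr s 9) (arr s 10) (arr s 11) (arr s 12) (arr s 21) (arr s 13)"
    by (rule COL_cong[OF D(5)]) (use clE nz in blast)
   then show ?thesis unfolding A4 by (simp add: A)
  qed
  moreover have "LIST (arr s1 4) (arr s1 5) (arr s1 7) (arr s1 8) E"
   using LIST_cong[OF D(6), of ?cl] clE unfolding A4 by (simp add: A)
  moreover have "arr s1 3 = wt (arr s1 4) E"
  proof -
   have "arr s1 3 = arr s 3" by (simp add: A)
   also have "\<dots> = wt (arr s 4) E" by (rule D(7))
   also have "\<dots> = wt ?cl E" by (rule wt_cong[symmetric]) (rule clE)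
   finally show ?thesis unfolding A4 .
  qed
  moreover have "MIs s1 G X" using D(3) by (simp add: A)
  ultimately have I1: "Inv0 s1 G X E" using D(2,8) unfolding Inv0_def by blast
  have N1: "NZ s1 E" using I0(2) unfolding NZ_def by (simp add: A)
  have S1: "Step 30 0 100 s s1" unfolding Step_def using s1 by (simp add: eqA_def Mmono_def A)
  have l1: "arr s1 6 (pr u v) = 0" "arr s1 6 (pr v u) = 0" using nz uv vu by (auto simp: A)
  have c1: "arr s1 4 (pr u v) = j" "arr s1 4 (pr v u) = j" unfolding A4 cl by simp_all
  show "ht B (Seq AddEp (Seq (Assign 30 (Reg 21)) (Seq (Assign 31 (Reg 20)) (Seq AddEp (Seq (Assign 40 (Reg 20)) (Seq (Assign 41 (Reg 21)) Color)))))) s1 ?Q"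
  proof (rule ht_Seq[OF AddEp_spec[OF I1 N1 uv l1(1) c1(1) j s1(2-4)]], elim conjE)
   fix s2 assume S2: "Step 33 0 200 s1 s2" and I2: "Inv0 s2 G X (insert (u, v) E)" "NZ s2 E" "arr s2 4 = arr s1 4"
   define s3 where "s3 = tick 2 (set_reg 31 u (tick 2 (set_reg 30 v s2)))"
   have s3: "arr s3 = arr s2" "same 30 s2 s3" "clock s3 = clock s2 + 4" "reg s3 30 = v" "reg s3 31 = u" "reg s3 32 = j"
    using Step_same[OF S2] s1 by (simp_all add: s3_def same_def)
   have regs2: "reg s2 20 = u" "reg s2 21 = v" using Step_same[OF S2] same_reg[OF s1(1)] r by simp_all
   have S3: "Step 30 0 304 s s3"
   proof -
    have "Step 30 0 300 s s2" by (rule Step_trans[OF S1 S2]) simp_all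
    moreover have "Step 30 0 4 s2 s3" by (rule Step_regs) (use s3 in auto)
    ultimately show ?thesis by (rule Step_trans) simp_all
   qed
   have I3: "Inv0 s3 G X (insert (u, v) E)" by (rule Inv0_regs[OF I2(1) s3(1) same_mono[OF s3(2)]]) simp
   have N3: "NZ s3 E" by (rule NZ_regs[OF I2(2) s3(1)])
   have nin: "(v, u) \<notin> insert (u, v) E" using vu uvn by auto
   have l3: "arr s3 6 (pr u v) = 0" "arr s3 6 (pr v u) = 0" using N3 uv vu unfolding NZ_def by blast+
   have c3: "arr s3 4 = ?cl" using s3(1) I2(3) A4 by simp
   have c3': "arr s3 4 (pr v u) = j" unfolding c3 cl by simp
   have run3: "ht B (Seq (Assign 30 (Reg 21)) (Seq (Assign 31 (Reg 20)) (Seq AddEp (Seq (Assign 40 (Reg 20)) (Seq (Assign 41 (Reg 21)) Color))))) s2 ?Q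
    = ht B (Seq AddEp (Seq (Assign 40 (Reg 20)) (Seq (Assign 41 (Reg 21)) Color))) s3 ?Q"
    by (simp add: s3_def regs2 numeral_2_eq_2)
   show "ht B (Seq (Assign 30 (Reg 21)) (Seq (Assign 31 (Reg 20)) (Seq AddEp (Seq (Assign 40 (Reg 20)) (Seq (Assign 41 (Reg 21)) Color))))) s2 ?Q"
    unfolding run3
   proof (rule ht_Seq[OF AddEp_spec[OF I3 N3 nin vu(2) l3(2) c3' j s3(4-6)]], elim conjE)
    fix s4 assume S4: "Step 33 0 200 s3 s4" and I4: "Inv0 s4 G X (insert (v, u) (insert (u, v) E))" "NZ s4 E" "arr s4 4 = arr s3 4"
    define s5 where "s5 = tick 2 (set_reg 41 v (tick 2 (set_reg 40 u s4)))"
    have s5: "arr s5 = arr s4" "same 40 s4 s5" "clock s5 = clock s4 + 4" "reg s5 40 = u" "reg s5 41 = v"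
     by (simp_all add: s5_def same_def)
    have S5: "Step 30 0 508 s s5"
    proof -
     have "Step 30 0 504 s s4" by (rule Step_trans[OF S3 S4]) simp_all
     moreover have "Step 40 0 4 s4 s5" by (rule Step_regs) (use s5 in auto)
     ultimately show ?thesis by (rule Step_trans) simp_all
    qed
    have E': "insert (v, u) (insert (u, v) E) = E \<union> {(u, v), (v, u)}" by auto
    have I5: "Inv0 s5 G X (E \<union> {(u, v), (v, u)})"
     by (rule Inv0_regs[OF I4(1)[unfolded E'] s5(1) same_mono[OF s5(2)]]) simp
    have N5: "NZ s5 E" by (rule NZ_regs[OF I4(2) s5(1)])
    have regs4: "reg s4 20 = u" "reg s4 21 = v" using Step_same[OF S4] same_reg[OF s3(2)] regs2 by simp_all
    have run5: "ht B (Seq (Assign 40 (Reg 20)) (Seq (Assign 41 (Reg 21)) Color)) s4 ?Q = ht B Color s5 ?Q"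
     by (simp add: s5_def regs4 numeral_2_eq_2)
    have c5: "arr s5 4 = ?cl" using s5(1) I4(3) c3 by simp
    have c5': "arr s5 4 (pr u v) = arr s5 4 (pr v u)" unfolding c5 cl by simp
    have EE: "E \<subseteq> E \<union> {(u, v), (v, u)}" "(u, v) \<in> E \<union> {(u, v), (v, u)}" "(v, u) \<in> E \<union> {(u, v), (v, u)}" by auto
    show "ht B (Seq (Assign 40 (Reg 20)) (Seq (Assign 41 (Reg 21)) Color)) s4 ?Q" unfolding run5
    proof (rule ht_mono[OF Color_Inv0[OF I5 N5 EE(1) uv(1) vu(1) EE(2,3) c5' s5(4,5)]], elim conjE)
     fix s6 assume S6: "Step 40 1 (1000 * (L + 3)) s5 s6" and I6: "Inv0 s6 G X (E \<union> {(u, v), (v, u)})"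
      "NZ s6 (E \<union> {(u, v), (v, u)})" "arr s6 4 = arr s5 4"
     have "(b, a) \<in> E \<union> {(u, v), (v, u)}" if "(a, b) \<in> E \<union> {(u, v), (v, u)}" for a b
      using that I0(3)[of a b] by auto
     then have "Inv s6 G X (E \<union> {(u, v), (v, u)})" unfolding Inv_def using I6 by blast
     moreover have "Step 30 1 (2000 * (L + 3)) s s6" by (rule Step_trans[OF S5 S6]) simp_all
     moreover have "arr s6 4 = ?cl" using I6(3) c5 by simp
     ultimately show "?Q s6" by blast
    qed
   qed
  qed
 qed
qed

definition STK :: "state \<Rightarrow> bool" where
 "STK s \<longleftrightarrow> inj_on (arr s 18) {..<reg s 9} \<and> arr s 18 ` {..<reg s 9} = {x. arr s 19 x ~= 0} \<and> {x. arr s 19 x ~= 0} \<subseteq> {..<n}"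

lemma STK_le: "STK s ==> reg s 9 <= n"
proof -
 assume s: "STK s"
 then have "card (arr s 18 ` {..<reg s 9}) = reg s 9" unfolding STK_def using card_image by fastforce
 moreover have "card (arr s 18 ` {..<reg s 9}) <= card {..<n}" using s unfolding STK_def by (intro card_mono) auto
 ultimately show ?thesis by simp
qed

lemma Push_spec:
 assumes S: "STK s" and r: "reg s r = x" "x < n" "r ~= 9"
 shows "ht B (Push r) s (\<lambda>s'. STK s' \<and> {y. arr s' 19 y ~= 0} = insert x {y. arr s 19 y ~= 0} \<and> reg s' 9 <= reg s 9 + 1 \<and>
  (\<forall>q. q ~= 9 --> reg s' q = reg s q) \<and> eqA {18, 19} s s' \<and> clock s' <= clock s + 50)"
  (is "ht B _ s ?Q")
proof (cases "arr s 19 x = 0")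
 case False
 have "ht B (Push r) s (\<lambda>s'. s' = tick 4 s)" unfolding Push_def using False r by (simp add: tick_def)
 then show ?thesis
 proof (rule ht_mono)
  fix s' assume s': "s' = tick 4 s"
  show "?Q s'" unfolding s' using S False by (auto simp: STK_def eqA_def)
 qed
next
 case True
 have sm: "sm (reg s 9)" using STK_le[OF S] by simp
 define s1 where "s1 = tick 4 (set_reg 9 (Suc (reg s 9)) (tick 3 (set_arr 18 (reg s 9) x (tick 3 (set_arr 19 x 1 (tick 3 s))))))"
 have run: "ht B (Push r) s ?Q = ?Q s1" unfolding Push_def s1_def using True r sm by (simp add: eval_nat_numeral)
 have a: "arr s1 18 = (arr s 18)(reg s 9 := x)" "arr s1 19 = (arr s 19)(x := 1)" "reg s1 9 = Suc (reg s 9)"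
  by (simp_all add: s1_def)
 have f: "{y. arr s1 19 y ~= 0} = insert x {y. arr s 19 y ~= 0}" unfolding a by auto
 have im: "arr s1 18 ` {..<reg s1 9} = insert x (arr s 18 ` {..<reg s 9})"
  unfolding a lessThan_Suc by (auto simp: image_iff)
 have inj: "inj_on (arr s1 18) {..<reg s1 9}"
 proof -
  have "x \<notin> arr s 18 ` {..<reg s 9}" using S True unfolding STK_def by auto
  moreover have "inj_on (arr s 18) {..<reg s 9}" using S unfolding STK_def by blast
  moreover have "((arr s 18)(reg s 9 := x)) ` ({..<reg s 9} - {reg s 9}) = arr s 18 ` {..<reg s 9}"
   by (intro image_cong) auto
  ultimately show ?thesis unfolding a lessThan_Suc inj_on_insert by (simp add: inj_on_fun_updI)
 qed
 have "STK s1" using S r inj im f unfolding STK_def by simp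
 moreover have "eqA {18, 19} s s1" unfolding eqA_def by (simp add: s1_def)
 ultimately have "?Q s1" using f by (simp add: s1_def)
 then show ?thesis unfolding run .
qed

lemma Copy_spec:
 assumes I: "Inv0 s G X E" and r: "reg s 10 = v" "reg s 11 = l" "v < n" "l <= L"
 shows "ht B Copy s (\<lambda>s'. same 12 s s' \<and> eqA {22} s s' \<and> reg s' 12 = arr s 8 (pr v l) \<and>
  (\<forall>q < arr s 8 (pr v l). arr s' 22 q = arr s 7 (pr v (pr l q))) \<and> clock s' <= clock s + 100 * (arr s 8 (pr v l) + 1))"
  (is "ht B Copy s ?Q")
proof -
 define m where "m = arr s 8 (pr v l)"
 have m: "m <= n" unfolding m_def by (rule LIST_ln[OF Inv0_D(6)[OF I]])
 define W where "W s1 \<longleftrightarrow> (\<exists>p \<le> m. reg s1 13 = p \<and> same 12 s s1 \<and> eqA {22} s s1 \<and> reg s1 12 = m \<and>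
  (\<forall>q < p. arr s1 22 q = arr s 7 (pr v (pr l q))) \<and> clock s1 <= clock s + 50 + 80 * p)" for s1
 have sms: "sm v" "sm l" using r by simp_all
 have "ht B Copy s (\<lambda>s'. \<exists>s1. W s1 \<and> reg s1 13 = m \<and> s' = tick 4 s1)"
  unfolding Copy_def blk.simps ht_Seq_Assign
 proof (rule ht_While[where I = W and m = "\<lambda>s1. m - reg s1 13"])
  show "W (tick (1 + cost (Const 0)) (set_reg 13 (eval B (tick (1 + cost (Arr 8 (PE (Reg 10) (Reg 11)))) (set_reg 12 (eval B s (Arr 8 (PE (Reg 10) (Reg 11)))) s)) (Const 0))
    (tick (1 + cost (Arr 8 (PE (Reg 10) (Reg 11)))) (set_reg 12 (eval B s (Arr 8 (PE (Reg 10) (Reg 11)))) s))))"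
   unfolding W_def by (rule exI[of _ 0]) (simp add: r sms m_def same_def eqA_def)
 next
  fix s1 assume "W s1" and e: "eval B s1 (Less (Reg 13) (Reg 12)) ~= 0"
  then obtain p where p: "p <= m" "reg s1 13 = p" "same 12 s s1" "eqA {22} s s1" "reg s1 12 = m"
   "\<forall>q < p. arr s1 22 q = arr s 7 (pr v (pr l q))" "clock s1 <= clock s + 50 + 80 * p" unfolding W_def by blast
  have pm: "p < m" using e p by (simp split: if_splits)
  have regs: "reg s1 10 = v" "reg s1 11 = l" using same_reg[OF p(3)] r by simp_all
  have smp: "sm p" "sm0 p" "sm0 l" using pm m r by simp_all
  have smlp: "sm (pr l p)" using sm12[OF sm_pr[OF smp(3,2)]] .
  have a7: "arr s1 7 = arr s 7" using eqA_D[OF p(4)] by simp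
  define s2 where "s2 = tick (1 + cost (Add (Reg 13) (Const 1))) (set_reg 13 (Suc p)
   (tick (1 + cost (Reg 13) + cost (Arr 7 (PE (Reg 10) (PE (Reg 11) (Reg 13))))) (set_arr 22 p (arr s 7 (pr v (pr l p)))
   (tick (1 + cost (Less (Reg 13) (Reg 12))) s1))))"
  have run: "ht B (Seq (Store 22 (Reg 13) (Arr 7 (PE (Reg 10) (PE (Reg 11) (Reg 13))))) (Assign 13 (Add (Reg 13) (Const 1))))
     (tick (1 + cost (Less (Reg 13) (Reg 12))) s1) Q = Q s2" for Q
   by (simp add: p regs sms smp smlp a7 s2_def)
  have "W s2" unfolding W_def
  proof (intro exI[of _ "Suc p"] conjI)
   show "same 12 s s2" using p(3) by (simp add: s2_def same_def)
   show "eqA {22} s s2" using p(4) by (simp add: s2_def eqA_def)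
   show "\<forall>q < Suc p. arr s2 22 q = arr s 7 (pr v (pr l q))" using p(6) by (simp add: s2_def less_Suc_eq)
   show "clock s2 <= clock s + 50 + 80 * Suc p" using p(7) by (simp add: s2_def)
  qed (use pm p in \<open>simp_all add: s2_def\<close>)
  moreover have "reg s2 13 = Suc p" by (simp add: s2_def)
  ultimately show "ht B (Seq (Store 22 (Reg 13) (Arr 7 (PE (Reg 10) (PE (Reg 11) (Reg 13))))) (Assign 13 (Add (Reg 13) (Const 1))))
     (tick (1 + cost (Less (Reg 13) (Reg 12))) s1) (\<lambda>s'. W s' \<and> m - reg s' 13 < m - reg s1 13)"
   unfolding run using pm p(2) by simp
 next
  fix s1 assume w: "W s1" and e: "eval B s1 (Less (Reg 13) (Reg 12)) = 0"
  then have "reg s1 13 = m" unfolding W_def by (auto split: if_splits)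
  moreover have "tick (1 + cost (Less (Reg 13) (Reg 12))) s1 = tick 4 s1" by (simp add: eval_nat_numeral)
  ultimately show "\<exists>s1'. W s1' \<and> reg s1' 13 = m \<and> tick (1 + cost (Less (Reg 13) (Reg 12))) s1 = tick 4 s1'" using w by blast
 qed
 then show ?thesis
 proof (rule ht_mono, elim exE conjE)
  fix s' s1 assume w: "W s1" "reg s1 13 = m" "s' = tick 4 s1"
  from w(1) obtain p' where p': "reg s1 13 = p'" "same 12 s s1" "eqA {22} s s1" "reg s1 12 = m"
   "\<forall>q < p'. arr s1 22 q = arr s 7 (pr v (pr l q))" "clock s1 <= clock s + 50 + 80 * p'" unfolding W_def by blast
  have pm: "p' = m" using p'(1) w(2) by simp
  note p = p'(2-)[unfolded pm]
  show "?Q s'" unfolding w(3) m_def[symmetric]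
  proof (intro conjI)
   show "same 12 s (tick 4 s1)" using p(1) by (simp add: same_def)
   show "eqA {22} s (tick 4 s1)" using p(2) by (simp add: eqA_def)
  qed (use p in simp_all)
 qed
qed

text \<open>The classes after the edges from \<open>v\<close> to \<open>P\<close> have been moved.
  Here \<open>lev\<close> already contains the new level of \<open>v\<close>, while
  \<open>cl\<close> still holds the classes from before.\<close>

definition relev :: "(nat \<Rightarrow> nat) \<Rightarrow> (nat \<Rightarrow> nat) \<Rightarrow> nat \<Rightarrow> nat set \<Rightarrow> nat \<Rightarrow> nat \<Rightarrow> nat" where
 "relev lev cl v P a b = (if a = v \<and> b \<in> P \<or> b = v \<and> a \<in> P then max (lev a) (lev b) else cl (pr a b))"

definition flags :: "state \<Rightarrow> nat set" where
 "flags s = {x. arr s 19 x ~= 0}"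

lemma Inv_eqA: "Inv s G X E ==> eqA {2, 18, 19, 22} s s' ==> same 6 s s' ==> Inv s' G X E"
proof -
 assume I: "Inv s G X E" and e: "eqA {2, 18, 19, 22} s s'" and m: "same 6 s s'"
 have A: "arr s' a = arr s a" if "a \<notin> {2, 18, 19, 22}" for a by (rule eqA_D[OF e that])
 note D = Inv0_D[OF Inv_D(1)[OF I]]
 have "Cst s'" by (rule Cst_mono[OF D(1) m _ e]) auto
 moreover have "J s'" using D(4) unfolding J_def cov_def by (simp add: A)
 ultimately have "Inv0 s' G X E" using D unfolding Inv0_def by (simp add: A)
 moreover have "NZ s' E" using Inv_D(2)[OF I] unfolding NZ_def by (simp add: A)
 ultimately show ?thesis using Inv_D(3)[OF I] unfolding Inv_def by blast
qed

text \<open>A move is a deletion and a reinsertion, which colour at most two edges and one edge. The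
  matching does not notice it, because the edge stays in \<open>G\<close> throughout.\<close>

lemma Move_spec:
 assumes I: "Inv s G X G" and S: "STK s" and r: "reg s 10 = v" "reg s 13 = p" and y: "arr s 22 p = y" "(v, y) \<in> G" "p < n"
  and lev: "\<And>x. x < n ==> arr s 2 x <= L"
 shows "ht B Move s (\<lambda>s'. Inv s' G X G \<and> STK s' \<and> flags s' = insert y (flags s) \<and> reg s' 9 <= reg s 9 + 1 \<and>
   reg s' 13 = Suc p \<and> (\<forall>q < 13. q ~= 9 --> reg s' q = reg s q) \<and> eqA (FC \<union> {18, 19}) s s' \<and> Mmono s s' \<and>
   p2 s' <= p2 s + 3 \<and> clock s' <= clock s + 7500 * (L + 3) \<and>
   (\<forall>a b. arr s' 4 (pr a b) = relev (arr s 2) (arr s 4) v {y} a b))"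
  (is "ht B Move s ?Q")
proof -
 have G: "graph G" using Inv0_D(2)[OF Inv_D(1)[OF I]] .
 have vy: "v < n" "y < n" "v ~= y" "(y, v) \<in> G" using G y unfolding graph_def by blast+
 define j where "j = max (arr s 2 v) (arr s 2 y)"
 have jL: "j <= L" using lev vy by (simp add: j_def)
 define s1 where "s1 = tick (1 + cost (Reg 14)) (set_reg 21 y (tick (1 + cost (Reg 10)) (set_reg 20 v
  (tick (1 + cost (Arr 22 (Reg 13))) (set_reg 14 y s)))))"
 have s1: "arr s1 = arr s" "same 14 s s1" "clock s1 = clock s + 7" "reg s1 20 = v" "reg s1 21 = y" "reg s1 14 = y"
  by (simp_all add: s1_def same_def)
 have I1: "Inv s1 G X G" by (rule Inv_eqA[OF I]) (use s1 in \<open>simp_all add: eqA_def same_def\<close>)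
 have run: "ht B Move s Q = ht B (Seq Del (Seq Move2 (Seq AddEdge (Seq (Push 14) (Assign 13 (Add (Reg 13) (Const 1))))))) s1 Q" for Q
  unfolding Move_def Move1_def s1_def by (simp add: r y)
 show ?thesis unfolding run
 proof (rule ht_Seq[OF Del_spec[OF I1 y(2) s1(4,5)]], elim conjE)
  fix s2 assume S2: "Step 30 2 (5000 * (L + 3)) s1 s2" and I2: "Inv s2 G X (G - {(v, y), (y, v)})" "arr s2 4 = arr s1 4"
  have A2: "arr s2 2 = arr s 2" using Step_arr[OF S2, of 2] s1 by simp
  have regs2: "reg s2 10 = v" "reg s2 14 = y" "reg s2 20 = v" "reg s2 21 = y"
   using Step_same[OF S2] same_reg[OF s1(2)] s1 r by simp_all
  define s3 where "s3 = tick (1 + cost (Arr 2 (Reg 10))) (set_reg 22 j (tick (1 + cost (Less (Arr 2 (Reg 10)) (Arr 2 (Reg 14)))) s2))"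
  have s3: "arr s3 = arr s2" "same 20 s2 s3" "clock s3 = clock s2 + 9" "reg s3 20 = v" "reg s3 21 = y" "reg s3 22 = j"
   by (simp_all add: s3_def same_def regs2)
  have I3: "Inv s3 G X (G - {(v, y), (y, v)})" by (rule Inv_eqA[OF I2(1)]) (use s3 in \<open>simp_all add: eqA_def same_def\<close>)
  have run2: "ht B (Seq Move2 q) s2 Q = ht B q s3 Q" for q Q
   unfolding Move2_def s3_def by (simp add: regs2 A2 j_def max_def)
  show "ht B (Seq Move2 (Seq AddEdge (Seq (Push 14) (Assign 13 (Add (Reg 13) (Const 1)))))) s2 ?Q" unfolding run2
  proof (rule ht_Seq[OF AddEdge_spec[OF I3 _ y(2) jL s3(4-6)]]; (elim conjE)?)
   show "(v, y) \<notin> G - {(v, y), (y, v)}" by simp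
   fix s4 assume S4: "Step 30 1 (2000 * (L + 3)) s3 s4" and I4: "Inv s4 G X (G - {(v, y), (y, v)} \<union> {(v, y), (y, v)})"
    "arr s4 4 = (arr s3 4)(pr v y := j, pr y v := j)"
   have GG: "G - {(v, y), (y, v)} \<union> {(v, y), (y, v)} = G" using y vy by auto
   have S14: "Step 14 3 (7000 * (L + 3) + 16) s s4"
   proof -
    have "Step 14 0 7 s s1" by (rule Step_regs) (use s1 in auto)
    from Step_trans[OF this S2] have a: "Step 14 2 (5000 * (L + 3) + 7) s s2" by simp
    have "Step 20 0 9 s2 s3" by (rule Step_regs) (use s3 in auto)
    from Step_trans[OF a this] have a: "Step 14 2 (5000 * (L + 3) + 16) s s3" by simp
    show ?thesis by (rule Step_trans[OF a S4]) simp_all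
   qed
   have A4: "arr s4 a = arr s a" if "a \<notin> FC" for a by (rule Step_arr[OF S14 that])
   have R4: "reg s4 q = reg s q" if "q < 14" for q by (rule Step_same[OF S14 that])
   have r14: "reg s4 14 = y" using Step_same[OF S4] same_reg[OF s3(2)] regs2 by simp
   have STK4: "STK s4" using S unfolding STK_def by (simp add: A4 R4)
   show "ht B (Seq (Push 14) (Assign 13 (Add (Reg 13) (Const 1)))) s4 ?Q"
   proof (rule ht_Seq[OF Push_spec[OF STK4 r14 vy(2)]]; (elim conjE)?)
    fix s5 assume s5: "STK s5" "{z. arr s5 19 z ~= 0} = insert y {z. arr s4 19 z ~= 0}" "reg s5 9 <= reg s4 9 + 1"
     "\<forall>q. q ~= 9 --> reg s5 q = reg s4 q" "eqA {18, 19} s4 s5" "clock s5 <= clock s4 + 50"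
    have r5: "reg s5 13 = p" using s5(4) R4 r by simp
    have A5: "arr s5 a = arr s4 a" if "a \<notin> {18, 19}" for a by (rule eqA_D[OF s5(5) that])
    define s6 where "s6 = tick (1 + cost (Add (Reg 13) (Const 1))) (set_reg 13 (Suc p) s5)"
    have smp: "sm p" using y(3) by simp
    have run6: "ht B (Assign 13 (Add (Reg 13) (Const 1))) s5 Q = Q s6" for Q
     by (simp add: s6_def r5 smp)
    have s6: "arr s6 = arr s5" "reg s6 13 = Suc p" "clock s6 = clock s5 + 4" by (simp_all add: s6_def)
    have R6: "reg s6 q = reg s5 q" if "q ~= 13" for q using that by (simp add: s6_def)
    have "?Q s6"
    proof (intro conjI)
     have "Inv s5 G X G"
      by (rule Inv_eqA[OF I4(1)[unfolded GG]]) (use s5 in \<open>simp_all add: eqA_def same_def\<close>)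
     then show "Inv s6 G X G" by (rule Inv_eqA) (use s6 R6 in \<open>simp_all add: eqA_def same_def\<close>)
     show "STK s6" using s5(1) R6 unfolding STK_def s6(1) by simp
     show "flags s6 = insert y (flags s)" unfolding flags_def s6(1) s5(2) by (simp add: A4)
     show "reg s6 9 <= reg s 9 + 1" using R6[of 9] s5(3) R4[of 9] by simp
     show "\<forall>q < 13. q ~= 9 --> reg s6 q = reg s q" using R6 s5(4) R4 by simp
     show "eqA (FC \<union> {18, 19}) s s6" unfolding eqA_def s6(1) using A5 A4 by simp
     have "Mmono s s4" using S14 unfolding Step_def by blast
     then show "Mmono s s6" unfolding Mmono_def s6(1) by (simp add: A5)
     have "p2 s4 <= p2 s + 3" using S14 unfolding Step_def by blast
     then show "p2 s6 <= p2 s + 3" unfolding s6(1) by (simp add: A5)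
     have "clock s4 <= clock s + (7000 * (L + 3) + 16)" using S14 unfolding Step_def by blast
     then show "clock s6 <= clock s + 7500 * (L + 3)" using s5(6) s6(3) by simp
     show "\<forall>a b. arr s6 4 (pr a b) = relev (arr s 2) (arr s 4) v {y} a b"
     proof (intro allI)
      fix a b
      have "arr s6 4 (pr a b) = ((arr s 4)(pr v y := j, pr y v := j)) (pr a b)"
       unfolding s6(1) A5[of 4, simplified] I4(2) s3(1) I2(2) s1(1) ..
      also have "\<dots> = (if E2 v y a b then j else arr s 4 (pr a b))" by (rule E2_upd)
      also have "\<dots> = relev (arr s 2) (arr s 4) v {y} a b"
      proof (cases "E2 v y a b")
       case True
       then have "j = max (arr s 2 a) (arr s 2 b)" unfolding E2_def j_def by (auto simp: max.commute)
       moreover have "a = v \<and> b \<in> {y} \<or> b = v \<and> a \<in> {y}" using True unfolding E2_def by blast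
       ultimately show ?thesis using True unfolding relev_def by simp
      next
       case False
       then have h: "\<not> (a = v \<and> b \<in> {y} \<or> b = v \<and> a \<in> {y})" unfolding E2_def by auto
       show ?thesis unfolding relev_def if_not_P[OF False] if_not_P[OF h] ..
      qed
      finally show "arr s6 4 (pr a b) = relev (arr s 2) (arr s 4) v {y} a b" .
     qed
    qed (rule s6(2))
    then show "ht B (Assign 13 (Add (Reg 13) (Const 1))) s5 ?Q" unfolding run6 .
   qed simp
  qed
 qed
qed

text \<open>\<open>l\<close> is the level of \<open>v\<close> before the change. Only edges of class
  \<open>l\<close> have to be moved: an edge to a higher neighbour takes its class from that
  neighbour both before and after.\<close>

lemma Relevel_spec:
 assumes I: "Inv s G X G" and S: "STK s" and r: "reg s 10 = v" "reg s 11 = l" "v < n" "l <= L"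
  and lev: "\<And>x. x < n ==> arr s 2 x <= L" and U: "U = {y. (v, y) \<in> G \<and> arr s 4 (pr v y) = l}"
 shows "ht B Relevel s (\<lambda>s'. Inv s' G X G \<and> STK s' \<and> flags s' = flags s \<union> U \<and> reg s' 9 <= reg s 9 + card U \<and>
   (\<forall>q < 11. q ~= 9 --> reg s' q = reg s q) \<and> eqA (FC \<union> {18, 19, 22}) s s' \<and> Mmono s s' \<and>
   p2 s' <= p2 s + 3 * card U \<and> clock s' <= clock s + 8000 * (L + 3) * card U + 200 \<and>
   (\<forall>a b. arr s' 4 (pr a b) = relev (arr s 2) (arr s 4) v U a b))"
  (is "ht B Relevel s ?Q")
proof -
 note I0 = Inv_D(1)[OF I]
 note li = Inv0_D(6)[OF I0]
 have G: "graph G" using Inv0_D(2)[OF I0] .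
 define m where "m = arr s 8 (pr v l)"
 have mU: "m = card U" unfolding m_def U by (rule LIST_card[OF li])
 have mn: "m <= n" unfolding m_def by (rule LIST_ln[OF li])
 define t where "t q = arr s 7 (pr v (pr l q))" for q
 have bij: "bij_betw t {..<m} U" using LIST_bij[OF li, of v l] unfolding m_def U t_def .
 show ?thesis unfolding Relevel_def blk.simps
 proof (rule ht_Seq[OF Copy_spec[OF I0 r]], elim conjE)
  fix s1 assume s1: "same 12 s s1" "eqA {22} s s1" "reg s1 12 = arr s 8 (pr v l)"
   "\<forall>q < arr s 8 (pr v l). arr s1 22 q = arr s 7 (pr v (pr l q))" "clock s1 <= clock s + 100 * (arr s 8 (pr v l) + 1)"
  have t1: "arr s1 22 q = t q" if "q < m" for q using s1(4) that unfolding m_def t_def by simp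
  have A1: "arr s1 a = arr s a" if "a ~= 22" for a using eqA_D[OF s1(2)] that by simp
  have I1: "Inv s1 G X G" by (rule Inv_eqA[OF I]) (use s1 in \<open>simp_all add: eqA_def same_def\<close>)
  have c1: "clock s1 <= clock s + 100 * m + 100" using s1(5) unfolding m_def by simp
  define W where "W s2 \<longleftrightarrow> (\<exists>p \<le> m. reg s2 13 = p \<and> Inv s2 G X G \<and> STK s2 \<and> flags s2 = flags s \<union> t ` {..<p} \<and> reg s2 9 <= reg s 9 + p \<and>
    (\<forall>q < 13. q ~= 9 --> reg s2 q = reg s1 q) \<and> eqA (FC \<union> {18, 19}) s1 s2 \<and> Mmono s s2 \<and>
    p2 s2 <= p2 s + 3 * p \<and> clock s2 <= clock s1 + 10 + 7600 * (L + 3) * p \<and>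
    (\<forall>a b. arr s2 4 (pr a b) = relev (arr s 2) (arr s 4) v (t ` {..<p}) a b))" for s2
  have "ht B (Seq (Assign 13 (Const 0)) (While (Less (Reg 13) (Reg 12)) Move)) s1 (\<lambda>s'. \<exists>s2. W s2 \<and> reg s2 13 = m \<and> s' = tick 4 s2)"
   unfolding ht_Seq_Assign
  proof (rule ht_While[where I = W and m = "\<lambda>s1. m - reg s1 13"])
   let ?s = "tick (1 + cost (Const 0)) (set_reg 13 (eval B s1 (Const 0)) s1)"
   have "Inv ?s G X G" by (rule Inv_eqA[OF I1]) (simp_all add: eqA_def same_def)
   moreover have "STK ?s" using S same_reg[OF s1(1), of 9] unfolding STK_def by (simp add: A1)
   moreover have "flags ?s = flags s" unfolding flags_def by (simp add: A1)
   moreover have "Mmono s ?s" unfolding Mmono_def by (simp add: A1)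
   moreover have "relev (arr s 2) (arr s 4) v {} a b = arr s 4 (pr a b)" for a b unfolding relev_def by simp
   ultimately show "W ?s" unfolding W_def using same_reg[OF s1(1), of 9]
    by (intro exI[of _ 0]) (simp add: A1 eqA_def)
  next
   fix s2 assume "W s2" and e: "eval B s2 (Less (Reg 13) (Reg 12)) ~= 0"
   then obtain p where p: "p <= m" "reg s2 13 = p" "Inv s2 G X G" "STK s2" "flags s2 = flags s \<union> t ` {..<p}" "reg s2 9 <= reg s 9 + p"
    "\<forall>q < 13. q ~= 9 --> reg s2 q = reg s1 q" "eqA (FC \<union> {18, 19}) s1 s2" "Mmono s s2"
    "p2 s2 <= p2 s + 3 * p" "clock s2 <= clock s1 + 10 + 7600 * (L + 3) * p"
    "\<forall>a b. arr s2 4 (pr a b) = relev (arr s 2) (arr s 4) v (t ` {..<p}) a b" unfolding W_def by blast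
   have r12: "reg s2 12 = m" using p(7) s1(3) unfolding m_def by simp
   have pm: "p < m" using e p(2) r12 by (simp split: if_splits)
   have A2: "arr s2 a = arr s1 a" if "a \<notin> FC \<union> {18, 19}" for a by (rule eqA_D[OF p(8) that])
   have yU: "t p \<in> U" using bij pm unfolding bij_betw_def by auto
   let ?s = "tick (1 + cost (Less (Reg 13) (Reg 12))) s2"
   have I2: "Inv ?s G X G" by (rule Inv_eqA[OF p(3)]) (simp_all add: eqA_def same_def)
   have S2: "STK ?s" using p(4) unfolding STK_def by simp
   have l2: "arr ?s 2 = arr s 2" "arr ?s 22 p = t p" using t1[OF pm] by (simp_all add: A2 A1)
   have r10: "reg ?s 10 = v" using p(7) same_reg[OF s1(1), of 10] r by simp
   have yG: "(v, t p) \<in> G" using yU unfolding U by simp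
   have r13: "reg ?s 13 = p" using p(2) by simp
   have pn: "p < n" using pm mn by simp
   have "ht B Move ?s (\<lambda>s'. Inv s' G X G \<and> STK s' \<and> flags s' = insert (t p) (flags ?s) \<and> reg s' 9 <= reg ?s 9 + 1 \<and>
     reg s' 13 = Suc p \<and> (\<forall>q < 13. q ~= 9 --> reg s' q = reg ?s q) \<and> eqA (FC \<union> {18, 19}) ?s s' \<and> Mmono ?s s' \<and>
     p2 s' <= p2 ?s + 3 \<and> clock s' <= clock ?s + 7500 * (L + 3) \<and>
     (\<forall>a b. arr s' 4 (pr a b) = relev (arr ?s 2) (arr ?s 4) v {t p} a b))"
    by (rule Move_spec[OF I2 S2 r10 r13 l2(2) yG pn]) (simp add: lev A2 A1)
   then show "ht B Move ?s (\<lambda>s'. W s' \<and> m - reg s' 13 < m - reg s2 13)"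
   proof (rule ht_mono, elim conjE)
    fix s' assume s': "Inv s' G X G" "STK s'" "flags s' = insert (t p) (flags ?s)" "reg s' 9 <= reg ?s 9 + 1"
     "reg s' 13 = Suc p" "\<forall>q < 13. q ~= 9 --> reg s' q = reg ?s q" "eqA (FC \<union> {18, 19}) ?s s'" "Mmono ?s s'"
     "p2 s' <= p2 ?s + 3" "clock s' <= clock ?s + 7500 * (L + 3)"
     and cl': "\<forall>a b. arr s' 4 (pr a b) = relev (arr ?s 2) (arr ?s 4) v {t p} a b"
    have img: "t ` {..<Suc p} = insert (t p) (t ` {..<p})" by (simp add: lessThan_Suc)
    have "W s'" unfolding W_def
    proof (intro exI[of _ "Suc p"] conjI)
     show "flags s' = flags s \<union> t ` {..<Suc p}" unfolding s'(3) img using p(5) unfolding flags_def by simp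
     show "reg s' 9 <= reg s 9 + Suc p" using s'(4) p(6) by simp
     show "\<forall>q < 13. q ~= 9 --> reg s' q = reg s1 q" using s'(6) p(7) by simp
     show "eqA (FC \<union> {18, 19}) s1 s'" using s'(7) p(8) unfolding eqA_def by simp
     have "Mmono s2 s'" using s'(8) unfolding Mmono_def by simp
     with p(9) show "Mmono s s'" by (rule Mmono_trans)
     show "p2 s' <= p2 s + 3 * Suc p" using s'(9) p(10) by simp
     show "clock s' <= clock s1 + 10 + 7600 * (L + 3) * Suc p" using s'(10) p(11) by simp
     show "\<forall>a b. arr s' 4 (pr a b) = relev (arr s 2) (arr s 4) v (t ` {..<Suc p}) a b"
     proof (intro allI)
      fix a b
      have "arr s' 4 (pr a b) = relev (arr s 2) (arr s2 4) v {t p} a b" using cl' unfolding l2(1) by simp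
      also have "\<dots> = relev (arr s 2) (arr s 4) v (t ` {..<Suc p}) a b"
       unfolding relev_def p(12)[rule_format] unfolding relev_def img by auto
      finally show "arr s' 4 (pr a b) = relev (arr s 2) (arr s 4) v (t ` {..<Suc p}) a b" .
     qed
    qed (use s' pm in simp_all)
    then show "W s' \<and> m - reg s' 13 < m - reg s2 13" using s'(5) p(2) pm by simp
   qed
  next
   fix s2 assume w: "W s2" and e: "eval B s2 (Less (Reg 13) (Reg 12)) = 0"
   have "reg s2 13 = m"
   proof -
    obtain p where p: "p <= m" "reg s2 13 = p" "\<forall>q < 13. q ~= 9 --> reg s2 q = reg s1 q" using w unfolding W_def by blast
    have "reg s2 12 = m" using p(3) s1(3) unfolding m_def by simp
    then show ?thesis using e p by (simp split: if_splits)
   qed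
   moreover have "tick (1 + cost (Less (Reg 13) (Reg 12))) s2 = tick 4 s2" by (simp add: eval_nat_numeral)
   ultimately show "\<exists>s2'. W s2' \<and> reg s2' 13 = m \<and> tick (1 + cost (Less (Reg 13) (Reg 12))) s2 = tick 4 s2'" using w by blast
  qed
  then show "ht B (Seq (Assign 13 (Const 0)) (While (Less (Reg 13) (Reg 12)) Move)) s1 ?Q"
  proof (rule ht_mono, elim exE conjE)
   fix s' s2 assume w: "W s2" "reg s2 13 = m" "s' = tick 4 s2"
   have tm: "t ` {..<m} = U" using bij unfolding bij_betw_def by blast
   from w(1) obtain p' where p': "reg s2 13 = p'" "Inv s2 G X G" "STK s2" "flags s2 = flags s \<union> t ` {..<p'}" "reg s2 9 <= reg s 9 + p'"
    "\<forall>q < 13. q ~= 9 --> reg s2 q = reg s1 q" "eqA (FC \<union> {18, 19}) s1 s2" "Mmono s s2"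
    "p2 s2 <= p2 s + 3 * p'" "clock s2 <= clock s1 + 10 + 7600 * (L + 3) * p'"
    "\<forall>a b. arr s2 4 (pr a b) = relev (arr s 2) (arr s 4) v (t ` {..<p'}) a b" unfolding W_def by blast
   have pm: "p' = m" using p'(1) w(2) by simp
   note p = p'(2-)[unfolded pm tm]
   show "?Q s'" unfolding w(3)
   proof (intro conjI)
    show "Inv (tick 4 s2) G X G" by (rule Inv_eqA[OF p(1)]) (simp_all add: eqA_def same_def)
    show "STK (tick 4 s2)" using p(2) unfolding STK_def by simp
    show "flags (tick 4 s2) = flags s \<union> U" using p(3) unfolding flags_def by simp
    show "reg (tick 4 s2) 9 <= reg s 9 + card U" using p(4) mU by simp
    show "\<forall>q < 11. q ~= 9 --> reg (tick 4 s2) q = reg s q" using p(5) same_reg[OF s1(1)] by simp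
    show "eqA (FC \<union> {18, 19, 22}) s (tick 4 s2)" using p(6) A1 unfolding eqA_def by simp
    show "Mmono s (tick 4 s2)" using p(7) unfolding Mmono_def by simp
    show "p2 (tick 4 s2) <= p2 s + 3 * card U" using p(8) mU by simp
    have "7600 * (L + 3) * m + 100 * m <= 8000 * (L + 3) * m" by (simp add: algebra_simps)
    then show "clock (tick 4 s2) <= clock s + 8000 * (L + 3) * card U + 200" using p(9) c1 mU by simp
    show "\<forall>a b. arr (tick 4 s2) 4 (pr a b) = relev (arr s 2) (arr s 4) v U a b" using p(10) by simp
   qed
  qed
 qed
qed

end

section \<open>Level adjustment and its potential\<close>

definition FixCase :: com where
 "FixCase = If (Less (Mul (Arr 0 (Reg 10)) (Arr 20 (Reg 4))) (Arr 3 (Reg 10)))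
   (Seq (Store 2 (Reg 10) (Add (Reg 11) (Const 1))) (Seq Relevel (Push 10)))
   (If (Reg 11) (If (Less (Mul (Const 8) (Arr 3 (Reg 10))) (Mul (Arr 0 (Reg 10)) (Arr 20 (Reg 4))))
    (Seq (Store 2 (Reg 10) (Sub (Reg 11) (Const 1))) (Seq Relevel (Push 10))) Skip) Skip)"

definition FixBody :: com where
 "FixBody = Seq (Assign 9 (Sub (Reg 9) (Const 1))) (Seq (Assign 10 (Arr 18 (Reg 9)))
   (Seq (Store 19 (Reg 10) (Const 0)) (Seq (Assign 11 (Arr 2 (Reg 10))) FixCase)))"

definition Fixup :: com where
 "Fixup = While (Reg 9) FixBody"

context bm
begin

definition LC :: "(nat \<Rightarrow> nat) \<Rightarrow> (nat \<Rightarrow> nat) \<Rightarrow> (nat \<times> nat) set \<Rightarrow> bool" where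
 "LC lev cl G \<longleftrightarrow> (\<forall>a b. (a, b) \<in> G --> cl (pr a b) = max (lev a) (lev b)) \<and> (\<forall>x<n. lev x <= L)"

text \<open>The shortfall of the weight below half of the capacity, measured in edges of weight
  \<open>2 ^ - lev x\<close>. Half lies between the two thresholds: a vertex that has just risen
  still has half of its capacity in weight and so no defect, whereas a vertex about to fall has a
  large one.\<close>

definition defect :: "(nat \<Rightarrow> nat) \<Rightarrow> (nat \<Rightarrow> nat) \<Rightarrow> (nat \<times> nat) set \<Rightarrow> nat \<Rightarrow> real" where
 "defect lev cl G x = 2 ^ lev x * max 0 (real (c x) / 2 - real (wt cl G x) / 2 ^ L)"

text \<open>The first sum runs over ordered pairs, so an edge moving up one class releases 8. Out of
  this a rise pays at most 6 per edge for the defects of the neighbours; a fall takes the 8 per edge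
  from the defect of the falling vertex. The last sum pays for a rise that moves no edge. It is
  restricted to vertices with an edge, so that isolated vertices bring no initial charge of
  \<open>L\<close> each.\<close>

definition phi :: "(nat \<Rightarrow> nat) \<Rightarrow> (nat \<Rightarrow> nat) \<Rightarrow> (nat \<times> nat) set \<Rightarrow> real" where
 "phi lev cl G = 4 * (\<Sum>e\<in>G. real L - real (cl (prod_encode e))) + 12 * (\<Sum>x<n. defect lev cl G x)
   + (\<Sum>x<n. if wt cl G x > 0 then real L - real (lev x) else 0)"

lemma graph_D: "graph G ==> (x, y) \<in> G ==> x < n \<and> y < n \<and> x ~= y \<and> (y, x) \<in> G"
 unfolding graph_def by blast

lemma graph_fin: assumes "graph G" shows "finite G" "finite {y. (x, y) \<in> G}"
proof -
 have "G \<subseteq> {..<n} \<times> {..<n}" using graph_D[OF assms] by auto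
 then show "finite G" by (rule finite_subset) simp
 have "{y. (x, y) \<in> G} \<subseteq> {..<n}" using graph_D[OF assms] by auto
 then show "finite {y. (x, y) \<in> G}" by (rule finite_subset) simp
qed

lemma wt_pos: assumes "graph G" shows "wt cl G x > 0 \<longleftrightarrow> (\<exists>y. (x, y) \<in> G)"
 unfolding wt_def using graph_fin(2)[OF assms, of x] by (simp add: zero_less_iff_neq_zero)

lemma phi_nonneg: "graph G ==> LC lev cl G ==> 0 <= phi lev cl G"
proof -
 assume G: "graph G" and lc: "LC lev cl G"
 have "cl (prod_encode e) <= L" if "e \<in> G" for e
  using lc graph_D[OF G, of "fst e" "snd e"] that unfolding LC_def by (cases e) auto
 then have "0 <= (\<Sum>e\<in>G. real L - real (cl (prod_encode e)))" by (intro sum_nonneg) simp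
 moreover have "0 <= (\<Sum>x<n. defect lev cl G x)" by (intro sum_nonneg) (simp add: defect_def)
 moreover have "0 <= (\<Sum>x<n. if wt cl G x > 0 then real L - real (lev x) else 0)"
  using lc unfolding LC_def by (intro sum_nonneg) auto
 ultimately show ?thesis unfolding phi_def by linarith
qed

context
 fixes G :: "(nat \<times> nat) set" and lev lev' cl cl' :: "nat \<Rightarrow> nat" and v l l' :: nat and U :: "nat set"
 assumes G: "graph G" and lc: "LC lev cl G" and v: "v < n" "lev v = l"
  and U: "U = {y. (v, y) \<in> G \<and> cl (pr v y) = l}"
  and lev': "lev' = lev(v := l')" and cl': "\<And>a b. cl' (pr a b) = relev lev' cl v U a b"
begin

lemma clG: "(a, b) \<in> G ==> cl (pr a b) = max (lev a) (lev b)"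
 using lc unfolding LC_def by blast

lemma U_facts: assumes "u \<in> U" shows "(v, u) \<in> G" "(u, v) \<in> G" "u < n" "u ~= v" "lev u <= l" "cl (pr v u) = l" "cl (pr u v) = l"
  "cl' (pr v u) = max l' (lev u)" "cl' (pr u v) = max l' (lev u)"
proof -
 show 1: "(v, u) \<in> G" "cl (pr v u) = l" using assms U by auto
 show 2: "(u, v) \<in> G" "u < n" "u ~= v" using graph_D[OF G 1(1)] by auto
 have "max l (lev u) = l" using clG[OF 1(1)] 1(2) v by simp
 then show "lev u <= l" by simp
 then show "cl (pr u v) = l" using clG[OF 2(1)] v by simp
 have "lev' v = l'" "lev' u = lev u" using 2 lev' by simp_all
 then show "cl' (pr v u) = max l' (lev u)" "cl' (pr u v) = max l' (lev u)"
  unfolding cl' relev_def using assms 2 by (simp_all add: max.commute)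
qed

lemma cl'_other: "\<not> (a = v \<and> b \<in> U) ==> \<not> (b = v \<and> a \<in> U) ==> cl' (pr a b) = cl (pr a b)"
 unfolding cl' relev_def by (rule if_not_P) blast

lemma wt_other: "x ~= v ==> x \<notin> U ==> wt cl' G x = wt cl G x"
 unfolding wt_def by (intro sum.cong refl) (use cl'_other[of x] in simp)

lemma U_fin: "finite U" "U \<subseteq> {..<n}"
proof -
 show "U \<subseteq> {..<n}" using U_facts(3) by auto
 then show "finite U" by (rule finite_subset) simp
qed

text \<open>A neighbour outside \<open>U\<close> has level above \<open>l\<close>, hence at least
  \<open>l'\<close>, so the maximum on that edge remains the neighbour's level.\<close>

lemma LC_relev: assumes "l' = Suc l \<or> Suc l' = l" "l' <= L" shows "LC lev' cl' G"
 unfolding LC_def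
proof (intro conjI allI impI)
 fix a b assume ab: "(a, b) \<in> G"
 show "cl' (pr a b) = max (lev' a) (lev' b)"
 proof (cases "a = v \<and> b \<in> U \<or> b = v \<and> a \<in> U")
  case True
  then show ?thesis unfolding cl' relev_def by simp
 next
  case False
  then have e: "cl' (pr a b) = cl (pr a b)" using cl'_other by blast
  have ne: "a ~= b" "(b, a) \<in> G" using graph_D[OF G ab] by auto
  have h: "lev y > l" if "(v, y) \<in> G" "y \<notin> U" for y
  proof -
   have "cl (pr v y) ~= l" using that U by simp
   then show ?thesis using clG[OF that(1)] v by (simp add: max_def split: if_splits)
  qed
  show ?thesis
  proof (cases "a = v")
   case True
   then have "lev b > l" using h[of b] ab False by simp
   then show ?thesis unfolding e clG[OF ab] using True ne v lev' assms by auto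
  next
   case a: False
   show ?thesis
   proof (cases "b = v")
    case True
    then have "lev a > l" using h[of a] ne False by simp
    then show ?thesis unfolding e clG[OF ab] using True ne v lev' assms by auto
   next
    case False
    then show ?thesis unfolding e clG[OF ab] using a lev' by simp
   qed
  qed
 qed
next
 fix x assume "x < n" then show "lev' x <= L" using lc assms lev' unfolding LC_def by simp
qed

abbreviation "MV \<equiv> Pair v ` U \<union> (\<lambda>u. (u, v)) ` U"

lemma MV_iff: "(a, b) \<in> MV \<longleftrightarrow> (a = v \<and> b \<in> U \<or> b = v \<and> a \<in> U)"
 by auto

lemma MV_sum: "(\<Sum>e\<in>G. if e \<in> MV then d else 0) = 2 * real (card U) * d"
proof -
 have sub: "MV \<subseteq> G" using U_facts(1,2) by auto
 have "v \<notin> U" using U_facts(4) by blast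
 then have disj: "Pair v ` U \<inter> (\<lambda>u. (u, v)) ` U = {}" by auto
 have "card MV = card (Pair v ` U) + card ((\<lambda>u. (u, v)) ` U)" using U_fin disj by (intro card_Un_disjoint) auto
 also have "card (Pair v ` U) = card U" by (intro card_image inj_onI) auto
 also have "card ((\<lambda>u. (u, v)) ` U) = card U" by (intro card_image inj_onI) auto
 finally have c: "card MV = 2 * card U" by simp
 have "(\<Sum>e\<in>G. if e \<in> MV then d else 0) = (\<Sum>e\<in>G \<inter> MV. d)"
  by (rule sum.inter_restrict[symmetric]) (rule graph_fin(1)[OF G])
 also have "G \<inter> MV = MV" using sub by blast
 finally show ?thesis by (simp add: c)
qed

lemma U_sum: "(\<Sum>x<n. if x \<in> U then d else 0) = real (card U) * d"
proof -
 have "(\<Sum>x<n. if x \<in> U then d else 0) = (\<Sum>x\<in>{..<n} \<inter> U. d)" by (rule sum.inter_restrict[symmetric]) simp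
 also have "{..<n} \<inter> U = U" using U_fin by blast
 finally show ?thesis by simp
qed

lemma v_sum: "(\<Sum>x<n. if x = v then d else 0) = (d::real)"
 using v by simp

lemma card_U: "card U * 2 ^ (L - l) <= wt cl G v"
proof -
 have "card U * 2 ^ (L - l) = (\<Sum>y\<in>U. 2 ^ (L - cl (pr v y)))" using U_facts(6) by simp
 also have "\<dots> <= wt cl G v" unfolding wt_def by (rule sum_mono2) (use graph_fin[OF G] U in auto)
 finally show ?thesis .
qed

text \<open>At level \<open>L\<close> all edges at \<open>v\<close> have the least weight, and there
  are at most \<open>n <= 2 ^ L\<close> of them, so an overloaded vertex is below the top. For each
  edge in \<open>U\<close> the first sum releases 8. The neighbour, whose level is at most
  \<open>l\<close>, loses weight \<open>2 ^ - (l + 1)\<close>, so its defect grows by at most 1/2,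
  at the price 6. The weight at \<open>v\<close> at most halves and leaves no defect, and the last
  sum falls by 1.\<close>

lemma phi_up:
 assumes l': "l' = Suc l" and W: "c v * 2 ^ L < wt cl G v"
 shows "l < L" "phi lev' cl' G + real (card U) + 1 <= phi lev cl G"
proof -
 have cv: "1 <= c v" using c1 v by simp
 have lL: "l <= L" using lc v unfolding LC_def by auto
 show ll: "l < L"
 proof (rule ccontr)
  assume "\<not> l < L"
  then have l: "l = L" using lL by simp
  have "L <= cl (pr v y)" if "(v, y) \<in> G" for y using clG[OF that] v l by simp
  then have "wt cl G v = card {y. (v, y) \<in> G}" unfolding wt_def by simp
  also have "\<dots> <= card {..<n}" using graph_D[OF G] by (intro card_mono) auto
  finally have "wt cl G v <= 1 * 2 ^ L" using Ln by simp
  also have "\<dots> <= c v * 2 ^ L" using cv by (intro mult_right_mono) auto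
  finally show False using W by simp
 qed
 have mv: "cl' (pr a b) = Suc (cl (pr a b)) \<and> cl (pr a b) = l" if "(a, b) \<in> MV" for a b
 proof -
  have m: "max (Suc l) (lev u) = Suc l" if "u \<in> U" for u using U_facts(5)[OF that] by simp
  show ?thesis using that U_facts(6-9) m unfolding MV_iff l' by auto
 qed
 have nm: "cl' (pr a b) = cl (pr a b)" if "(a, b) \<notin> MV" for a b using that cl'_other unfolding MV_iff by blast
 have pw2: "(2::nat) ^ (L - l) = 2 * 2 ^ (L - Suc l)" using ll by (simp flip: power_Suc)
 have Wv: "wt cl G v <= 2 * wt cl' G v"
  unfolding wt_def sum_distrib_left
 proof (rule sum_mono)
  fix y
  show "2 ^ (L - cl (pr v y)) <= 2 * (2::nat) ^ (L - cl' (pr v y))"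
   by (cases "(v, y) \<in> MV") (use mv[of v y] nm[of v y] pw2 in auto)
 qed
 have Wx: "wt cl G x <= wt cl' G x + (if x \<in> U then 2 ^ (L - Suc l) else 0)" if "x ~= v" for x
 proof (cases "x \<in> U")
  case False
  then show ?thesis using wt_other[OF that] by simp
 next
  case True
  have "wt cl G x <= (\<Sum>y\<in>{y. (x, y) \<in> G}. 2 ^ (L - cl' (pr x y)) + (if y = v then 2 ^ (L - Suc l) else 0))"
   unfolding wt_def
  proof (rule sum_mono)
   fix y
   show "2 ^ (L - cl (pr x y)) <= 2 ^ (L - cl' (pr x y)) + (if y = v then 2 ^ (L - Suc l) else (0::nat))"
   proof -
    have i: "(x, y) \<in> MV \<longleftrightarrow> y = v" using that True unfolding MV_iff by auto
    show ?thesis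
    proof (cases "y = v")
     case True
     then show ?thesis using mv[of x y] pw2 unfolding i by simp
    next
     case False
     then show ?thesis using nm[of x y] unfolding i by simp
    qed
   qed
  qed
  also have "\<dots> = wt cl' G x + 2 ^ (L - Suc l)"
   unfolding sum.distrib wt_def using graph_fin(2)[OF G] U_facts(2)[OF True] by simp
  finally show ?thesis using True by simp
 qed
 have pw3: "2 ^ L = (2::real) ^ (L - Suc l) * 2 ^ Suc l" using ll by (simp only: flip: power_add) simp
 have dx: "defect lev' cl' G x <= defect lev cl G x + (if x \<in> U then 1 / 2 else 0)" if "x < n" for x
 proof (cases "x = v")
  case True
  have "real (c v) / 2 - real (wt cl' G v) / 2 ^ L <= 0"
  proof -
   have "real (c v * 2 ^ L) <= real (2 * wt cl' G v)" using W Wv by linarith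
   then have "real (c v) * 2 ^ L <= 2 * real (wt cl' G v)" by simp
   then have "real (c v) <= 2 * real (wt cl' G v) / 2 ^ L" by (simp add: pos_le_divide_eq)
   then have "real (c v) <= 2 * (real (wt cl' G v) / 2 ^ L)" by (simp only: times_divide_eq_right)
   then show ?thesis by linarith
  qed
  then have "defect lev' cl' G v = 0" unfolding defect_def by simp
  moreover have "0 <= defect lev cl G v" unfolding defect_def by simp
  ultimately show ?thesis using True by simp
 next
  case False
  have lx: "lev' x = lev x" using False lev' by simp
  show ?thesis
  proof (cases "x \<in> U")
   case xU: False
   then show ?thesis unfolding defect_def lx wt_other[OF False xU] by simp
  next
   case True
   let ?a = "real (c x) / 2 - real (wt cl G x) / 2 ^ L" and ?b = "real (c x) / 2 - real (wt cl' G x) / 2 ^ L"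
   have "real (wt cl G x) <= real (wt cl' G x + 2 ^ (L - Suc l))" using Wx[OF False] True by (simp only: of_nat_le_iff if_True)
   then have "real (wt cl G x) <= real (wt cl' G x) + 2 ^ (L - Suc l)" by simp
   then have "real (wt cl G x) / 2 ^ L <= (real (wt cl' G x) + 2 ^ (L - Suc l)) / 2 ^ L" by (intro divide_right_mono) auto
   moreover have "(2::real) ^ (L - Suc l) / 2 ^ L = 1 / 2 ^ Suc l" unfolding pw3 by simp
   ultimately have "?b <= ?a + 1 / 2 ^ Suc l" by (simp add: add_divide_distrib)
   then have "max 0 ?b <= max 0 ?a + 1 / 2 ^ Suc l"
   proof -
    assume h: "?b <= ?a + 1 / 2 ^ Suc l"
    have "0 <= 1 / (2::real) ^ Suc l" by simp
    then show ?thesis using h by linarith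
   qed
   then have "2 ^ lev x * max 0 ?b <= 2 ^ lev x * (max 0 ?a + 1 / 2 ^ Suc l)" by (intro mult_left_mono) auto
   also have "\<dots> = 2 ^ lev x * max 0 ?a + 2 ^ lev x / 2 ^ Suc l" by (simp only: distrib_left times_divide_eq_right mult_1_right)
   also have "(2::real) ^ lev x / 2 ^ Suc l <= 2 ^ l / 2 ^ Suc l" using U_facts(5)[OF True] by (intro divide_right_mono power_increasing) auto
   also have "(2::real) ^ l / 2 ^ Suc l = 1 / 2" by simp
   finally show ?thesis unfolding defect_def lx using True by simp
  qed
 qed
 have s2: "(\<Sum>x<n. defect lev' cl' G x) <= (\<Sum>x<n. defect lev cl G x) + real (card U) * (1 / 2)"
  unfolding U_sum[symmetric] sum.distrib[symmetric] using dx by (intro sum_mono) simp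
 have s1: "(\<Sum>e\<in>G. real L - real (cl' (prod_encode e))) = (\<Sum>e\<in>G. real L - real (cl (prod_encode e))) + 2 * real (card U) * (- 1)"
  unfolding MV_sum[symmetric] sum.distrib[symmetric]
 proof (rule sum.cong[OF refl])
  fix e :: "nat \<times> nat"
  obtain a b where e: "e = (a, b)" by (cases e)
  show "real L - real (cl' (prod_encode e)) = real L - real (cl (prod_encode e)) + (if e \<in> MV then - 1 else 0)"
   unfolding e using mv[of a b] nm[of a b] by (cases "(a, b) \<in> MV") simp_all
 qed
 have s3: "(\<Sum>x<n. if wt cl' G x > 0 then real L - real (lev' x) else 0) = (\<Sum>x<n. if wt cl G x > 0 then real L - real (lev x) else 0) + (- 1)"
 proof -
  have W0: "0 < wt cl G v" using W by simp
  have "(\<Sum>x<n. if wt cl' G x > 0 then real L - real (lev' x) else 0)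
   = (\<Sum>x<n. (if wt cl G x > 0 then real L - real (lev x) else 0) + (if x = v then - 1 else 0))"
  proof (rule sum.cong[OF refl])
   fix x
   have p: "wt cl' G x > 0 \<longleftrightarrow> wt cl G x > 0" unfolding wt_pos[OF G] ..
   show "(if wt cl' G x > 0 then real L - real (lev' x) else 0) = (if wt cl G x > 0 then real L - real (lev x) else 0) + (if x = v then - 1 else 0)"
    unfolding p using W0 lev' l' v by (cases "x = v") simp_all
  qed
  then show ?thesis unfolding sum.distrib v_sum .
 qed
 show "phi lev' cl' G + real (card U) + 1 <= phi lev cl G" using s1 s2 s3 unfolding phi_def by simp
qed

text \<open>The weight is below an eighth of the capacity, so the shortfall of \<open>v\<close> is
  at least 3/8 of it. Halving the factor \<open>2 ^ l\<close> therefore frees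
  \<open>3 / 16 * y\<close>, and \<open>9 / 4 * y\<close> after multiplication by 12. At most
  \<open>y / 8\<close> edges are moved, each at the price 8. What remains covers
  \<open>card U + 2\<close>, because \<open>2 <= y\<close> holds for a positive level.\<close>

lemma phi_down:
 assumes l': "Suc l' = l" and W: "8 * wt cl G v < c v * 2 ^ L"
 shows "phi lev' cl' G + real (card U) + 1 <= phi lev cl G"
proof -
 have cv: "1 <= c v" using c1 v by simp
 have lL: "l <= L" using lc v unfolding LC_def by auto
 have mv: "cl' (pr a b) <= cl (pr a b) \<and> cl (pr a b) <= Suc (cl' (pr a b))" if "(a, b) \<in> MV" for a b
  using that U_facts(5-9) l' unfolding MV_iff by auto
 have nm: "cl' (pr a b) = cl (pr a b)" if "(a, b) \<notin> MV" for a b using that cl'_other unfolding MV_iff by blast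
 have le: "cl' (pr a b) <= cl (pr a b)" for a b using mv nm by (cases "(a, b) \<in> MV") auto
 have Wx: "wt cl G x <= wt cl' G x" for x
  unfolding wt_def by (intro sum_mono power_increasing diff_le_mono2 le) simp
 define a where "a = real (c v) / 2 - real (wt cl G v) / 2 ^ L"
 have w8: "8 * (real (wt cl G v) / 2 ^ L) <= real (c v)"
 proof -
  have "real (8 * wt cl G v) <= real (c v * 2 ^ L)" using W by linarith
  then have "8 * real (wt cl G v) <= real (c v) * 2 ^ L" by simp
  then have "8 * real (wt cl G v) / 2 ^ L <= real (c v)" by (subst pos_divide_le_eq) simp_all
  then show ?thesis by (simp only: times_divide_eq_right)
 qed
 then have a: "3 / 8 * real (c v) <= a" unfolding a_def by linarith
 have a0: "0 <= a" using a by (rule order_trans[rotated]) simp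
 have pl: "(2::real) ^ l = 2 * 2 ^ l'" using l' by auto
 define y where "y = 2 ^ l * real (c v)"
 have dv: "defect lev' cl' G v + 3 / 16 * y <= defect lev cl G v"
 proof -
  have "real (c v) / 2 - real (wt cl' G v) / 2 ^ L <= a" unfolding a_def using Wx[of v] by (simp add: divide_right_mono)
  then have "max 0 (real (c v) / 2 - real (wt cl' G v) / 2 ^ L) <= a" using a0 by simp
  then have "defect lev' cl' G v <= 2 ^ l' * a" unfolding defect_def lev' by (simp add: mult_left_mono)
  moreover have "defect lev cl G v = 2 * (2 ^ l' * a)" unfolding defect_def v a_def[symmetric] pl using a0 by simp
  moreover have "2 ^ l' * (3 / 8 * real (c v)) <= 2 ^ l' * a" by (intro mult_left_mono a) simp
  moreover have "2 ^ l' * (3 / 8 * real (c v)) = 3 / 16 * y" unfolding y_def pl by simp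
  ultimately show ?thesis by linarith
 qed
 have dx: "defect lev' cl' G x <= defect lev cl G x + (if x = v then - (3 / 16 * y) else 0)" for x
 proof (cases "x = v")
  case True then show ?thesis using dv by simp
 next
  case False
  have "real (c x) / 2 - real (wt cl' G x) / 2 ^ L <= real (c x) / 2 - real (wt cl G x) / 2 ^ L"
   using Wx[of x] by (simp add: divide_right_mono)
  then have "max 0 (real (c x) / 2 - real (wt cl' G x) / 2 ^ L) <= max 0 (real (c x) / 2 - real (wt cl G x) / 2 ^ L)"
   by linarith
  then show ?thesis using False unfolding defect_def lev' by (simp add: mult_left_mono)
 qed
 have s2: "(\<Sum>x<n. defect lev' cl' G x) <= (\<Sum>x<n. defect lev cl G x) + - (3 / 16 * y)"
 proof -
  have "(\<Sum>x<n. defect lev' cl' G x) <= (\<Sum>x<n. defect lev cl G x + (if x = v then - (3 / 16 * y) else 0))"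
   by (intro sum_mono dx)
  then show ?thesis unfolding sum.distrib v_sum .
 qed
 have s1: "(\<Sum>e\<in>G. real L - real (cl' (prod_encode e))) <= (\<Sum>e\<in>G. real L - real (cl (prod_encode e))) + 2 * real (card U) * 1"
  unfolding MV_sum[symmetric] sum.distrib[symmetric]
 proof (rule sum_mono)
  fix e :: "nat \<times> nat"
  obtain a b where e: "e = (a, b)" by (cases e)
  show "real L - real (cl' (prod_encode e)) <= real L - real (cl (prod_encode e)) + (if e \<in> MV then 1 else 0)"
   unfolding e using mv[of a b] nm[of a b] by (cases "(a, b) \<in> MV") simp_all
 qed
 have s3: "(\<Sum>x<n. if wt cl' G x > 0 then real L - real (lev' x) else 0) <= (\<Sum>x<n. if wt cl G x > 0 then real L - real (lev x) else 0) + 1"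
 proof -
  have "(\<Sum>x<n. if wt cl' G x > 0 then real L - real (lev' x) else 0)
   <= (\<Sum>x<n. (if wt cl G x > 0 then real L - real (lev x) else 0) + (if x = v then 1 else 0))"
  proof (rule sum_mono)
   fix x
   have p: "wt cl' G x > 0 \<longleftrightarrow> wt cl G x > 0" unfolding wt_pos[OF G] ..
   show "(if wt cl' G x > 0 then real L - real (lev' x) else 0) <= (if wt cl G x > 0 then real L - real (lev x) else 0) + (if x = v then 1 else 0)"
    unfolding p using lev' l' v by (cases "x = v") auto
  qed
  then show ?thesis unfolding sum.distrib v_sum .
 qed
 have cU: "8 * real (card U) <= y"
 proof -
  have "real (card U * 2 ^ (L - l)) <= real (wt cl G v)" using card_U by (rule of_nat_mono)
  then have "real (card U) * 2 ^ (L - l) / 2 ^ L <= real (wt cl G v) / 2 ^ L" by (intro divide_right_mono) simp_all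
  moreover have "(2::real) ^ L = 2 ^ (L - l) * 2 ^ l" using lL by (simp flip: power_add)
  ultimately have "real (card U) / 2 ^ l <= real (wt cl G v) / 2 ^ L" by simp
  then have "8 * (real (card U) / 2 ^ l) <= real (c v)" using w8 by linarith
  then show ?thesis unfolding y_def by (simp add: pos_divide_le_eq mult.commute)
 qed
 have y2: "2 <= y"
 proof -
  have "(2::real) * 1 <= 2 ^ l * real (c v)" using cv unfolding pl by (intro mult_mono) simp_all
  then show ?thesis unfolding y_def by simp
 qed
 show ?thesis using s1 s2 s3 cU y2 unfolding phi_def by simp
qed

end

lemma Shift_spec:
 assumes I: "Inv s G X G" and S: "STK s" and r: "reg s 10 = v" "reg s 11 = l" "v < n" "l <= L"
  and lev: "\<And>x. x < n ==> arr s 2 x <= L" and U: "U = {y. (v, y) \<in> G \<and> arr s 4 (pr v y) = l}"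
 shows "ht B (Seq Relevel (Push 10)) s (\<lambda>s'. Inv s' G X G \<and> STK s' \<and> flags s' = insert v (flags s \<union> U) \<and> reg s' 9 <= reg s 9 + card U + 1 \<and>
   (\<forall>q < 9. reg s' q = reg s q) \<and> eqA (FC \<union> {18, 19, 22}) s s' \<and> Mmono s s' \<and>
   p2 s' <= p2 s + 3 * card U \<and> clock s' <= clock s + 8000 * (L + 3) * card U + 250 \<and>
   (\<forall>a b. arr s' 4 (pr a b) = relev (arr s 2) (arr s 4) v U a b))"
  (is "ht B _ s ?Q")
proof (rule ht_Seq[OF Relevel_spec[OF I S r lev U]]; (elim conjE)?)
 fix s1 assume s1: "Inv s1 G X G" "STK s1" "flags s1 = flags s \<union> U" "reg s1 9 <= reg s 9 + card U"
   "\<forall>q < 11. q ~= 9 --> reg s1 q = reg s q" "eqA (FC \<union> {18, 19, 22}) s s1" "Mmono s s1"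
   "p2 s1 <= p2 s + 3 * card U" "clock s1 <= clock s + 8000 * (L + 3) * card U + 200"
   "\<forall>a b. arr s1 4 (pr a b) = relev (arr s 2) (arr s 4) v U a b"
 have r1: "reg s1 10 = v" using s1(5) r by simp
 show "ht B (Push 10) s1 ?Q"
 proof (rule ht_mono[OF Push_spec[OF s1(2) r1 r(3)]]; (elim conjE)?)
  fix s2 assume s2: "STK s2" "{z. arr s2 19 z ~= 0} = insert v {z. arr s1 19 z ~= 0}" "reg s2 9 <= reg s1 9 + 1"
   "\<forall>q. q ~= 9 --> reg s2 q = reg s1 q" "eqA {18, 19} s1 s2" "clock s2 <= clock s1 + 50"
  have A: "arr s2 a = arr s1 a" if "a \<notin> {18, 19}" for a by (rule eqA_D[OF s2(5) that])
  show "?Q s2"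
  proof (intro conjI)
   show "Inv s2 G X G" by (rule Inv_eqA[OF s1(1)]) (use s2 in \<open>simp_all add: eqA_def same_def\<close>)
   show "flags s2 = insert v (flags s \<union> U)" using s2(2) s1(3) unfolding flags_def by simp
   show "eqA (FC \<union> {18, 19, 22}) s s2" using s1(6) A unfolding eqA_def by simp
   show "Mmono s s2" using s1(7) unfolding Mmono_def by (simp add: A)
   show "\<forall>a b. arr s2 4 (pr a b) = relev (arr s 2) (arr s 4) v U a b" using s1(10) by (simp add: A)
   show "p2 s2 <= p2 s + 3 * card U" using s1(8) by (simp add: A)
  qed (use s1 s2 in simp_all)
 qed simp
qed

definition clean :: "(nat \<Rightarrow> nat) \<Rightarrow> (nat \<Rightarrow> nat) \<Rightarrow> nat \<Rightarrow> bool" where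
 "clean lev W x \<longleftrightarrow> W x <= c x * 2 ^ L \<and> (lev x > 0 --> c x * 2 ^ L <= 8 * W x)"

text \<open>Vertices that may lie outside the thresholds are on the stack; an empty stack means that
  all are clean.\<close>

definition FI :: "state \<Rightarrow> (nat \<times> nat) set \<Rightarrow> nat set \<Rightarrow> bool" where
 "FI s G X \<longleftrightarrow> Inv s G X G \<and> STK s \<and> LC (arr s 2) (arr s 4) G \<and> (\<forall>x<n. x \<notin> flags s --> clean (arr s 2) (arr s 3) x)"

text \<open>The price of one unit of \<open>phi\<close>. Moving an edge takes
  \<open>8000 * (L + 3)\<close> operations; the remaining third pays for three newly coloured edges
  at 1000 each and one push at 100.\<close>

definition tau :: real where "tau = 12000 * (real L + 3)"

definition pot :: "state \<Rightarrow> (nat \<times> nat) set \<Rightarrow> real" where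
 "pot s G = tau * phi (arr s 2) (arr s 4) G + 1000 * real (p2 s) + 100 * real (reg s 9)"

abbreviation "FD \<equiv> FC \<union> {2, 18, 19, 22} :: nat set"

definition FStep :: "state \<Rightarrow> state \<Rightarrow> bool" where
 "FStep s s' \<longleftrightarrow> (\<forall>q < 9. reg s' q = reg s q) \<and> eqA FD s s' \<and> Mmono s s'"

lemma FStep_trans: "FStep s s' ==> FStep s' s'' ==> FStep s s''"
 unfolding FStep_def using Mmono_trans[of s s' s''] by (auto simp: eqA_def)

text \<open>Both directions of a level change are treated together. \<open>phi\<close> drops by
  \<open>card U + 1\<close>; what grows is \<open>pot2\<close>, by 3 for each moved edge, and the
  stack, by those neighbours and \<open>v\<close> itself. This is where 3100 and 100 come
  from.\<close>

lemma shift_case: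
 assumes F: "Inv s G X G" "STK s" "LC (arr s 2) (arr s 4) G" "\<And>x. x < n ==> x \<notin> flags s ==> x ~= v ==> clean (arr s 2) (arr s 3) x"
  and r: "reg s 10 = v" "reg s 11 = l" "v < n" "arr s 2 v = l" and U: "U = {y. (v, y) \<in> G \<and> arr s 4 (pr v y) = l}"
  and l': "l' = Suc l \<and> c v * 2 ^ L < wt (arr s 4) G v \<or> Suc l' = l \<and> 8 * wt (arr s 4) G v < c v * 2 ^ L"
  and s1: "arr s1 = (arr s)(2 := (arr s 2)(v := l'))" "reg s1 = reg s" "clock s1 <= clock s + 40"
 shows "ht B (Seq Relevel (Push 10)) s1 (\<lambda>s'. FI s' G X \<and> FStep s s' \<and>
  pot s' G + tau + tau * real (card U) <= pot s G + 100 + 3100 * real (card U) \<and>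
  real (clock s') <= real (clock s) + (8000 * (real L + 3)) * real (card U) + 290)"
  (is "ht B _ s1 ?Q")
proof -
 have G: "graph G" using Inv0_D(2)[OF Inv_D(1)[OF F(1)]] .
 have lL: "l <= L" using F(3) r unfolding LC_def by auto
 define lev' where "lev' = (arr s 2)(v := l')"
 have a: "arr s1 2 = lev'" "\<And>a. a ~= 2 ==> arr s1 a = arr s a" unfolding s1 lev'_def by simp_all
 have I1: "Inv s1 G X G" by (rule Inv_eqA[OF F(1)]) (simp_all add: eqA_def same_def s1 lev'_def)
 have S1: "STK s1" using F(2) unfolding STK_def s1(2) by (simp add: a)
 have l'L: "l' <= L"
  using l'
 proof
  assume h: "l' = Suc l \<and> c v * 2 ^ L < wt (arr s 4) G v"
  \<comment> \<open>That there is room for a further level is needed before any edge has been moved,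
    so the new classes are supplied explicitly instead of being read off a later state.\<close>
  have "l < L"
   by (rule phi_up(1)[where l' = "Suc l" and cl' = "\<lambda>e. case prod_decode e of (a, b) \<Rightarrow> relev ((arr s 2)(v := Suc l)) (arr s 4) v U a b",
     OF G F(3) r(3,4) U refl])
    (use h in simp_all)
  then show ?thesis using h by simp
 qed (use lL in simp)
 have lev1: "arr s1 2 x <= L" if "x < n" for x using F(3) that l'L unfolding a lev'_def LC_def by simp
 have U1: "U = {y. (v, y) \<in> G \<and> arr s1 4 (pr v y) = l}" using U by (simp add: a)
 have r1: "reg s1 10 = v" "reg s1 11 = l" using r s1(2) by simp_all
 show ?thesis
 proof (rule ht_mono[OF Shift_spec[OF I1 S1 r1 r(3) lL lev1 U1]]; (elim conjE)?)
  fix s' assume s': "Inv s' G X G" "STK s'" "flags s' = insert v (flags s1 \<union> U)" "reg s' 9 <= reg s1 9 + card U + 1"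
   "\<forall>q < 9. reg s' q = reg s1 q" "eqA (FC \<union> {18, 19, 22}) s1 s'" "Mmono s1 s'"
   "p2 s' <= p2 s1 + 3 * card U" "clock s' <= clock s1 + 8000 * (L + 3) * card U + 250"
   and cl': "\<forall>a b. arr s' 4 (pr a b) = relev (arr s1 2) (arr s1 4) v U a b"
  have lev': "arr s' 2 = (arr s 2)(v := l')" using eqA_D[OF s'(6), of 2] a(1) unfolding lev'_def by simp
  have cl'': "arr s' 4 (pr a b) = relev (arr s' 2) (arr s 4) v U a b" for a b
   using cl' a unfolding lev' lev'_def by simp
  note ctx = G F(3) r(3,4) U lev' cl''
  have W': "arr s' 3 = wt (arr s' 4) G" "arr s 3 = wt (arr s 4) G"
   using Inv0_D(7)[OF Inv_D(1)[OF s'(1)]] Inv0_D(7)[OF Inv_D(1)[OF F(1)]] by auto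
  have LC': "LC (arr s' 2) (arr s' 4) G" by (rule LC_relev[OF ctx]) (use l' l'L in auto)
  have ph: "phi (arr s' 2) (arr s' 4) G + real (card U) + 1 <= phi (arr s 2) (arr s 4) G"
   using l'
  proof
   assume "l' = Suc l \<and> c v * 2 ^ L < wt (arr s 4) G v"
   then show ?thesis using phi_up(2)[OF ctx] by blast
  next
   assume "Suc l' = l \<and> 8 * wt (arr s 4) G v < c v * 2 ^ L"
   then show ?thesis using phi_down[OF ctx] by blast
  qed
  have fl: "flags s1 = flags s" unfolding flags_def by (simp add: a)
  have FI': "FI s' G X" unfolding FI_def
  proof (intro conjI allI impI)
   fix x assume x: "x < n" "x \<notin> flags s'"
   then have x': "x ~= v" "x \<notin> U" "x \<notin> flags s" using s'(3) fl by auto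
   have "arr s' 3 x = arr s 3 x" unfolding W' by (rule wt_other[OF ctx x'(1,2)])
   moreover have "arr s' 2 x = arr s 2 x" using x' lev' by simp
   ultimately show "clean (arr s' 2) (arr s' 3) x" using F(4)[OF x(1) x'(3,1)] unfolding clean_def by simp
  qed (use s' LC' in blast)+
  have FS: "FStep s s'" unfolding FStep_def
  proof (intro conjI)
   show "\<forall>q < 9. reg s' q = reg s q" using s'(5) s1(2) by simp
   show "eqA FD s s'" using s'(6) a(2) unfolding eqA_def by simp
   show "Mmono s s'" using s'(7) unfolding Mmono_def by (simp add: a)
  qed
  have t0: "0 <= tau" unfolding tau_def by simp
  have "tau * (phi (arr s' 2) (arr s' 4) G + real (card U) + 1) <= tau * phi (arr s 2) (arr s 4) G"
   by (rule mult_left_mono[OF ph t0])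
  then have t: "tau * phi (arr s' 2) (arr s' 4) G + tau * real (card U) + tau <= tau * phi (arr s 2) (arr s 4) G"
   by (simp add: algebra_simps)
  have p: "real (p2 s') <= real (p2 s) + 3 * real (card U)" using s'(8) by (simp add: a)
  have sp: "real (reg s' 9) <= real (reg s 9) + real (card U) + 1" using s'(4) s1(2) by simp
  have "real (clock s') <= real (clock s1 + 8000 * (L + 3) * card U + 250)" using s'(9) by (rule of_nat_mono)
  then have ck: "real (clock s') <= real (clock s) + (8000 * (real L + 3)) * real (card U) + 290" using s1(3) by simp
  show "?Q s'" using FI' FS ck t p sp unfolding pot_def by simp
 qed
qed

lemma pop_STK:
 assumes S: "STK s" and k: "reg s 9 = Suc k" and v: "arr s 18 k = v"
  and s': "arr s' 18 = arr s 18" "arr s' 19 = (arr s 19)(v := 0)" "reg s' 9 = k"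
 shows "STK s'" "flags s' = flags s - {v}" "v < n" "v \<in> flags s"
proof -
 have inj: "inj_on (arr s 18) {..<Suc k}" and im: "arr s 18 ` {..<Suc k} = {x. arr s 19 x ~= 0}"
  and lt: "{x. arr s 19 x ~= 0} \<subseteq> {..<n}" using S unfolding STK_def k by blast+
 have "v \<in> arr s 18 ` {..<Suc k}" using v by auto
 then have vf: "v \<in> {x. arr s 19 x ~= 0}" unfolding im .
 then show "v \<in> flags s" "v < n" using lt unfolding flags_def by auto
 show f: "flags s' = flags s - {v}" unfolding flags_def s' by auto
 have nv: "v \<notin> arr s 18 ` {..<k}"
 proof
  assume "v \<in> arr s 18 ` {..<k}"
  then obtain j where j: "j < k" "arr s 18 j = arr s 18 k" using v by auto
  then have "j = k" using inj_onD[OF inj j(2)] by simp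
  then show False using j by simp
 qed
 have "arr s 18 ` {..<k} = {x. arr s 19 x ~= 0} - {v}"
 proof -
  have "insert v (arr s 18 ` {..<k}) = {x. arr s 19 x ~= 0}" using im v unfolding lessThan_Suc by simp
  then show ?thesis using Diff_insert_absorb[OF nv] by simp
 qed
 moreover have "inj_on (arr s 18) {..<k}" using inj by (rule inj_on_subset) auto
 ultimately show "STK s'" using f lt unfolding STK_def flags_def s' by auto
qed

text \<open>Popping an entry frees 100, enough to examine a vertex that turns out to be clean; a
  level change is paid for by \<open>phi\<close>. The separate drop by 1 is for termination.\<close>

lemma FixBody_spec:
 assumes F: "FI s G X" and sp: "reg s 9 ~= 0"
 shows "ht B FixBody s (\<lambda>s'. FI s' G X \<and> FStep s s' \<and> pot s' G + 1 <= pot s G \<and>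
  real (clock s') + pot s' G + 2 <= real (clock s) + pot s G)"
  (is "ht B FixBody s ?Q")
proof -
 have I: "Inv s G X G" and S: "STK s" and lc: "LC (arr s 2) (arr s 4) G"
  and cl: "\<And>x. x < n ==> x \<notin> flags s ==> clean (arr s 2) (arr s 3) x" using F unfolding FI_def by blast+
 note D = Inv0_D[OF Inv_D(1)[OF I]]
 obtain k where k: "reg s 9 = Suc k" using sp by (cases "reg s 9") auto
 define v where "v = arr s 18 k"
 define l where "l = arr s 2 v"
 define s1 where "s1 = tick (1 + cost (Arr 2 (Reg 10))) (set_reg 11 l (tick (1 + cost (Reg 10) + cost (Const 0)) (set_arr 19 v 0
  (tick (1 + cost (Arr 18 (Reg 9))) (set_reg 10 v (tick (1 + cost (Sub (Reg 9) (Const 1))) (set_reg 9 k s)))))))"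
 have run: "ht B FixBody s Q = ht B FixCase s1 Q" for Q
  unfolding FixBody_def s1_def by (simp add: k v_def l_def)
 have A1: "arr s1 18 = arr s 18" "arr s1 19 = (arr s 19)(v := 0)" "\<And>a. a ~= 19 ==> arr s1 a = arr s a" by (simp_all add: s1_def)
 have R1: "reg s1 9 = k" "reg s1 10 = v" "reg s1 11 = l" "\<And>q. q < 9 ==> reg s1 q = reg s q" by (simp_all add: s1_def)
 have C1: "clock s1 = clock s + 13" by (simp add: s1_def)
 note pop = pop_STK[OF S k v_def[symmetric] A1(1,2) R1(1)]
 have I1: "Inv s1 G X G" by (rule Inv_eqA[OF I]) (use A1 R1 in \<open>simp_all add: eqA_def same_def\<close>)
 have lc1: "LC (arr s1 2) (arr s1 4) G" using lc by (simp add: A1)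
 have cl1: "clean (arr s1 2) (arr s1 3) x" if "x < n" "x \<notin> flags s1" "x ~= v" for x
  using cl[of x] that pop(2) by (simp add: A1)
 have W1: "arr s1 3 = wt (arr s1 4) G" using D(7) by (simp add: A1)
 have lL: "l <= L" using lc pop(3) unfolding LC_def l_def by simp
 have p1: "pot s1 G = pot s G - 100" unfolding pot_def using k R1(1) by (simp add: A1)
 have FS1: "FStep s s1" unfolding FStep_def using R1(4) by (simp add: eqA_def A1 Mmono_def)
 have cst: "arr s1 0 v = c v" "arr s1 20 L = 2 ^ L" "reg s1 4 = L" using D(1) pop(3) R1(4) unfolding Cst_def by (simp_all add: A1)
 have smL: "sm (2 ^ L)" using sm_pow[of 0] by simp
 have "sm0 8" using n2 by (simp add: sm0_def q0_def)
 then have sms: "sm v" "sm l" "sm (c v)" "sm 8" using pop(3) lL cn[OF pop(3)] by simp_all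
 have smw: "sm (arr s1 3 v)" unfolding W1 using wt_sm(1)[OF D(6)] by (simp add: A1)
 define U where "U = {y. (v, y) \<in> G \<and> arr s1 4 (pr v y) = l}"
 have tau3: "tau = 12000 * real L + 36000" unfolding tau_def by simp
 have post: "?Q s'" if "FI s' G X" "FStep s1 s'"
  "pot s' G + tau + tau * real (card U) <= pot s1 G + 100 + 3100 * real (card U)"
  "real (clock s') <= real (clock s1) + (8000 * (real L + 3)) * real (card U) + 290" for s'
 proof -
  have e: "tau * real (card U) = (8000 * (real L + 3)) * real (card U) + (4000 * real L + 12000) * real (card U)"
   unfolding tau3 by (simp add: algebra_simps)
  have h: "12000 * real (card U) <= (4000 * real L + 12000) * real (card U)" by (intro mult_right_mono) simp_all
  have pos: "0 <= (8000 * (real L + 3)) * real (card U)" by simp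
  have t: "36000 <= tau" unfolding tau3 by simp
  have C1r: "real (clock s1) = real (clock s) + 13" by (simp add: C1)
  have "0 <= real (card U)" by simp
  then have "pot s' G + 1 <= pot s G" "real (clock s') + pot s' G + 2 <= real (clock s) + pot s G"
   using that(3,4) e h pos t p1 C1r by linarith+
  then show ?thesis using that FStep_trans[OF FS1] by blast
 qed
 have shift: "ht B (Seq Relevel (Push 10)) s2 ?Q"
  if l': "l' = Suc l \<and> c v * 2 ^ L < wt (arr s1 4) G v \<or> Suc l' = l \<and> 8 * wt (arr s1 4) G v < c v * 2 ^ L"
   and s2: "arr s2 = (arr s1)(2 := (arr s1 2)(v := l'))" "reg s2 = reg s1" "clock s2 <= clock s1 + 40" for s2 l'
 proof -
  have lv: "arr s1 2 v = l" by (simp add: A1 l_def)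
  show ?thesis
   by (rule ht_mono[OF shift_case[OF I1 pop(1) lc1 cl1 R1(2,3) pop(3) lv U_def l' s2]]) (assumption, assumption, assumption, elim conjE, (rule post; assumption))
 qed
 have skip: "?Q s2" if "arr s2 = arr s1" "reg s2 = reg s1" "clock s2 <= clock s1 + 40" and cv: "clean (arr s1 2) (arr s1 3) v" for s2
 proof -
  have "Inv s2 G X G" by (rule Inv_eqA[OF I1]) (use that in \<open>simp_all add: eqA_def same_def\<close>)
  moreover have "STK s2" using pop(1) that unfolding STK_def by simp
  moreover have "clean (arr s1 2) (arr s1 3) x" if "x < n" "x \<notin> flags s1" for x using cl1[OF that] cv by (cases "x = v") auto
  ultimately have "FI s2 G X" using lc1 that unfolding FI_def flags_def by simp
  moreover have "FStep s s2" using FS1 that unfolding FStep_def eqA_def Mmono_def by simp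
  moreover have "pot s2 G = pot s1 G" unfolding pot_def using that by simp
  ultimately show ?thesis using p1 C1 that by simp
 qed
 show ?thesis unfolding run
 proof (cases "c v * 2 ^ L < arr s1 3 v")
  case True
  define s2 where "s2 = tick (1 + cost (Reg 10) + cost (Add (Reg 11) (Const 1))) (set_arr 2 v (Suc l)
   (tick (1 + cost (Less (Mul (Arr 0 (Reg 10)) (Arr 20 (Reg 4))) (Arr 3 (Reg 10)))) s1))"
  have run2: "ht B FixCase s1 Q = ht B (Seq Relevel (Push 10)) s2 Q" for Q
   unfolding FixCase_def s2_def using True by (simp add: R1 cst sms smL)
  show "ht B FixCase s1 ?Q" unfolding run2
   by (rule shift[of "Suc l"]) (use True in \<open>simp_all add: s2_def W1\<close>)
 next
  case F1: False
  show "ht B FixCase s1 ?Q"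
  proof (cases "l ~= 0 \<and> 8 * arr s1 3 v < c v * 2 ^ L")
   case True
   define s2 where "s2 = tick (1 + cost (Reg 10) + cost (Sub (Reg 11) (Const 1))) (set_arr 2 v (l - 1)
    (tick (1 + cost (Less (Mul (Const 8) (Arr 3 (Reg 10))) (Mul (Arr 0 (Reg 10)) (Arr 20 (Reg 4)))))
    (tick (1 + cost (Reg 11)) (tick (1 + cost (Less (Mul (Arr 0 (Reg 10)) (Arr 20 (Reg 4))) (Arr 3 (Reg 10)))) s1))))"
   have run2: "ht B FixCase s1 Q = ht B (Seq Relevel (Push 10)) s2 Q" for Q
    unfolding FixCase_def s2_def using True F1 by (simp add: R1 cst sms smL smw)
   show ?thesis unfolding run2
    by (rule shift[of "l - 1"]) (use True in \<open>simp_all add: s2_def W1\<close>)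
  next
   case False
   have lv: "arr s1 2 v = l" by (simp add: A1 l_def)
   have cv: "clean (arr s1 2) (arr s1 3) v" unfolding clean_def lv using F1 False by auto
   have "ht B FixCase s1 (\<lambda>s'. arr s' = arr s1 \<and> reg s' = reg s1 \<and> clock s' <= clock s1 + 40)"
    unfolding FixCase_def using F1 False by (cases "l = 0") (simp_all add: R1 cst sms smL smw)
   then show ?thesis by (rule ht_mono) (use skip cv in blast)
  qed
 qed
qed

text \<open>The potential is nonnegative and falls by at least 1 in each round; its integer part is
  the termination measure, and the potential itself is the time budget.\<close>

lemma Fixup_spec:
 assumes F: "FI s G X"
 shows "ht B Fixup s (\<lambda>s'. FI s' G X \<and> FStep s s' \<and> reg s' 9 = 0 \<and>
  real (clock s') + pot s' G <= real (clock s) + pot s G + 10)"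
proof -
 have G: "graph G" using F Inv0_D(2)[OF Inv_D(1)] unfolding FI_def by blast
 have pn: "0 <= pot s' G" if "FI s' G X" for s'
  using phi_nonneg[OF G] that unfolding FI_def pot_def tau_def by simp
 define W where "W s1 \<longleftrightarrow> FI s1 G X \<and> FStep s s1 \<and> real (clock s1) + pot s1 G <= real (clock s) + pot s G" for s1
 have same: "FI (tick d s1) G X = FI s1 G X" "pot (tick d s1) G = pot s1 G" "FStep (tick d s1) s2 = FStep s1 s2"
  "FStep s2 (tick d s1) = FStep s2 s1" for d s1 s2
  unfolding FI_def pot_def FStep_def Inv_def Inv0_def NZ_def Cst_def J_def cov_def STK_def flags_def eqA_def Mmono_def
  by simp_all
 show ?thesis unfolding Fixup_def
 proof (rule ht_While[where I = W and m = "\<lambda>s1. nat \<lfloor>pot s1 G\<rfloor>"])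
  show "W s" unfolding W_def using F by (simp add: FStep_def eqA_def Mmono_def)
 next
  fix s1 assume w: "W s1" and e: "eval B s1 (Reg 9) ~= 0"
  let ?s = "tick (1 + cost (Reg 9)) s1"
  have F1: "FI ?s G X" using w unfolding W_def same by blast
  show "ht B FixBody ?s (\<lambda>s'. W s' \<and> nat \<lfloor>pot s' G\<rfloor> < nat \<lfloor>pot s1 G\<rfloor>)"
  proof (rule ht_mono[OF FixBody_spec[OF F1]]; (elim conjE)?)
   fix s' assume s': "FI s' G X" "FStep ?s s'" "pot s' G + 1 <= pot ?s G" "real (clock s') + pot s' G + 2 <= real (clock ?s) + pot ?s G"
   have "W s'" unfolding W_def
   proof (intro conjI)
    show "FI s' G X" by (rule s'(1))
    show "FStep s s'" using w s'(2) FStep_trans unfolding W_def same by blast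
    show "real (clock s') + pot s' G <= real (clock s) + pot s G" using s'(4) w unfolding W_def same by simp
   qed
   moreover have "nat \<lfloor>pot s' G\<rfloor> < nat \<lfloor>pot s1 G\<rfloor>" using s'(3) pn[OF s'(1)] unfolding same by linarith
   ultimately show "W s' \<and> nat \<lfloor>pot s' G\<rfloor> < nat \<lfloor>pot s1 G\<rfloor>" by blast
  qed (use e in simp)
 next
  fix s1 assume w: "W s1" and e: "eval B s1 (Reg 9) = 0"
  let ?s = "tick (1 + cost (Reg 9)) s1"
  show "FI ?s G X \<and> FStep s ?s \<and> reg ?s 9 = 0 \<and> real (clock ?s) + pot ?s G <= real (clock s) + pot s G + 10"
   using w e unfolding W_def same by simp
 qed
qed

end

section \<open>Reselecting the colour of a class\<close>

definition SwBody :: com where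
 "SwBody = Seq (Assign 60 (Arr 12 (PE (Reg 13) (Reg 12)))) (Seq (Assign 61 (Arr 21 (PE (Reg 13) (Reg 12))))
   (Seq TryMatch (Assign 12 (Add (Reg 12) (Const 1)))))"

definition Switch2 :: com where
 "Switch2 = Seq (Store 14 (Reg 10) (Reg 53)) (Seq (Assign 12 (Const 0)) (Seq (Assign 13 (PE (Reg 10) (Reg 53)))
   (Seq (Assign 14 (Arr 10 (Reg 13))) (While (Less (Reg 12) (Reg 14)) SwBody))))"

definition Switch :: com where
 "Switch = Seq (Assign 52 (Reg 10)) (Seq (Assign 56 (Add (Reg 11) (Reg 11))) (Seq FindFullest Switch2))"

text \<open>A colour is given up once its share of the class is below \<open>1 / (8 * K)\<close>,
  while the fullest one has at least \<open>1 / (2 * K)\<close>. The new colour is thus at least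
  four times as frequent, and this gap pays for the switch.\<close>

definition SelCond :: exp where
 "SelCond = Less (Mul (Mul (Const 8) (Reg 11)) (Arr 10 (PE (Reg 10) (Arr 14 (Reg 10))))) (Arr 10 (PE (Reg 10) (Const 1)))"

definition SelBody :: com where
 "SelBody = Seq (Assign 11 (Arr 20 (Sub (Reg 10) (Reg 5)))) (Seq (If SelCond Switch Skip) (Assign 10 (Add (Reg 10) (Const 1))))"

definition FixSel :: com where
 "FixSel = Seq (Assign 10 (Const 0)) (While (Less (Reg 10) (Add (Reg 4) (Const 1))) SelBody)"

context bm
begin

text \<open>The invariant without coverage, for the phases in which coverage is only being
  re-established.\<close>

definition NJ :: "state \<Rightarrow> (nat \<times> nat) set \<Rightarrow> nat set \<Rightarrow> bool" where
 "NJ s G X \<longleftrightarrow> Cst s \<and> graph G \<and> MIs s G X \<and> COLs s \<and> LIST (arr s 4) (arr s 5) (arr s 7) (arr s 8) G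
   \<and> arr s 3 = wt (arr s 4) G \<and> NZ s G"

lemma NJ_D: assumes "NJ s G X" shows "Cst s" "graph G" "MIs s G X" "COLs s" "LIST (arr s 4) (arr s 5) (arr s 7) (arr s 8) G"
  "arr s 3 = wt (arr s 4) G" "NZ s G"
 using assms unfolding NJ_def by - (elim conjE, assumption)+

lemma Inv_NJ: "Inv s G X G \<longleftrightarrow> NJ s G X \<and> J s"
proof
 assume I: "Inv s G X G"
 note D = Inv0_D[OF Inv_D(1)[OF I]]
 show "NJ s G X \<and> J s" unfolding NJ_def by (intro conjI D Inv_D(2)[OF I])
next
 assume a: "NJ s G X \<and> J s"
 then have N: "NJ s G X" and j: "J s" by auto
 note D = NJ_D[OF N]
 have "\<forall>a b. (a, b) \<in> G --> (b, a) \<in> G" using graph_D[OF D(2)] by blast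
 then show "Inv s G X G" unfolding Inv_def Inv0_def using D j by simp
qed

lemma NJ_frame: "NJ s G X ==> eqA {1, 14, 15, 16, 17} s s' ==> same 6 s s' ==> MIs s' G X' ==> NJ s' G X'"
proof -
 assume N: "NJ s G X" and e: "eqA {1, 14, 15, 16, 17} s s'" and m: "same 6 s s'" and M: "MIs s' G X'"
 have A: "arr s' a = arr s a" if "a \<notin> {1, 14, 15, 16, 17}" for a by (rule eqA_D[OF e that])
 note D = NJ_D[OF N]
 have "Cst s'" by (rule Cst_mono[OF D(1) m _ e]) auto
 moreover have "NZ s' G" using D(7) unfolding NZ_def by (simp add: A)
 ultimately show ?thesis using D M unfolding NJ_def by (simp add: A)
qed

text \<open>Coverage except on \<open>P\<close>, the pairs that the current loop has still to
  visit.\<close>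

definition JP :: "state \<Rightarrow> (nat \<Rightarrow> nat \<Rightarrow> bool) \<Rightarrow> bool" where
 "JP s P \<longleftrightarrow> (\<forall>x y. arr s 6 (pr x y) ~= 0 --> arr s 6 (pr x y) = arr s 14 (arr s 4 (pr x y)) --> cov s x y \<or> P x y)"

lemma JP_D: "JP s P ==> arr s 6 (pr x y) ~= 0 ==> arr s 6 (pr x y) = arr s 14 (arr s 4 (pr x y)) ==> cov s x y \<or> P x y"
 unfolding JP_def by blast

lemma eqA_step: "eqA F s s' ==> eqA F s' s'' ==> eqA F s s''"
 by (simp add: eqA_def)

lemma tick_frame [simp]:
 "eqA F (tick k s) s' = eqA F s s'" "eqA F s (tick k s') = eqA F s s'"
 "Mmono (tick k s) s' = Mmono s s'" "Mmono s (tick k s') = Mmono s s'"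
 by (simp_all add: eqA_def Mmono_def)

text \<open>Leaves only; the value 0 stands for a class in which no colour has been selected yet.\<close>

definition SELB :: "(nat \<Rightarrow> nat) \<Rightarrow> bool" where
 "SELB sel \<longleftrightarrow> (\<forall>i\<le>L. sel i = 0 \<or> 2 * K i <= sel i \<and> sel i < 4 * K i)"

lemma SELB_sm: "SELB sel ==> i <= L ==> sm (sel i) \<and> sm0 (sel i)"
 using leaf_small[of "sel i" i] unfolding SELB_def by auto

abbreviation "FM \<equiv> {1, 15, 16, 17} :: nat set"

text \<open>\<open>p\<close> separates the visited from the pending places of the colour list. The
  place determines the edge up to orientation, so trying the edge at place \<open>p\<close> covers
  everything that leaves the pending set.\<close>

lemma SwBody_spec:
 assumes N: "NJ s G X" and r: "reg s 13 = pr i l" "reg s 12 = p" and i: "i <= L" and l: "2 * K i <= l" "l < 4 * K i"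
  and p: "p < arr s 10 (pr i l)" and JP: "JP s (\<lambda>x y. arr s 4 (pr x y) = i \<and> p <= arr s 13 (pr x y))" and sel: "arr s 14 i = l"
 shows "ht B SwBody s (\<lambda>s'. NJ s' G X \<and> JP s' (\<lambda>x y. arr s' 4 (pr x y) = i \<and> Suc p <= arr s' 13 (pr x y)) \<and>
  reg s' 12 = Suc p \<and> (\<forall>q<60. q ~= 12 --> reg s' q = reg s q) \<and> eqA FM s s' \<and> Mmono s s' \<and> clock s' <= clock s + 500)"
  (is "ht B _ s ?Q")
proof -
 note D = NJ_D[OF N]
 define x where "x = arr s 12 (pr (pr i l) p)"
 define y where "y = arr s 21 (pr (pr i l) p)"
 have e: "arr s 6 (pr x y) = l" "arr s 4 (pr x y) = i" "arr s 13 (pr x y) = p"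
  using COL_D(8)[OF D(4) conjI[OF p l(1)]] unfolding x_def y_def Let_def by auto
 have l0: "l ~= 0" using l(1) K_pos[of i] by linarith
 have xyG: "(x, y) \<in> G" using D(7) e(1) l0 unfolding NZ_def by auto
 have ls: "sm0 l" "sm0 i" using leaf_small[OF l(2) i] i by simp_all
 have sms: "sm (pr i l)" "sm p" using sm12[OF sm_pr[OF ls(2,1)]] col_sm(2)[OF D(4), of "pr i l"] p by (auto simp: sm_def)
 define s1 where "s1 = tick (1 + cost (Arr 21 (PE (Reg 13) (Reg 12)))) (set_reg 61 y (tick (1 + cost (Arr 12 (PE (Reg 13) (Reg 12)))) (set_reg 60 x s)))"
 have run: "ht B SwBody s Q = ht B (Seq TryMatch (Assign 12 (Add (Reg 12) (Const 1)))) s1 Q" for Q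
  unfolding SwBody_def s1_def by (simp add: r sms x_def y_def)
 have s1: "reg s1 60 = x" "reg s1 61 = y" "reg s1 0 = n" "arr s1 = arr s" "\<And>q. q < 60 ==> reg s1 q = reg s q" "clock s1 <= clock s + 100"
  using D(1) by (simp_all add: s1_def Cst_def)
 show ?thesis unfolding run
 proof (rule ht_Seq[OF TryMatch_spec[OF s1(1-3) D(2) xyG]]; (elim conjE)?)
  show "MIs s1 G X" "\<forall>v<n. arr s1 0 v = c v" using D(1,3) by (simp_all add: s1 Cst_def)
  fix s2 assume s2: "same 60 s1 s2" "eqA FM s1 s2" "clock s2 <= clock s1 + 300" "MIs s2 G X" "Mmono s1 s2" "cov s2 x y"
  have r2: "reg s2 q = reg s q" if "q < 60" for q using same_reg[OF s2(1) that] s1(5)[OF that] by simp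
  define s3 where "s3 = tick (1 + cost (Add (Reg 12) (Const 1))) (set_reg 12 (Suc p) s2)"
  have run3: "ht B (Assign 12 (Add (Reg 12) (Const 1))) s2 Q = Q s3" for Q
   by (simp add: s3_def r2 r sms)
  have a3: "arr s3 = arr s2" "reg s3 12 = Suc p" "\<And>q. q ~= 12 ==> reg s3 q = reg s2 q" "clock s3 = clock s2 + 4" by (simp_all add: s3_def)
  have A: "arr s3 a = arr s a" if "a \<notin> FM" for a using eqA_D[OF s2(2) that] a3(1) s1(4) by simp
  have Mm: "Mmono s s3" using s2(5) unfolding Mmono_def a3(1) s1(4) .
  have M3: "MIs s3 G X" using s2(4) unfolding a3(1) .
  have cv: "cov s3 x y" using s2(6) unfolding cov_def a3(1) .
  have "?Q s3"
  proof (intro conjI)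
   have eq: "eqA {1, 14, 15, 16, 17} s s3" unfolding eqA_def using A by simp
   show "NJ s3 G X" by (rule NJ_frame[OF N eq _ M3]) (simp add: same_def a3 r2)
   show "JP s3 (\<lambda>x y. arr s3 4 (pr x y) = i \<and> Suc p <= arr s3 13 (pr x y))" unfolding JP_def
   proof (intro allI impI)
    fix a b assume h: "arr s3 6 (pr a b) ~= 0" "arr s3 6 (pr a b) = arr s3 14 (arr s3 4 (pr a b))"
    have h': "arr s 6 (pr a b) ~= 0" "arr s 6 (pr a b) = arr s 14 (arr s 4 (pr a b))" using h by (simp_all add: A)
    from JP_D[OF JP h'] show "cov s3 a b \<or> arr s3 4 (pr a b) = i \<and> Suc p <= arr s3 13 (pr a b)"
    proof
     assume "cov s a b" then show ?thesis using Mmono_cov[OF Mm] by blast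
    next
     assume q: "arr s 4 (pr a b) = i \<and> p <= arr s 13 (pr a b)"
     show ?thesis
     proof (cases "arr s 13 (pr a b) = p")
      case False then show ?thesis using q by (simp add: A)
     next
      case True
      have lab: "arr s 6 (pr a b) = l" using h'(2) q sel by simp
      have "a = x \<and> b = y \<or> a = y \<and> b = x"
       by (rule cp_inj[OF D(4)]) (use e lab l0 q True in simp_all)
      then have "cov s3 a b" using cv cov_sym[OF M3 cv] by blast
      then show ?thesis ..
     qed
    qed
   qed
   show "\<forall>q<60. q ~= 12 --> reg s3 q = reg s q" using a3 r2 by simp
   show "eqA FM s s3" unfolding eqA_def using A by blast
   show "clock s3 <= clock s + 500" using a3 s1 s2 by simp
  qed (rule a3 Mm)+
  then show "ht B (Assign 12 (Add (Reg 12) (Const 1))) s2 ?Q" unfolding run3 .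
 qed
qed

text \<open>The contribution of the class drops by the difference of the two colour counts, at least
  three quarters of the new one; the factor 4 avoids fractions.\<close>

lemma pot2_switch:
 assumes i: "i <= L" and le: "CT (pr i l) <= CT (pr i 1)" and lt: "4 * CT (pr i (sel i)) <= CT (pr i l)"
 shows "4 * pot2 CT (sel(i := l)) + 3 * CT (pr i l) <= 4 * pot2 CT sel"
proof -
 have sp: "pot2 CT f = (\<Sum>j\<in>{..L} - {i}. CT (pr j 1) - CT (pr j (f j))) + (CT (pr i 1) - CT (pr i (f i)))" for f
  unfolding pot2_def using i by (subst sum.remove[of _ i]) auto
 have "(\<Sum>j\<in>{..L} - {i}. CT (pr j 1) - CT (pr j ((sel(i := l)) j))) = (\<Sum>j\<in>{..L} - {i}. CT (pr j 1) - CT (pr j (sel j)))"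
  by (rule sum.cong) auto
 then show ?thesis using le lt unfolding sp by simp
qed

lemma SelBody_spec:
 assumes N: "NJ s G X" and J: "J s" and r: "reg s 10 = i" and i: "i <= L" and S: "SELB (arr s 14)"
 shows "ht B SelBody s (\<lambda>s'. NJ s' G X \<and> J s' \<and> SELB (arr s' 14) \<and> reg s' 10 = Suc i \<and> (\<forall>q<10. reg s' q = reg s q) \<and>
  eqA (insert 14 FM) s s' \<and> Mmono s s' \<and> (\<forall>j. j ~= i --> arr s' 14 j = arr s 14 j) \<and>
  arr s' 10 (pr i 1) <= 8 * K i * arr s' 10 (pr i (arr s' 14 i)) \<and>
  clock s' + 1000 * p2 s' <= clock s + 1000 * p2 s + 300 * (L + 3))"
  (is "ht B _ s ?Q")
proof -
 note D = NJ_D[OF N]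
 have kk: "arr s 20 (i - ll) = K i" "reg s 5 = ll" using D(1) i unfolding Cst_def K_def by auto
 define s1 where "s1 = tick (1 + cost (Arr 20 (Sub (Reg 10) (Reg 5)))) (set_reg 11 (K i) s)"
 have run: "ht B SelBody s Q = ht B (Seq (If SelCond Switch Skip) (Assign 10 (Add (Reg 10) (Const 1)))) s1 Q" for Q
  unfolding SelBody_def s1_def by (simp add: r kk del: ht_Seq_If)
 have s1: "arr s1 = arr s" "reg s1 11 = K i" "\<And>q. q ~= 11 ==> reg s1 q = reg s q" "clock s1 = clock s + 5"
  by (simp_all add: s1_def)
 have smi: "sm i" "sm0 i" "sm 1" using i n2 by simp_all
 note sms = SELB_sm[OF S i]
 have K2: "K i <= 2 * n" using K_le[OF i] Ln2 by linarith
 have s8: "sm (8 * K i)" "sm (K i)" "sm (2 * K i)" "sm 8" using K2 n2 by (auto intro!: sm02 simp: sm0_def q0_def)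
 have smc: "sm (arr s 10 j)" for j by (rule col_sm(2)[OF D(4)])
 have ev: "eval B s1 SelCond = (if 8 * K i * arr s 10 (pr i (arr s 14 i)) < arr s 10 (pr i 1) then 1 else 0)"
  unfolding SelCond_def using sms by (simp add: s1 r smi s8 smc)
 have leS: "arr s 10 (pr i m) <= arr s 10 (pr i 1)" for m
 proof -
  have "CS (arr s 4) (arr s 6) i m \<subseteq> CS (arr s 4) (arr s 6) i 1"
  proof
   fix e assume "e \<in> CS (arr s 4) (arr s 6) i m"
   then obtain x y where e: "e = (x, y)" "x < y" "arr s 4 (pr x y) = i" "anc m (arr s 6 (pr x y))" unfolding CS_def by auto
   have "arr s 6 (pr x y) ~= 0" using e(4) by (auto intro: ccontr)
   then have "anc 1 (arr s 6 (pr x y))" by (rule anc_one)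
   then show "e \<in> CS (arr s 4) (arr s 6) i 1" using e unfolding CS_def by simp
  qed
  then show ?thesis unfolding COL_D(6)[OF D(4)] by (intro card_mono CS_fin[OF D(4)])
 qed
 have fin: "ht B (Assign 10 (Add (Reg 10) (Const 1))) s2 ?Q"
  if s2: "NJ s2 G X" "J s2" "SELB (arr s2 14)" "\<forall>q<11. reg s2 q = reg s q" "eqA (insert 14 FM) s s2" "Mmono s s2"
   "\<forall>j. j ~= i --> arr s2 14 j = arr s 14 j" "arr s2 10 (pr i 1) <= 8 * K i * arr s2 10 (pr i (arr s2 14 i))"
   "clock s2 + 1000 * p2 s2 <= clock s + 1000 * p2 s + 290 * (L + 3)" for s2
 proof -
  define s3 where "s3 = tick (1 + cost (Add (Reg 10) (Const 1))) (set_reg 10 (Suc i) s2)"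
  have r10: "reg s2 10 = i" using s2(4) r by simp
  have run3: "ht B (Assign 10 (Add (Reg 10) (Const 1))) s2 Q = Q s3" for Q
   by (simp add: s3_def r10 smi)
  have a3: "arr s3 = arr s2" "reg s3 10 = Suc i" "\<And>q. q ~= 10 ==> reg s3 q = reg s2 q" "clock s3 = clock s2 + 4" by (simp_all add: s3_def)
  have "?Q s3"
  proof (intro conjI)
   show "NJ s3 G X" by (rule NJ_frame[OF s2(1)]) (use NJ_D(3)[OF s2(1)] a3 in \<open>simp_all add: eqA_def same_def\<close>)
   show "J s3" using s2(2) unfolding J_def cov_def a3(1) .
   show "SELB (arr s3 14)" using s2(3) unfolding a3(1) .
   show "\<forall>q<10. reg s3 q = reg s q" using s2(4) a3 by simp
   show "eqA (insert 14 FM) s s3" using s2(5) unfolding eqA_def a3(1) .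
   show "Mmono s s3" using s2(6) unfolding Mmono_def a3(1) .
   show "\<forall>j. j ~= i --> arr s3 14 j = arr s 14 j" using s2(7) unfolding a3(1) .
   show "arr s3 10 (pr i 1) <= 8 * K i * arr s3 10 (pr i (arr s3 14 i))" using s2(8) unfolding a3(1) .
   show "clock s3 + 1000 * p2 s3 <= clock s + 1000 * p2 s + 300 * (L + 3)" using s2(9) unfolding a3(1,4) by simp
  qed (rule a3)
  then show ?thesis unfolding run3 .
 qed
 show ?thesis unfolding run
 proof (cases "8 * K i * arr s 10 (pr i (arr s 14 i)) < arr s 10 (pr i 1)")
  case False
  define s2 where "s2 = tick 1 (tick (1 + cost SelCond) s1)"
  have e0: "eval B s1 SelCond = 0" unfolding ev using False by simp
  have run2: "ht B (Seq (If SelCond Switch Skip) q) s1 Q = ht B q s2 Q" for q Q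
   unfolding ht_Seq_If s2_def by (simp add: e0)
  have a2: "arr s2 = arr s" "\<And>q. q ~= 11 ==> reg s2 q = reg s q" by (simp_all add: s2_def s1)
  have "cost SelCond <= 100" unfolding SelCond_def by simp
  then have c2: "clock s2 <= clock s + 107" by (simp add: s2_def s1)
  show "ht B (Seq (If SelCond Switch Skip) (Assign 10 (Add (Reg 10) (Const 1)))) s1 ?Q" unfolding run2
  proof (rule fin)
   show "NJ s2 G X" by (rule NJ_frame[OF N]) (use D(3) a2 in \<open>simp_all add: eqA_def same_def\<close>)
   show "J s2" using J unfolding J_def cov_def a2(1) .
  qed (use False S a2 c2 in \<open>simp_all add: eqA_def Mmono_def\<close>)
 next
  case True
  define s2 where "s2 = tick (1 + cost (Add (Reg 11) (Reg 11))) (set_reg 56 (2 * K i) (tick (1 + cost (Reg 10)) (set_reg 52 i (tick (1 + cost SelCond) s1))))"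
  have e1: "eval B s1 SelCond ~= 0" unfolding ev using True by simp
  have kk2: "K i + K i = 2 * K i" by simp
  have run2: "ht B (Seq (If SelCond Switch Skip) q) s1 Q = ht B (Seq FindFullest (Seq Switch2 q)) s2 Q" for q Q
   unfolding ht_Seq_If Switch_def s2_def using e1 by (simp add: s1 r s8 kk2)
  have a2: "arr s2 = arr s" "\<And>q. q < 11 ==> reg s2 q = reg s q" "reg s2 52 = i" "reg s2 56 = 2 * K i" by (simp_all add: s2_def s1)
  have "cost SelCond <= 100" unfolding SelCond_def by simp
  then have c2: "clock s2 <= clock s + 120" by (simp add: s2_def s1)
  have h: "K i = 2 ^ (i - ll)" "i - ll <= L" using i by (simp_all add: K_def)
  show "ht B (Seq (If SelCond Switch Skip) (Assign 10 (Add (Reg 10) (Const 1)))) s1 ?Q" unfolding run2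
  proof (rule ht_Seq[OF FindFullest_spec[OF a2(3,4) h smi(1)]]; (elim conjE)?)
   show "sm (arr s2 10 j)" for j unfolding a2 by (rule smc)
   show "arr s2 10 (pr i nd) = arr s2 10 (pr i (2 * nd)) + arr s2 10 (pr i (Suc (2 * nd)))" if "nd ~= 0" "nd < 2 * K i" for nd
    unfolding a2 by (rule CT_child[OF D(4) that])
   fix s3 assume s3: "same 53 s2 s3" "clock s3 <= clock s2 + 100 * (L + 3)" "arr s3 = arr s2"
    "2 * K i <= reg s3 53" "reg s3 53 < 4 * K i" "arr s2 10 (pr i 1) <= 2 * K i * arr s2 10 (pr i (reg s3 53))"
   define l where "l = reg s3 53"
   have l: "2 * K i <= l" "l < 4 * K i" using s3(4,5) unfolding l_def by auto
   have ls: "sm l" "sm0 l" using leaf_small[OF l(2) i] by simp_all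
   define m where "m = arr s 10 (pr i l)"
   have big: "arr s 10 (pr i 1) <= 2 * K i * m" using s3(6) a2(1) unfolding m_def l_def by simp
   have m4: "4 * arr s 10 (pr i (arr s 14 i)) <= m"
   proof (rule ccontr)
    assume "\<not> ?thesis"
    then have "m <= 4 * arr s 10 (pr i (arr s 14 i))" by simp
    then have "2 * K i * m <= 2 * K i * (4 * arr s 10 (pr i (arr s 14 i)))" by (rule mult_left_mono) simp
    also have "\<dots> = 8 * K i * arr s 10 (pr i (arr s 14 i))" by simp
    finally show False using big True by linarith
   qed
   have m1: "1 <= m" using big True by (cases m) auto
   have r3: "reg s3 q = reg s q" if "q < 11" for q using same_reg[OF s3(1), of q] a2(2) that by simp
   have r53: "reg s3 53 = l" by (simp add: l_def)
   have r10: "reg s3 10 = i" using r3 r by simp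
   have ar3: "arr s3 = arr s" using s3(3) a2(1) by simp
   define s4 where "s4 = tick (1 + cost (Arr 10 (Reg 13))) (set_reg 14 m (tick (1 + cost (PE (Reg 10) (Reg 53))) (set_reg 13 (pr i l)
    (tick (1 + cost (Const 0)) (set_reg 12 0 (tick (1 + cost (Reg 10) + cost (Reg 53)) (set_arr 14 i l s3)))))))"
   have run4: "ht B (Seq Switch2 q) s3 Q = ht B (Seq (While (Less (Reg 12) (Reg 14)) SwBody) q) s4 Q" for q Q
    by (simp add: Switch2_def s4_def r10 r53 smi ls ar3 m_def)
   have a4: "arr s4 = (arr s)(14 := (arr s 14)(i := l))" "reg s4 12 = 0" "reg s4 13 = pr i l" "reg s4 14 = m"
    "clock s4 <= clock s3 + 40" by (simp_all add: s4_def ar3)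
   have r4: "reg s4 q = reg s q" if "q < 11" for q using r3[OF that] that by (simp add: s4_def)
   have A4: "arr s4 a = arr s a" if "a ~= 14" for a using that by (simp add: a4(1))
   have A14: "arr s4 14 = (arr s 14)(i := l)" by (simp add: a4(1))
   have N4: "NJ s4 G X" by (rule NJ_frame[OF N]) (use D(3) A4 r4 in \<open>simp_all add: eqA_def same_def\<close>)
   have J4: "JP s4 (\<lambda>x y. arr s4 4 (pr x y) = i \<and> 0 <= arr s4 13 (pr x y))" unfolding JP_def
   proof (intro allI impI)
    fix a b assume h: "arr s4 6 (pr a b) ~= 0" "arr s4 6 (pr a b) = arr s4 14 (arr s4 4 (pr a b))"
    show "cov s4 a b \<or> arr s4 4 (pr a b) = i \<and> 0 <= arr s4 13 (pr a b)"
    proof (cases "arr s 4 (pr a b) = i")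
     case True then show ?thesis by (simp add: A4)
    next
     case False
     then have "cov s a b" using h J unfolding J_def by (simp add: A4 A14)
     then show ?thesis unfolding cov_def by (simp add: A4)
    qed
   qed
   have p4: "4 * p2 s4 + 3 * m <= 4 * p2 s" unfolding A14 A4[of 10, simplified] m_def
    by (rule pot2_switch[where CT = "arr s 10" and sel = "arr s 14" and l = l, OF i leS m4[unfolded m_def]])
   have Sel4: "SELB (arr s4 14)" using S l unfolding SELB_def A14 by simp
   have Q4: "arr s4 10 (pr i 1) <= 8 * K i * arr s4 10 (pr i (arr s4 14 i))"
   proof -
    have "2 * K i * m <= 8 * K i * m" by simp
    then have "arr s 10 (pr i 1) <= 8 * K i * m" using big by linarith
    then show ?thesis by (simp add: A4 A14 m_def)
   qed
   define W where "W s5 \<longleftrightarrow> (\<exists>p \<le> m. reg s5 12 = p \<and> NJ s5 G X \<and> JP s5 (\<lambda>x y. arr s5 4 (pr x y) = i \<and> p <= arr s5 13 (pr x y)) \<and>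
    (\<forall>q<60. q ~= 12 --> reg s5 q = reg s4 q) \<and> eqA FM s4 s5 \<and> Mmono s4 s5 \<and> clock s5 <= clock s4 + 510 * p)" for s5
   show "ht B (Seq Switch2 (Assign 10 (Add (Reg 10) (Const 1)))) s3 ?Q"
    unfolding run4
   proof (rule ht_Seq)
    show "ht B (While (Less (Reg 12) (Reg 14)) SwBody) s4 (\<lambda>s'. \<exists>s5. W s5 \<and> reg s5 12 = m \<and> s' = tick (1 + cost (Less (Reg 12) (Reg 14))) s5)"
    proof (rule ht_While[where I = W and m = "\<lambda>s5. m - reg s5 12"])
     show "W s4" unfolding W_def using N4 J4 a4 by (intro exI[of _ 0]) (simp add: eqA_def Mmono_refl)
    next
     fix s5 assume "W s5" and e: "eval B s5 (Less (Reg 12) (Reg 14)) ~= 0"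
     then obtain p where p: "p <= m" "reg s5 12 = p" "NJ s5 G X" "JP s5 (\<lambda>x y. arr s5 4 (pr x y) = i \<and> p <= arr s5 13 (pr x y))"
      "\<forall>q<60. q ~= 12 --> reg s5 q = reg s4 q" "eqA FM s4 s5" "Mmono s4 s5" "clock s5 <= clock s4 + 510 * p" unfolding W_def by blast
     have r14: "reg s5 14 = m" "reg s5 13 = pr i l" using p(5) a4 by simp_all
     have pm: "p < m" using e p(2) r14 by (simp split: if_splits)
     let ?s = "tick (1 + cost (Less (Reg 12) (Reg 14))) s5"
     have A5: "arr ?s a = arr s4 a" if "a \<notin> FM" for a using eqA_D[OF p(6) that] by simp
     have N5: "NJ ?s G X" by (rule NJ_frame[OF p(3)]) (use NJ_D(3)[OF p(3)] in \<open>simp_all add: eqA_def same_def\<close>)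
     have J5: "JP ?s (\<lambda>x y. arr ?s 4 (pr x y) = i \<and> p <= arr ?s 13 (pr x y))" using p(4) unfolding JP_def cov_def by simp
     have r5: "reg ?s 13 = pr i l" "reg ?s 12 = p" using r14 p(2) by simp_all
     have p5: "p < arr ?s 10 (pr i l)" "arr ?s 14 i = l" using pm A5[of 10] A4[of 10] A5[of 14] A14 unfolding m_def by simp_all
     show "ht B SwBody ?s (\<lambda>s'. W s' \<and> m - reg s' 12 < m - reg s5 12)"
     proof (rule ht_mono[OF SwBody_spec[OF N5 r5 i l p5(1) J5 p5(2)]], elim conjE)
      fix s' assume s': "NJ s' G X" "JP s' (\<lambda>x y. arr s' 4 (pr x y) = i \<and> Suc p <= arr s' 13 (pr x y))"
       "reg s' 12 = Suc p" "\<forall>q<60. q ~= 12 --> reg s' q = reg ?s q" "eqA FM ?s s'" "Mmono ?s s'" "clock s' <= clock ?s + 500"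
      have "W s'" unfolding W_def
      proof (intro exI[of _ "Suc p"] conjI)
       show "\<forall>q<60. q ~= 12 --> reg s' q = reg s4 q" using s'(4) p(5) by simp
       show "eqA FM s4 s'" using eqA_step[OF p(6)] s'(5) by simp
       show "Mmono s4 s'" using Mmono_trans[OF p(7)] s'(6) by simp
       show "clock s' <= clock s4 + 510 * Suc p" using s'(7) p(8) by simp
      qed (rule s' Suc_leI pm)+
      then show "W s' \<and> m - reg s' 12 < m - reg s5 12" using s'(3) p(2) pm by simp
     qed
    next
     fix s5 assume w: "W s5" and e: "eval B s5 (Less (Reg 12) (Reg 14)) = 0"
     obtain p where p: "p <= m" "reg s5 12 = p" "\<forall>q<60. q ~= 12 --> reg s5 q = reg s4 q" using w unfolding W_def by blast
     have "reg s5 14 = m" using p(3) a4 by simp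
     then have "reg s5 12 = m" using e p by (simp split: if_splits)
     then show "\<exists>s5'. W s5' \<and> reg s5' 12 = m \<and> tick (1 + cost (Less (Reg 12) (Reg 14))) s5 = tick (1 + cost (Less (Reg 12) (Reg 14))) s5'"
      using w by blast
    qed
   next
    fix s6 assume "\<exists>s5. W s5 \<and> reg s5 12 = m \<and> s6 = tick (1 + cost (Less (Reg 12) (Reg 14))) s5"
    then obtain s5 where w: "W s5" "reg s5 12 = m" "s6 = tick (1 + cost (Less (Reg 12) (Reg 14))) s5" by blast
    from w(1) obtain p where p': "reg s5 12 = p" "NJ s5 G X" "JP s5 (\<lambda>x y. arr s5 4 (pr x y) = i \<and> p <= arr s5 13 (pr x y))"
      "\<forall>q<60. q ~= 12 --> reg s5 q = reg s4 q" "eqA FM s4 s5" "Mmono s4 s5" "clock s5 <= clock s4 + 510 * p" unfolding W_def by blast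
    have pm: "p = m" using p'(1) w(2) by simp
    note p = p'[unfolded pm]
    have a6: "arr s6 = arr s5" "reg s6 = reg s5" "clock s6 = clock s5 + 4" by (simp_all add: w(3))
    have A5: "arr s5 a = arr s4 a" if "a \<notin> FM" for a by (rule eqA_D[OF p(5) that])
    have A5s: "arr s5 a = arr s a" if "a \<notin> insert 14 FM" for a using A5 A4 that by simp
    show "ht B (Assign 10 (Add (Reg 10) (Const 1))) s6 ?Q"
    proof (rule fin)
     show "NJ s6 G X" by (rule NJ_frame[OF p(2)]) (use NJ_D(3)[OF p(2)] a6 in \<open>simp_all add: eqA_def same_def\<close>)
     have "J s5" unfolding J_def
     proof (intro allI impI)
      fix a b assume h: "arr s5 6 (pr a b) ~= 0" "arr s5 6 (pr a b) = arr s5 14 (arr s5 4 (pr a b))"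
      from JP_D[OF p(3) h] show "cov s5 a b"
      proof
       assume q: "arr s5 4 (pr a b) = i \<and> m <= arr s5 13 (pr a b)"
       have "arr s5 14 i = l" using A5[of 14] A14 by simp
       then have lab: "arr s5 6 (pr a b) = l" using h(2) q by simp
       have "arr s5 13 (pr a b) < arr s5 10 (pr (arr s5 4 (pr a b)) (arr s5 6 (pr a b)))"
        using COL_D(7)[OF NJ_D(4)[OF p(2)] h(1)] by blast
       then have "arr s5 13 (pr a b) < arr s5 10 (pr i l)" unfolding lab using q by simp
       then show ?thesis using q A5s[of 10] unfolding m_def by simp
      qed
     qed
     then show "J s6" unfolding J_def cov_def a6(1) .
     show "SELB (arr s6 14)" using Sel4 A5[of 14] unfolding a6(1) by simp
     show "\<forall>q<11. reg s6 q = reg s q" unfolding a6(2) using p(4) r4 by simp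
     show "eqA (insert 14 FM) s s6" unfolding eqA_def a6(1) using A5s by blast
     have "Mmono s s4" unfolding Mmono_def by (simp add: A4)
     from Mmono_trans[OF this p(6)] show "Mmono s s6" unfolding Mmono_def a6(1) .
     show "\<forall>j. j ~= i --> arr s6 14 j = arr s 14 j" unfolding a6(1) using A5[of 14] A14 by simp
     show "arr s6 10 (pr i 1) <= 8 * K i * arr s6 10 (pr i (arr s6 14 i))" unfolding a6(1) using Q4 A5[of 10] A5[of 14] by simp
     have "p2 s6 = p2 s4" unfolding a6(1) using A5[of 10] A5[of 14] by simp
     \<comment> \<open>The drop of \<open>pot2\<close> is worth 750 for each edge of the new colour,
       against 510 charged for each round of the loop. The descent to the fullest colour is covered
       by the term in \<open>L + 3\<close>.\<close>
     then show "clock s6 + 1000 * p2 s6 <= clock s + 1000 * p2 s + 290 * (L + 3)"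
      using p(7) p4 a6(3) a4(5) s3(2) c2 m1 by simp
    qed
   qed
  qed
 qed
qed

text \<open>All \<open>L + 1\<close> classes are examined after every update, each at cost
  \<open>O(L)\<close> including a possible descent; this is the quadratic term. The loops over
  colour lists are paid for by \<open>pot2\<close>.\<close>

lemma FixSel_spec:
 assumes N: "NJ s G X" and J: "J s" and S: "SELB (arr s 14)"
 shows "ht B FixSel s (\<lambda>s'. NJ s' G X \<and> J s' \<and> SELB (arr s' 14) \<and> (\<forall>q<10. reg s' q = reg s q) \<and>
  eqA (insert 14 FM) s s' \<and> Mmono s s' \<and>
  (\<forall>i\<le>L. arr s' 10 (pr i 1) <= 8 * K i * arr s' 10 (pr i (arr s' 14 i))) \<and>
  clock s' + 1000 * p2 s' <= clock s + 1000 * p2 s + 320 * (L + 3) * (L + 3))"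
  (is "ht B _ s ?Q")
proof -
 define W where "W s1 \<longleftrightarrow> (\<exists>i \<le> Suc L. reg s1 10 = i \<and> NJ s1 G X \<and> J s1 \<and> SELB (arr s1 14) \<and> (\<forall>q<10. reg s1 q = reg s q) \<and>
  eqA (insert 14 FM) s s1 \<and> Mmono s s1 \<and>
  (\<forall>j<i. arr s1 10 (pr j 1) <= 8 * K j * arr s1 10 (pr j (arr s1 14 j))) \<and>
  clock s1 + 1000 * p2 s1 <= clock s + 1000 * p2 s + 10 + 310 * (L + 3) * i)" for s1
 have smL: "sm L" by simp
 have ev: "eval B s1 (Less (Reg 10) (Add (Reg 4) (Const 1))) = (if reg s1 10 < Suc L then 1 else 0)" if "Cst s1" for s1
  using that smL by (simp add: Cst_def)
 have "ht B FixSel s (\<lambda>s'. \<exists>s1. W s1 \<and> reg s1 10 = Suc L \<and> s' = tick (1 + cost (Less (Reg 10) (Add (Reg 4) (Const 1)))) s1)"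
  unfolding FixSel_def ht_Seq_Assign
 proof (rule ht_While[where I = W and m = "\<lambda>s1. Suc L - reg s1 10"])
  let ?s = "tick (1 + cost (Const 0)) (set_reg 10 (eval B s (Const 0)) s)"
  have "NJ ?s G X" by (rule NJ_frame[OF N]) (use NJ_D(3)[OF N] in \<open>simp_all add: eqA_def same_def\<close>)
  moreover have "J ?s" using J unfolding J_def cov_def by simp
  ultimately show "W ?s" unfolding W_def using S by (intro exI[of _ 0]) (simp add: eqA_def Mmono_def)
 next
  fix s1 assume "W s1" and e: "eval B s1 (Less (Reg 10) (Add (Reg 4) (Const 1))) ~= 0"
  then obtain i where w: "i <= Suc L" "reg s1 10 = i" "NJ s1 G X" "J s1" "SELB (arr s1 14)" "\<forall>q<10. reg s1 q = reg s q"
   "eqA (insert 14 FM) s s1" "Mmono s s1" "\<forall>j<i. arr s1 10 (pr j 1) <= 8 * K j * arr s1 10 (pr j (arr s1 14 j))"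
   "clock s1 + 1000 * p2 s1 <= clock s + 1000 * p2 s + 10 + 310 * (L + 3) * i" unfolding W_def by blast
  have iL: "i <= L" using e w(2) unfolding ev[OF NJ_D(1)[OF w(3)]] by (simp split: if_splits)
  let ?s = "tick (1 + cost (Less (Reg 10) (Add (Reg 4) (Const 1)))) s1"
  have N1: "NJ ?s G X" by (rule NJ_frame[OF w(3)]) (use NJ_D(3)[OF w(3)] in \<open>simp_all add: eqA_def same_def\<close>)
  have J1: "J ?s" using w(4) unfolding J_def cov_def by simp
  have r1: "reg ?s 10 = i" and S1: "SELB (arr ?s 14)" using w by simp_all
  show "ht B SelBody ?s (\<lambda>s'. W s' \<and> Suc L - reg s' 10 < Suc L - reg s1 10)"
  proof (rule ht_mono[OF SelBody_spec[OF N1 J1 r1 iL S1]], elim conjE)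
   fix s' assume s': "NJ s' G X" "J s'" "SELB (arr s' 14)" "reg s' 10 = Suc i" "\<forall>q<10. reg s' q = reg ?s q"
    "eqA (insert 14 FM) ?s s'" "Mmono ?s s'" "\<forall>j. j ~= i --> arr s' 14 j = arr ?s 14 j"
    "arr s' 10 (pr i 1) <= 8 * K i * arr s' 10 (pr i (arr s' 14 i))"
    "clock s' + 1000 * p2 s' <= clock ?s + 1000 * p2 ?s + 300 * (L + 3)"
   have A: "arr s' 10 = arr s1 10" using eqA_D[OF s'(6), of 10] by simp
   have "W s'" unfolding W_def
   proof (intro exI[of _ "Suc i"] conjI)
    show "\<forall>q<10. reg s' q = reg s q" using s'(5) w(6) by simp
    show "eqA (insert 14 FM) s s'" using eqA_step[OF w(7)] s'(6) by simp
    show "Mmono s s'" using Mmono_trans[OF w(8)] s'(7) by simp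
    show "\<forall>j<Suc i. arr s' 10 (pr j 1) <= 8 * K j * arr s' 10 (pr j (arr s' 14 j))"
    proof (intro allI impI)
     fix j assume "j < Suc i"
     show "arr s' 10 (pr j 1) <= 8 * K j * arr s' 10 (pr j (arr s' 14 j))"
     proof (cases "j = i")
      case True then show ?thesis using s'(9) by simp
     next
      case False
      then have "arr s' 14 j = arr s1 14 j" "j < i" using s'(8) \<open>j < Suc i\<close> by simp_all
      then show ?thesis using w(9) unfolding A by simp
     qed
    qed
    show "clock s' + 1000 * p2 s' <= clock s + 1000 * p2 s + 10 + 310 * (L + 3) * Suc i" using s'(10) w(10) by simp
   qed (rule s' iL Suc_le_mono[THEN iffD2])+
   then show "W s' \<and> Suc L - reg s' 10 < Suc L - reg s1 10" using s'(4) w(2) iL by simp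
  qed
 next
  fix s1 assume w: "W s1" and e: "eval B s1 (Less (Reg 10) (Add (Reg 4) (Const 1))) = 0"
  obtain i where i: "i <= Suc L" "reg s1 10 = i" "NJ s1 G X" using w unfolding W_def by blast
  have "reg s1 10 = Suc L" using e i unfolding ev[OF NJ_D(1)[OF i(3)]] by (simp split: if_splits)
  then show "\<exists>s1'. W s1' \<and> reg s1' 10 = Suc L \<and> tick (1 + cost (Less (Reg 10) (Add (Reg 4) (Const 1)))) s1
   = tick (1 + cost (Less (Reg 10) (Add (Reg 4) (Const 1)))) s1'" using w by blast
 qed
 then show ?thesis
 proof (rule ht_mono, elim exE conjE)
  fix s' s1 assume w: "W s1" "reg s1 10 = Suc L" "s' = tick (1 + cost (Less (Reg 10) (Add (Reg 4) (Const 1)))) s1"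
  from w(1) obtain i where q': "reg s1 10 = i" "NJ s1 G X" "J s1" "SELB (arr s1 14)" "\<forall>q<10. reg s1 q = reg s q"
   "eqA (insert 14 FM) s s1" "Mmono s s1" "\<forall>j<i. arr s1 10 (pr j 1) <= 8 * K j * arr s1 10 (pr j (arr s1 14 j))"
   "clock s1 + 1000 * p2 s1 <= clock s + 1000 * p2 s + 10 + 310 * (L + 3) * i" unfolding W_def by blast
  have iL: "i = Suc L" using q'(1) w(2) by simp
  note q = q'[unfolded iL]
  have a: "arr s' = arr s1" "reg s' = reg s1" "clock s' = clock s1 + 6" by (simp_all add: w(3))
  show "?Q s'"
  proof (intro conjI)
   show "NJ s' G X" by (rule NJ_frame[OF q(2)]) (use NJ_D(3)[OF q(2)] a in \<open>simp_all add: eqA_def same_def\<close>)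
   show "J s'" using q(3) unfolding J_def cov_def a(1) .
   show "SELB (arr s' 14)" using q(4) unfolding a(1) .
   show "\<forall>q<10. reg s' q = reg s q" using q(5) unfolding a(2) .
   show "eqA (insert 14 FM) s s'" using q(6) unfolding eqA_def a(1) .
   show "Mmono s s'" using q(7) unfolding Mmono_def a(1) .
   show "\<forall>i\<le>L. arr s' 10 (pr i 1) <= 8 * K i * arr s' 10 (pr i (arr s' 14 i))" using q(8) unfolding a(1) by simp
   have "310 * (L + 3) * Suc L + 20 <= 320 * (L + 3) * (L + 3)" by (simp add: algebra_simps)
   then show "clock s' + 1000 * p2 s' <= clock s + 1000 * p2 s + 320 * (L + 3) * (L + 3)" using q(9) unfolding a(1,3) by linarith
  qed
 qed
qed

end

section \<open>Scanning a vertex whose mark is withdrawn\<close>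

text \<open>Array 11 gives at once the only neighbour in the slot along the selected colour. It
  reads 0 when there is none, and also when the class has no selected colour.\<close>

definition ScanS :: com where
 "ScanS = Seq (Assign 13 (Arr 11 (PE (PE (Reg 8) (PE (Reg 10) (Reg 12))) (Arr 14 (Reg 10)))))
   (Seq (If (Reg 13) (Seq (Assign 60 (Reg 8)) (Seq (Assign 61 (Sub (Reg 13) (Const 1))) TryMatch)) Skip)
    (Assign 12 (Add (Reg 12) (Const 1))))"

definition ScanI :: com where
 "ScanI = Seq (Assign 11 (Arr 20 (Sub (Reg 10) (Reg 5)))) (Seq (Assign 12 (Const 0)) (Seq (Assign 14 (Arr 8 (PE (Reg 8) (Reg 10))))
   (Seq (While (Less (Mul (Reg 12) (Reg 11)) (Reg 14)) ScanS) (Assign 10 (Add (Reg 10) (Const 1))))))"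

definition Scan :: com where
 "Scan = Seq (Assign 10 (Const 0)) (While (Less (Reg 10) (Add (Reg 4) (Const 1))) ScanI)"

definition Unfull :: com where
 "Unfull = If (Arr 17 (Reg 8)) (If (Less (Mul (Const 2) (Arr 16 (Reg 8))) (Arr 0 (Reg 8)))
   (Seq (Store 17 (Reg 8) (Const 0)) Scan) Skip) Skip"

context bm
begin

text \<open>The slots of vertex \<open>x\<close> that the scan has still to visit when it is at slot \<open>\<sigma>\<close> of class \<open>i\<close>.\<close>

definition todo :: "(nat \<Rightarrow> nat) \<Rightarrow> (nat \<Rightarrow> nat) \<Rightarrow> nat \<Rightarrow> nat \<Rightarrow> nat \<Rightarrow> nat \<Rightarrow> bool" where
 "todo cl ps x i \<sigma> y \<longleftrightarrow> i < cl (pr x y) \<or> cl (pr x y) = i \<and> \<sigma> <= ps (pr x y) div K i"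

definition PD :: "state \<Rightarrow> nat \<Rightarrow> nat \<Rightarrow> nat \<Rightarrow> nat \<Rightarrow> nat \<Rightarrow> bool" where
 "PD s x i \<sigma> a b \<longleftrightarrow> a = x \<and> todo (arr s 4) (arr s 5) x i \<sigma> b \<or> b = x \<and> todo (arr s 4) (arr s 5) x i \<sigma> a"

text \<open>Of the pairs leaving the pending set, those of the sparse graph lie in slot
  \<open>\<sigma>\<close> and have its selected colour; properness leaves just one such neighbour,
  and \<open>cv\<close> covers it. The pending set is symmetric, hence the two orientations.\<close>

lemma JP_scan:
 assumes N: "NJ s G X" and JP: "JP s (PD s x i \<sigma>)"
  and A: "arr s' 4 = arr s 4" "arr s' 5 = arr s 5" "arr s' 6 = arr s 6" "arr s' 14 = arr s 14"
  and Mm: "Mmono s s'" and M: "MIs s' G X"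
  and cv: "\<And>y. arr s 11 (pr (pr x (pr i \<sigma>)) (arr s 14 i)) = Suc y ==> cov s' x y"
 shows "JP s' (PD s' x i (Suc \<sigma>))"
 unfolding JP_def
proof (intro allI impI)
 have key: "cov s' x y \<or> todo (arr s 4) (arr s 5) x i (Suc \<sigma>) y"
  if h: "arr s 6 (pr x y) ~= 0" "arr s 6 (pr x y) = arr s 14 (arr s 4 (pr x y))" and t: "todo (arr s 4) (arr s 5) x i \<sigma> y" for y
 proof (cases "arr s 4 (pr x y) = i \<and> arr s 5 (pr x y) div K i = \<sigma>")
  case True
  then have "slot (arr s 4) (arr s 5) x y = pr x (pr i \<sigma>)" "arr s 6 (pr x y) = arr s 14 i" using h(2) by (simp_all add: slot_def)
  then show ?thesis using COL_D(3)[OF NJ_D(4)[OF N] h(1)] cv[of y] by simp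
 next
  case False
  then show ?thesis using t unfolding todo_def by auto
 qed
 fix a b assume h': "arr s' 6 (pr a b) ~= 0" "arr s' 6 (pr a b) = arr s' 14 (arr s' 4 (pr a b))"
 then have h: "arr s 6 (pr a b) ~= 0" "arr s 6 (pr a b) = arr s 14 (arr s 4 (pr a b))" unfolding A by simp_all
 from JP_D[OF JP h] show "cov s' a b \<or> PD s' x i (Suc \<sigma>) a b"
 proof
  assume "cov s a b" then show ?thesis using Mmono_cov[OF Mm] by blast
 next
  assume "PD s x i \<sigma> a b"
  then show ?thesis unfolding PD_def A
  proof (elim disjE conjE)
   assume e: "a = x" and t: "todo (arr s 4) (arr s 5) x i \<sigma> b"
   show "cov s' a b \<or> a = x \<and> todo (arr s 4) (arr s 5) x i (Suc \<sigma>) b \<or> b = x \<and> todo (arr s 4) (arr s 5) x i (Suc \<sigma>) a"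
    using key[OF h[unfolded e] t] e by auto
  next
   assume e: "b = x" and t: "todo (arr s 4) (arr s 5) x i \<sigma> a"
   have "arr s 6 (pr b a) = arr s 6 (pr a b)" by (rule COL_D(1)[OF NJ_D(4)[OF N]])
   moreover have "arr s 4 (pr b a) = arr s 4 (pr a b)" using COL_D(2)[OF NJ_D(4)[OF N] h(1)] by simp
   ultimately have "arr s 6 (pr x a) ~= 0" "arr s 6 (pr x a) = arr s 14 (arr s 4 (pr x a))" using h e by simp_all
   from key[OF this t] show "cov s' a b \<or> a = x \<and> todo (arr s 4) (arr s 5) x i (Suc \<sigma>) b \<or> b = x \<and> todo (arr s 4) (arr s 5) x i (Suc \<sigma>) a"
   proof
    assume "cov s' x a"
    then have "cov s' a x" by (rule cov_sym[OF M])
    then show ?thesis using e by simp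
   qed (simp add: e)
  qed
 qed
qed

text \<open>A pair of class \<open>i\<close> in slot \<open>\<sigma>\<close> or later would have a
  position beyond the end of the list.\<close>

lemma PD_next:
 assumes N: "NJ s G X" and JP: "JP s (PD s x i \<sigma>)" and le: "arr s 8 (pr x i) <= \<sigma> * K i"
 shows "JP s (PD s x (Suc i) 0)"
 unfolding JP_def
proof (intro allI impI)
 have key: "todo (arr s 4) (arr s 5) x (Suc i) 0 y" if e: "(x, y) \<in> G" and t: "todo (arr s 4) (arr s 5) x i \<sigma> y" for y
 proof (cases "arr s 4 (pr x y) = i \<and> \<sigma> <= arr s 5 (pr x y) div K i")
  case True
  have "arr s 5 (pr x y) < arr s 8 (pr x (arr s 4 (pr x y)))" using LIST_1[OF NJ_D(5)[OF N] e] by simp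
  then have 1: "arr s 5 (pr x y) < arr s 8 (pr x i)" using True by simp
  have "\<sigma> * K i <= arr s 5 (pr x y) div K i * K i" using True by (intro mult_right_mono) simp_all
  also have "\<dots> <= arr s 5 (pr x y)" by simp
  finally show ?thesis using 1 le by simp
 next
  case False
  then show ?thesis using t unfolding todo_def by auto
 qed
 fix a b assume h: "arr s 6 (pr a b) ~= 0" "arr s 6 (pr a b) = arr s 14 (arr s 4 (pr a b))"
 have ab: "(a, b) \<in> G" using NJ_D(7)[OF N] h(1) unfolding NZ_def by blast
 have ba: "(b, a) \<in> G" using graph_D[OF NJ_D(2)[OF N] ab] by simp
 from JP_D[OF JP h] show "cov s a b \<or> PD s x (Suc i) 0 a b"
 proof
  assume "PD s x i \<sigma> a b"
  then show ?thesis using key[of a] key[of b] ab ba unfolding PD_def by auto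
 qed simp
qed

lemma ScanS_spec:
 assumes N: "NJ s G X" and r: "reg s 8 = x" "reg s 10 = i" "reg s 12 = \<sigma>" and x: "x < n" and i: "i <= L"
  and s: "\<sigma> <= n" and S: "SELB (arr s 14)" and JP: "JP s (PD s x i \<sigma>)"
 shows "ht B ScanS s (\<lambda>s'. NJ s' G X \<and> JP s' (PD s' x i (Suc \<sigma>)) \<and> reg s' 12 = Suc \<sigma> \<and>
  (\<forall>q<60. q ~= 12 --> q ~= 13 --> reg s' q = reg s q) \<and> eqA FM s s' \<and> Mmono s s' \<and> clock s' <= clock s + 480)"
  (is "ht B _ s ?Q")
proof -
 note D = NJ_D[OF N]
 define w where "w = arr s 11 (pr (pr x (pr i \<sigma>)) (arr s 14 i))"
 have sms: "sm0 x" "sm0 i" "sm0 \<sigma>" "sm (arr s 14 i)" using x i s SELB_sm[OF S i] by simp_all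
 have sms2: "sm (pr i \<sigma>)" "sm (pr x (pr i \<sigma>))" "sm x" "sm i" "sm \<sigma>"
  using sm12[OF sm_pr[OF sms(2,3)]] sm_pr1[OF sm01[OF sms(1)] sm_pr[OF sms(2,3)]] sms by simp_all
 define s1 where "s1 = tick (1 + cost (Arr 11 (PE (PE (Reg 8) (PE (Reg 10) (Reg 12))) (Arr 14 (Reg 10))))) (set_reg 13 w s)"
 have run: "ht B ScanS s Q = ht B (Seq (If (Reg 13) (Seq (Assign 60 (Reg 8)) (Seq (Assign 61 (Sub (Reg 13) (Const 1))) TryMatch)) Skip)
    (Assign 12 (Add (Reg 12) (Const 1)))) s1 Q" for Q
  unfolding ScanS_def s1_def using sms sms2 by (simp add: r w_def del: ht_Seq_If)
 have s1: "arr s1 = arr s" "reg s1 13 = w" "\<And>q. q ~= 13 ==> reg s1 q = reg s q" "clock s1 <= clock s + 130"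
  by (simp_all add: s1_def)
 have fin: "ht B (Assign 12 (Add (Reg 12) (Const 1))) s2 ?Q"
  if s2: "\<forall>q<60. q ~= 13 --> reg s2 q = reg s q" "eqA FM s s2" "Mmono s s2" "MIs s2 G X" "clock s2 <= clock s + 470"
   "\<And>y. w = Suc y ==> cov s2 x y" for s2
 proof -
  define s3 where "s3 = tick (1 + cost (Add (Reg 12) (Const 1))) (set_reg 12 (Suc \<sigma>) s2)"
  have r12: "reg s2 12 = \<sigma>" using s2(1) r by simp
  have run3: "ht B (Assign 12 (Add (Reg 12) (Const 1))) s2 Q = Q s3" for Q
   using sms2 by (simp add: s3_def r12)
  have a3: "arr s3 = arr s2" "reg s3 12 = Suc \<sigma>" "\<And>q. q ~= 12 ==> reg s3 q = reg s2 q" "clock s3 = clock s2 + 4" by (simp_all add: s3_def)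
  have A: "arr s3 a = arr s a" if "a \<notin> FM" for a using eqA_D[OF s2(2) that] a3(1) by simp
  have Mm: "Mmono s s3" using s2(3) unfolding Mmono_def a3(1) .
  have M3: "MIs s3 G X" using s2(4) unfolding a3(1) .
  have "?Q s3"
  proof (intro conjI)
   have "eqA {1, 14, 15, 16, 17} s s3" unfolding eqA_def using A by simp
   then show "NJ s3 G X" by (rule NJ_frame[OF N _ _ M3]) (use a3 s2(1) in \<open>simp add: same_def\<close>)
   show "JP s3 (PD s3 x i (Suc \<sigma>))"
    by (rule JP_scan[OF N JP A A A A Mm M3]) (use s2(6) in \<open>simp_all add: w_def cov_def a3(1)\<close>)
   show "\<forall>q<60. q ~= 12 --> q ~= 13 --> reg s3 q = reg s q" using a3 s2(1) by simp
   show "eqA FM s s3" unfolding eqA_def using A by blast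
   show "clock s3 <= clock s + 480" using a3 s2(5) by simp
  qed (rule a3 Mm)+
  then show ?thesis unfolding run3 .
 qed
 show ?thesis unfolding run
 proof (cases w)
  case 0
  define s2 where "s2 = tick 1 (tick (1 + cost (Reg 13)) s1)"
  have run2: "ht B (Seq (If (Reg 13) p Skip) q) s1 Q = ht B q s2 Q" for p q Q by (simp add: s2_def s1 0)
  have a2: "arr s2 = arr s" "reg s2 = reg s1" "clock s2 = clock s1 + 3" by (simp_all add: s2_def s1)
  show "ht B (Seq (If (Reg 13) (Seq (Assign 60 (Reg 8)) (Seq (Assign 61 (Sub (Reg 13) (Const 1))) TryMatch)) Skip)
    (Assign 12 (Add (Reg 12) (Const 1)))) s1 ?Q" unfolding run2
   by (rule fin) (use 0 a2 s1 D(3) in \<open>simp_all add: eqA_def Mmono_def\<close>)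
 next
  case (Suc y)
  have w0: "arr s 11 (pr (pr x (pr i \<sigma>)) (arr s 14 i)) ~= 0" using Suc unfolding w_def by simp
  have xy: "(x, y) \<in> G"
  proof -
   obtain a b where ab: "slot (arr s 4) (arr s 5) a b = pr x (pr i \<sigma>)" "arr s 6 (pr a b) = arr s 14 i" "arr s 14 i ~= 0" "w = Suc b"
    using COL_D(4)[OF D(4) w0] unfolding w_def by blast
   have "a = x" using ab(1) by (simp add: slot_def)
   moreover have "b = y" using ab(4) Suc by simp
   ultimately have "arr s 6 (pr x y) ~= 0" using ab(2,3) by simp
   then show ?thesis using D(7) unfolding NZ_def by blast
  qed
  define s2 where "s2 = tick (1 + cost (Sub (Reg 13) (Const 1))) (set_reg 61 y (tick (1 + cost (Reg 8)) (set_reg 60 x (tick (1 + cost (Reg 13)) s1))))"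
  have run2: "ht B (Seq (If (Reg 13) (Seq (Assign 60 (Reg 8)) (Seq (Assign 61 (Sub (Reg 13) (Const 1))) TryMatch)) Skip) q) s1 Q
   = ht B (Seq TryMatch q) s2 Q" for q Q by (simp add: s2_def s1 Suc r)
  have a2: "arr s2 = arr s" "reg s2 60 = x" "reg s2 61 = y" "reg s2 0 = n" "\<And>q. q < 60 ==> q ~= 13 ==> reg s2 q = reg s q" "clock s2 <= clock s + 140"
   using D(1) s1 by (simp_all add: s2_def Cst_def)
  show "ht B (Seq (If (Reg 13) (Seq (Assign 60 (Reg 8)) (Seq (Assign 61 (Sub (Reg 13) (Const 1))) TryMatch)) Skip)
    (Assign 12 (Add (Reg 12) (Const 1)))) s1 ?Q" unfolding run2
  proof (rule ht_Seq[OF TryMatch_spec[OF a2(2-4) D(2) xy]]; (elim conjE)?)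
   show "MIs s2 G X" "\<forall>v<n. arr s2 0 v = c v" using D(1,3) by (simp_all add: a2 Cst_def)
   fix s3 assume s3: "same 60 s2 s3" "eqA FM s2 s3" "clock s3 <= clock s2 + 300" "MIs s3 G X" "Mmono s2 s3" "cov s3 x y"
   show "ht B (Assign 12 (Add (Reg 12) (Const 1))) s3 ?Q"
   proof (rule fin)
    show "\<forall>q<60. q ~= 13 --> reg s3 q = reg s q" using same_reg[OF s3(1)] a2(5) by simp
    show "eqA FM s s3" using s3(2) unfolding eqA_def a2(1) .
    show "Mmono s s3" using s3(5) unfolding Mmono_def a2(1) .
    show "MIs s3 G X" by (rule s3(4))
    show "clock s3 <= clock s + 470" using s3(3) a2(6) by simp
    show "cov s3 x z" if "w = Suc z" for z using that Suc s3(6) by simp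
   qed
  qed
 qed
qed

text \<open>The invariant \<open>\<sigma> * K i <= len + K i\<close> bounds the number of visited
  slots by \<open>len / K i + 1\<close>. The rounding is absorbed in the additive constant.\<close>

lemma ScanI_spec:
 assumes N: "NJ s G X" and r: "reg s 8 = x" "reg s 10 = i" and x: "x < n" and i: "i <= L"
  and S: "SELB (arr s 14)" and JP: "JP s (PD s x i 0)"
 shows "ht B ScanI s (\<lambda>s'. NJ s' G X \<and> JP s' (PD s' x (Suc i) 0) \<and> reg s' 10 = Suc i \<and>
  (\<forall>q<10. reg s' q = reg s q) \<and> eqA FM s s' \<and> Mmono s s' \<and>
  real (clock s') <= real (clock s) + 500 * (real (arr s 8 (pr x i)) / real (K i)) + 590)"
  (is "ht B _ s ?Q")
proof -
 note D = NJ_D[OF N]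
 define len where "len = arr s 8 (pr x i)"
 have lenn: "len <= n" unfolding len_def by (rule LIST_ln[OF D(5)])
 have kk: "arr s 20 (i - ll) = K i" "reg s 5 = ll" using D(1) i unfolding Cst_def K_def by auto
 have K2: "K i <= 2 * n" using K_le[OF i] Ln2 by linarith
 have sms: "sm x" "sm i" using x i by simp_all
 define s1 where "s1 = tick (1 + cost (Arr 8 (PE (Reg 8) (Reg 10)))) (set_reg 14 len (tick (1 + cost (Const 0)) (set_reg 12 0
  (tick (1 + cost (Arr 20 (Sub (Reg 10) (Reg 5)))) (set_reg 11 (K i) s)))))"
 have run: "ht B ScanI s Q = ht B (Seq (While (Less (Mul (Reg 12) (Reg 11)) (Reg 14)) ScanS) (Assign 10 (Add (Reg 10) (Const 1)))) s1 Q" for Q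
  unfolding ScanI_def s1_def using sms by (simp add: r kk len_def)
 have a1: "arr s1 = arr s" "reg s1 12 = 0" "reg s1 11 = K i" "reg s1 14 = len" "clock s1 <= clock s + 40"
  "\<And>q. q <= 10 ==> reg s1 q = reg s q" by (simp_all add: s1_def)
 let ?e = "Less (Mul (Reg 12) (Reg 11)) (Reg 14)"
 define W where "W s2 \<longleftrightarrow> (\<exists>\<sigma>. reg s2 12 = \<sigma> \<and> NJ s2 G X \<and> JP s2 (PD s2 x i \<sigma>) \<and>
  (\<forall>q<60. q ~= 12 --> q ~= 13 --> reg s2 q = reg s1 q) \<and> eqA FM s1 s2 \<and> Mmono s1 s2 \<and> \<sigma> * K i <= len + K i \<and> clock s2 <= clock s1 + 490 * \<sigma>)" for s2
 have ev: "eval B s2 ?e = (if reg s2 12 * K i < len then 1 else 0)" if "W s2" for s2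
 proof -
  from that obtain \<sigma> where w: "reg s2 12 = \<sigma>" "\<forall>q<60. q ~= 12 --> q ~= 13 --> reg s2 q = reg s1 q" "\<sigma> * K i <= len + K i"
   unfolding W_def by blast
  have "\<sigma> <= \<sigma> * K i" using K_pos(1)[of i] by (simp add: Suc_le_eq)
  then have "\<sigma> <= 3 * n" using w(3) lenn K2 by linarith
  then have "sm0 \<sigma>" "sm0 (K i)" using K2 n2 by (simp_all add: sm0_def q0_def)
  then show ?thesis using w a1 by simp
 qed
 show ?thesis unfolding run
 proof (rule ht_Seq)
  show "ht B (While ?e ScanS) s1 (\<lambda>s'. \<exists>s2. W s2 \<and> len <= reg s2 12 * K i \<and> s' = tick (1 + cost ?e) s2)"
  proof (rule ht_While[where I = W and m = "\<lambda>s2. len - reg s2 12 * K i"])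
   have "NJ s1 G X" by (rule NJ_frame[OF N]) (use D(3) a1 in \<open>simp_all add: eqA_def same_def\<close>)
   moreover have "JP s1 (PD s1 x i 0)" using JP unfolding JP_def cov_def PD_def a1(1) .
   ultimately show "W s1" unfolding W_def using a1 by (intro exI[of _ 0]) (simp add: eqA_def Mmono_refl)
  next
   fix s2 assume W2: "W s2" and e: "eval B s2 ?e ~= 0"
   from W2 obtain \<sigma> where p: "reg s2 12 = \<sigma>" "NJ s2 G X" "JP s2 (PD s2 x i \<sigma>)"
    "\<forall>q<60. q ~= 12 --> q ~= 13 --> reg s2 q = reg s1 q" "eqA FM s1 s2" "Mmono s1 s2" "\<sigma> * K i <= len + K i" "clock s2 <= clock s1 + 490 * \<sigma>"
    unfolding W_def by blast
   have lt: "\<sigma> * K i < len" using e p(1) unfolding ev[OF W2] by (simp split: if_splits)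
   have "\<sigma> <= \<sigma> * K i" using K_pos(1)[of i] by (simp add: Suc_le_eq)
   then have sn: "\<sigma> <= n" using lt lenn by linarith
   let ?s = "tick (1 + cost ?e) s2"
   have A5: "arr ?s a = arr s a" if "a \<notin> FM" for a using eqA_D[OF p(5) that] a1(1) by simp
   have N5: "NJ ?s G X" by (rule NJ_frame[OF p(2)]) (use NJ_D(3)[OF p(2)] in \<open>simp_all add: eqA_def same_def\<close>)
   have J5: "JP ?s (PD ?s x i \<sigma>)" using p(3) unfolding JP_def cov_def PD_def by simp
   have r5: "reg ?s 8 = x" "reg ?s 10 = i" "reg ?s 12 = \<sigma>" using p(1,4) a1(6) r by simp_all
   have S5: "SELB (arr ?s 14)" using S A5[of 14] by simp
   show "ht B ScanS ?s (\<lambda>s'. W s' \<and> len - reg s' 12 * K i < len - reg s2 12 * K i)"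
   proof (rule ht_mono[OF ScanS_spec[OF N5 r5 x i sn S5 J5]], elim conjE)
    fix s' assume s': "NJ s' G X" "JP s' (PD s' x i (Suc \<sigma>))" "reg s' 12 = Suc \<sigma>"
     "\<forall>q<60. q ~= 12 --> q ~= 13 --> reg s' q = reg ?s q" "eqA FM ?s s'" "Mmono ?s s'" "clock s' <= clock ?s + 480"
    have "W s'" unfolding W_def
    proof (intro exI[of _ "Suc \<sigma>"] conjI)
     show "\<forall>q<60. q ~= 12 --> q ~= 13 --> reg s' q = reg s1 q" using s'(4) p(4) by simp
     show "eqA FM s1 s'" using eqA_step[OF p(5)] s'(5) by simp
     show "Mmono s1 s'" using Mmono_trans[OF p(6)] s'(6) by simp
     show "clock s' <= clock s1 + 490 * Suc \<sigma>" using s'(7) p(8) by simp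
     show "Suc \<sigma> * K i <= len + K i" using lt by simp
    qed (rule s')+
    moreover have "len - Suc \<sigma> * K i < len - \<sigma> * K i" by (rule diff_less_mono2[OF _ lt]) simp
    ultimately show "W s' \<and> len - reg s' 12 * K i < len - reg s2 12 * K i" using s'(3) p(1) by simp
   qed
  next
   fix s2 assume w: "W s2" and e: "eval B s2 ?e = 0"
   have "len <= reg s2 12 * K i" using e unfolding ev[OF w] by (simp split: if_splits)
   then show "\<exists>s2'. W s2' \<and> len <= reg s2' 12 * K i \<and> tick (1 + cost ?e) s2 = tick (1 + cost ?e) s2'"
    using w by blast
  qed
 next
  fix s3 assume "\<exists>s2. W s2 \<and> len <= reg s2 12 * K i \<and> s3 = tick (1 + cost ?e) s2"
  then obtain s2 where w: "W s2" "len <= reg s2 12 * K i" "s3 = tick (1 + cost ?e) s2" by blast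
  from w(1) obtain \<sigma> where p: "reg s2 12 = \<sigma>" "NJ s2 G X" "JP s2 (PD s2 x i \<sigma>)"
    "\<forall>q<60. q ~= 12 --> q ~= 13 --> reg s2 q = reg s1 q" "eqA FM s1 s2" "Mmono s1 s2" "\<sigma> * K i <= len + K i" "clock s2 <= clock s1 + 490 * \<sigma>"
    unfolding W_def by blast
  define s4 where "s4 = tick (1 + cost (Add (Reg 10) (Const 1))) (set_reg 10 (Suc i) s3)"
  have r10: "reg s3 10 = i" using p(4) a1(6) r w(3) by simp
  have run3: "ht B (Assign 10 (Add (Reg 10) (Const 1))) s3 Q = Q s4" for Q
   using sms by (simp add: s4_def r10)
  have a4: "arr s4 = arr s2" "reg s4 10 = Suc i" "\<And>q. q ~= 10 ==> reg s4 q = reg s2 q" "clock s4 = clock s2 + 10"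
   by (simp_all add: s4_def w(3))
  have A2: "arr s2 a = arr s a" if "a \<notin> FM" for a using eqA_D[OF p(5) that] a1(1) by simp
  have "?Q s4"
  proof (intro conjI)
   show "NJ s4 G X" by (rule NJ_frame[OF p(2)]) (use NJ_D(3)[OF p(2)] a4 in \<open>simp_all add: eqA_def same_def\<close>)
   have "arr s2 8 (pr x i) <= \<sigma> * K i" using w(2) p(1) A2[of 8] unfolding len_def by simp
   from PD_next[OF p(2,3) this] show "JP s4 (PD s4 x (Suc i) 0)" unfolding JP_def cov_def PD_def a4(1) .
   show "\<forall>q<10. reg s4 q = reg s q" using a4(3) p(4) a1(6) by simp
   show "eqA FM s s4" unfolding eqA_def a4(1) using A2 by blast
   show "Mmono s s4" using p(6) unfolding Mmono_def a4(1) a1(1) .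
   have "real \<sigma> * real (K i) <= real len + real (K i)" using p(7) by (metis of_nat_add of_nat_le_iff of_nat_mult)
   then have "real \<sigma> <= real len / real (K i) + 1" using K_pos(1)[of i] by (simp add: field_simps)
   moreover have "real (clock s4) <= real (clock s) + 490 * real \<sigma> + 50" using p(8) a4(4) a1(5) by simp
   moreover have "0 <= real len / real (K i)" by simp
   ultimately show "real (clock s4) <= real (clock s) + 500 * (real (arr s 8 (pr x i)) / real (K i)) + 590"
    unfolding len_def by linarith
  qed (rule a4)
  then show "ht B (Assign 10 (Add (Reg 10) (Const 1))) s3 ?Q" unfolding run3 .
 qed
qed

lemma wt_classes:
 assumes l: "LIST cl ps nb len G"
 shows "wt cl G x = (\<Sum>i\<le>L. len (pr x i) * 2 ^ (L - i))"
proof -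
 have fin: "finite {y. (x, y) \<in> G}" by (rule LIST_fin[OF l])
 have "(\<Sum>i\<le>L. len (pr x i) * 2 ^ (L - i)) = (\<Sum>i\<le>L. \<Sum>y\<in>{y \<in> {y. (x, y) \<in> G}. cl (pr x y) = i}. 2 ^ (L - cl (pr x y)))"
  unfolding LIST_card[OF l] by (intro sum.cong) simp_all
 also have "\<dots> = wt cl G x" unfolding wt_def
  by (rule sum.group[OF fin]) (use LIST_1[OF l] in auto)
 finally show ?thesis by simp
qed

text \<open>\<open>K i\<close> is at least \<open>2 ^ i / 2 ^ ll\<close>, so a full slot of any
  class carries weight at least \<open>2 ^ - ll\<close>. A vertex of weight at most
  \<open>c x\<close> therefore has no more than \<open>2 ^ ll * c x\<close> slots, counted
  fractionally.\<close>

lemma slots_bound: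
 assumes l: "LIST cl ps nb len G" and W: "wt cl G x <= c x * 2 ^ L"
 shows "(\<Sum>i\<le>L. real (len (pr x i)) / real (K i)) <= 2 * (real L + 1) * real (c x)"
proof -
 have "real (len (pr x i)) / real (K i) <= 2 ^ ll / 2 ^ L * real (len (pr x i) * 2 ^ (L - i))" if "i <= L" for i
 proof -
  have 1: "(2::real) ^ (L - i) / 2 ^ L = 1 / 2 ^ i" using that by (simp add: power_diff)
  have "(2::real) ^ i <= 2 ^ ll * 2 ^ (i - ll)" by (simp flip: power_add)
  then have "1 / (2::real) ^ (i - ll) <= 2 ^ ll / 2 ^ i" by (simp add: field_simps)
  then have "real (len (pr x i)) * (1 / 2 ^ (i - ll)) <= real (len (pr x i)) * (2 ^ ll / 2 ^ i)" by (rule mult_left_mono) simp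
  also have "2 ^ ll / 2 ^ i = (2::real) ^ ll * (2 ^ (L - i) / 2 ^ L)" unfolding 1 by simp
  finally show ?thesis by (simp add: K_def mult_ac)
 qed
 then have "(\<Sum>i\<le>L. real (len (pr x i)) / real (K i)) <= (\<Sum>i\<le>L. 2 ^ ll / 2 ^ L * real (len (pr x i) * 2 ^ (L - i)))"
  by (intro sum_mono) simp
 also have "\<dots> = 2 ^ ll / 2 ^ L * real (wt cl G x)" unfolding wt_classes[OF l] by (simp add: sum_distrib_left)
 also have "\<dots> <= 2 ^ ll / 2 ^ L * real (c x * 2 ^ L)"
  by (rule mult_left_mono[OF of_nat_mono[OF W]]) simp
 also have "\<dots> = real (2 ^ ll) * real (c x)" by simp
 also have "\<dots> <= real (2 * (L + 1)) * real (c x)" using ll2 by (intro mult_right_mono) (simp_all only: of_nat_le_iff of_nat_0_le_iff)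
 also have "real (2 * (L + 1)) = 2 * (real L + 1)" by simp
 finally show ?thesis .
qed

lemma Scan_spec:
 assumes N: "NJ s G X" and r: "reg s 8 = x" and x: "x < n"
  and S: "SELB (arr s 14)" and JP: "JP s (PD s x 0 0)" and W: "arr s 3 x <= c x * 2 ^ L"
 shows "ht B Scan s (\<lambda>s'. NJ s' G X \<and> J s' \<and> (\<forall>q<10. reg s' q = reg s q) \<and> eqA FM s s' \<and> Mmono s s' \<and>
  clock s' <= clock s + 1700 * (L + 3) * c x)"
  (is "ht B _ s ?Q")
proof -
 let ?e = "Less (Reg 10) (Add (Reg 4) (Const 1))"
 define T where "T i = real (arr s 8 (pr x i)) / real (K i)" for i
 define W where "W s1 \<longleftrightarrow> (\<exists>i \<le> Suc L. reg s1 10 = i \<and> NJ s1 G X \<and> JP s1 (PD s1 x i 0) \<and> (\<forall>q<10. reg s1 q = reg s q) \<and>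
  eqA FM s s1 \<and> Mmono s s1 \<and> real (clock s1) <= real (clock s) + 10 + 500 * (\<Sum>j<i. T j) + 600 * real i)" for s1
 have smL: "sm L" by simp
 have ev: "eval B s1 ?e = (if reg s1 10 < Suc L then 1 else 0)" if "Cst s1" for s1
  using that smL by (simp add: Cst_def)
 have "ht B Scan s (\<lambda>s'. \<exists>s1. W s1 \<and> reg s1 10 = Suc L \<and> s' = tick (1 + cost ?e) s1)"
  unfolding Scan_def ht_Seq_Assign
 proof (rule ht_While[where I = W and m = "\<lambda>s1. Suc L - reg s1 10"])
  let ?s = "tick (1 + cost (Const 0)) (set_reg 10 (eval B s (Const 0)) s)"
  have "NJ ?s G X" by (rule NJ_frame[OF N]) (use NJ_D(3)[OF N] in \<open>simp_all add: eqA_def same_def\<close>)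
  moreover have "JP ?s (PD ?s x 0 0)" using JP unfolding JP_def cov_def PD_def by simp
  ultimately show "W ?s" unfolding W_def by (intro exI[of _ 0]) (simp add: eqA_def Mmono_def)
 next
  fix s1 assume "W s1" and e: "eval B s1 ?e ~= 0"
  then obtain i where w: "i <= Suc L" "reg s1 10 = i" "NJ s1 G X" "JP s1 (PD s1 x i 0)" "\<forall>q<10. reg s1 q = reg s q"
   "eqA FM s s1" "Mmono s s1" "real (clock s1) <= real (clock s) + 10 + 500 * (\<Sum>j<i. T j) + 600 * real i" unfolding W_def by blast
  have iL: "i <= L" using e w(2) unfolding ev[OF NJ_D(1)[OF w(3)]] by (simp split: if_splits)
  let ?s = "tick (1 + cost ?e) s1"
  have N1: "NJ ?s G X" by (rule NJ_frame[OF w(3)]) (use NJ_D(3)[OF w(3)] in \<open>simp_all add: eqA_def same_def\<close>)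
  have J1: "JP ?s (PD ?s x i 0)" using w(4) unfolding JP_def cov_def PD_def by simp
  have A1: "arr ?s a = arr s a" if "a \<notin> FM" for a using eqA_D[OF w(6) that] by simp
  have r1: "reg ?s 8 = x" "reg ?s 10 = i" and S1: "SELB (arr ?s 14)" using w r S A1[of 14] by simp_all
  show "ht B ScanI ?s (\<lambda>s'. W s' \<and> Suc L - reg s' 10 < Suc L - reg s1 10)"
  proof (rule ht_mono[OF ScanI_spec[OF N1 r1 x iL S1 J1]], elim conjE)
   fix s' assume s': "NJ s' G X" "JP s' (PD s' x (Suc i) 0)" "reg s' 10 = Suc i" "\<forall>q<10. reg s' q = reg ?s q"
    "eqA FM ?s s'" "Mmono ?s s'" "real (clock s') <= real (clock ?s) + 500 * (real (arr ?s 8 (pr x i)) / real (K i)) + 590"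
   have "real (arr ?s 8 (pr x i)) / real (K i) = T i" using A1[of 8] unfolding T_def by simp
   then have cl: "real (clock s') <= real (clock s1) + 500 * T i + 596" using s'(7) by simp
   have "W s'" unfolding W_def
   proof (intro exI[of _ "Suc i"] conjI)
    show "\<forall>q<10. reg s' q = reg s q" using s'(4) w(5) by simp
    show "eqA FM s s'" using eqA_step[OF w(6)] s'(5) by simp
    show "Mmono s s'" using Mmono_trans[OF w(7)] s'(6) by simp
    show "real (clock s') <= real (clock s) + 10 + 500 * (\<Sum>j<Suc i. T j) + 600 * real (Suc i)"
     using cl w(8) by (simp add: algebra_simps)
   qed (rule s' iL Suc_le_mono[THEN iffD2])+
   then show "W s' \<and> Suc L - reg s' 10 < Suc L - reg s1 10" using s'(3) w(2) iL by simp
  qed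
 next
  fix s1 assume w: "W s1" and e: "eval B s1 ?e = 0"
  obtain i where i: "i <= Suc L" "reg s1 10 = i" "NJ s1 G X" using w unfolding W_def by blast
  have "reg s1 10 = Suc L" using e i unfolding ev[OF NJ_D(1)[OF i(3)]] by (simp split: if_splits)
  then show "\<exists>s1'. W s1' \<and> reg s1' 10 = Suc L \<and> tick (1 + cost ?e) s1 = tick (1 + cost ?e) s1'" using w by blast
 qed
 then show ?thesis
 proof (rule ht_mono, elim exE conjE)
  fix s' s1 assume w: "W s1" "reg s1 10 = Suc L" "s' = tick (1 + cost ?e) s1"
  from w(1) obtain i where q': "reg s1 10 = i" "NJ s1 G X" "JP s1 (PD s1 x i 0)" "\<forall>q<10. reg s1 q = reg s q"
   "eqA FM s s1" "Mmono s s1" "real (clock s1) <= real (clock s) + 10 + 500 * (\<Sum>j<i. T j) + 600 * real i" unfolding W_def by blast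
  have iL: "i = Suc L" using q'(1) w(2) by simp
  note q = q'[unfolded iL]
  have a: "arr s' = arr s1" "reg s' = reg s1" "clock s' = clock s1 + 6" by (simp_all add: w(3))
  show "?Q s'"
  proof (intro conjI)
   show "NJ s' G X" by (rule NJ_frame[OF q(2)]) (use NJ_D(3)[OF q(2)] a in \<open>simp_all add: eqA_def same_def\<close>)
   have "J s1" unfolding J_def
   proof (intro allI impI)
    fix y z assume h: "arr s1 6 (pr y z) ~= 0" "arr s1 6 (pr y z) = arr s1 14 (arr s1 4 (pr y z))"
    have "arr s1 4 (pr y z) = arr s1 4 (pr z y)" "arr s1 4 (pr y z) <= L" using COL_D(2)[OF NJ_D(4)[OF q(2)] h(1)] by simp_all
    then have "\<not> PD s1 x (Suc L) 0 y z" unfolding PD_def todo_def by auto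
    then show "cov s1 y z" using JP_D[OF q(3) h] by simp
   qed
   then show "J s'" unfolding J_def cov_def a(1) .
   show "\<forall>q<10. reg s' q = reg s q" using q(4) unfolding a(2) .
   show "eqA FM s s'" using q(5) unfolding eqA_def a(1) .
   show "Mmono s s'" using q(6) unfolding Mmono_def a(1) .
   have wt: "wt (arr s 4) G x <= c x * 2 ^ L" using assms(6) NJ_D(6)[OF N] by simp
   define sT where "sT = (\<Sum>j<Suc L. T j)"
   define Q where "Q = (real L + 1) * real (c x)"
   have "sT <= 2 * Q"
    using slots_bound[OF NJ_D(5)[OF N] wt] unfolding sT_def Q_def T_def lessThan_Suc_atMost by (simp only: mult.assoc)
   moreover have c6: "real (clock s') = real (clock s1) + 6" and sL: "real (Suc L) = real L + 1" using a(3) by simp_all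
   moreover have "real (clock s1) <= real (clock s) + 10 + 500 * sT + 600 * (real L + 1)"
    using q(7) unfolding sT_def[symmetric] sL .
   ultimately have 1: "real (clock s') <= real (clock s) + 16 + 1000 * Q + 600 * (real L + 1)" by linarith
   \<comment> \<open>With capacity at least 1 the cost of the \<open>L + 1\<close> incomplete slots
     is absorbed into the term proportional to the capacity.\<close>
   have aux: "z <= y + 1700 * (q + 2 * d)" if "z <= y + 16 + 1000 * q + 600 * l" "l * 1 <= q" "1 <= d" "0 <= l" for y z q l d :: real
    using that by (simp add: algebra_simps)
   have Ql: "(real L + 1) * 1 <= Q" unfolding Q_def using c1 x by (intro mult_left_mono) auto
   have c1': "1 <= real (c x)" using c1 x by auto
   have Q3: "(real L + 3) * real (c x) = Q + 2 * real (c x)" unfolding Q_def by (simp add: algebra_simps)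
   have "real (clock s') <= real (clock s) + 1700 * ((real L + 3) * real (c x))" unfolding Q3 by (rule aux[OF 1 Ql c1']) simp
   then have "real (clock s') <= real (clock s + 1700 * (L + 3) * c x)" by (simp add: algebra_simps)
   then show "clock s' <= clock s + 1700 * (L + 3) * c x" by (simp only: of_nat_le_iff)
  qed
 qed
qed

text \<open>Withdrawing the mark releases \<open>c - d\<close>, more than half of the capacity, at
  the price \<open>4000 * (L + 3)\<close>; that is at least \<open>2000 * (L + 3) * c x\<close>, and
  the scan takes only 1700 in place of 2000. Afterwards \<open>x\<close> needs no exemption.\<close>

lemma Unfull_spec:
 assumes N: "NJ s G X" and J: "J s" and r: "reg s 8 = x" and x: "x < n"
  and S: "SELB (arr s 14)" and W: "arr s 3 x <= c x * 2 ^ L"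
 shows "ht B Unfull s (\<lambda>s'. NJ s' G (X - {x}) \<and> J s' \<and> (\<forall>q<10. reg s' q = reg s q) \<and> eqA FM s s' \<and>
  clock s' + 4000 * (L + 3) * pot3 (arr s' 16) (arr s' 17) <= clock s + 4000 * (L + 3) * pot3 (arr s 16) (arr s 17) + 30)"
  (is "ht B _ s ?Q")
proof -
 note D = NJ_D[OF N]
 note M = MI_D[OF D(3)]
 have cap: "arr s 0 x = c x" using D(1) x by (simp add: Cst_def)
 have dn: "arr s 16 x <= n" using M(5)[OF x] cn[OF x] by (simp add: sm0_def)
 have sms: "sm0 (arr s 16 x)" "sm0 (2 * arr s 16 x)" using dn n2 by (simp_all add: sm0_def q0_def)
 have trivial: "?Q s'" if "arr s' = arr s" "reg s' = reg s" "clock s' <= clock s + 30" and ok: "arr s 17 x = 0 \<or> c x <= 2 * arr s 16 x" for s'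
 proof (intro conjI)
  have "MIs s G (X - {x})"
  proof (rule MI_I)
   show "\<And>z. z < n ==> z \<notin> X - {x} ==> arr s 17 z ~= 0 ==> c z <= 2 * arr s 16 z" using M(7) ok by (metis Diff_iff singletonD)
  qed ((rule M(1), simp), rule M(2), (rule M(3), assumption), rule M(4), (rule M(5), assumption), (rule M(6), assumption+))
  then show "NJ s' G (X - {x})" by - (rule NJ_frame[OF N], use that in \<open>simp_all add: eqA_def same_def\<close>)
  show "J s'" using J unfolding J_def cov_def that(1) .
 qed (use that in \<open>simp_all add: eqA_def\<close>)
 show ?thesis
 proof (cases "arr s 17 x = 0 \<or> c x <= 2 * arr s 16 x")
  case True
  have "ht B Unfull s (\<lambda>s'. arr s' = arr s \<and> reg s' = reg s \<and> clock s' <= clock s + 30)"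
   unfolding Unfull_def using True sms by (cases "arr s 17 x = 0") (simp_all add: r cap)
  then show ?thesis by (rule ht_mono) (use trivial True in blast)
 next
  case False
  then have f: "arr s 17 x ~= 0" "2 * arr s 16 x < c x" by auto
  let ?e2 = "Less (Mul (Const 2) (Arr 16 (Reg 8))) (Arr 0 (Reg 8))"
  define s1 where "s1 = tick (1 + cost (Reg 8) + cost (Const 0)) (set_arr 17 x 0 (tick (1 + cost ?e2) (tick (1 + cost (Arr 17 (Reg 8))) s)))"
  have run: "ht B Unfull s Q = ht B Scan s1 Q" for Q
   unfolding Unfull_def s1_def using f sms by (simp add: r cap)
  have a1: "arr s1 = (arr s)(17 := (arr s 17)(x := 0))" "reg s1 = reg s" "clock s1 <= clock s + 20" by (simp_all add: s1_def)
  have A1: "arr s1 a = arr s a" if "a ~= 17" for a using that by (simp add: a1)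
  have A17: "arr s1 17 = (arr s 17)(x := 0)" by (simp add: a1)
  have "MI (arr s 1) (arr s 15) (arr s 16) ((arr s 17)(x := 0)) G (X - {x})"
  proof (rule MI_I)
   show "arr s 16 z < c z" if "z < n" "((arr s 17)(x := 0)) z = 0" for z
    using M(6)[OF that(1)] that(2) f(2) by (cases "z = x") simp_all
   show "c z <= 2 * arr s 16 z" if "z < n" "z \<notin> X - {x}" "((arr s 17)(x := 0)) z ~= 0" for z
    using M(7)[OF that(1)] that(2,3) by (cases "z = x") simp_all
  qed ((rule M(1), simp), rule M(2), (rule M(3), assumption), rule M(4), (rule M(5), assumption))
  then have "MIs s1 G (X - {x})" by (simp add: A1 A17)
  then have N1: "NJ s1 G (X - {x})" by - (rule NJ_frame[OF N], use a1 in \<open>simp_all add: eqA_def same_def\<close>)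
  \<comment> \<open>Withdrawing the mark can uncover only pairs at \<open>x\<close>, and all of
    these are pending at slot 0 of class 0.\<close>
  have J1: "JP s1 (PD s1 x 0 0)" unfolding JP_def
  proof (intro allI impI)
   fix a b assume "arr s1 6 (pr a b) ~= 0" "arr s1 6 (pr a b) = arr s1 14 (arr s1 4 (pr a b))"
   then have "cov s a b" using J unfolding J_def by (simp add: A1)
   moreover have "todo (arr s1 4) (arr s1 5) x 0 0 z" for z unfolding todo_def by auto
   ultimately show "cov s1 a b \<or> PD s1 x 0 0 a b" unfolding cov_def PD_def A1[of 15, simplified] A17 by auto
  qed
  have r1: "reg s1 8 = x" "SELB (arr s1 14)" "arr s1 3 x <= c x * 2 ^ L" using r S W A1 by (simp_all add: a1)
  have "pot3 (arr s 16) (arr s 17) = (\<Sum>v\<in>{..<n} - {x}. if arr s 17 v ~= 0 then c v - arr s 16 v else 0) + (c x - arr s 16 x)"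
   unfolding pot3_def using f(1) x by (subst sum.remove[of _ x]) auto
  moreover have "pot3 (arr s 16) (arr s1 17) = (\<Sum>v\<in>{..<n} - {x}. if arr s1 17 v ~= 0 then c v - arr s 16 v else 0)"
   unfolding pot3_def using x A17 by (subst sum.remove[of _ x]) auto
  moreover have "(\<Sum>v\<in>{..<n} - {x}. if arr s1 17 v ~= 0 then c v - arr s 16 v else 0) = (\<Sum>v\<in>{..<n} - {x}. if arr s 17 v ~= 0 then c v - arr s 16 v else 0)"
   by (intro sum.cong) (auto simp: A17)
  ultimately have "2 * pot3 (arr s 16) (arr s1 17) + c x <= 2 * pot3 (arr s 16) (arr s 17)" using f(2) by simp
  then have "2000 * (L + 3) * (2 * pot3 (arr s 16) (arr s1 17) + c x) <= 2000 * (L + 3) * (2 * pot3 (arr s 16) (arr s 17))"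
   by (rule mult_left_mono) simp
  then have p3: "4000 * (L + 3) * pot3 (arr s1 16) (arr s1 17) + 2000 * (L + 3) * c x <= 4000 * (L + 3) * pot3 (arr s 16) (arr s 17)"
   using A1[of 16] by (simp add: algebra_simps)
  show ?thesis unfolding run
  proof (rule ht_mono[OF Scan_spec[OF N1 r1(1) x r1(2) J1 r1(3)]], elim conjE)
   fix s' assume s': "NJ s' G (X - {x})" "J s'" "\<forall>q<10. reg s' q = reg s1 q" "eqA FM s1 s'" "Mmono s1 s'" "clock s' <= clock s1 + 1700 * (L + 3) * c x"
   show "?Q s'"
   proof (intro conjI)
    show "\<forall>q<10. reg s' q = reg s q" using s'(3) a1(2) by simp
    show "eqA FM s s'" using s'(4) A1 unfolding eqA_def by simp
    have e: "pot3 (arr s' 16) (arr s' 17) = pot3 (arr s1 16) (arr s1 17)" using s'(5) unfolding Mmono_def by simp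
    have "1700 * (L + 3) * c x <= 2000 * (L + 3) * c x" by (intro mult_right_mono) simp_all
    then show "clock s' + 4000 * (L + 3) * pot3 (arr s' 16) (arr s' 17) <= clock s + 4000 * (L + 3) * pot3 (arr s 16) (arr s 17) + 30"
     unfolding e using s'(6) p3 a1(3) by linarith
   qed (rule s')+
  qed
 qed
qed

end

section \<open>The approximation ratio\<close>

definition Eset :: "(nat \<times> nat) set \<Rightarrow> nat set set" where
 "Eset R = (\<lambda>(a, b). {a, b}) ` R"

lemma card_symmetric_relation:
 fixes R :: "(nat \<times> nat) set"
 assumes fin: "finite R" and sym: "\<And>x y. (x, y) \<in> R ==> (y, x) \<in> R \<and> x ~= y"
 shows "card R = 2 * card {e \<in> R. fst e < snd e}"
proof -
 let ?A = "{e \<in> R. fst e < snd e}" and ?B = "{e \<in> R. snd e < fst e}"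
 have "?A \<union> ?B = R"
 proof (intro equalityI subsetI)
  fix e assume "e \<in> R"
  then show "e \<in> ?A \<union> ?B" using sym[of "fst e" "snd e"] by (cases "fst e < snd e") auto
 qed auto
 moreover have "card (?A \<union> ?B) = card ?A + card ?B" by (rule card_Un_disjoint) (use fin in auto)
 moreover have "bij_betw prod.swap ?A ?B"
  by (rule bij_betwI[where g = prod.swap]) (use sym in auto)
 then have "card ?A = card ?B" by (rule bij_betw_same_card)
 ultimately show ?thesis by simp
qed

lemma card_Eset_less: "card (Eset {e \<in> R. fst e < snd e}) = card {e \<in> R. fst e < snd e}"
 unfolding Eset_def by (rule card_image) (auto simp: inj_on_def doubleton_eq_iff)

context bm
begin

lemma sum_pairs:
 assumes "graph G" "R \<subseteq> G"
 shows "(\<Sum>x<n. \<Sum>y\<in>{y. (x, y) \<in> R}. f (x, y)) = (\<Sum>e\<in>R. f e)"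
proof -
 have fin: "finite {y. (x, y) \<in> R}" for x
  by (rule finite_subset[OF _ graph_fin(2)[OF assms(1), of x]]) (use assms(2) in auto)
 have "Sigma {..<n} (\<lambda>x. {y. (x, y) \<in> R}) = R" using graph_D[OF assms(1)] assms(2) by auto
 then show ?thesis using sum.Sigma[of "{..<n}" "\<lambda>x. {y. (x, y) \<in> R}" "\<lambda>x y. f (x, y)"] fin by simp
qed

lemma sum_classes:
 fixes g :: "nat \<Rightarrow> nat"
 assumes "finite R" "\<And>e. e \<in> R ==> h e <= L"
 shows "(\<Sum>e\<in>R. g (h e)) = (\<Sum>i\<le>L. card {e \<in> R. h e = i} * g i)"
proof -
 have "(\<Sum>i\<le>L. card {e \<in> R. h e = i} * g i) = (\<Sum>i\<le>L. \<Sum>e\<in>{e \<in> R. h e = i}. g (h e))"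
  by (intro sum.cong) simp_all
 also have "\<dots> = (\<Sum>e\<in>R. g (h e))" by (rule sum.group) (use assms in auto)
 finally show ?thesis by simp
qed

lemma output_b_matching:
 assumes G: "graph G" and M: "MIs s G X"
 shows "b_matching n c (Eset G) (output_edges n s)" "(\<Sum>x<n. arr s 16 x) = 2 * card (output_edges n s)"
proof -
 note D = MI_D[OF M]
 define Ms where "Ms = {e. arr s 15 (prod_encode e) ~= 0}"
 have MsG: "Ms \<subseteq> G" using D(3) unfolding Ms_def by auto
 have out: "output_edges n s = Eset {e \<in> Ms. fst e < snd e}"
 proof
  show "output_edges n s \<subseteq> Eset {e \<in> Ms. fst e < snd e}"
  proof
   fix E assume "E \<in> output_edges n s"
   then obtain u v where e: "E = {u, v}" "u < v" "v < n" "arr s 1 (u * n + v) ~= 0" unfolding output_edges_def by auto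
   then have "(u, v) \<in> Ms" using D(1)[of u v] unfolding Ms_def by simp
   then show "E \<in> Eset {e \<in> Ms. fst e < snd e}" unfolding Eset_def using e by force
  qed
  show "Eset {e \<in> Ms. fst e < snd e} \<subseteq> output_edges n s"
  proof
   fix E assume "E \<in> Eset {e \<in> Ms. fst e < snd e}"
   then obtain u v where e: "E = {u, v}" "u < v" "(u, v) \<in> Ms" unfolding Eset_def by auto
   then have "v < n" using MsG graph_D[OF G] by blast
   moreover from this have "arr s 1 (u * n + v) ~= 0" using D(1)[of u v] e unfolding Ms_def by simp
   ultimately show "E \<in> output_edges n s" unfolding output_edges_def using e by blast
  qed
 qed
 have "(\<Sum>x<n. arr s 16 x) = (\<Sum>x<n. \<Sum>y\<in>{y. (x, y) \<in> Ms}. 1)" using D(4) by (simp add: Ms_def)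
 also have "\<dots> = card Ms" using sum_pairs[OF G MsG, of "\<lambda>_. 1 :: nat"] by simp
 also have "\<dots> = 2 * card {e \<in> Ms. fst e < snd e}"
 proof (rule card_symmetric_relation)
  show "finite Ms" by (rule finite_subset[OF MsG graph_fin(1)[OF G]])
  show "(y, x) \<in> Ms \<and> x ~= y" if "(x, y) \<in> Ms" for x y
  proof
   have "arr s 15 (pr x y) ~= 0" using that unfolding Ms_def by simp
   then have "arr s 15 (pr y x) ~= 0" using D(2)[of x y] by argo
   then show "(y, x) \<in> Ms" unfolding Ms_def by simp
   show "x ~= y" using graph_D[OF G] that MsG by blast
  qed
 qed
 finally show "(\<Sum>x<n. arr s 16 x) = 2 * card (output_edges n s)" unfolding out card_Eset_less .
 show "b_matching n c (Eset G) (output_edges n s)" unfolding b_matching_def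
 proof (intro conjI allI impI)
  show "output_edges n s \<subseteq> Eset G" unfolding out Eset_def using MsG by auto
  fix v assume v: "v < n"
  have "{e \<in> output_edges n s. v \<in> e} \<subseteq> (\<lambda>y. {v, y}) ` {y. arr s 15 (pr v y) ~= 0}"
  proof
   fix E assume "E \<in> {e \<in> output_edges n s. v \<in> e}"
   then obtain a b where e: "E = {a, b}" "(a, b) \<in> Ms" "v = a \<or> v = b" unfolding out Eset_def by auto
   have ab: "arr s 15 (pr a b) ~= 0" using e(2) unfolding Ms_def by simp
   then have ba: "arr s 15 (pr b a) ~= 0" using D(2)[of a b] by argo
   from e(3) show "E \<in> (\<lambda>y. {v, y}) ` {y. arr s 15 (pr v y) ~= 0}"
   proof
    assume v: "v = a"
    have "b \<in> {y. arr s 15 (pr v y) ~= 0}" unfolding v using ab by (rule CollectI)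
    then show ?thesis unfolding e(1) v by (rule rev_image_eqI) (rule refl)
   next
    assume v: "v = b"
    have "a \<in> {y. arr s 15 (pr v y) ~= 0}" unfolding v using ba by (rule CollectI)
    then show ?thesis unfolding e(1) v by (rule rev_image_eqI) (rule insert_commute)
   qed
  qed
  then have "card {e \<in> output_edges n s. v \<in> e} <= card {y. arr s 15 (pr v y) ~= 0}"
   by (rule surj_card_le[OF MI_finite[OF G M]])
  also have "\<dots> <= c v" using D(4,5) v by simp
  finally show "card {e \<in> output_edges n s. v \<in> e} <= c v" .
 qed
qed

context
 fixes s :: state and G :: "(nat \<times> nat) set"
 assumes N: "NJ s G {}" and J: "J s" and S: "SELB (arr s 14)"
  and lc: "LC (arr s 2) (arr s 4) G" and clean: "\<And>x. x < n ==> clean (arr s 2) (arr s 3) x"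
  and sel: "\<And>i. i <= L ==> arr s 10 (pr i 1) <= 8 * K i * arr s 10 (pr i (arr s 14 i))"
begin

definition clE :: "nat \<times> nat \<Rightarrow> nat" where "clE e = arr s 4 (prod_encode e)"
definition lfE :: "nat \<times> nat \<Rightarrow> nat" where "lfE e = arr s 6 (prod_encode e)"
text \<open>The scaled weight of a selected edge: \<open>K i\<close> times that of an edge of its
  class, because it stands for about \<open>K i\<close> of them. The minimum reflects that
  \<open>K i\<close> is 1 up to class \<open>ll\<close>.\<close>

definition wE :: "nat \<Rightarrow> nat" where "wE i = 2 ^ (L - min i ll)"
definition HE :: "(nat \<times> nat) set" where "HE = {e \<in> G. lfE e = arr s 14 (clE e)}"
definition hE :: "nat \<Rightarrow> nat" where "hE x = (\<Sum>y\<in>{y. (x, y) \<in> HE}. wE (clE (x, y)))"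

lemma graph_G: "graph G" and finite_G: "finite G" by (rule NJ_D(2)[OF N], rule graph_fin(1)[OF NJ_D(2)[OF N]])

lemma lf_G: "lfE e ~= 0 \<longleftrightarrow> e \<in> G"
 using NJ_D(7)[OF N] unfolding NZ_def lfE_def by (cases e) simp

lemma cl_le: "e \<in> G ==> clE e <= L"
 using LIST_1[OF NJ_D(5)[OF N], of "fst e" "snd e"] unfolding clE_def by simp

lemma cl_sym: "(x, y) \<in> G ==> clE (y, x) = clE (x, y)"
 using COL_D(2)[OF NJ_D(4)[OF N], of x y] lf_G[of "(x, y)"] unfolding clE_def lfE_def by simp

lemma lf_sym: "lfE (y, x) = lfE (x, y)"
 unfolding lfE_def by (rule COL_D(1)[OF NJ_D(4)[OF N]])

lemma HG: "HE \<subseteq> G" and fH: "finite HE"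
 unfolding HE_def using finite_G by auto

lemma H_sym: "(x, y) \<in> HE ==> (y, x) \<in> HE"
 using graph_D[OF graph_G, of x y] cl_sym[of x y] lf_sym[of y x] unfolding HE_def by simp

lemma w_K: "i <= L ==> K i * 2 ^ (L - i) = wE i"
proof -
 assume i: "i <= L"
 have "i - ll + (L - i) = L - min i ll" using i llL by (cases "i <= ll") auto
 then show ?thesis unfolding K_def wE_def by (simp flip: power_add)
qed

lemma card_class_G: "card {e \<in> G. clE e = i} = 2 * arr s 10 (pr i 1)"
proof -
 have e: "{e \<in> {e \<in> G. clE e = i}. fst e < snd e} = CS (arr s 4) (arr s 6) i 1"
 proof (intro equalityI subsetI)
  fix e assume e: "e \<in> {e \<in> {e \<in> G. clE e = i}. fst e < snd e}"
  then have "anc 1 (lfE e)" using lf_G[of e] by (intro anc_one) simp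
  then show "e \<in> CS (arr s 4) (arr s 6) i 1" using e unfolding CS_def clE_def lfE_def by (cases e) simp
 next
  fix e assume e: "e \<in> CS (arr s 4) (arr s 6) i 1"
  then have "anc 1 (lfE e)" unfolding CS_def lfE_def by (cases e) simp
  then have "lfE e ~= 0" by (auto intro: ccontr)
  then show "e \<in> {e \<in> {e \<in> G. clE e = i}. fst e < snd e}" using e lf_G[of e] unfolding CS_def clE_def by (cases e) simp
 qed
 have "card {e \<in> G. clE e = i} = 2 * card {e \<in> {e \<in> G. clE e = i}. fst e < snd e}"
  by (rule card_symmetric_relation) (use finite_G graph_D[OF graph_G] cl_sym in auto)
 then show ?thesis unfolding e COL_D(6)[OF NJ_D(4)[OF N]] .
qed

lemma card_class_H: "i <= L ==> 2 * arr s 10 (pr i (arr s 14 i)) <= card {e \<in> HE. clE e = i}"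
proof -
 assume i: "i <= L"
 have "CS (arr s 4) (arr s 6) i (arr s 14 i) \<subseteq> {e \<in> {e \<in> HE. clE e = i}. fst e < snd e}"
 proof
  fix e assume e: "e \<in> CS (arr s 4) (arr s 6) i (arr s 14 i)"
  then have a: "anc (arr s 14 i) (lfE e)" "fst e < snd e" "clE e = i" unfolding CS_def lfE_def clE_def by (cases e; simp)+
  then have nz: "lfE e ~= 0" "arr s 14 i ~= 0" by (auto intro: ccontr)
  then have "2 * K i <= arr s 14 i" using S i unfolding SELB_def by auto
  then have "arr s 14 i = arr s 6 (pr (fst e) (snd e))"
   by (intro leaf_anc[OF NJ_D(4)[OF N]]) (use nz a in \<open>simp_all add: lfE_def clE_def\<close>)
  then have "lfE e = arr s 14 i" unfolding lfE_def by simp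
  then show "e \<in> {e \<in> {e \<in> HE. clE e = i}. fst e < snd e}" unfolding HE_def using a lf_G[of e] nz by simp
 qed
 then have "card (CS (arr s 4) (arr s 6) i (arr s 14 i)) <= card {e \<in> {e \<in> HE. clE e = i}. fst e < snd e}"
  by (intro card_mono) (use fH in auto)
 moreover have "card {e \<in> HE. clE e = i} = 2 * card {e \<in> {e \<in> HE. clE e = i}. fst e < snd e}"
 proof (rule card_symmetric_relation)
  fix x y assume "(x, y) \<in> {e \<in> HE. clE e = i}"
  then have hE: "(x, y) \<in> HE" "clE (x, y) = i" "(x, y) \<in> G" using HG by auto
  then show "(y, x) \<in> {e \<in> HE. clE e = i} \<and> x ~= y" using H_sym[OF hE(1)] cl_sym[OF hE(3)] graph_D[OF graph_G hE(3)] by simp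
 qed (use fH in simp)
 ultimately show ?thesis unfolding COL_D(6)[OF NJ_D(4)[OF N]] by simp
qed

lemma weight_sum: "(\<Sum>x<n. arr s 3 x) = (\<Sum>e\<in>G. 2 ^ (L - clE e))"
 unfolding NJ_D(6)[OF N] wt_def clE_def using sum_pairs[OF graph_G subset_refl, of "\<lambda>e. 2 ^ (L - arr s 4 (prod_encode e))"] by simp

text \<open>The comparison is made class by class: the selected colour has at least
  \<open>1 / (8 * K i)\<close> of the edges, and each of these counts \<open>K i\<close>
  times.\<close>

lemma weight_le_selected: "(\<Sum>x<n. arr s 3 x) <= 8 * (\<Sum>x<n. hE x)"
proof -
 have "(\<Sum>x<n. arr s 3 x) = (\<Sum>i\<le>L. card {e \<in> G. clE e = i} * 2 ^ (L - i))"
  unfolding weight_sum by (rule sum_classes[OF finite_G cl_le])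
 also have "\<dots> <= (\<Sum>i\<le>L. 8 * (card {e \<in> HE. clE e = i} * wE i))"
 proof (rule sum_mono)
  fix i assume "i \<in> {..L}"
  then have i: "i <= L" by simp
  have "card {e \<in> G. clE e = i} * 2 ^ (L - i) <= 2 * (8 * K i * arr s 10 (pr i (arr s 14 i))) * 2 ^ (L - i)"
   unfolding card_class_G using sel[OF i] by (intro mult_right_mono) simp_all
  also have "\<dots> = 8 * (2 * arr s 10 (pr i (arr s 14 i)) * wE i)" unfolding w_K[OF i, symmetric] by simp
  also have "\<dots> <= 8 * (card {e \<in> HE. clE e = i} * wE i)" using card_class_H[OF i] by (intro mult_left_mono mult_right_mono) simp_all
  finally show "card {e \<in> G. clE e = i} * 2 ^ (L - i) <= 8 * (card {e \<in> HE. clE e = i} * wE i)" .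
 qed
 also have "\<dots> = 8 * (\<Sum>e\<in>HE. wE (clE e))"
 proof -
  have "clE e <= L" if "e \<in> HE" for e using cl_le that HG by blast
  from sum_classes[where h = clE and g = wE, OF fH this] show ?thesis by (simp add: sum_distrib_left)
 qed
 also have "(\<Sum>e\<in>HE. wE (clE e)) = (\<Sum>x<n. hE x)"
  unfolding hE_def using sum_pairs[OF graph_G HG, of "\<lambda>e. wE (clE e)"] by simp
 finally show ?thesis .
qed

text \<open>A selected edge weighs as much as a full slot, and the colouring permits at most one per
  slot. Only the last slot may be incomplete, which adds at most one slot weight
  \<open>2 ^ (L - ll)\<close>. Up to class \<open>ll\<close> slots have single entries and there is
  no surplus.\<close>

lemma selected_class:
 assumes i: "i <= L"
 shows "card {y \<in> {y. (x, y) \<in> HE}. clE (x, y) = i} * wE i <= arr s 8 (pr x i) * 2 ^ (L - i) + 2 ^ (L - ll)"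
proof -
 define A where "A = {y \<in> {y. (x, y) \<in> HE}. clE (x, y) = i}"
 have AG: "(x, y) \<in> G" "clE (x, y) = i" "lfE (x, y) = arr s 14 i" if "y \<in> A" for y using that unfolding A_def HE_def by auto
 have len: "arr s 8 (pr x i) = card {y. (x, y) \<in> G \<and> arr s 4 (pr x y) = i}" by (rule LIST_card[OF NJ_D(5)[OF N]])
 show ?thesis unfolding A_def[symmetric]
 proof (cases "i <= ll")
  case True
  have "finite {y. (x, y) \<in> G \<and> arr s 4 (pr x y) = i}" using graph_fin(2)[OF graph_G, of x] by simp
  then have "card A <= arr s 8 (pr x i)" unfolding len using AG unfolding clE_def by (intro card_mono) auto
  then have "card A * wE i <= arr s 8 (pr x i) * 2 ^ (L - i)" unfolding wE_def using True by (simp add: min_def)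
  then show "card A * wE i <= arr s 8 (pr x i) * 2 ^ (L - i) + 2 ^ (L - ll)" by simp
 next
  case False
  have ps: "arr s 5 (pr x y) < arr s 8 (pr x i)" if "y \<in> A" for y
   using LIST_1[OF NJ_D(5)[OF N] AG(1)[OF that]] AG(2)[OF that] unfolding clE_def by simp
  have "card A <= card {..arr s 8 (pr x i) div K i}"
  proof (rule card_inj_on_le)
   show "inj_on (\<lambda>y. arr s 5 (pr x y) div K i) A"
   proof (rule inj_onI)
    fix y z assume y: "y \<in> A" and z: "z \<in> A" and e: "arr s 5 (pr x y) div K i = arr s 5 (pr x z) div K i"
    have "arr s 11 (pr (slot (arr s 4) (arr s 5) x y) (arr s 6 (pr x y))) = Suc y"
     by (rule COL_D(3)[OF NJ_D(4)[OF N]]) (use lf_G[of "(x, y)"] AG(1)[OF y] in \<open>simp add: lfE_def\<close>)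
    moreover have "arr s 11 (pr (slot (arr s 4) (arr s 5) x z) (arr s 6 (pr x z))) = Suc z"
     by (rule COL_D(3)[OF NJ_D(4)[OF N]]) (use lf_G[of "(x, z)"] AG(1)[OF z] in \<open>simp add: lfE_def\<close>)
    ultimately show "y = z" using AG(2,3)[OF y] AG(2,3)[OF z] e unfolding slot_def clE_def lfE_def by simp
   qed
   show "(\<lambda>y. arr s 5 (pr x y) div K i) ` A \<subseteq> {..arr s 8 (pr x i) div K i}"
   proof
    fix z assume "z \<in> (\<lambda>y. arr s 5 (pr x y) div K i) ` A"
    then obtain y where "y \<in> A" "z = arr s 5 (pr x y) div K i" by blast
    then show "z \<in> {..arr s 8 (pr x i) div K i}" using div_le_mono[OF less_imp_le[OF ps[of y]], of "K i"] by simp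
   qed
  qed simp
  then have "card A * wE i <= Suc (arr s 8 (pr x i) div K i) * wE i" by (intro mult_right_mono) simp_all
  also have "\<dots> = arr s 8 (pr x i) div K i * K i * 2 ^ (L - i) + wE i" using w_K[OF i] by (simp add: mult.assoc)
  also have "\<dots> <= arr s 8 (pr x i) * 2 ^ (L - i) + wE i" by (intro add_right_mono mult_right_mono) simp_all
  also have "\<dots> = arr s 8 (pr x i) * 2 ^ (L - i) + 2 ^ (L - ll)" unfolding wE_def using False by simp
  finally show "card A * wE i <= arr s 8 (pr x i) * 2 ^ (L - i) + 2 ^ (L - ll)" .
 qed
qed

text \<open>The \<open>L + 1\<close> surpluses sum to
  \<open>(L + 1) * 2 ^ (L - ll) <= 2 ^ L\<close>, one unit of capacity. Here the logarithm in the
  slot size is used.\<close>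

lemma h_le: "x < n ==> hE x <= 2 * c x * 2 ^ L"
proof -
 assume x: "x < n"
 have "finite {y. (x, y) \<in> HE}" by (rule finite_subset[OF _ graph_fin(2)[OF graph_G, of x]]) (use HG in auto)
 then have "hE x = (\<Sum>i\<le>L. card {y \<in> {y. (x, y) \<in> HE}. clE (x, y) = i} * wE i)"
  unfolding hE_def by (rule sum_classes) (use cl_le HG in auto)
 also have "\<dots> <= (\<Sum>i\<le>L. arr s 8 (pr x i) * 2 ^ (L - i) + 2 ^ (L - ll))"
  by (intro sum_mono selected_class) simp
 also have "\<dots> = arr s 3 x + (L + 1) * 2 ^ (L - ll)"
  unfolding sum.distrib wt_classes[OF NJ_D(5)[OF N], symmetric] NJ_D(6)[OF N] by simp
 also have "\<dots> <= c x * 2 ^ L + 2 ^ ll * 2 ^ (L - ll)"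
  using clean[OF x] ll1 unfolding clean_def by (intro add_mono mult_right_mono) simp_all
 also have "\<dots> = (c x + 1) * 2 ^ L" using llL by (simp flip: power_add)
 also have "\<dots> <= 2 * c x * 2 ^ L" using c1[OF x] by (intro mult_right_mono) simp_all
 finally show ?thesis .
qed

text \<open>A selected edge is matched, with weight at most \<open>2 ^ L\<close>, or has a marked
  end. A marked \<open>x\<close> has \<open>c x <= 2 * d\<close>, so the selected weight at
  \<open>x\<close> is at most \<open>4 * d * 2 ^ L\<close>. Marked first ends, marked second ends
  and matched pairs give \<open>4 + 4 + 1\<close>.\<close>

lemma selected_le_matching: "(\<Sum>x<n. hE x) <= 9 * 2 ^ L * (\<Sum>x<n. arr s 16 x)"
proof -
 define F where "F = {x. x < n \<and> arr s 17 x ~= 0}"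
 note M = MI_D[OF NJ_D(3)[OF N]]
 define Ms where "Ms = {e \<in> HE. arr s 15 (prod_encode e) ~= 0}"
 define HF where "HF = {e \<in> HE. fst e \<in> F}"
 define HF' where "HF' = {e \<in> HE. snd e \<in> F}"
 have HH: "(\<Sum>x<n. hE x) = (\<Sum>e\<in>HE. wE (clE e))"
  unfolding hE_def using sum_pairs[OF graph_G HG, of "\<lambda>e. wE (clE e)"] by simp
 have fin: "finite Ms" "finite HF" "finite HF'" unfolding Ms_def HF_def HF'_def using fH by auto
 have "HE \<subseteq> Ms \<union> (HF \<union> HF')"
 proof
  fix e assume e: "e \<in> HE"
  obtain x y where xy: "e = (x, y)" by force
  have "cov s x y" using J e lf_G[of e] HG unfolding J_def HE_def lfE_def clE_def xy by auto
  moreover have "x < n" "y < n" using graph_D[OF graph_G] HG e xy by auto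
  ultimately show "e \<in> Ms \<union> (HF \<union> HF')" using e unfolding cov_def Ms_def HF_def HF'_def F_def xy by auto
 qed
 then have s1: "(\<Sum>e\<in>HE. wE (clE e)) <= (\<Sum>e\<in>Ms \<union> (HF \<union> HF'). wE (clE e))" by (intro sum_mono2) (use fin in auto)
 have s2: "(\<Sum>e\<in>Ms \<union> (HF \<union> HF'). wE (clE e)) <= (\<Sum>e\<in>Ms. wE (clE e)) + (\<Sum>e\<in>HF \<union> HF'. wE (clE e))"
  using sum.union_inter[of Ms "HF \<union> HF'" "\<lambda>e. wE (clE e)"] fin by simp
 have s3: "(\<Sum>e\<in>HF \<union> HF'. wE (clE e)) <= (\<Sum>e\<in>HF. wE (clE e)) + (\<Sum>e\<in>HF'. wE (clE e))"
  using sum.union_inter[of HF HF' "\<lambda>e. wE (clE e)"] fin by simp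
 have s4: "(\<Sum>e\<in>HF'. wE (clE e)) = (\<Sum>e\<in>HF. wE (clE e))"
 proof (rule sum.reindex_bij_witness[where i = prod.swap and j = prod.swap])
  fix e assume "e \<in> HF'"
  then have e: "e \<in> HE" "snd e \<in> F" unfolding HF'_def by simp_all
  obtain x y where xy: "e = (x, y)" by (cases e)
  have hE: "(x, y) \<in> HE" "y \<in> F" using e xy by simp_all
  show "prod.swap e \<in> HF" using H_sym[OF hE(1)] hE(2) unfolding HF_def xy by simp
  show "wE (clE (prod.swap e)) = wE (clE e)" using cl_sym[OF subsetD[OF HG hE(1)]] unfolding xy by simp
 next
  fix e assume "e \<in> HF"
  then have e: "e \<in> HE" "fst e \<in> F" unfolding HF_def by simp_all
  obtain x y where xy: "e = (x, y)" by (cases e)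
  have hE: "(x, y) \<in> HE" "x \<in> F" using e xy by simp_all
  show "prod.swap e \<in> HF'" using H_sym[OF hE(1)] hE(2) unfolding HF'_def xy by simp
 qed simp_all
 have s5: "(\<Sum>e\<in>HF. wE (clE e)) <= 4 * 2 ^ L * (\<Sum>x<n. arr s 16 x)"
 proof -
  have HFG: "HF \<subseteq> G" unfolding HF_def using HG by auto
  have "(\<Sum>e\<in>HF. wE (clE e)) = (\<Sum>x<n. \<Sum>y\<in>{y. (x, y) \<in> HF}. wE (clE (x, y)))"
   using sum_pairs[OF graph_G HFG, of "\<lambda>e. wE (clE e)"] by simp
  also have "\<dots> <= (\<Sum>x<n. 4 * 2 ^ L * arr s 16 x)"
  proof (rule sum_mono)
   fix x assume "x \<in> {..<n}"
   then have x: "x < n" by simp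
   show "(\<Sum>y\<in>{y. (x, y) \<in> HF}. wE (clE (x, y))) <= 4 * 2 ^ L * arr s 16 x"
   proof (cases "x \<in> F")
    case True
    then have "(\<Sum>y\<in>{y. (x, y) \<in> HF}. wE (clE (x, y))) = hE x" unfolding HF_def hE_def by simp
    also have "\<dots> <= 2 * c x * 2 ^ L" by (rule h_le[OF x])
    also have "\<dots> <= 2 * (2 * arr s 16 x) * 2 ^ L" using M(7)[OF x] True unfolding F_def by (intro mult_right_mono mult_left_mono) simp_all
    finally show ?thesis by (simp add: mult_ac)
   next
    case False
    then show ?thesis unfolding HF_def by simp
   qed
  qed
  finally show ?thesis by (simp add: sum_distrib_left)
 qed
 have s6: "(\<Sum>e\<in>Ms. wE (clE e)) <= 2 ^ L * (\<Sum>x<n. arr s 16 x)"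
 proof -
  let ?M = "{e. arr s 15 (prod_encode e) ~= 0}"
  have MG: "?M \<subseteq> G" using M(3) by auto
  have "(\<Sum>e\<in>Ms. wE (clE e)) <= (\<Sum>e\<in>Ms. 2 ^ L)" unfolding wE_def by (intro sum_mono power_increasing) auto
  also have "\<dots> <= card ?M * 2 ^ L" unfolding Ms_def
   using finite_subset[OF MG finite_G] by (simp add: card_mono Collect_mono)
  also have "card ?M = (\<Sum>x<n. arr s 16 x)" using sum_pairs[OF graph_G MG, of "\<lambda>_. 1 :: nat"] M(4) by simp
  finally show ?thesis by (simp add: mult.commute)
 qed
 show ?thesis unfolding HH using s1 s2 s3 s4 s5 s6 by simp
qed

text \<open>Capacities and edges of class 0 act as a dual cover. An edge of \<open>P\<close> either
  has class 0 and full weight, or has an end of positive level, whose capacity is at most eight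
  times its weight; this gives \<open>1 + 8\<close>.\<close>

lemma b_matching_le_weight:
 assumes P: "b_matching n c (Eset G) P"
 shows "card P * 2 ^ L <= 9 * (\<Sum>x<n. arr s 3 x)"
proof -
 define T where "T = {x. x < n \<and> arr s 2 x > 0}"
 define G0 where "G0 = {e \<in> G. clE e = 0}"
 have fin: "finite T" "finite G0" unfolding T_def G0_def using finite_G by auto
 have "finite (Eset G)" unfolding Eset_def using finite_G by simp
 then have fP: "finite P" using P finite_subset unfolding b_matching_def by blast
 have "P \<subseteq> Eset G0 \<union> (\<Union>x\<in>T. {e \<in> P. x \<in> e})"
 proof
  fix e assume e: "e \<in> P"
  then obtain a b where ab: "e = {a, b}" "(a, b) \<in> G" using P unfolding b_matching_def Eset_def by auto
  have "clE (a, b) = max (arr s 2 a) (arr s 2 b)" using lc ab(2) unfolding LC_def clE_def by blast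
  moreover have "a < n" "b < n" using graph_D[OF graph_G ab(2)] by auto
  ultimately show "e \<in> Eset G0 \<union> (\<Union>x\<in>T. {e \<in> P. x \<in> e})"
   using e ab unfolding T_def G0_def Eset_def by (cases "clE (a, b) = 0") (force simp: max_def split: if_splits)+
 qed
 then have 1: "card P <= card (Eset G0 \<union> (\<Union>x\<in>T. {e \<in> P. x \<in> e}))"
  by (intro card_mono) (use fin fP in \<open>auto simp: Eset_def\<close>)
 have 2: "card (Eset G0 \<union> (\<Union>x\<in>T. {e \<in> P. x \<in> e})) <= card (Eset G0) + card (\<Union>x\<in>T. {e \<in> P. x \<in> e})"
  by (rule card_Un_le)
 have 3: "card (\<Union>x\<in>T. {e \<in> P. x \<in> e}) <= (\<Sum>x\<in>T. card {e \<in> P. x \<in> e})" by (rule card_UN_le[OF fin(1)])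
 have 4: "(\<Sum>x\<in>T. card {e \<in> P. x \<in> e}) <= (\<Sum>x\<in>T. c x)"
  using P unfolding b_matching_def T_def by (intro sum_mono) auto
 have 5: "card (Eset G0) <= card G0" unfolding Eset_def using fin by (intro card_image_le)
 have "card P * 2 ^ L <= (card G0 + (\<Sum>x\<in>T. c x)) * 2 ^ L" using 1 2 3 4 5 by (intro mult_right_mono) simp_all
 then have 6: "card P * 2 ^ L <= card G0 * 2 ^ L + (\<Sum>x\<in>T. c x * 2 ^ L)" by (simp add: add_mult_distrib sum_distrib_right)
 have 7: "(\<Sum>x\<in>T. c x * 2 ^ L) <= (\<Sum>x\<in>T. 8 * arr s 3 x)"
  using clean unfolding T_def clean_def by (intro sum_mono) auto
 have 8: "(\<Sum>x\<in>T. 8 * arr s 3 x) <= (\<Sum>x<n. 8 * arr s 3 x)" unfolding T_def by (intro sum_mono2) auto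
 have "card G0 * 2 ^ L = (\<Sum>e\<in>G0. 2 ^ (L - clE e))" unfolding G0_def by simp
 also have "\<dots> <= (\<Sum>x<n. arr s 3 x)" unfolding weight_sum G0_def by (intro sum_mono2) (use finite_G in auto)
 finally show ?thesis using 6 7 8 unfolding sum_distrib_left[symmetric] by linarith
qed

text \<open>The factors 9, 8 and 9 of the three comparisons are multiplied by 2, because the degrees
  count every matched edge at both ends.\<close>

lemma approximation: "approx_b_matching (1 / 1296) n c (Eset G) (output_edges n s)"
proof -
 note out = output_b_matching[OF graph_G NJ_D(3)[OF N]]
 have bound: "card P <= 1296 * card (output_edges n s)" if P: "b_matching n c (Eset G) P" for P
 proof -
  have "card P * 2 ^ L <= 9 * (8 * (9 * 2 ^ L * (\<Sum>x<n. arr s 16 x)))"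
   using b_matching_le_weight[OF P] weight_le_selected selected_le_matching by linarith
  then have "card P * 2 ^ L <= 1296 * card (output_edges n s) * 2 ^ L" unfolding out(2) by simp
  then show ?thesis by simp
 qed
 have "finite (Eset G)" unfolding Eset_def using finite_G by simp
 then have "finite (Pow (Eset G))" by simp
 moreover have "{P. b_matching n c (Eset G) P} \<subseteq> Pow (Eset G)" by (auto simp: b_matching_def)
 ultimately have "finite {P. b_matching n c (Eset G) P}" by (rule rev_finite_subset)
 moreover have "{card P |P. b_matching n c (Eset G) P} = card ` {P. b_matching n c (Eset G) P}" by auto
 ultimately have "finite {card P |P. b_matching n c (Eset G) P}" by simp
 moreover have "card (output_edges n s) \<in> {card P |P. b_matching n c (Eset G) P}" using out(1) by blast
 ultimately have "max_b_matching_size n c (Eset G) <= 1296 * card (output_edges n s)"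
  unfolding max_b_matching_size_def using bound by (intro Max.boundedI) auto
 then have "real (max_b_matching_size n c (Eset G)) <= real (1296 * card (output_edges n s))" by (simp only: of_nat_le_iff)
 then show ?thesis unfolding approx_b_matching_def using out(1) by simp
qed

end

end

section \<open>Processing one update\<close>

text \<open>Marks are left alone when a matched edge disappears; whether an end has fallen below
  half of its capacity is tested at the very end of the update.\<close>

definition RemoveM :: com where
 "RemoveM = If (Arr 15 (PE (Reg 2) (Reg 3)))
   (Seq (Store 15 (PE (Reg 2) (Reg 3)) (Const 0)) (Seq (Store 15 (PE (Reg 3) (Reg 2)) (Const 0))
   (Seq (Store 1 (Add (Mul (Reg 2) (Reg 0)) (Reg 3)) (Const 0)) (Seq (Store 1 (Add (Mul (Reg 3) (Reg 0)) (Reg 2)) (Const 0))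
   (Seq (Store 16 (Reg 2) (Sub (Arr 16 (Reg 2)) (Const 1))) (Store 16 (Reg 3) (Sub (Arr 16 (Reg 3)) (Const 1)))))))) Skip"

definition Ins :: com where
 "Ins = Seq (Assign 20 (Reg 2)) (Seq (Assign 21 (Reg 3))
   (Seq (If (Less (Arr 2 (Reg 2)) (Arr 2 (Reg 3))) (Assign 22 (Arr 2 (Reg 3))) (Assign 22 (Arr 2 (Reg 2)))) AddEdge))"

definition Rem :: com where
 "Rem = Seq (Assign 20 (Reg 2)) (Seq (Assign 21 (Reg 3)) (Seq Del RemoveM))"

text \<open>\<open>FixSel\<close> follows \<open>Fixup\<close>, whose recolourings change the shares
  of the colours. The scans come last: their time bound presumes a weight within the capacity, and
  they alter no colours.\<close>

definition Tail :: com where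
 "Tail = Seq (Push 2) (Seq (Push 3) (Seq Fixup (Seq FixSel
   (Seq (Assign 8 (Reg 2)) (Seq Unfull (Seq (Assign 8 (Reg 3)) Unfull))))))"

definition Pow1 :: com where
 "Pow1 = Seq (Store 20 (Add (Reg 4) (Const 1)) (Add (Arr 20 (Reg 4)) (Arr 20 (Reg 4)))) (Assign 4 (Add (Reg 4) (Const 1)))"

text \<open>Logarithms and the table of powers are computed once, during the first update; register
  6 remembers that this has been done.\<close>

definition Init :: com where
 "Init = If (Reg 6) Skip (Seq (Store 20 (Const 0) (Const 1)) (Seq (While (Less (Arr 20 (Reg 4)) (Reg 0)) Pow1)
   (Seq (While (Less (Arr 20 (Reg 5)) (Add (Reg 4) (Const 1))) (Assign 5 (Add (Reg 5) (Const 1)))) (Assign 6 (Const 1)))))"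

definition Main :: com where
 "Main = Seq Init (Seq (If (Reg 1) Ins Rem) Tail)"

context bm
begin

lemma MI_mono:
 assumes "MI out M d full G X" "G \<subseteq> G'" "X \<subseteq> X'"
 shows "MI out M d full G' X'"
proof -
 note D = MI_D[OF assms(1)]
 show ?thesis
 proof (rule MI_I)
  show "(x, y) \<in> G'" if "M (pr x y) ~= 0" for x y using D(3)[OF that] assms(2) by blast
  show "c x <= 2 * d x" if "x < n" "x \<notin> X'" "full x ~= 0" for x
  proof -
   have "x \<notin> X" using that(2) assms(3) by blast
   then show ?thesis using D(7)[OF that(1)] that(3) by simp
  qed
 qed ((rule D(1), simp), rule D(2), rule D(4), (rule D(5), assumption), (rule D(6), assumption+))
qed

text \<open>Each end loses one unit of used capacity, which raises \<open>pot3\<close> if the end is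
  marked. Both ends join the exempted set.\<close>

lemma MI_remove:
 assumes MI: "MI out M d full G X" and G: "graph G" and uv: "M (pr u v) ~= 0"
 shows "MI (out(u * n + v := 0, v * n + u := 0)) (M(pr u v := 0, pr v u := 0)) (d(u := d u - 1, v := d v - 1)) full
   (G - {(u, v), (v, u)}) (X \<union> {u, v})" (is "MI ?out ?M ?d full ?G ?X")
  and "pot3 (d(u := d u - 1, v := d v - 1)) full <= pot3 d full + 2"
proof -
 note D = MI_D[OF MI]
 have g: "u < n" "v < n" "u ~= v" using graph_D[OF G D(3)[OF uv]] by simp_all
 have vu: "M (pr v u) ~= 0" using uv D(2)[of u v] by simp
 have M': "?M (pr a b) = (if E2 u v a b then 0 else M (pr a b))" for a b by (rule E2_upd)
 have E2: "E2 u v a b \<longleftrightarrow> (a = u \<and> b = v) \<or> (a = v \<and> b = u)" for a b unfolding E2_def by auto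
 have le: "?d x <= d x" for x by simp
 show "MI ?out ?M ?d full ?G ?X"
 proof (rule MI_I)
  fix a b assume ab: "a < b" "b < n"
  then have an: "a < n" by simp
  show "(?out (a * n + b) ~= 0) = (?M (pr a b) ~= 0)"
  proof (cases "E2 u v a b")
   case True
   then have "?out (a * n + b) = 0" unfolding E2 by auto
   then show ?thesis unfolding M' using True by simp
  next
   case False
   have "a * n + b ~= u * n + v" using pos_inj[OF an ab(2) g(1,2)] False unfolding E2 by simp
   moreover have "a * n + b ~= v * n + u" using pos_inj[OF an ab(2) g(2,1)] False unfolding E2 by simp
   ultimately have "?out (a * n + b) = out (a * n + b)" by simp
   then show ?thesis unfolding M' using False D(1)[of a b] ab by simp
  qed
 next
  fix a b
  have "E2 u v b a = E2 u v a b" unfolding E2 by blast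
  then show "?M (pr a b) = ?M (pr b a)" unfolding M' using D(2)[of a b] by simp
 next
  fix a b assume "?M (pr a b) ~= 0"
  then have h: "\<not> E2 u v a b" "M (pr a b) ~= 0" unfolding M' by (simp_all split: if_splits)
  show "(a, b) \<in> ?G" using D(3)[OF h(2)] h(1) unfolding E2 by simp
 next
  fix x
  have fin: "finite {y. M (pr x y) ~= 0}" by (rule MI_finite[OF G MI])
  have eq: "{y. ?M (pr x y) ~= 0} = {y. M (pr x y) ~= 0} - {y. E2 u v x y}" unfolding M' by (simp add: set_eq_iff)
  show "?d x = card {y. ?M (pr x y) ~= 0}"
  proof (cases "x = u \<or> x = v")
   case False
   then have "{y. E2 u v x y} = {}" unfolding E2 by simp
   then show ?thesis unfolding eq using False D(4)[of x] by (metis Diff_empty array_rules(4))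
  next
   case True
   then show ?thesis
   proof
    assume x: "x = u"
    have "{y. E2 u v x y} = {v}" unfolding E2 x using g by auto
    then show ?thesis unfolding eq using uv g D(4)[of u] fin x by (simp add: card_Diff_singleton)
   next
    assume x: "x = v"
    have "{y. E2 u v x y} = {u}" unfolding E2 x using g by auto
    then show ?thesis unfolding eq using vu g D(4)[of v] fin x by (simp add: card_Diff_singleton)
   qed
  qed
 next
  fix x assume x: "x < n"
  show "?d x <= c x" using le[of x] D(5)[OF x] by (rule le_trans)
 next
  fix x assume x: "x < n" "full x = 0"
  show "?d x < c x" using le[of x] D(6)[OF x] by (rule le_less_trans)
 next
  fix x assume x: "x < n" "x \<notin> ?X" "full x ~= 0"
  have "x \<notin> X" "?d x = d x" using x(2) by simp_all
  then show "c x <= 2 * ?d x" using D(7)[OF x(1)] x(3) by simp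
 qed
 have "pot3 ?d full <= (\<Sum>x<n. (if full x ~= 0 then c x - d x else 0) + (if x = u then 1 else 0) + (if x = v then 1 else 0))"
  unfolding pot3_def by (intro sum_mono) auto
 also have "\<dots> = pot3 d full + 2" unfolding pot3_def sum.distrib using g by simp
 finally show "pot3 ?d full <= pot3 d full + 2" .
qed

lemma Inv_grow:
 assumes I: "Inv s G X E" and G': "graph G'" "G \<subseteq> G'"
 shows "Inv s G' X E"
proof -
 note D = Inv0_D[OF Inv_D(1)[OF I]]
 have M: "MIs s G' X" by (rule MI_mono[OF D(3) G'(2) subset_refl])
 have E: "E \<subseteq> G'" using D(8) G'(2) by blast
 show ?thesis unfolding Inv_def Inv0_def using D(1,4,5,6,7) M E G'(1) Inv_D(2,3)[OF I] by simp
qed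

text \<open>Coverage survives because pairs that remain in the graph keep their matching entry and
  the marks are unchanged; only the deleted edge loses its entry.\<close>

lemma Inv_restrict:
 assumes I: "Inv s G X E" and g: "graph E" and e: "eqA {1, 15, 16} s s'" and r: "reg s' = reg s" and M: "MIs s' E Y"
  and m: "\<And>x y. (x, y) \<in> E ==> arr s' 15 (pr x y) = arr s 15 (pr x y)"
 shows "Inv s' E Y E"
proof -
 note D = Inv0_D[OF Inv_D(1)[OF I]]
 have A: "arr s' a = arr s a" if "a \<notin> {1, 15, 16}" for a by (rule eqA_D[OF e that])
 have C: "Cst s'" using D(1) unfolding Cst_def by (simp add: A r)
 have J': "J s'" unfolding J_def
 proof (intro allI impI)
  fix x y assume h: "arr s' 6 (pr x y) ~= 0" "arr s' 6 (pr x y) = arr s' 14 (arr s' 4 (pr x y))"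
  have l: "arr s 6 (pr x y) ~= 0" using h(1) by (simp add: A)
  then have "(x, y) \<in> E" using Inv_D(2)[OF I] unfolding NZ_def by blast
  then have "arr s' 15 (pr x y) = arr s 15 (pr x y)" by (rule m)
  moreover have "cov s x y" using D(4) h unfolding J_def by (simp add: A)
  ultimately show "cov s' x y" unfolding cov_def by (simp add: A)
 qed
 have N: "NZ s' E" using Inv_D(2)[OF I] unfolding NZ_def by (simp add: A)
 show ?thesis unfolding Inv_def Inv0_def using C J' N M g D(5,6,7) Inv_D(3)[OF I] by (simp add: A)
qed

text \<open>While its colour and its list entries are removed, the deleted edge stays in
  \<open>G\<close>, since the matching may still contain it. Only here does the graph itself shrink
  to \<open>E\<close>.\<close>

lemma RemoveM_spec:
 assumes I: "Inv s G {} E" and E: "E = G - {(u, v), (v, u)}" and g: "graph E" and r: "reg s 2 = u" "reg s 3 = v" and uv: "u < n" "v < n" "u ~= v"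
 shows "ht B RemoveM s (\<lambda>s'. Inv s' E {u, v} E \<and> eqA {1, 15, 16} s s' \<and> reg s' = reg s \<and>
  pot3 (arr s' 16) (arr s' 17) <= pot3 (arr s 16) (arr s 17) + 2 \<and> clock s' <= clock s + 200)"
  (is "ht B _ s ?Q")
proof -
 note D = Inv0_D[OF Inv_D(1)[OF I]]
 note M = MI_D[OF D(3)]
 have r0: "reg s 0 = n" using D(1) by (simp add: Cst_def)
 have sms: "sm u" "sm v" "sm n" using uv by simp_all
 have sq: "sm (u * n)" "sm (v * n)" using uv n2
  by (auto intro!: sm12 simp: sm1_def q1_def power2_eq_square intro: order_trans[OF mult_right_mono[of _ n n]])
 show ?thesis
 proof (cases "arr s 15 (pr u v) = 0")
  case True
  define s1 where "s1 = tick 1 (tick (1 + cost (Arr 15 (PE (Reg 2) (Reg 3)))) s)"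
  have run: "ht B RemoveM s Q = Q s1" for Q unfolding RemoveM_def s1_def using True sms by (simp add: r)
  have a1: "arr s1 = arr s" "reg s1 = reg s" "clock s1 <= clock s + 200" by (simp_all add: s1_def)
  have vu: "arr s 15 (pr v u) = 0" using True M(2)[of u v] by simp
  have "MI (arr s 1) (arr s 15) (arr s 16) (arr s 17) E {u, v}"
  proof (rule MI_I)
   show "(x, y) \<in> E" if h: "arr s 15 (pr x y) ~= 0" for x y
   proof -
    have "(x, y) ~= (u, v)" using h True by (intro notI) simp
    moreover have "(x, y) ~= (v, u)" using h vu by (intro notI) simp
    ultimately show ?thesis unfolding E using M(3)[OF h] by simp
   qed
   show "c x <= 2 * arr s 16 x" if "x < n" "x \<notin> {u, v}" "arr s 17 x ~= 0" for x using M(7)[OF that(1)] that(3) by simp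
  qed ((rule M(1), simp), rule M(2), rule M(4), (rule M(5), assumption), (rule M(6), assumption+))
  then have M1: "MIs s1 E {u, v}" unfolding a1 .
  have e1: "eqA {1, 15, 16} s s1" unfolding eqA_def a1 by simp
  have "Inv s1 E {u, v} E" by (rule Inv_restrict[OF I g e1 a1(2) M1]) (simp add: a1)
  then show ?thesis unfolding run using a1 e1 by simp
 next
  case False
  define s1 where "s1 = tick (1 + cost (Reg 3) + cost (Sub (Arr 16 (Reg 3)) (Const 1))) (set_arr 16 v (arr s 16 v - 1)
   (tick (1 + cost (Reg 2) + cost (Sub (Arr 16 (Reg 2)) (Const 1))) (set_arr 16 u (arr s 16 u - 1)
   (tick (1 + cost (Add (Mul (Reg 3) (Reg 0)) (Reg 2)) + cost (Const 0)) (set_arr 1 (v * n + u) 0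
   (tick (1 + cost (Add (Mul (Reg 2) (Reg 0)) (Reg 3)) + cost (Const 0)) (set_arr 1 (u * n + v) 0
   (tick (1 + cost (PE (Reg 3) (Reg 2)) + cost (Const 0)) (set_arr 15 (pr v u) 0
   (tick (1 + cost (PE (Reg 2) (Reg 3)) + cost (Const 0)) (set_arr 15 (pr u v) 0
   (tick (1 + cost (Arr 15 (PE (Reg 2) (Reg 3)))) s))))))))))))"
  have run: "ht B RemoveM s Q = Q s1" for Q unfolding RemoveM_def s1_def using False sms sq uv by (simp add: r r0)
  have a1: "arr s1 = (arr s)(15 := (arr s 15)(pr u v := 0, pr v u := 0), 1 := (arr s 1)(u * n + v := 0, v * n + u := 0),
    16 := (arr s 16)(u := arr s 16 u - 1, v := arr s 16 v - 1))" unfolding s1_def by (simp add: fun_upd_twist)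
  have b1: "reg s1 = reg s" "clock s1 <= clock s + 200" by (simp_all add: s1_def)
  have A1: "arr s1 1 = (arr s 1)(u * n + v := 0, v * n + u := 0)" "arr s1 15 = (arr s 15)(pr u v := 0, pr v u := 0)"
   "arr s1 16 = (arr s 16)(u := arr s 16 u - 1, v := arr s 16 v - 1)" "arr s1 17 = arr s 17" unfolding a1 by simp_all
  note R = MI_remove[OF D(3) D(2) False]
  have M1: "MIs s1 E {u, v}" using R(1) unfolding A1 E by simp
  have e1: "eqA {1, 15, 16} s s1" unfolding eqA_def a1 by simp
  have "Inv s1 E {u, v} E"
  proof (rule Inv_restrict[OF I g e1 b1(1) M1])
   fix x y assume "(x, y) \<in> E"
   then have "\<not> E2 u v x y" unfolding E E2_def by auto
   moreover have "arr s1 15 (pr x y) = (if E2 u v x y then 0 else arr s 15 (pr x y))" unfolding A1(2) by (rule E2_upd)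
   ultimately show "arr s1 15 (pr x y) = arr s 15 (pr x y)" by simp
  qed
  moreover have "pot3 (arr s1 16) (arr s1 17) <= pot3 (arr s 16) (arr s 17) + 2" using R(2) unfolding A1 .
  ultimately show ?thesis unfolding run using b1 e1 by simp
 qed
qed

lemma wt_unaffected:
 assumes "\<And>y. (x, y) \<in> G' \<longleftrightarrow> (x, y) \<in> G" "\<And>y. (x, y) \<in> G ==> cl' (pr x y) = cl (pr x y)"
 shows "wt cl' G' x = wt cl G x"
 unfolding wt_def assms(1) by (rule sum.cong) (use assms(2) in auto)

lemma level_term_le:
 assumes "lev x <= L"
 shows "(if wt cl' G' x > 0 then real L - real (lev x) else 0) <= (if wt cl G x > 0 then real L - real (lev x) else 0) + real L"
 using assms by simp

text \<open>\<open>10 = 4 * 2 + 2\<close>: two new ordered pairs contribute at most \<open>L\<close>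
  each, and both ends may cease to be isolated. Weights only grow, so defects do not.\<close>

lemma phi_insert:
 assumes G: "graph G" and lc: "LC lev cl G" and uv: "(u, v) \<notin> G" "(v, u) \<notin> G" "u < n" "v < n" "u ~= v"
  and cl': "cl' = cl(pr u v := j, pr v u := j)" and G': "G' = G \<union> {(u, v), (v, u)}"
 shows "phi lev cl' G' <= phi lev cl G + 10 * real L"
proof -
 note fG = graph_fin(1)[OF G]
 have same: "cl' (pr x y) = cl (pr x y)" if "(x, y) \<in> G" for x y
 proof -
  have "\<not> E2 u v x y" using that uv unfolding E2_def by auto
  moreover have "cl' (pr x y) = (if E2 u v x y then j else cl (pr x y))" unfolding cl' by (rule E2_upd)
  ultimately show ?thesis by simp
 qed
 have "(\<Sum>e\<in>G'. real L - real (cl' (prod_encode e))) = (\<Sum>e\<in>G. real L - real (cl' (prod_encode e))) + (\<Sum>e\<in>{(u, v), (v, u)}. real L - real (cl' (prod_encode e)))"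
  unfolding G' by (rule sum.union_disjoint) (use fG uv in auto)
 moreover have "(\<Sum>e\<in>G. real L - real (cl' (prod_encode e))) = (\<Sum>e\<in>G. real L - real (cl (prod_encode e)))"
  by (rule sum.cong) (use same in auto)
 moreover have "(\<Sum>e\<in>{(u, v), (v, u)}. real L - real (cl' (prod_encode e))) <= 2 * real L"
  using uv(5) by simp
 ultimately have 1: "(\<Sum>e\<in>G'. real L - real (cl' (prod_encode e))) <= (\<Sum>e\<in>G. real L - real (cl (prod_encode e))) + 2 * real L" by linarith
 have fin: "finite {y. (x, y) \<in> G'}" for x
 proof -
  have "{y. (x, y) \<in> G'} \<subseteq> insert u (insert v {y. (x, y) \<in> G})" unfolding G' by auto
  then show ?thesis by (rule finite_subset) (simp add: graph_fin(2)[OF G])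
 qed
 have W: "wt cl G x <= wt cl' G' x" for x
 proof -
  have "wt cl G x = (\<Sum>y\<in>{y. (x, y) \<in> G}. 2 ^ (L - cl' (pr x y)))" unfolding wt_def by (rule sum.cong) (use same in auto)
  also have "\<dots> <= wt cl' G' x" unfolding wt_def by (rule sum_mono2[OF fin]) (auto simp: G')
  finally show ?thesis .
 qed
 have "defect lev cl' G' x <= defect lev cl G x" for x
 proof -
  have "real (wt cl G x) / 2 ^ L <= real (wt cl' G' x) / 2 ^ L" using W[of x] by (simp add: divide_right_mono)
  then show ?thesis unfolding defect_def by (intro mult_left_mono) auto
 qed
 then have 2: "(\<Sum>x<n. defect lev cl' G' x) <= (\<Sum>x<n. defect lev cl G x)" by (intro sum_mono)
 have "(\<Sum>x<n. if wt cl' G' x > 0 then real L - real (lev x) else 0) \<le>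
  (\<Sum>x<n. (if wt cl G x > 0 then real L - real (lev x) else 0) + (if x = u then real L else 0) + (if x = v then real L else 0))"
 proof (rule sum_mono)
  fix x assume "x \<in> {..<n}"
  then have l: "lev x <= L" using lc unfolding LC_def by simp
  show "(if wt cl' G' x > 0 then real L - real (lev x) else 0) \<le>
   (if wt cl G x > 0 then real L - real (lev x) else 0) + (if x = u then real L else 0) + (if x = v then real L else 0)"
  proof (cases "x = u \<or> x = v")
   case True
   then have "real L <= (if x = u then real L else 0) + (if x = v then real L else 0)" by auto
   then show ?thesis using level_term_le[of lev x cl' G' cl G, OF l] by linarith
  next
   case False
   have "wt cl' G' x = wt cl G x" by (rule wt_unaffected) (use False same in \<open>auto simp: G'\<close>)
   then show ?thesis using False by simp
  qed
 qed
 also have "\<dots> = (\<Sum>x<n. if wt cl G x > 0 then real L - real (lev x) else 0) + 2 * real L"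
  unfolding sum.distrib using uv(3,4) by simp
 finally show ?thesis unfolding phi_def using 1 2 by linarith
qed

text \<open>The weight lost is \<open>2 ^ - cl\<close>, and the class is at least the level; after
  scaling by \<open>2 ^ lev x\<close> the defect grows by at most 1.\<close>

lemma defect_remove:
 assumes fin: "finite {y. (x, y) \<in> E}" and S: "{y. (x, y) \<in> G} = insert z {y. (x, y) \<in> E}" "(x, z) \<notin> E"
  and l: "lev x <= cl (pr x z)" "cl (pr x z) <= L"
 shows "defect lev cl E x <= defect lev cl G x + 1"
proof -
 have z: "z \<notin> {y. (x, y) \<in> E}" using S(2) by simp
 have W: "wt cl G x = wt cl E x + 2 ^ (L - cl (pr x z))" unfolding wt_def S(1) using fin z by simp
 define a where "a = real (c x) / 2 - real (wt cl G x) / 2 ^ L"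
 define b where "b = (2::real) ^ (L - cl (pr x z)) / 2 ^ L"
 have b: "b = 1 / 2 ^ cl (pr x z)" unfolding b_def using l(2) by (simp add: power_diff)
 have e: "real (c x) / 2 - real (wt cl E x) / 2 ^ L = a + b" unfolding a_def b_def W by (simp add: add_divide_distrib)
 have "0 <= b" unfolding b by simp
 then have "max 0 (a + b) <= max 0 a + b" by simp
 then have "2 ^ lev x * max 0 (a + b) <= 2 ^ lev x * (max 0 a + b)" by (rule mult_left_mono) simp
 moreover have "2 ^ lev x * b <= 1" unfolding b using l(1) by (simp add: power_increasing)
 ultimately show ?thesis unfolding defect_def e a_def[symmetric] by (simp add: distrib_left)
qed

text \<open>Only the defects of the two ends can grow, by 1 each and with coefficient 12.\<close>

lemma phi_delete:
 assumes G: "graph G" and lc: "LC lev cl G" and uv: "(u, v) \<in> G" and E: "E = G - {(u, v), (v, u)}"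
 shows "phi lev cl E <= phi lev cl G + 24"
proof -
 note fG = graph_fin[OF G]
 have g: "u < n" "v < n" "u ~= v" "(v, u) \<in> G" using graph_D[OF G uv] by simp_all
 have cG: "cl (pr x y) = max (lev x) (lev y)" if "(x, y) \<in> G" for x y using lc that unfolding LC_def by simp
 have lL: "lev x <= L" if "x < n" for x using lc that unfolding LC_def by simp
 have cL: "cl (pr x y) <= L" if "(x, y) \<in> G" for x y using cG[OF that] lL graph_D[OF G that] by simp
 have EG: "E \<subseteq> G" unfolding E by blast
 have fin: "finite {y. (x, y) \<in> E}" for x by (rule finite_subset[OF _ fG(2)[of x]]) (use EG in auto)
 have 1: "(\<Sum>e\<in>E. real L - real (cl (prod_encode e))) <= (\<Sum>e\<in>G. real L - real (cl (prod_encode e)))"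
  by (rule sum_mono2[OF fG(1) EG]) (use cL in auto)
 have W: "wt cl E x <= wt cl G x" for x unfolding wt_def by (rule sum_mono2[OF fG(2)]) (use EG in auto)
 have "(\<Sum>x<n. defect lev cl E x) <= (\<Sum>x<n. defect lev cl G x + (if x = u then 1 else 0) + (if x = v then 1 else 0))"
 proof (rule sum_mono)
  fix x assume "x \<in> {..<n}"
  show "defect lev cl E x <= defect lev cl G x + (if x = u then 1 else 0) + (if x = v then 1 else 0)"
  proof (cases "x = u \<or> x = v")
   case False
   have "wt cl E x = wt cl G x" by (rule wt_unaffected) (use False in \<open>auto simp: E\<close>)
   then show ?thesis using False unfolding defect_def by simp
  next
   case True
   then show ?thesis
   proof
    assume x: "x = u"
    have "defect lev cl E u <= defect lev cl G u + 1"
     by (rule defect_remove[where z = v, OF fin]) (use uv g cG[OF uv] cL[OF uv] in \<open>auto simp: E\<close>)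
    then show ?thesis using x g by simp
   next
    assume x: "x = v"
    have "defect lev cl E v <= defect lev cl G v + 1"
     by (rule defect_remove[where z = u, OF fin]) (use uv g cG[OF g(4)] cL[OF g(4)] in \<open>auto simp: E\<close>)
    then show ?thesis using x g by simp
   qed
  qed
 qed
 also have "\<dots> = (\<Sum>x<n. defect lev cl G x) + 2" unfolding sum.distrib using g by simp
 finally have 2: "(\<Sum>x<n. defect lev cl E x) <= (\<Sum>x<n. defect lev cl G x) + 2" .
 have 3: "(\<Sum>x<n. if wt cl E x > 0 then real L - real (lev x) else 0) <= (\<Sum>x<n. if wt cl G x > 0 then real L - real (lev x) else 0)"
 proof (rule sum_mono)
  fix x assume "x \<in> {..<n}"
  then show "(if wt cl E x > 0 then real L - real (lev x) else 0) <= (if wt cl G x > 0 then real L - real (lev x) else 0)"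
   using W[of x] lL[of x] by simp
 qed
 show ?thesis unfolding phi_def using 1 2 3 by linarith
qed

text \<open>The initial potential is not small. It is never spent: every unit by which the defects
 fall below their initial value is matched by an edge.\<close>

lemma phi_lower:
 assumes G: "graph G" and lc: "LC lev cl G" and cle: "\<And>x. x < n ==> clean lev (wt cl G) x"
 shows "6 * (\<Sum>x<n. real (c x)) - 48 * real (card G) <= phi lev cl G"
proof -
 \<comment> \<open>At level 0 the defect has factor 1 and the weight is at most the degree. At a
   positive level cleanness gives \<open>c x\<close> at most eight times the degree, so the left
   side is not positive.\<close>
 have d: "real (c x) / 2 - 4 * real (card {y. (x, y) \<in> G}) <= defect lev cl G x" if x: "x < n" for x
 proof -
  have "wt cl G x <= (\<Sum>y\<in>{y. (x, y) \<in> G}. 2 ^ L)" unfolding wt_def by (intro sum_mono power_increasing) auto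
  then have "wt cl G x <= card {y. (x, y) \<in> G} * 2 ^ L" by simp
  then have "real (wt cl G x) <= real (card {y. (x, y) \<in> G} * 2 ^ L)" by (simp only: of_nat_le_iff)
  then have W: "real (wt cl G x) / 2 ^ L <= real (card {y. (x, y) \<in> G})" by (simp add: field_simps)
  show ?thesis
  proof (cases "lev x = 0")
   case True
   have "real (c x) / 2 - real (wt cl G x) / 2 ^ L <= defect lev cl G x" unfolding defect_def using True by simp
   moreover have "0 <= real (card {y. (x, y) \<in> G})" by simp
   ultimately show ?thesis using W by linarith
  next
   case False
   have "c x * 2 ^ L <= 8 * wt cl G x" using cle[OF x] False unfolding clean_def by simp
   then have "real (c x * 2 ^ L) <= real (8 * wt cl G x)" by (simp only: of_nat_le_iff)
   then have "real (c x) <= 8 * (real (wt cl G x) / 2 ^ L)" by (simp add: field_simps)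
   moreover have "0 <= defect lev cl G x" unfolding defect_def by simp
   ultimately show ?thesis using W by linarith
  qed
 qed
 have "(\<Sum>x<n. real (c x) / 2 - 4 * real (card {y. (x, y) \<in> G})) <= (\<Sum>x<n. defect lev cl G x)"
  by (rule sum_mono) (use d in simp)
 moreover have "(\<Sum>x<n. real (c x) / 2 - 4 * real (card {y. (x, y) \<in> G})) = (\<Sum>x<n. real (c x)) / 2 - 4 * (\<Sum>x<n. real (card {y. (x, y) \<in> G}))"
  by (simp add: sum_subtractf sum_divide_distrib sum_distrib_left)
 moreover have "(\<Sum>x<n. real (card {y. (x, y) \<in> G})) = real (card G)"
  using sum_pairs[OF G subset_refl, of "\<lambda>_. 1 :: real"] by simp
 ultimately have 1: "(\<Sum>x<n. real (c x)) / 2 - 4 * real (card G) <= (\<Sum>x<n. defect lev cl G x)" by simp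
 have cL: "cl (pr x y) <= L" if "(x, y) \<in> G" for x y using lc graph_D[OF G that] that unfolding LC_def by simp
 have 2: "0 <= (\<Sum>e\<in>G. real L - real (cl (prod_encode e)))" by (rule sum_nonneg) (use cL in auto)
 have 3: "0 <= (\<Sum>x<n. if wt cl G x > 0 then real L - real (lev x) else 0)"
  using lc unfolding LC_def by (intro sum_nonneg) auto
 show ?thesis unfolding phi_def using 1 2 3 by linarith
qed

definition TP :: "state \<Rightarrow> (nat \<times> nat) set \<Rightarrow> real" where
 "TP s G = real (clock s) + pot s G + 4000 * (real L + 3) * real (pot3 (arr s 16) (arr s 17))"

definition GI :: "state \<Rightarrow> (nat \<times> nat) set \<Rightarrow> bool" where
 "GI s G \<longleftrightarrow> FI s G {} \<and> SELB (arr s 14) \<and> reg s 9 = 0 \<and> reg s 6 = 1"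

text \<open>The state after the edge has been changed and before repairs: only its two ends may be
  outside the thresholds or carry a mark with less than half of the capacity in use.\<close>

definition Mid :: "state \<Rightarrow> (nat \<times> nat) set \<Rightarrow> nat \<Rightarrow> nat \<Rightarrow> bool" where
 "Mid s G u v \<longleftrightarrow> Inv s G {u, v} G \<and> STK s \<and> LC (arr s 2) (arr s 4) G \<and> (\<forall>x<n. x \<notin> {u, v} --> clean (arr s 2) (arr s 3) x)
   \<and> SELB (arr s 14) \<and> reg s 2 = u \<and> reg s 3 = v \<and> reg s 6 = 1"

text \<open>In spite of its name a square: the amortised bound reached is quadratic in
  \<open>L\<close>, and a further logarithm is given away only in the final estimate.\<close>

definition cubic :: real where "cubic = (real L + 3) * (real L + 3)"

lemma cubic_ge: "3 * (real L + 3) <= cubic" "9 <= cubic"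
proof -
 show 1: "3 * (real L + 3) <= cubic" unfolding cubic_def by (rule mult_right_mono) simp_all
 then show "9 <= cubic" by simp
qed

lemma STK_frame: "arr s' 18 = arr s 18 ==> arr s' 19 = arr s 19 ==> reg s' 9 = reg s 9 ==> STK s' = STK s"
 unfolding STK_def by simp

lemma flags_empty: "STK s ==> reg s 9 = 0 ==> flags s = {}"
 unfolding STK_def flags_def by simp

lemma FI_D:
 assumes "FI s G X"
 shows "Inv s G X G" "STK s" "LC (arr s 2) (arr s 4) G" "\<And>x. x < n ==> x \<notin> flags s ==> clean (arr s 2) (arr s 3) x"
 using assms unfolding FI_def by blast+

lemma clean_cong: "W' x = W x ==> clean lev W' x = clean lev W x"
 unfolding clean_def by simp

lemma LC_insert:
 assumes lc: "LC lev cl G" and uv: "(u, v) \<notin> G" "(v, u) \<notin> G" and j: "j = max (lev u) (lev v)"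
 shows "LC lev (cl(pr u v := j, pr v u := j)) (G \<union> {(u, v), (v, u)})"
 unfolding LC_def
proof (intro conjI allI impI)
 show "lev x <= L" if "x < n" for x using lc that unfolding LC_def by simp
 fix a b assume ab: "(a, b) \<in> G \<union> {(u, v), (v, u)}"
 have e: "(cl(pr u v := j, pr v u := j)) (pr a b) = (if E2 u v a b then j else cl (pr a b))" by (rule E2_upd)
 show "(cl(pr u v := j, pr v u := j)) (pr a b) = max (lev a) (lev b)"
 proof (cases "E2 u v a b")
  case True
  then show ?thesis unfolding e j E2_def by (auto simp: max.commute)
 next
  case False
  then have "(a, b) \<in> G" using ab unfolding E2_def by auto
  then show ?thesis unfolding e using False lc unfolding LC_def by simp
 qed
qed

lemma Step_facts:
 assumes "Step R k d s s'"
 shows "eqA FC s s'" "Mmono s s'" "clock s' <= clock s + d" "p2 s' <= p2 s + k"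
 using assms unfolding Step_def by simp_all

text \<open>The \<open>10 * L\<close> units of \<open>phi\<close> cost at most
  \<open>120000 * cubic\<close> at the price \<open>tau\<close>; the other 2000 cover the execution
  and the newly coloured edge.\<close>

lemma Ins_spec:
 assumes g: "GI s G" and r: "reg s 2 = u" "reg s 3 = v" and uv: "u < n" "v < n" "u ~= v" "(u, v) \<notin> G"
  and G': "G' = G \<union> {(u, v), (v, u)}"
 shows "ht B Ins s (\<lambda>s'. Mid s' G' u v \<and> TP s' G' <= TP s G + 122000 * cubic)"
  (is "ht B _ s ?Q")
proof -
 have F: "FI s G {}" and S: "SELB (arr s 14)" and r9: "reg s 9 = 0" "reg s 6 = 1" using g unfolding GI_def by auto
 note F = FI_D[OF F]
 note D = Inv0_D[OF Inv_D(1)[OF F(1)]]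
 have fl: "flags s = {}" by (rule flags_empty[OF F(2) r9(1)])
 have vu: "(v, u) \<notin> G" using graph_D[OF D(2), of v u] uv(4) by blast
 have gG': "graph G'" using D(2) uv unfolding G' graph_def by auto
 define j where "j = max (arr s 2 u) (arr s 2 v)"
 have jL: "j <= L" using F(3) uv unfolding LC_def j_def by simp
 define s1 where "s1 = tick (1 + cost (Arr 2 (Reg 2))) (set_reg 22 j (tick (1 + cost (Less (Arr 2 (Reg 2)) (Arr 2 (Reg 3))))
  (tick (1 + cost (Reg 3)) (set_reg 21 v (tick (1 + cost (Reg 2)) (set_reg 20 u s))))))"
 have run: "ht B Ins s Q = ht B AddEdge s1 Q" for Q
  unfolding Ins_def s1_def j_def by (cases "arr s 2 u < arr s 2 v") (simp_all add: r max_def)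
 have a1: "arr s1 = arr s" "reg s1 20 = u" "reg s1 21 = v" "reg s1 22 = j" "\<And>q. q < 20 ==> reg s1 q = reg s q" "clock s1 <= clock s + 50"
  by (simp_all add: s1_def)
 have "Inv s1 G {} G" by (rule Inv_eqA[OF F(1)]) (use a1 in \<open>simp_all add: eqA_def same_def\<close>)
 then have I1: "Inv s1 G' {} G" by (rule Inv_grow[OF _ gG']) (auto simp: G')
 have uvG': "(u, v) \<in> G'" unfolding G' by simp
 show ?thesis unfolding run
 proof (rule ht_mono[OF AddEdge_spec[OF I1 uv(4) uvG' jL a1(2-4)]], elim conjE)
  fix s' assume st: "Step 30 1 (2000 * (L + 3)) s1 s'" and I': "Inv s' G' {} (G \<union> {(u, v), (v, u)})" and c4: "arr s' 4 = (arr s1 4)(pr u v := j, pr v u := j)"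
  note sf = Step_facts[OF st]
  have A: "arr s' a = arr s a" if "a \<notin> FC" for a using eqA_D[OF sf(1) that] a1(1) by simp
  have R: "reg s' q = reg s q" if "q < 20" for q using Step_same[OF st, of q] a1(5)[OF that] that by simp
  have I2: "Inv s' G' {} G'" using I' unfolding G' .
  note D2 = Inv0_D[OF Inv_D(1)[OF I2]]
  have "MIs s' G' {u, v}" by (rule MI_mono[OF D2(3)]) simp_all
  then have I3: "Inv s' G' {u, v} G'" using I2 unfolding Inv_def Inv0_def by simp
  have c4': "arr s' 4 = (arr s 4)(pr u v := j, pr v u := j)" using c4 a1(1) by simp
  have l2: "arr s' 2 = arr s 2" by (rule A) simp
  have lc: "LC (arr s' 2) (arr s' 4) G'" unfolding l2 c4' G' by (rule LC_insert[OF F(3) uv(4) vu j_def])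
  have ph: "phi (arr s' 2) (arr s' 4) G' <= phi (arr s 2) (arr s 4) G + 10 * real L"
   unfolding l2 by (rule phi_insert[OF D(2) F(3) uv(4) vu uv(1-3) c4' G'])
  have cl: "clean (arr s' 2) (arr s' 3) x" if "x < n" "x \<notin> {u, v}" for x
  proof -
   have "wt (arr s' 4) G' x = wt (arr s 4) G x"
   proof (rule wt_unaffected)
    show "(x, y) \<in> G' \<longleftrightarrow> (x, y) \<in> G" for y using that unfolding G' by auto
    show "arr s' 4 (pr x y) = arr s 4 (pr x y)" for y
    proof -
     have "arr s' 4 (pr x y) = (if E2 u v x y then j else arr s 4 (pr x y))" unfolding c4' by (rule E2_upd)
     moreover have "\<not> E2 u v x y" using that unfolding E2_def by auto
     ultimately show ?thesis by simp
    qed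
   qed
   then have "arr s' 3 x = arr s 3 x" using D2(7) D(7) by simp
   moreover have "clean (arr s 2) (arr s 3) x" using F(4)[OF that(1)] fl by simp
   ultimately show ?thesis unfolding l2 using clean_cong by blast
  qed
  have stk: "STK s'" using F(2) STK_frame[of s' s] A[of 18] A[of 19] R[of 9] by simp
  have "arr s' 14 = arr s 14" by (rule A) simp
  then have mid: "Mid s' G' u v" unfolding Mid_def using I3 stk lc cl S R[of 2] R[of 3] R[of 6] r r9 by simp
  have p3: "pot3 (arr s' 16) (arr s' 17) = pot3 (arr s 16) (arr s 17)" using sf(2) a1(1) unfolding Mmono_def by simp
  have "real (p2 s') <= real (p2 s) + 1" using sf(4) a1(1) by simp
  moreover have "real (clock s') <= real (clock s) + 2000 * (real L + 3) + 50"
  proof -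
   have "clock s' <= clock s + 2000 * (L + 3) + 50" using sf(3) a1(6) by linarith
   then have "real (clock s') <= real (clock s + 2000 * (L + 3) + 50)" by (simp only: of_nat_le_iff)
   then show ?thesis by simp
  qed
  moreover have "tau * phi (arr s' 2) (arr s' 4) G' <= tau * phi (arr s 2) (arr s 4) G + 120000 * cubic"
  proof -
   have "tau * phi (arr s' 2) (arr s' 4) G' <= tau * (phi (arr s 2) (arr s 4) G + 10 * real L)"
    using ph by (rule mult_left_mono) (simp add: tau_def)
   also have "\<dots> = tau * phi (arr s 2) (arr s 4) G + 120000 * ((real L + 3) * real L)" unfolding tau_def by (simp add: algebra_simps)
   also have "\<dots> <= tau * phi (arr s 2) (arr s 4) G + 120000 * cubic" unfolding cubic_def by (simp add: mult_left_mono)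
   finally show ?thesis .
  qed
  moreover have "reg s' 9 = reg s 9" by (rule R) simp
  ultimately have "TP s' G' <= TP s G + 122000 * cubic" unfolding TP_def pot_def p3 using cubic_ge by simp
  then show "?Q s'" using mid by simp
 qed
qed

lemma Rem_spec:
 assumes g: "GI s G" and r: "reg s 2 = u" "reg s 3 = v" and uv: "(u, v) \<in> G" and E: "E = G - {(u, v), (v, u)}"
 shows "ht B Rem s (\<lambda>s'. Mid s' E u v \<and> TP s' E <= TP s G + 122000 * cubic)"
  (is "ht B _ s ?Q")
proof -
 have F: "FI s G {}" and S: "SELB (arr s 14)" and r9: "reg s 9 = 0" "reg s 6 = 1" using g unfolding GI_def by auto
 note F = FI_D[OF F]
 note D = Inv0_D[OF Inv_D(1)[OF F(1)]]
 have fl: "flags s = {}" by (rule flags_empty[OF F(2) r9(1)])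
 have uvn: "u < n" "v < n" "u ~= v" using graph_D[OF D(2) uv] by simp_all
 have gE: "graph E" using D(2) unfolding E graph_def by auto
 define s1 where "s1 = tick (1 + cost (Reg 3)) (set_reg 21 v (tick (1 + cost (Reg 2)) (set_reg 20 u s)))"
 have run: "ht B Rem s Q = ht B (Seq Del RemoveM) s1 Q" for Q
  unfolding Rem_def s1_def by (simp add: r)
 have a1: "arr s1 = arr s" "reg s1 20 = u" "reg s1 21 = v" "\<And>q. q < 20 ==> reg s1 q = reg s q" "clock s1 <= clock s + 50"
  by (simp_all add: s1_def)
 have I1: "Inv s1 G {} G" by (rule Inv_eqA[OF F(1)]) (use a1 in \<open>simp_all add: eqA_def same_def\<close>)
 show ?thesis unfolding run
 proof (rule ht_Seq[OF Del_spec[OF I1 uv a1(2,3)]], elim conjE)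
  fix s2 assume st: "Step 30 2 (5000 * (L + 3)) s1 s2" and I2: "Inv s2 G {} (G - {(u, v), (v, u)})" and c4: "arr s2 4 = arr s1 4"
  note sf = Step_facts[OF st]
  have A: "arr s2 a = arr s a" if "a \<notin> FC" for a using eqA_D[OF sf(1) that] a1(1) by simp
  have R: "reg s2 q = reg s q" if "q < 20" for q using Step_same[OF st, of q] a1(4)[OF that] that by simp
  have I2': "Inv s2 G {} E" using I2 unfolding E .
  have r2: "reg s2 2 = u" "reg s2 3 = v" using R r by simp_all
  show "ht B RemoveM s2 ?Q"
  proof (rule ht_mono[OF RemoveM_spec[OF I2' E gE r2 uvn]], elim conjE)
   fix s' assume I3: "Inv s' E {u, v} E" and e: "eqA {1, 15, 16} s2 s'" and rg: "reg s' = reg s2"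
    and p3: "pot3 (arr s' 16) (arr s' 17) <= pot3 (arr s2 16) (arr s2 17) + 2" and ck: "clock s' <= clock s2 + 200"
   have A2: "arr s' a = arr s2 a" if "a \<notin> {1, 15, 16}" for a by (rule eqA_D[OF e that])
   have c4': "arr s' 4 = arr s 4" using A2[of 4] c4 a1(1) by simp
   have l2: "arr s' 2 = arr s 2" using A2[of 2] A[of 2] by simp
   have lc: "LC (arr s' 2) (arr s' 4) E" using F(3) unfolding l2 c4' LC_def E by simp
   have ph: "phi (arr s' 2) (arr s' 4) E <= phi (arr s 2) (arr s 4) G + 24"
    unfolding l2 c4' by (rule phi_delete[OF D(2) F(3) uv E])
   note D3 = Inv0_D[OF Inv_D(1)[OF I3]]
   have cl: "clean (arr s' 2) (arr s' 3) x" if "x < n" "x \<notin> {u, v}" for x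
   proof -
    have "wt (arr s' 4) E x = wt (arr s 4) G x"
     by (rule wt_unaffected) (use that in \<open>auto simp: E c4'\<close>)
    then have "arr s' 3 x = arr s 3 x" using D3(7) D(7) by simp
    moreover have "clean (arr s 2) (arr s 3) x" using F(4)[OF that(1)] fl by simp
    ultimately show ?thesis unfolding l2 using clean_cong by blast
   qed
   have stk: "STK s'" using F(2) STK_frame[of s' s] A[of 18] A[of 19] A2[of 18] A2[of 19] R[of 9] rg by simp
   have "arr s' 14 = arr s 14" using A[of 14] A2[of 14] by simp
   then have mid: "Mid s' E u v" unfolding Mid_def using I3 stk lc cl S r2 R[of 6] rg r9 by simp
   have "pot3 (arr s2 16) (arr s2 17) = pot3 (arr s 16) (arr s 17)" using sf(2) a1(1) unfolding Mmono_def by simp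
   then have p3': "real (pot3 (arr s' 16) (arr s' 17)) <= real (pot3 (arr s 16) (arr s 17)) + 2" using p3 by simp
   then have P3: "4000 * (real L + 3) * real (pot3 (arr s' 16) (arr s' 17)) <= 4000 * (real L + 3) * real (pot3 (arr s 16) (arr s 17)) + 8000 * (real L + 3)"
   proof -
    have "4000 * (real L + 3) * real (pot3 (arr s' 16) (arr s' 17)) <= 4000 * (real L + 3) * (real (pot3 (arr s 16) (arr s 17)) + 2)"
     using p3' by (rule mult_left_mono) simp
    then show ?thesis by (simp add: distrib_left)
   qed
   have "p2 s' = p2 s2" using A2[of 10] A2[of 14] by simp
   then have P2: "real (p2 s') <= real (p2 s) + 2" using sf(4) a1(1) by simp
   have CK: "real (clock s') <= real (clock s) + 5000 * (real L + 3) + 250"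
   proof -
    have "clock s' <= clock s + 5000 * (L + 3) + 250" using sf(3) a1(5) ck by linarith
    then have "real (clock s') <= real (clock s + 5000 * (L + 3) + 250)" by (simp only: of_nat_le_iff)
    then show ?thesis by simp
   qed
   have PH: "tau * phi (arr s' 2) (arr s' 4) E <= tau * phi (arr s 2) (arr s 4) G + 288000 * (real L + 3)"
   proof -
    have "tau * phi (arr s' 2) (arr s' 4) E <= tau * (phi (arr s 2) (arr s 4) G + 24)"
     using ph by (rule mult_left_mono) (simp add: tau_def)
    also have "\<dots> = tau * phi (arr s 2) (arr s 4) G + 288000 * (real L + 3)" unfolding tau_def by (simp add: algebra_simps)
    finally show ?thesis .
   qed
   have R9: "reg s' 9 = reg s 9" using R[of 9] rg by simp
   have "TP s' E <= TP s G + 122000 * cubic" unfolding TP_def pot_def R9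
    using P3 P2 CK PH cubic_ge by linarith
   then show "?Q s'" using mid by simp
  qed
 qed
qed

definition quality :: "state \<Rightarrow> bool" where
 "quality s \<longleftrightarrow> (\<forall>i\<le>L. arr s 10 (pr i 1) <= 8 * K i * arr s 10 (pr i (arr s 14 i)))"

text \<open>The two calls of \<open>Unfull\<close> clear the exempted set one end at a time. Level
  changes, switches and scans are paid from the potentials, so what remains is dominated by the
  check of all classes.\<close>

lemma Tail_spec:
 assumes m: "Mid s G u v" and uv: "u < n" "v < n"
 shows "ht B Tail s (\<lambda>s'. GI s' G \<and> quality s' \<and> TP s' G <= TP s G + 500 * cubic)"
  (is "ht B _ s ?Q")
proof -
 have I: "Inv s G {u, v} G" and S: "STK s" and lc: "LC (arr s 2) (arr s 4) G" and SB: "SELB (arr s 14)"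
  and cl: "\<And>x. x < n ==> x \<notin> {u, v} ==> clean (arr s 2) (arr s 3) x" and r: "reg s 2 = u" "reg s 3 = v" "reg s 6 = 1"
  using m unfolding Mid_def by blast+
 have n9: "(2::nat) ~= 9" "(3::nat) ~= 9" by simp_all
 show ?thesis unfolding Tail_def
 proof (rule ht_Seq[OF Push_spec[OF S r(1) uv(1) n9(1)]], elim conjE)
  fix s1 assume S1: "STK s1" and f1: "{y. arr s1 19 y ~= 0} = insert u {y. arr s 19 y ~= 0}" and n1: "reg s1 9 <= reg s 9 + 1"
   and g1: "\<forall>q. q ~= 9 --> reg s1 q = reg s q" and e1: "eqA {18, 19} s s1" and k1: "clock s1 <= clock s + 50"
  have r1: "reg s1 3 = v" using g1 r by simp
  show "ht B (Seq (Push 3) (Seq Fixup (Seq FixSel (Seq (Assign 8 (Reg 2)) (Seq Unfull (Seq (Assign 8 (Reg 3)) Unfull)))))) s1 ?Q"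
  proof (rule ht_Seq[OF Push_spec[OF S1 r1 uv(2) n9(2)]], elim conjE)
   fix s2 assume S2: "STK s2" and f2: "{y. arr s2 19 y ~= 0} = insert v {y. arr s1 19 y ~= 0}" and n2': "reg s2 9 <= reg s1 9 + 1"
    and g2: "\<forall>q. q ~= 9 --> reg s2 q = reg s1 q" and e2: "eqA {18, 19} s1 s2" and k2: "clock s2 <= clock s1 + 50"
   have A2: "arr s2 a = arr s a" if "a \<notin> {18, 19}" for a using eqA_D[OF e1 that] eqA_D[OF e2 that] by simp
   have R2: "reg s2 q = reg s q" if "q ~= 9" for q using g1 g2 that by simp
   have I2: "Inv s2 G {u, v} G" by (rule Inv_eqA[OF I]) (use A2 R2 in \<open>simp_all add: eqA_def same_def\<close>)
   have cl2: "clean (arr s2 2) (arr s2 3) x" if "x < n" "x \<notin> flags s2" for x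
   proof -
    have "x \<notin> {u, v}" using that(2) unfolding flags_def f2 f1 by simp
    then show ?thesis using cl[OF that(1)] by (simp add: A2)
   qed
   have "LC (arr s2 2) (arr s2 4) G" using lc by (simp add: A2)
   then have F2: "FI s2 G {u, v}" unfolding FI_def using I2 S2 cl2 by simp
   have "real (clock s2) <= real (clock s) + 100" "real (reg s2 9) <= real (reg s 9) + 2" using k1 k2 n1 n2' by simp_all
   then have T2: "real (clock s2) + pot s2 G <= real (clock s) + pot s G + 300" unfolding pot_def by (simp add: A2)
   show "ht B (Seq Fixup (Seq FixSel (Seq (Assign 8 (Reg 2)) (Seq Unfull (Seq (Assign 8 (Reg 3)) Unfull))))) s2 ?Q"
   proof (rule ht_Seq[OF Fixup_spec[OF F2]], elim conjE)
    fix s3 assume F3: "FI s3 G {u, v}" and st3: "FStep s2 s3" and r3: "reg s3 9 = 0"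
     and T3: "real (clock s3) + pot s3 G <= real (clock s2) + pot s2 G + 10"
    have R3: "reg s3 q = reg s q" if "q < 9" for q using st3 that R2[of q] unfolding FStep_def by simp
    have A3: "arr s3 a = arr s a" if "a \<notin> FD" for a
    proof -
     have "eqA FD s2 s3" using st3 unfolding FStep_def by blast
     from eqA_D[OF this that] show ?thesis using A2[of a] that by simp
    qed
    have M3: "pot3 (arr s3 16) (arr s3 17) = pot3 (arr s 16) (arr s 17)" using st3 A2[of 16] A2[of 17] unfolding FStep_def Mmono_def by simp
    note F3' = FI_D[OF F3]
    have fl3: "flags s3 = {}" by (rule flags_empty[OF F3'(2) r3])
    have N3: "NJ s3 G {u, v}" and J3: "J s3" using F3'(1) unfolding Inv_NJ by simp_all
    have SB3: "SELB (arr s3 14)" using SB A3[of 14] by simp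
    show "ht B (Seq FixSel (Seq (Assign 8 (Reg 2)) (Seq Unfull (Seq (Assign 8 (Reg 3)) Unfull)))) s3 ?Q"
    proof (rule ht_Seq[OF FixSel_spec[OF N3 J3 SB3]], elim conjE)
     fix s4 assume N4: "NJ s4 G {u, v}" and J4: "J s4" and SB4: "SELB (arr s4 14)" and R4: "\<forall>q<10. reg s4 q = reg s3 q"
      and e4: "eqA (insert 14 FM) s3 s4" and M4: "Mmono s3 s4"
      and q4: "\<forall>i\<le>L. arr s4 10 (pr i 1) <= 8 * K i * arr s4 10 (pr i (arr s4 14 i))"
      and T4: "clock s4 + 1000 * p2 s4 <= clock s3 + 1000 * p2 s3 + 320 * (L + 3) * (L + 3)"
     have A4: "arr s4 a = arr s3 a" if "a \<notin> insert 14 FM" for a by (rule eqA_D[OF e4 that])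
     have cl3: "clean (arr s3 2) (arr s3 3) x" if "x < n" for x using F3'(4)[OF that] fl3 by simp
     define s5 where "s5 = tick (1 + cost (Reg 2)) (set_reg 8 u s4)"
     have run5: "ht B (Seq (Assign 8 (Reg 2)) q) s4 Q = ht B q s5 Q" for q Q
      using R4 R3[of 2] r by (simp add: s5_def)
     have a5: "arr s5 = arr s4" "reg s5 8 = u" "\<And>q. q ~= 8 ==> reg s5 q = reg s4 q" "clock s5 = clock s4 + 2" by (simp_all add: s5_def)
     have N5: "NJ s5 G {u, v}" by (rule NJ_frame[OF N4]) (use NJ_D(3)[OF N4] a5 in \<open>simp_all add: eqA_def same_def\<close>)
     have J5: "J s5" using J4 unfolding J_def cov_def a5(1) .
     have SB5: "SELB (arr s5 14)" using SB4 unfolding a5(1) .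
     have W5: "arr s5 3 u <= c u * 2 ^ L" using cl3[OF uv(1)] A4[of 3] unfolding clean_def a5(1) by simp
     show "ht B (Seq (Assign 8 (Reg 2)) (Seq Unfull (Seq (Assign 8 (Reg 3)) Unfull))) s4 ?Q"
      unfolding run5
     proof (rule ht_Seq[OF Unfull_spec[OF N5 J5 a5(2) uv(1) SB5 W5]], elim conjE)
      fix s6 assume N6: "NJ s6 G ({u, v} - {u})" and J6: "J s6" and R6: "\<forall>q<10. reg s6 q = reg s5 q" and e6: "eqA FM s5 s6"
       and T6: "clock s6 + 4000 * (L + 3) * pot3 (arr s6 16) (arr s6 17) <= clock s5 + 4000 * (L + 3) * pot3 (arr s5 16) (arr s5 17) + 30"
      have A6: "arr s6 a = arr s5 a" if "a \<notin> FM" for a by (rule eqA_D[OF e6 that])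
      define s7 where "s7 = tick (1 + cost (Reg 3)) (set_reg 8 v s6)"
      have r63: "reg s6 3 = v" using R6 a5(3)[of 3] R4 R3[of 3] r by simp
      have run7: "ht B (Seq (Assign 8 (Reg 3)) q) s6 Q = ht B q s7 Q" for q Q by (simp add: s7_def r63)
      have a7: "arr s7 = arr s6" "reg s7 8 = v" "\<And>q. q ~= 8 ==> reg s7 q = reg s6 q" "clock s7 = clock s6 + 2" by (simp_all add: s7_def)
      have N7: "NJ s7 G ({u, v} - {u})" by (rule NJ_frame[OF N6]) (use NJ_D(3)[OF N6] a7 in \<open>simp_all add: eqA_def same_def\<close>)
      have J7: "J s7" using J6 unfolding J_def cov_def a7(1) .
      have SB7: "SELB (arr s7 14)" using SB5 A6[of 14] unfolding a7(1) by simp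
      have W7: "arr s7 3 v <= c v * 2 ^ L" using cl3[OF uv(2)] A4[of 3] A6[of 3] unfolding clean_def a7(1) a5(1) by simp
      show "ht B (Seq (Assign 8 (Reg 3)) Unfull) s6 ?Q"
       unfolding run7
      proof (rule ht_mono[OF Unfull_spec[OF N7 J7 a7(2) uv(2) SB7 W7]], elim conjE)
       fix s8 assume N8: "NJ s8 G ({u, v} - {u} - {v})" and J8: "J s8" and R8: "\<forall>q<10. reg s8 q = reg s7 q" and e8: "eqA FM s7 s8"
        and T8: "clock s8 + 4000 * (L + 3) * pot3 (arr s8 16) (arr s8 17) <= clock s7 + 4000 * (L + 3) * pot3 (arr s7 16) (arr s7 17) + 30"
       have A84: "arr s8 a = arr s4 a" if "a \<notin> FM" for a using eqA_D[OF e8 that] A6[OF that] a7(1) a5(1) by simp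
       have A83: "arr s8 a = arr s3 a" if "a \<notin> insert 14 FM" for a using A84[of a] A4[OF that] that by simp
       have R8': "reg s8 q = reg s3 q" if "q < 10" "q ~= 8" for q using R8 a7(3)[of q] R6 a5(3)[of q] R4 that by simp
       have X: "{u, v} - {u} - {v} = {}" by auto
       have I8: "Inv s8 G {} G" unfolding Inv_NJ using N8 J8 unfolding X by simp
       have stk: "STK s8" using F3'(2) STK_frame[of s8 s3] A83[of 18] A83[of 19] R8'[of 9] by simp
       have lc8: "LC (arr s8 2) (arr s8 4) G" using F3'(3) A83[of 2] A83[of 4] by simp
       have cl8: "clean (arr s8 2) (arr s8 3) x" if "x < n" for x using cl3[OF that] A83[of 2] A83[of 3] by simp
       have F8: "FI s8 G {}" unfolding FI_def using I8 stk lc8 cl8 by simp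
       have sel8: "arr s8 14 = arr s4 14" "arr s8 10 = arr s4 10" by (rule A84; simp)+
       have gi: "GI s8 G" unfolding GI_def sel8 using F8 SB4 R8'[of 9] R8'[of 6] R3[of 6] r r3 by simp
       have qu: "quality s8" unfolding quality_def sel8 by (rule q4)
       have ph: "phi (arr s8 2) (arr s8 4) G = phi (arr s3 2) (arr s3 4) G" using A83[of 2] A83[of 4] by simp
       have p4: "pot3 (arr s4 16) (arr s4 17) = pot3 (arr s 16) (arr s 17)" using M4 M3 unfolding Mmono_def by simp
       define y where "y = 4000 * (L + 3) * pot3 (arr s 16) (arr s 17)"
       define z where "z = 4000 * (L + 3) * pot3 (arr s8 16) (arr s8 17)"
       have "clock s8 + 1000 * p2 s8 + z <= clock s4 + 1000 * p2 s4 + y + 70"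
        using T6 T8 a5(4) a7(4) unfolding y_def z_def sel8 a5(1) a7(1) p4 by linarith
       then have "clock s8 + 1000 * p2 s8 + z <= clock s3 + 1000 * p2 s3 + 320 * (L + 3) * (L + 3) + y + 70" using T4 by linarith
       then have "real (clock s8 + 1000 * p2 s8 + z) <= real (clock s3 + 1000 * p2 s3 + 320 * (L + 3) * (L + 3) + y + 70)" by (simp only: of_nat_le_iff)
       moreover have "real (320 * (L + 3) * (L + 3)) = 320 * cubic" unfolding cubic_def by simp
       ultimately have N: "real (clock s8) + 1000 * real (p2 s8) + real z <= real (clock s3) + 1000 * real (p2 s3) + 320 * cubic + real y + 70" by simp
       have zz: "real z = 4000 * (real L + 3) * real (pot3 (arr s8 16) (arr s8 17))" "real y = 4000 * (real L + 3) * real (pot3 (arr s 16) (arr s 17))"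
        unfolding z_def y_def by simp_all
       have R89: "reg s8 9 = 0" using R8'[of 9] r3 by simp
       have "TP s8 G <= TP s G + 500 * cubic"
        using N T3 T2 cubic_ge(2) unfolding TP_def zz[symmetric] unfolding pot_def ph R89 r3 by simp
       then show "?Q s8" using gi qu by simp
      qed
     qed
    qed
   qed
  qed
 qed
qed

lemma Eset_mem:
 assumes "graph G" shows "{u, v} \<in> Eset G \<longleftrightarrow> (u, v) \<in> G"
proof
 assume "{u, v} \<in> Eset G"
 then obtain a b where ab: "(a, b) \<in> G" "{u, v} = {a, b}" unfolding Eset_def by auto
 then have "u = a \<and> v = b \<or> u = b \<and> v = a" by (simp add: doubleton_eq_iff)
 then show "(u, v) \<in> G" using ab(1) graph_D[OF assms ab(1)] by auto
next
 assume "(u, v) \<in> G"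
 then show "{u, v} \<in> Eset G" unfolding Eset_def by (rule rev_image_eqI) simp
qed

lemma Eset_insert: "insert {u, v} (Eset G) = Eset (G \<union> {(u, v), (v, u)})"
 unfolding Eset_def by (auto simp: insert_commute)

lemma Eset_delete: "Eset G - {{u, v}} = Eset (G - {(u, v), (v, u)})"
proof (intro equalityI subsetI)
 fix e assume "e \<in> Eset G - {{u, v}}"
 then obtain a b where ab: "(a, b) \<in> G" "e = {a, b}" "{a, b} ~= {u, v}" unfolding Eset_def by auto
 then have "(a, b) \<in> G - {(u, v), (v, u)}" by auto
 then show "e \<in> Eset (G - {(u, v), (v, u)})" unfolding Eset_def ab(2) by (rule rev_image_eqI) simp
next
 fix e assume "e \<in> Eset (G - {(u, v), (v, u)})"
 then obtain a b where ab: "(a, b) \<in> G" "e = {a, b}" "(a, b) ~= (u, v)" "(a, b) ~= (v, u)" unfolding Eset_def by auto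
 then have "{a, b} ~= {u, v}" by (simp add: doubleton_eq_iff)
 moreover have "{a, b} \<in> Eset G" unfolding Eset_def using ab(1) by (rule rev_image_eqI) simp
 ultimately show "e \<in> Eset G - {{u, v}}" using ab(2) by simp
qed

section \<open>Amortisation over the update sequence\<close>

text \<open>The term \<open>6 * tau * (\<Sum>x<n. real (c x))\<close> is the potential of the empty
  graph. It is carried along and cancelled against \<open>phi_lower\<close> when the time is read
  off; the bound on \<open>card G\<close> makes the difference linear in \<open>t\<close>.\<close>

definition OK :: "nat \<Rightarrow> state \<Rightarrow> nat set set \<Rightarrow> bool" where
 "OK t s E \<longleftrightarrow> (\<exists>G. E = Eset G \<and> GI s G \<and> quality s \<and> card G <= 2 * t \<and>
   TP s G <= 6 * tau * (\<Sum>x<n. real (c x)) + 1000 * cubic + 123000 * cubic * real t)"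

lemma FI_frame:
 assumes a: "arr s' = arr s" and r: "reg s' 0 = reg s 0" "reg s' 4 = reg s 4" "reg s' 5 = reg s 5" "reg s' 9 = reg s 9"
 shows "FI s' G X = FI s G X"
proof -
 have "Cst s' = Cst s" unfolding Cst_def a r by (rule refl)
 moreover have "J s' = J s" unfolding J_def cov_def a by (rule refl)
 moreover have "NZ s' G = NZ s G" unfolding NZ_def a by (rule refl)
 moreover have "STK s' = STK s" unfolding STK_def a r by (rule refl)
 moreover have "flags s' = flags s" unfolding flags_def a by (rule refl)
 ultimately show ?thesis unfolding FI_def Inv_def Inv0_def by (simp only: a)
qed

lemma GI_frame:
 assumes "arr s' = arr s" "reg s' 0 = reg s 0" "reg s' 4 = reg s 4" "reg s' 5 = reg s 5" "reg s' 6 = reg s 6" "reg s' 9 = reg s 9"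
 shows "GI s' G = GI s G"
 unfolding GI_def using FI_frame[of s' s G "{}"] assms by simp

text \<open>\<open>s0\<close> abstracts from the way past \<open>Init\<close>: it is
  \<open>s\<close> with the update loaded and a few ticks added. On the first update
  \<open>s\<close> is itself the state after initialisation.\<close>

lemma step_spec:
 assumes g: "GI s G" and l: "s' = load_update a s" and v: "valid_update n (Eset G) a" and card: "card G <= 2 * t"
  and T: "TP s G <= 6 * tau * (\<Sum>x<n. real (c x)) + 1000 * cubic + 123000 * cubic * real t"
  and s0: "arr s0 = arr s" "\<And>q. q \<notin> {1, 2, 3} ==> reg s0 q = reg s q" "clock s0 <= clock s + 10"
   "\<And>q. q \<in> {1, 2, 3} ==> reg s0 q = reg s' q"
 shows "ht B (Seq (If (Reg 1) Ins Rem) Tail) s0 (\<lambda>s1. OK (Suc t) s1 (apply_update a (Eset G)))"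
proof -
 have c10: "real (clock s0) <= real (clock s) + 10" using s0(3) by simp
 have g0: "GI s0 G" using g GI_frame[of s0 s G] s0 by simp
 have T0: "TP s0 G <= TP s G + 10" using c10 s0 unfolding TP_def pot_def by simp
 have G: "graph G" using g0 Inv0_D(2)[OF Inv_D(1)] unfolding GI_def FI_def by blast
 define s1 where "s1 = tick (1 + cost (Reg 1)) s0"
 have g1: "GI s1 G" using g0 GI_frame[of s1 s0 G] by (simp add: s1_def)
 have T1: "TP s1 G <= TP s G + 12" using T0 unfolding s1_def TP_def pot_def by (simp add: tick_def)
 have fin: "ht B Tail s2 (\<lambda>s1. OK (Suc t) s1 (Eset G'))"
  if m: "Mid s2 G' u v" and uv: "u < n" "v < n" and T2: "TP s2 G' <= TP s1 G + 122000 * cubic" and cG: "card G' <= 2 * Suc t" for s2 G' u v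
 proof (rule ht_mono[OF Tail_spec[OF m uv]], elim conjE)
  fix s3 assume g3: "GI s3 G'" and q3: "quality s3" and T3: "TP s3 G' <= TP s2 G' + 500 * cubic"
  have "123000 * cubic * real (Suc t) = 123000 * cubic * real t + 123000 * cubic" by (simp add: algebra_simps)
  then have "TP s3 G' <= 6 * tau * (\<Sum>x<n. real (c x)) + 1000 * cubic + 123000 * cubic * real (Suc t)"
   using T T1 T2 T3 cubic_ge(2) by linarith
  then show "OK (Suc t) s3 (Eset G')" unfolding OK_def using g3 q3 cG by blast
 qed
 show ?thesis
 proof (cases a)
  case (Insert u v)
  have r: "reg s0 1 = 1" "reg s0 2 = u" "reg s0 3 = v" using s0(4)[of 1] s0(4)[of 2] s0(4)[of 3] l Insert by simp_all
  have uv: "u < n" "v < n" "u ~= v" "(u, v) \<notin> G" using v Insert Eset_mem[OF G] by simp_all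
  have r1: "reg s1 2 = u" "reg s1 3 = v" using r by (simp_all add: s1_def)
  have "card (G \<union> {(u, v), (v, u)}) <= card G + card {(u, v), (v, u)}" by (rule card_Un_le)
  also have "\<dots> <= 2 * Suc t" using card uv(3) by simp
  finally have cG: "card (G \<union> {(u, v), (v, u)}) <= 2 * Suc t" .
  have run: "ht B (Seq (If (Reg 1) Ins Rem) Tail) s0 Q = ht B (Seq Ins Tail) s1 Q" for Q using r(1) by (simp add: s1_def)
  have E: "apply_update a (Eset G) = Eset (G \<union> {(u, v), (v, u)})" using Insert Eset_insert[of u v G] by simp
  show ?thesis unfolding run E
   by (rule ht_Seq[OF Ins_spec[OF g1 r1 uv refl]]) (elim conjE, rule fin[OF _ uv(1,2) _ cG])
 next
  case (Delete u v)
  have r: "reg s0 1 = 0" "reg s0 2 = u" "reg s0 3 = v" using s0(4)[of 1] s0(4)[of 2] s0(4)[of 3] l Delete by simp_all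
  have uv: "(u, v) \<in> G" using v Delete Eset_mem[OF G] by simp
  have uvn: "u < n" "v < n" using graph_D[OF G uv] by simp_all
  have r1: "reg s1 2 = u" "reg s1 3 = v" using r by (simp_all add: s1_def)
  have "card (G - {(u, v), (v, u)}) <= card G" by (rule card_mono[OF graph_fin(1)[OF G]]) simp
  then have cG: "card (G - {(u, v), (v, u)}) <= 2 * Suc t" using card by simp
  have run: "ht B (Seq (If (Reg 1) Ins Rem) Tail) s0 Q = ht B (Seq Rem Tail) s1 Q" for Q using r(1) by (simp add: s1_def)
  have E: "apply_update a (Eset G) = Eset (G - {(u, v), (v, u)})" using Delete Eset_delete[of G u v] by simp
  show ?thesis unfolding run E
   by (rule ht_Seq[OF Rem_spec[OF g1 r1 uv refl]]) (elim conjE, rule fin[OF _ uvn _ cG])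
 qed
qed

text \<open>Without edges every vertex is at level 0 with defect \<open>c x / 2\<close>, and the
  coefficient 12 turns this into 6 times the total capacity. All other potentials vanish.\<close>

lemma initial_GI:
 assumes C: "Cst s" and z: "\<And>a. a ~= 0 ==> a ~= 20 ==> arr s a = (\<lambda>_. 0)" and r: "reg s 9 = 0" "reg s 6 = 1"
 shows "GI s {}" "TP s {} = real (clock s) + 6 * tau * (\<Sum>x<n. real (c x))"
proof -
 have Z: "arr s 1 = (\<lambda>_. 0)" "arr s 2 = (\<lambda>_. 0)" "arr s 3 = (\<lambda>_. 0)" "arr s 4 = (\<lambda>_. 0)" "arr s 5 = (\<lambda>_. 0)" "arr s 6 = (\<lambda>_. 0)"
  "arr s 7 = (\<lambda>_. 0)" "arr s 8 = (\<lambda>_. 0)" "arr s 9 = (\<lambda>_. 0)" "arr s 10 = (\<lambda>_. 0)" "arr s 11 = (\<lambda>_. 0)" "arr s 12 = (\<lambda>_. 0)"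
  "arr s 13 = (\<lambda>_. 0)" "arr s 14 = (\<lambda>_. 0)" "arr s 15 = (\<lambda>_. 0)" "arr s 16 = (\<lambda>_. 0)" "arr s 17 = (\<lambda>_. 0)" "arr s 18 = (\<lambda>_. 0)"
  "arr s 19 = (\<lambda>_. 0)" "arr s 21 = (\<lambda>_. 0)" by (simp_all add: z)
 have c0: "0 < c x" if "x < n" for x using c1[OF that] by simp
 have M: "MIs s {} {}" unfolding Z MI_def using c0 by simp
 have COL: "COLs s" unfolding Z COL_def by (simp add: TS_def CS_def)
 have LIST: "LIST (arr s 4) (arr s 5) (arr s 7) (arr s 8) {}" unfolding Z LIST_def by simp
 have W: "arr s 3 = wt (arr s 4) {}" unfolding Z wt_def by simp
 have gr: "graph {}" unfolding graph_def by simp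
 have J': "J s" unfolding J_def Z by simp
 have NZ': "NZ s {}" unfolding NZ_def Z by simp
 have I: "Inv s {} {} {}" unfolding Inv_def Inv0_def using C M COL LIST W gr J' NZ' by simp
 have S: "STK s" unfolding STK_def Z r by simp
 have lc: "LC (arr s 2) (arr s 4) {}" unfolding LC_def Z by simp
 have cl: "clean (arr s 2) (arr s 3) x" for x unfolding clean_def Z by simp
 have "SELB (arr s 14)" unfolding SELB_def Z by simp
 then show "GI s {}" unfolding GI_def FI_def using I S lc cl r by simp
 have df: "defect (\<lambda>_. 0) (\<lambda>_. 0) {} x = real (c x) / 2" for x unfolding defect_def wt_def by simp
 have "(\<Sum>x<n. defect (\<lambda>_. 0) (\<lambda>_. 0) {} x) = (\<Sum>x<n. real (c x) / 2)" by (rule sum.cong[OF refl]) (rule df)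
 then have ds: "(\<Sum>x<n. defect (\<lambda>_. 0) (\<lambda>_. 0) {} x) = (\<Sum>x<n. real (c x)) / 2" by (simp add: sum_divide_distrib)
 have "phi (\<lambda>_. 0) (\<lambda>_. 0) {} = 6 * (\<Sum>x<n. real (c x))"
  unfolding phi_def ds by (simp add: wt_def)
 moreover have "p2 s = 0" unfolding pot2_def Z by simp
 moreover have "pot3 (arr s 16) (arr s 17) = 0" unfolding pot3_def Z by simp
 ultimately show "TP s {} = real (clock s) + 6 * tau * (\<Sum>x<n. real (c x))"
  unfolding TP_def pot_def using r by (simp add: Z)
qed

text \<open>\<open>mL\<close> and \<open>ml\<close> make \<open>L\<close> and \<open>ll\<close> the
  least exponents with their bounds, so the two loops stop at exactly these values.\<close>

lemma Init_spec:
 assumes z: "\<And>a. a ~= 0 ==> arr s a = (\<lambda>_. 0)" and cap: "\<And>v. v < n ==> arr s 0 v = c v" and r: "reg s 0 = n" "\<And>q. q > 3 ==> reg s q = 0"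
  and mL: "\<And>j. j < L ==> 2 ^ j < n" and ml: "\<And>j. j < ll ==> 2 ^ j < L + 1"
 shows "ht B Init s (\<lambda>s'. GI s' {} \<and> (\<forall>q<4. reg s' q = reg s q) \<and> TP s' {} <= real (clock s) + 6 * tau * (\<Sum>x<n. real (c x)) + 100 * (real L + 3))"
  (is "ht B _ s ?Q")
proof -
 define s1 where "s1 = tick (1 + cost (Const 0) + cost (Const 1)) (set_arr 20 0 1 (tick (1 + cost (Reg 6)) s))"
 have run: "ht B Init s Q = ht B (Seq (While (Less (Arr 20 (Reg 4)) (Reg 0)) Pow1)
   (Seq (While (Less (Arr 20 (Reg 5)) (Add (Reg 4) (Const 1))) (Assign 5 (Add (Reg 5) (Const 1)))) (Assign 6 (Const 1)))) s1 Q" for Q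
  unfolding Init_def s1_def by (simp add: r)
 have a1: "\<And>a. a ~= 20 ==> arr s1 a = arr s a" "arr s1 20 0 = 1" "reg s1 = reg s" "clock s1 <= clock s + 10" by (simp_all add: s1_def)
 have smj: "sm (2 ^ j)" "sm j" if "j <= L" for j
 proof -
  have "(2::nat) ^ j <= 2 ^ L" using that by (simp add: power_increasing)
  then have "sm0 (2 ^ j)" using Ln2 unfolding sm0_def q0_def by linarith
  then show "sm (2 ^ j)" by simp
  show "sm j" using that by simp
 qed
 define W1 where "W1 s2 \<longleftrightarrow> (\<exists>j\<le>L. reg s2 4 = j \<and> (\<forall>i\<le>j. arr s2 20 i = 2 ^ i) \<and> (\<forall>a. a ~= 20 --> arr s2 a = arr s a) \<and>
  (\<forall>q. q ~= 4 --> reg s2 q = reg s q) \<and> clock s2 <= clock s + 10 + 30 * j)" for s2 :: state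
 define W2 where "W2 s2 \<longleftrightarrow> (\<exists>k\<le>ll. reg s2 5 = k \<and> reg s2 4 = L \<and> (\<forall>i\<le>L. arr s2 20 i = 2 ^ i) \<and> (\<forall>a. a ~= 20 --> arr s2 a = arr s a) \<and>
  (\<forall>q. q ~= 4 --> q ~= 5 --> reg s2 q = reg s q) \<and> clock s2 <= clock s + 20 + 30 * L + 30 * k)" for s2 :: state
 show ?thesis unfolding run
 proof (rule ht_Seq)
  show "ht B (While (Less (Arr 20 (Reg 4)) (Reg 0)) Pow1) s1 W2"
  proof (rule ht_While[where I = W1 and m = "\<lambda>s2. L - reg s2 4"])
   show "W1 s1" unfolding W1_def by (intro exI[of _ 0]) (simp add: a1 r)
  next
   fix s2 assume w: "W1 s2" and e: "eval B s2 (Less (Arr 20 (Reg 4)) (Reg 0)) ~= 0"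
   from w obtain j where j: "j <= L" "reg s2 4 = j" "\<forall>i\<le>j. arr s2 20 i = 2 ^ i" "\<forall>a. a ~= 20 --> arr s2 a = arr s a"
    "\<forall>q. q ~= 4 --> reg s2 q = reg s q" "clock s2 <= clock s + 10 + 30 * j" unfolding W1_def by blast
   have "2 ^ j < n" using e j r by (simp split: if_splits)
   then have jL: "j < L" using Ln j(1) by (cases "j = L") simp_all
   let ?s = "tick (1 + cost (Less (Arr 20 (Reg 4)) (Reg 0))) s2"
   define s3 where "s3 = tick (1 + cost (Add (Reg 4) (Const 1))) (set_reg 4 (Suc j)
    (tick (1 + cost (Add (Reg 4) (Const 1)) + cost (Add (Arr 20 (Reg 4)) (Arr 20 (Reg 4)))) (set_arr 20 (Suc j) (2 ^ Suc j) ?s)))"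
   have v: "arr s2 20 j = 2 ^ j" using j(3) by simp
   have tw: "(2 ^ j + 2 ^ j) mod B = 2 ^ Suc j" using smj(1)[OF j(1)] by simp
   have run3: "ht B Pow1 ?s Q = Q s3" for Q
    unfolding Pow1_def s3_def using smj(2)[OF j(1)] by (simp add: j(2) v tw del: power_Suc)
   have "W1 s3" unfolding W1_def
   proof (intro exI[of _ "Suc j"] conjI)
    show "\<forall>i\<le>Suc j. arr s3 20 i = 2 ^ i" using j(3) by (simp add: s3_def le_Suc_eq del: power_Suc)
    show "\<forall>a. a ~= 20 --> arr s3 a = arr s a" using j(4) by (simp add: s3_def)
    show "\<forall>q. q ~= 4 --> reg s3 q = reg s q" using j(5) by (simp add: s3_def)
    show "clock s3 <= clock s + 10 + 30 * Suc j" using j(6) by (simp add: s3_def)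
   qed (use jL in \<open>simp_all add: s3_def\<close>)
   then show "ht B Pow1 ?s (\<lambda>s'. W1 s' \<and> L - reg s' 4 < L - reg s2 4)" unfolding run3 using jL j(2) by (simp add: s3_def)
  next
   fix s2 assume w: "W1 s2" and e: "eval B s2 (Less (Arr 20 (Reg 4)) (Reg 0)) = 0"
   from w obtain j where j: "j <= L" "reg s2 4 = j" "\<forall>i\<le>j. arr s2 20 i = 2 ^ i" "\<forall>a. a ~= 20 --> arr s2 a = arr s a"
    "\<forall>q. q ~= 4 --> reg s2 q = reg s q" "clock s2 <= clock s + 10 + 30 * j" unfolding W1_def by blast
   have "\<not> 2 ^ j < n" using e j r by (simp split: if_splits)
   then have jL: "j = L" using mL[of j] j(1) by (cases "j = L") auto
   show "W2 (tick (1 + cost (Less (Arr 20 (Reg 4)) (Reg 0))) s2)" unfolding W2_def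
    by (intro exI[of _ 0]) (use j r jL in simp)
  qed
 next
  fix s2 assume w2: "W2 s2"
  let ?e = "Less (Arr 20 (Reg 5)) (Add (Reg 4) (Const 1))"
  have ev: "eval B s3 ?e = (if 2 ^ reg s3 5 < L + 1 then 1 else 0)" if "W2 s3" for s3
  proof -
   from that obtain k where k: "k <= ll" "reg s3 5 = k" "reg s3 4 = L" "\<forall>i\<le>L. arr s3 20 i = 2 ^ i" unfolding W2_def by blast
   then have "arr s3 20 k = 2 ^ k" using llL by simp
   then show ?thesis using k smj(2)[of L] by simp
  qed
  show "ht B (Seq (While ?e (Assign 5 (Add (Reg 5) (Const 1)))) (Assign 6 (Const 1))) s2 ?Q"
  proof (rule ht_Seq)
   show "ht B (While ?e (Assign 5 (Add (Reg 5) (Const 1)))) s2 (\<lambda>s'. \<exists>s3. W2 s3 \<and> reg s3 5 = ll \<and> s' = tick (1 + cost ?e) s3)"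
   proof (rule ht_While[where I = W2 and m = "\<lambda>s3. ll - reg s3 5"])
    show "W2 s2" by (rule w2)
   next
    fix s3 assume w: "W2 s3" and e: "eval B s3 ?e ~= 0"
    from w obtain k where k: "k <= ll" "reg s3 5 = k" "reg s3 4 = L" "\<forall>i\<le>L. arr s3 20 i = 2 ^ i" "\<forall>a. a ~= 20 --> arr s3 a = arr s a"
     "\<forall>q. q ~= 4 --> q ~= 5 --> reg s3 q = reg s q" "clock s3 <= clock s + 20 + 30 * L + 30 * k" unfolding W2_def by blast
    have "2 ^ k < L + 1" using e k(2) unfolding ev[OF w] by (simp split: if_splits)
    then have kl: "k < ll" using ll1 k(1) by (cases "k = ll") simp_all
    define s4 where "s4 = tick (1 + cost (Add (Reg 5) (Const 1))) (set_reg 5 (Suc k) (tick (1 + cost ?e) s3))"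
    have "k <= L" using kl llL by simp
    then have run4: "ht B (Assign 5 (Add (Reg 5) (Const 1))) (tick (1 + cost ?e) s3) Q = Q s4" for Q
     using smj(2)[of k] by (simp add: s4_def k(2))
    have "W2 s4" unfolding W2_def by (intro exI[of _ "Suc k"]) (use k kl in \<open>simp add: s4_def\<close>)
    then show "ht B (Assign 5 (Add (Reg 5) (Const 1))) (tick (1 + cost ?e) s3) (\<lambda>s'. W2 s' \<and> ll - reg s' 5 < ll - reg s3 5)"
     unfolding run4 using kl k(2) by (simp add: s4_def)
   next
    fix s3 assume w: "W2 s3" and e: "eval B s3 ?e = 0"
    obtain k where k: "k <= ll" "reg s3 5 = k" using w unfolding W2_def by blast
    have "\<not> 2 ^ k < L + 1" using e k(2) unfolding ev[OF w] by (simp split: if_splits)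
    then have "k = ll" using ml[of k] k(1) by (cases "k = ll") auto
    then show "\<exists>s3'. W2 s3' \<and> reg s3' 5 = ll \<and> tick (1 + cost ?e) s3 = tick (1 + cost ?e) s3'" using w k(2) by blast
   qed
  next
   fix s4 assume "\<exists>s3. W2 s3 \<and> reg s3 5 = ll \<and> s4 = tick (1 + cost ?e) s3"
   then obtain s3 where w: "W2 s3" "reg s3 5 = ll" "s4 = tick (1 + cost ?e) s3" by blast
   from w(1) obtain k where k: "k <= ll" "reg s3 5 = k" "reg s3 4 = L" "\<forall>i\<le>L. arr s3 20 i = 2 ^ i" "\<forall>a. a ~= 20 --> arr s3 a = arr s a"
     "\<forall>q. q ~= 4 --> q ~= 5 --> reg s3 q = reg s q" "clock s3 <= clock s + 20 + 30 * L + 30 * k" unfolding W2_def by blast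
   define s5 where "s5 = tick (1 + cost (Const 1)) (set_reg 6 1 s4)"
   have run5: "ht B (Assign 6 (Const 1)) s4 Q = Q s5" for Q by (simp add: s5_def)
   have a5: "arr s5 = arr s3" "reg s5 6 = 1" "\<And>q. q ~= 6 ==> reg s5 q = reg s3 q" "clock s5 <= clock s3 + 20" by (simp_all add: s5_def w(3))
   have C: "Cst s5" unfolding Cst_def using a5 k w(2) r cap by simp
   have Z: "arr s5 a = (\<lambda>_. 0)" if "a ~= 0" "a ~= 20" for a using z[OF that(1)] k(5) that(2) by (simp add: a5(1))
   have r9: "reg s5 9 = 0" using a5(3)[of 9] k(6) r(2)[of 9] by simp
   have g: "GI s5 {}" "TP s5 {} = real (clock s5) + 6 * tau * (\<Sum>x<n. real (c x))"
    by (rule initial_GI[OF C _ r9 a5(2)], rule Z, assumption, assumption)+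
   have "clock s5 <= clock s + 40 + 60 * L" using a5(4) k(1,7) llL by linarith
   then have "real (clock s5) <= real (clock s + 40 + 60 * L)" by (simp only: of_nat_le_iff)
   then have "TP s5 {} <= real (clock s) + 6 * tau * (\<Sum>x<n. real (c x)) + 100 * (real L + 3)" unfolding g(2) by simp
   moreover have "\<forall>q<4. reg s5 q = reg s q" using a5(3) k(6) by simp
   ultimately show "ht B (Assign 6 (Const 1)) s4 ?Q" unfolding run5 using g(1) by simp
  qed
 qed
qed

definition Ok :: "nat \<Rightarrow> state \<Rightarrow> nat set set \<Rightarrow> bool" where
 "Ok t s E \<longleftrightarrow> t = 0 \<and> s = init_state n c \<and> E = {} \<or> OK t s E"

lemma update_spec:
 assumes o: "Ok t s E" and v: "valid_update n E a"
  and mL: "\<And>j. j < L ==> 2 ^ j < n" and ml: "\<And>j. j < ll ==> 2 ^ j < L + 1"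
 shows "ht B Main (load_update a s) (\<lambda>s'. Ok (Suc t) s' (apply_update a E))"
proof -
 define s' where "s' = load_update a s"
 have ld: "arr s' = arr s" "clock s' = clock s" "\<And>q. q \<notin> {1, 2, 3} ==> reg s' q = reg s q"
  unfolding s'_def by (cases a; simp add: set_reg_def)+
 have "ht B Main s' (\<lambda>s'. OK (Suc t) s' (apply_update a E))" using o unfolding Ok_def
 proof (elim disjE conjE)
  assume i: "t = 0" "s = init_state n c" "E = {}"
  have z: "arr s' a = (\<lambda>_. 0)" if "a ~= 0" for a using that unfolding ld i init_state_def by simp
  have cap: "arr s' 0 v = c v" if "v < n" for v using that unfolding ld i init_state_def by simp
  have r: "reg s' 0 = n" "\<And>q. q > 3 ==> reg s' q = 0" using ld(3) unfolding i init_state_def by simp_all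
  have k0: "clock s' = 0" unfolding ld i init_state_def by simp
  have E: "E = Eset {}" unfolding i Eset_def by simp
  have IS: "ht B Init s' (\<lambda>s1. GI s1 {} \<and> (\<forall>q<4. reg s1 q = reg s' q) \<and>
    TP s1 {} <= real (clock s') + 6 * tau * (\<Sum>x<n. real (c x)) + 100 * (real L + 3))"
   by (rule Init_spec) (erule z, erule cap, rule r(1), erule r(2), erule mL, erule ml)
  show ?thesis unfolding Main_def
  proof (rule ht_Seq[OF IS], elim conjE)
   fix s1 assume g: "GI s1 {}" and q: "\<forall>q<4. reg s1 q = reg s' q"
    and T: "TP s1 {} <= real (clock s') + 6 * tau * (\<Sum>x<n. real (c x)) + 100 * (real L + 3)"
   have T': "TP s1 {} <= 6 * tau * (\<Sum>x<n. real (c x)) + 1000 * cubic + 123000 * cubic * real t"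
    using T k0 i(1) cubic_ge by simp
   show "ht B (Seq (If (Reg 1) Ins Rem) Tail) s1 (\<lambda>s'. OK (Suc t) s' (apply_update a E))"
    unfolding E
   proof (rule step_spec[OF g refl _ _ T'])
    show "valid_update n (Eset {}) a" using v unfolding E .
    show "reg s1 q = reg (load_update a s1) q" if "q \<in> {1, 2, 3}" for q
    proof -
     have "reg s1 q = reg s' q" using q that by auto
     also have "\<dots> = reg (load_update a s1) q" unfolding s'_def using that by (cases a) (auto simp: set_reg_def)
     finally show ?thesis .
    qed
   qed simp_all
  qed
 next
  assume "OK t s E"
  then obtain G where G: "E = Eset G" "GI s G" "card G <= 2 * t"
   "TP s G <= 6 * tau * (\<Sum>x<n. real (c x)) + 1000 * cubic + 123000 * cubic * real t" unfolding OK_def by blast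
  have r6: "reg s' 6 = 1" using G(2) ld(3)[of 6] unfolding GI_def by simp
  define s1 where "s1 = tick 1 (tick (1 + cost (Reg 6)) s')"
  have run: "ht B Main s' Q = ht B (Seq (If (Reg 1) Ins Rem) Tail) s1 Q" for Q
   unfolding Main_def Init_def s1_def by (simp add: r6 del: ht_Seq_If) (simp add: r6)
  show ?thesis unfolding run G(1)
   by (rule step_spec[OF G(2) s'_def _ G(3,4)]) (use v G(1) ld in \<open>simp_all add: s1_def\<close>)
 qed
 then show ?thesis unfolding s'_def Ok_def by (rule ht_mono) simp
qed

text \<open>By \<open>phi_lower\<close> and \<open>card G <= 2 * t\<close> the potential is at most
  \<open>96 * t\<close> units of \<open>tau\<close> below its initial value. As
  \<open>tau <= 4000 * cubic\<close>, the coefficient of \<open>t\<close> is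
  \<open>96 * 4000 + 123000 = 507000\<close>.\<close>

lemma OK_approx:
 assumes "OK t s E"
 shows "approx_b_matching (1 / 1296) n c E (output_edges n s)" "real (clock s) <= 1000 * cubic + 507000 * cubic * real t"
proof -
 from assms obtain G where G: "E = Eset G" "GI s G" "quality s" "card G <= 2 * t"
  "TP s G <= 6 * tau * (\<Sum>x<n. real (c x)) + 1000 * cubic + 123000 * cubic * real t" unfolding OK_def by blast
 have F: "FI s G {}" and SB: "SELB (arr s 14)" and r9: "reg s 9 = 0" using G(2) unfolding GI_def by auto
 note F = FI_D[OF F]
 have cl: "clean (arr s 2) (arr s 3) x" if "x < n" for x using F(4)[OF that] flags_empty[OF F(2) r9] by simp
 have N: "NJ s G {}" and J': "J s" using F(1) unfolding Inv_NJ by simp_all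
 have q: "arr s 10 (pr i 1) <= 8 * K i * arr s 10 (pr i (arr s 14 i))" if "i <= L" for i using G(3) that unfolding quality_def by simp
 show "approx_b_matching (1 / 1296) n c E (output_edges n s)" unfolding G(1) by (rule approximation[OF N J' SB F(3) cl q])
 have cl': "clean (arr s 2) (wt (arr s 4) G) x" if "x < n" for x using cl[OF that] unfolding NJ_D(6)[OF N] .
 have "6 * (\<Sum>x<n. real (c x)) - 48 * real (card G) <= phi (arr s 2) (arr s 4) G" by (rule phi_lower[OF NJ_D(2)[OF N] F(3) cl'])
 moreover have "real (card G) <= 2 * real t" using G(4) by linarith
 ultimately have "6 * (\<Sum>x<n. real (c x)) - 96 * real t <= phi (arr s 2) (arr s 4) G" by linarith
 then have "tau * (6 * (\<Sum>x<n. real (c x)) - 96 * real t) <= tau * phi (arr s 2) (arr s 4) G" by (rule mult_left_mono) (simp add: tau_def)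
 moreover have "tau * (6 * (\<Sum>x<n. real (c x)) - 96 * real t) = 6 * tau * (\<Sum>x<n. real (c x)) - 96 * (tau * real t)" by (simp add: algebra_simps)
 moreover have "0 <= 4000 * (real L + 3) * real (pot3 (arr s 16) (arr s 17))" by simp
 moreover have "0 <= 1000 * real (p2 s) + 100 * real (reg s 9)" by simp
 ultimately have 1: "real (clock s) <= 96 * (tau * real t) + 1000 * cubic + 123000 * cubic * real t"
  using G(5) unfolding TP_def pot_def by linarith
 have "tau <= 4000 * cubic" using cubic_ge(1) unfolding tau_def by simp
 then have "tau * real t <= 4000 * cubic * real t" by (rule mult_right_mono) simp
 then show "real (clock s) <= 1000 * cubic + 507000 * cubic * real t" using 1 by linarith
qed

end

section \<open>From single updates to the whole run\<close>

text \<open>The invariant is indexed by the number of updates processed, so that it can carry the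
  time bound. Determinism turns the distribution over traces into one explicit list.\<close>

lemma trace_return:
 assumes step: "\<And>t s E a. I t s E ==> valid_update n E a ==> ht B P (load_update a s) (\<lambda>s'. I (Suc t) s' (apply_update a E))"
 shows "I t s E ==> (\<And>i. i < length us ==> valid_update n (fold apply_update (take i us) E) (us ! i)) ==>
  \<exists>ss. trace B P us s = return_spmf ss \<and> length ss = length us \<and>
   (\<forall>i<length us. I (t + Suc i) (ss ! i) (fold apply_update (take (Suc i) us) E))"
proof (induction us arbitrary: t s E)
 case Nil
 then show ?case by simp
next
 case (Cons a us)
 have "valid_update n E a" using Cons.prems(2)[of 0] by simp
 then obtain s' where s': "exec B P (load_update a s) = return_spmf s'" "I (Suc t) s' (apply_update a E)"
  using step[OF Cons.prems(1)] unfolding ht_def by blast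
 have "valid_update n (fold apply_update (take i us) (apply_update a E)) (us ! i)" if "i < length us" for i
  using Cons.prems(2)[of "Suc i"] that by simp
 from Cons.IH[OF s'(2) this] obtain ss where ss: "trace B P us s' = return_spmf ss" "length ss = length us"
  "\<forall>i<length us. I (Suc t + Suc i) (ss ! i) (fold apply_update (take (Suc i) us) (apply_update a E))" by blast
 show ?case
 proof (intro exI[of _ "s' # ss"] conjI allI impI)
  show "trace B P (a # us) s = return_spmf (s' # ss)" using s'(1) ss(1) by simp
  show "length (s' # ss) = length (a # us)" using ss(2) by simp
  fix i assume i: "i < length (a # us)"
  show "I (t + Suc i) ((s' # ss) ! i) (fold apply_update (take (Suc i) (a # us)) E)"
  proof (cases i)
   case 0
   then show ?thesis using s'(2) by simp
  next
   case (Suc k)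
   then show ?thesis using ss(3) i by simp
  qed
 qed
qed

lemma least_power:
 fixes m :: nat
 assumes "1 <= m"
 obtains l where "m <= 2 ^ l" "2 ^ l <= 2 * m" "\<And>j. j < l ==> 2 ^ j < m"
proof -
 define l where "l = (LEAST l. m <= 2 ^ l)"
 have "m <= 2 ^ m" by (simp add: less_imp_le)
 then have 1: "m <= 2 ^ l" unfolding l_def by (rule LeastI)
 have 2: "2 ^ j < m" if "j < l" for j using not_less_Least[OF that[unfolded l_def]] by simp
 have "2 ^ l <= 2 * m"
 proof (cases l)
  case 0
  then show ?thesis using assms by simp
 next
  case (Suc k)
  then show ?thesis using 2[of k] by simp
 qed
 then show ?thesis using that 1 2 by blast
qed

text \<open>The base \<open>n + t + 2\<close> is at least 4, so its fourth power exceeds 80 and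
  \<open>80 * n\<close> is at most its fifth power; the exponent is \<open>5 * 16\<close>.\<close>

lemma word_bound:
 fixes n t :: nat
 assumes "2 <= n"
 shows "(80 * n) ^ 16 <= (n + t + 2) ^ 80"
proof -
 have "80 <= (4::nat) ^ 4" by simp
 also have "\<dots> <= (n + t + 2) ^ 4" using assms by (intro power_mono) simp_all
 finally have "80 * n <= (n + t + 2) ^ 4 * (n + t + 2)" by (intro mult_mono) simp_all
 also have "\<dots> = (n + t + 2) ^ 5" by algebra
 finally have "(80 * n) ^ 16 <= ((n + t + 2) ^ 5) ^ 16" by (intro power_mono) simp_all
 then show ?thesis by (simp flip: power_mult)
qed

lemma run_good:
 fixes n :: nat
 assumes n: "2 <= n" and c: "\<And>v. v < n ==> 1 <= c v \<and> c v <= n" and v: "valid_updates n us"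
 shows "\<exists>ss. run 80 Main n c us = return_spmf ss \<and> length ss = length us \<and> maintains_approx_b_matching (1 / 1296) n c us ss \<and>
  (\<forall>i<length ss. real (clock (ss ! i)) <= real (Suc i) * (12700000 * (log 2 (real n)) ^ 3))"
proof -
 obtain L where L: "n <= 2 ^ L" "2 ^ L <= 2 * n" "\<And>j. j < L ==> 2 ^ j < n" using least_power[of n] n by auto
 obtain ll where ll: "L + 1 <= 2 ^ ll" "2 ^ ll <= 2 * (L + 1)" "\<And>j. j < ll ==> 2 ^ j < L + 1" using least_power[of "L + 1"] by auto
 have "ll <= L"
 proof (rule ccontr)
  assume "\<not> ll <= L"
  then have "2 ^ L < L + 1" using ll(3) by simp
  moreover have "L < 2 ^ L" by simp
  ultimately show False by linarith
 qed
 then interpret bm n L ll "(n + length us + 2) ^ 80" c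
  using n c L(1,2) ll(1,2) word_bound[OF n, of "length us"] by unfold_locales auto
 have "\<exists>ss. trace ((n + length us + 2) ^ 80) Main us (init_state n c) = return_spmf ss \<and> length ss = length us \<and>
   (\<forall>i<length us. Ok (0 + Suc i) (ss ! i) (fold apply_update (take (Suc i) us) {}))"
 proof (rule trace_return[where I = Ok and n = n])
  show "ht ((n + length us + 2) ^ 80) Main (load_update a s) (\<lambda>s'. Ok (Suc t) s' (apply_update a E))"
   if "Ok t s E" "valid_update n E a" for t s E a by (rule update_spec[OF that L(3) ll(3)])
  show "Ok 0 (init_state n c) {}" unfolding Ok_def by simp
  show "valid_update n (fold apply_update (take i us) {}) (us ! i)" if "i < length us" for i
   using v that unfolding valid_updates_def graph_after_def by simp
 qed
 then obtain ss where ss: "run 80 Main n c us = return_spmf ss" "length ss = length us"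
  "\<And>i. i < length us ==> OK (Suc i) (ss ! i) (graph_after (take (Suc i) us))" unfolding run_def graph_after_def Ok_def by auto
 have "real L <= log 2 (real n) + 1"
 proof -
  have "real (2 ^ L) <= real (2 * n)" using L(2) by (simp only: of_nat_le_iff)
  then have "(2::real) ^ L <= 2 * real n" by simp
  then have "log 2 ((2::real) ^ L) <= log 2 (2 * real n)" using n by (subst log_le_cancel_iff) simp_all
  then show ?thesis using n by (simp add: log_mult log_nat_power)
 qed
 define x where "x = log 2 (real n)"
 have x1: "1 <= x" unfolding x_def using n by simp
 \<comment> \<open>\<open>L + 3 <= x + 4 <= 5 * x\<close> since \<open>1 <= x\<close>; the square of
   5 is the 25 below, and \<open>25 * 508000\<close> is the final constant.\<close>
 have Lx: "real L + 3 <= 5 * x" using \<open>real L <= log 2 (real n) + 1\<close> x1 unfolding x_def by linarith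
 have "cubic <= (5 * x) * (5 * x)" unfolding cubic_def using Lx x1 by (intro mult_mono) simp_all
 also have "\<dots> = 25 * x ^ 2" by (simp add: power2_eq_square)
 \<comment> \<open>The step from the square to the cube uses \<open>1 <= x\<close>, that is
   \<open>2 <= n\<close>.\<close>
 also have "\<dots> <= 25 * x ^ 3" using x1 by (simp add: power_increasing)
 finally have cb: "cubic <= 25 * x ^ 3" .
 have "real (clock (ss ! i)) <= real (Suc i) * (12700000 * x ^ 3)" if "i < length us" for i
 proof -
  have "real (clock (ss ! i)) <= 1000 * cubic + 507000 * cubic * real (Suc i)" using OK_approx(2)[OF ss(3)[OF that]] .
  also have "\<dots> <= 1000 * cubic * real (Suc i) + 507000 * cubic * real (Suc i)"
  proof -
   have "1000 * cubic * 1 <= 1000 * cubic * real (Suc i)" using cubic_ge(2) by (intro mult_left_mono) simp_all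
   then show ?thesis by simp
  qed
  also have "\<dots> = 508000 * (cubic * real (Suc i))" by simp
  also have "\<dots> <= 508000 * (25 * x ^ 3 * real (Suc i))" using cb by (intro mult_left_mono mult_right_mono) simp_all
  also have "\<dots> = real (Suc i) * (12700000 * x ^ 3)" by simp
  finally show ?thesis .
 qed
 moreover have "approx_b_matching (1 / 1296) n c (graph_after (take (Suc i) us)) (output_edges n (ss ! i))" if "i < length us" for i
  by (rule OK_approx(1)[OF ss(3)[OF that]])
 ultimately show ?thesis
  using ss(1,2) unfolding maintains_approx_b_matching_def x_def by (intro exI[of _ ss]) simp
qed

theorem theorem8:
  "\<exists>\<alpha>::real. \<alpha> > 0 \<and>
     (\<forall>d::nat. \<exists>(P::com) (K::nat) (C::real).
       \<forall>(n::nat) (c::nat \<Rightarrow> nat) (us::update list).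
         n \<ge> 1 \<longrightarrow> (\<forall>v < n. 1 \<le> c v \<and> c v \<le> n) \<longrightarrow> valid_updates n us \<longrightarrow>
           amortized_time (C * (log 2 (real n)) ^ 3) (run K P n c us) \<and>
           measure (measure_spmf (run K P n c us)) {ss. maintains_approx_b_matching \<alpha> n c us ss}
             \<ge> 1 - 1 / real n ^ d)"
proof (intro exI[of _ "1 / 1296 :: real"] conjI allI)
  show "(0::real) < 1 / 1296" by simp
  fix d :: nat
  have "amortized_time (12700000 * (log 2 (real n)) ^ 3) (run 80 Main n c us) \<and>
      measure (measure_spmf (run 80 Main n c us)) {ss. maintains_approx_b_matching (1 / 1296) n c us ss} \<ge> 1 - 1 / real n ^ d"
    if n: "1 \<le> n" and c: "\<forall>v<n. 1 \<le> c v \<and> c v \<le> n" and v: "valid_updates n us" for n c us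
  proof -
    have "\<exists>ss. run 80 Main n c us = return_spmf ss \<and> maintains_approx_b_matching (1 / 1296) n c us ss \<and>
      (\<forall>i<length ss. real (clock (ss ! i)) \<le> real (Suc i) * (12700000 * (log 2 (real n)) ^ 3))"
    proof (cases "2 \<le> n")
      case True
      then show ?thesis using run_good[of n c us] c v by blast
    next
      \<comment> \<open>For \<open>n = 1\<close> the claimed time is 0, because
        \<open>log 2 1 = 0\<close>. On a single vertex no update is valid, so there is nothing to
        bound.\<close>
      case False
      then have n1: "n = 1" using n by simp
      have "us = []"
      proof (rule ccontr)
        assume "us \<noteq> []"
        then have "valid_update n {} (us ! 0)" using v unfolding valid_updates_def graph_after_def by force
        then show False using n1 by (cases "us ! 0") auto
      qed
      then show ?thesis unfolding run_def maintains_approx_b_matching_def by simp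
    qed
    then obtain ss where ss: "run 80 Main n c us = return_spmf ss" "maintains_approx_b_matching (1 / 1296) n c us ss"
      "\<forall>i<length ss. real (clock (ss ! i)) \<le> real (Suc i) * (12700000 * (log 2 (real n)) ^ 3)" by blast
    \<comment> \<open>The run is a point mass on a good trace, so the probability is 1 for every
      \<open>d\<close>, and the same program and constants serve all \<open>d\<close>.\<close>
    have "measure (measure_spmf (run 80 Main n c us)) {ss. maintains_approx_b_matching (1 / 1296) n c us ss} = 1"
      unfolding ss(1) using ss(2) by (simp add: measure_spmf_return_spmf measure_return)
    then show ?thesis unfolding amortized_time_def ss(1) using ss(3) n by simp
  qed
  then show "\<exists>(P::com) (K::nat) (C::real). \<forall>(n::nat) (c::nat \<Rightarrow> nat) (us::update list).
         n \<ge> 1 \<longrightarrow> (\<forall>v < n. 1 \<le> c v \<and> c v \<le> n) \<longrightarrow> valid_updates n us \<longrightarrow>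
           amortized_time (C * (log 2 (real n)) ^ 3) (run K P n c us) \<and>
           measure (measure_spmf (run K P n c us)) {ss. maintains_approx_b_matching (1 / 1296) n c us ss}
             \<ge> 1 - 1 / real n ^ d" by blast
qed

end
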